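(* Let $(\alpha,u)$ be a twisted action of a discrete group $G$ on $C_0(X)$, where $X$ is a locally compact Hausdorff space, with dual action $\varphi$ on $X$. For any $P\subseteq\{1,\infty\}$ the crossed product $F^P(\alpha,u)$ is residually reduced. More specifically, for every open $\varphi$-invariant $U\subseteq X$ and $Y:=X\setminus U$ the restriction map $\ell^1(G,C_0(X))\ni b\mapsto b|_Y\in\ell^1(G,C_0(Y))$, where $b|_Y(t):=b(t)|_Y$, $t\in G$, yields an isometric isomorphism $$F^P(\alpha,u)/F^P(\alpha^U,u^U)\cong F^P(\alpha^Y,u^Y).$$
   Context: Setting: $\varphi:G\to\mathrm{Homeo}(X)$ is a group homomorphism, $\alpha_s(a)=a\circ\varphi_{s^{-1}}$ for $a\in C_0(X)$, and also for $a\in C_b(X)$. $C_u(X)=\{a\in C_b(X):|a(x)|=1\ \forall x\}$. A twisted action $(\alpha,u)$ consists of such $\alpha$ and a normalised $2$-cocycle: $u:G\times G\to C_u(X)$ with $\alpha_r(u(s,t))u(r,st)=u(r,s)u(rs,t)$ and $u(1,1)=1$. A set $V\subseteq X$ is $\varphi$-invariant if $\varphi_t(V)=V$ for all $t\in G$. For an invariant open or closed $V$, $(\alpha^V,u^V)$ is the twisted action on $C_0(V)$ given by $\varphi^V_t=\varphi_t|_V$ and $u^V(s,t)=u(s,t)|_V$. $F(\alpha,u)=\ell^1(G,C_0(X))$ has norm $\|b\|_1=\sum_g\|b(g)\|_\infty$ and product $(a*b)(r)=\sum_{st=r}a(s)\alpha_s(b(t))u(s,t)$. For $p=1$, $\|b\|_{L^1}$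 is the supremum of $\|\psi(b)\|$ over all non-degenerate representations $\psi$ (contractive homomorphisms into $B(E)$) of $F(\alpha,u)$ on $L^1$-spaces $E$ (spaces isometric to some $L^1(\mu)$); for $p=\infty$, $\|b\|_{L^\infty}$ is the supremum over non-degenerate representations on $C_0$-spaces (spaces isometric to $C_0(\Omega)$ for some topological space $\Omega$). It is known that $\|b\|_{L^1}=\max_{x\in X}\sum_{t}|b(t)(x)|$ and $\|b\|_{L^\infty}=\max_{x\in X}\sum_t|b(t)(\varphi_t(x))|$. For non-empty $P\subseteq\{1,\infty\}$, $F^P(\alpha,u)$ is the completion of $F(\alpha,u)$ in $\max_{p\in P}\|b\|_{L^p}$, and $F^\emptyset(\alpha,u)=F(\alpha,u)$. For open invariant $U$, $F^P(\alpha^U,u^U)$ is identified with the closure of $\ell^1(G,C_0(U))$ in $F^P(\alpha,u)$, a closed two-sided ideal. For a family $\mathcal R$ of representations separating points of $F(\alpha,u)$, $F_{\mathcal R}(\alpha,u)$ is the completion of $F(\alpha,u)$ in $\sup_{\psi\in\mathcal R}\|\psi(b)\|$; it is a (Banach algebra) crossed product for $(\alpha,u)$ if $E_1(b)=b(1)$ extends to a contraction $F_{\mathcal R}(\alpha,u)\to C_0(X)$. Then all $E_t(b)=b(t)$ extend to contractions $E_t^{\mathcal R}$, and it is reduced if $\bigcap_{t}\ker E_t^{\mathcal R}=\{0\}$. A crossed product $F_{\mathcal R}(\alpha,u)$ is residually reduced if for every open $\varphi$-invariant $U\subseteq X$, with $Y=X\setminus U$ and $F_{\mathcal R^U}(\alpha^U,u^U)$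 the closure of $\ell^1(G,C_0(U))$ in $F_{\mathcal R}(\alpha,u)$, the quotient $F_{\mathcal R}(\alpha,u)/F_{\mathcal R^U}(\alpha^U,u^U)$ is naturally (i.e. as a completion of $F(\alpha^Y,u^Y)\cong\ell^1(G,C_0(X))/\ell^1(G,C_0(U))$ via $b\mapsto b|_Y$) a reduced crossed product for $(\alpha^Y,u^Y)$. *)

theory Defs
  imports
    "HOL-Analysis.Analysis"
    "HOL-Algebra.Module"
    "HOL-Algebra.QuotRing"
    "HOL-Algebra.Group_Action"
begin

section \<open>Complex normed spaces and Banach algebras on carriers\<close>

text \<open>
  One record serves for normed spaces and for normed algebras. The field \<open>one\<close> is never used (the
  algebras need not be unital), and \<open>mult\<close> is irrelevant when only the normed space matters.
\<close>

definition complex_ring :: "complex ring" where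
  "complex_ring = \<lparr>carrier = UNIV, mult = (*), one = 1, zero = 0, add = (+)\<rparr>"

record 'b cnormed = "(complex, 'b) module" +
  nrm :: "'b \<Rightarrow> real"

text \<open>Zero off the carrier, as the locale \<^locale>\<open>Metric_space\<close> constrains the distance on the whole type.\<close>

definition ndist :: "'b cnormed \<Rightarrow> 'b \<Rightarrow> 'b \<Rightarrow> real" where
  "ndist E x y = (if x \<in> carrier E \<and> y \<in> carrier E then nrm E (x \<ominus>\<^bsub>E\<^esub> y) else 0)"

definition nclosure :: "'b cnormed \<Rightarrow> 'b set \<Rightarrow> 'b set" where
  "nclosure E S = Metric_space.mtopology (carrier E) (ndist E) closure_of S"

locale banach_space = Module.module complex_ring E
  for E :: "'b cnormed" (structure) +
  assumes nrm_eq_0_iff: "x \<in> carrier E \<Longrightarrow> nrm E x = 0 \<longleftrightarrow> x = \<zero>"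
    and nrm_smult: "x \<in> carrier E \<Longrightarrow> nrm E (c \<odot> x) = cmod c * nrm E x"
    and nrm_triangle:
      "\<lbrakk>x \<in> carrier E; y \<in> carrier E\<rbrakk> \<Longrightarrow> nrm E (x \<oplus> y) \<le> nrm E x + nrm E y"
    and complete: "Metric_space.mcomplete (carrier E) (ndist E)"

locale banach_algebra = banach_space A for A :: "'b cnormed" (structure) +
  assumes mult_closed: "\<lbrakk>x \<in> carrier A; y \<in> carrier A\<rbrakk> \<Longrightarrow> x \<otimes> y \<in> carrier A"
    and mult_assoc: "\<lbrakk>x \<in> carrier A; y \<in> carrier A; z \<in> carrier A\<rbrakk>
      \<Longrightarrow> (x \<otimes> y) \<otimes> z = x \<otimes> (y \<otimes> z)"
    and mult_add_left: "\<lbrakk>x \<in> carrier A; y \<in> carrier A; z \<in> carrier A\<rbrakk>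
      \<Longrightarrow> (x \<oplus> y) \<otimes> z = x \<otimes> z \<oplus> y \<otimes> z"
    and mult_add_right: "\<lbrakk>x \<in> carrier A; y \<in> carrier A; z \<in> carrier A\<rbrakk>
      \<Longrightarrow> x \<otimes> (y \<oplus> z) = x \<otimes> y \<oplus> x \<otimes> z"
    and smult_mult_left: "\<lbrakk>x \<in> carrier A; y \<in> carrier A\<rbrakk> \<Longrightarrow> (c \<odot> x) \<otimes> y = c \<odot> (x \<otimes> y)"
    and smult_mult_right: "\<lbrakk>x \<in> carrier A; y \<in> carrier A\<rbrakk> \<Longrightarrow> x \<otimes> (c \<odot> y) = c \<odot> (x \<otimes> y)"
    and nrm_mult: "\<lbrakk>x \<in> carrier A; y \<in> carrier A\<rbrakk> \<Longrightarrow> nrm A (x \<otimes> y) \<le> nrm A x * nrm A y"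

definition linear_maps :: "'a cnormed \<Rightarrow> 'b cnormed \<Rightarrow> ('a \<Rightarrow> 'b) set" where
  "linear_maps E F = {f \<in> carrier E \<rightarrow> carrier F.
     (\<forall>x\<in>carrier E. \<forall>y\<in>carrier E. f (x \<oplus>\<^bsub>E\<^esub> y) = f x \<oplus>\<^bsub>F\<^esub> f y) \<and>
     (\<forall>c. \<forall>x\<in>carrier E. f (c \<odot>\<^bsub>E\<^esub> x) = c \<odot>\<^bsub>F\<^esub> f x)}"

definition alg_hom :: "'a cnormed \<Rightarrow> 'b cnormed \<Rightarrow> ('a \<Rightarrow> 'b) set" where
  "alg_hom A B = {f \<in> linear_maps A B.
     \<forall>x\<in>carrier A. \<forall>y\<in>carrier A. f (x \<otimes>\<^bsub>A\<^esub> y) = f x \<otimes>\<^bsub>B\<^esub> f y}"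

definition linear_contractions :: "'a cnormed \<Rightarrow> 'b cnormed \<Rightarrow> ('a \<Rightarrow> 'b) set" where
  "linear_contractions E F = {f \<in> linear_maps E F. \<forall>x\<in>carrier E. nrm F (f x) \<le> nrm E x}"

definition isometric_hom :: "'a cnormed \<Rightarrow> 'b cnormed \<Rightarrow> ('a \<Rightarrow> 'b) set" where
  "isometric_hom A B = {f \<in> alg_hom A B. \<forall>x\<in>carrier A. nrm B (f x) = nrm A x}"

definition isometric_iso :: "'a cnormed \<Rightarrow> 'b cnormed \<Rightarrow> ('a \<Rightarrow> 'b) set" where
  "isometric_iso A B = {f \<in> isometric_hom A B. bij_betw f (carrier A) (carrier B)}"

text \<open>The algebraic part agrees with \<^const>\<open>FactRing\<close>; the norm is the quotient norm.\<close>

definition nquot :: "'b cnormed \<Rightarrow> 'b set \<Rightarrow> 'b set cnormed" where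
  "nquot A I = \<lparr>carrier = a_rcosets\<^bsub>A\<^esub> I, mult = rcoset_mult A I, one = I +>\<^bsub>A\<^esub> \<one>\<^bsub>A\<^esub>,
     zero = I, add = set_add A, smult = (\<lambda>c K. \<Union>x\<in>K. I +>\<^bsub>A\<^esub> (c \<odot>\<^bsub>A\<^esub> x)),
     nrm = (\<lambda>K. INF x\<in>K. nrm A x)\<rparr>"

text \<open>\<open>(A, \<iota>)\<close> is the completion of \<open>F\<close> in the seminorm \<open>N\<close>; this determines it up to a unique
  isometric isomorphism.\<close>

definition is_completion ::
    "'b cnormed \<Rightarrow> ('b \<Rightarrow> real) \<Rightarrow> 'a cnormed \<Rightarrow> ('b \<Rightarrow> 'a) \<Rightarrow> bool" where
  "is_completion F N A \<iota> \<longleftrightarrow> banach_algebra A \<and> \<iota> \<in> alg_hom F A \<and>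
     (\<forall>b\<in>carrier F. nrm A (\<iota> b) = N b) \<and> nclosure A (\<iota> ` carrier F) = carrier A"


section \<open>Representations\<close>

definition bounded_operators :: "'e cnormed \<Rightarrow> ('e \<Rightarrow> 'e) cnormed" where
  "bounded_operators E = \<lparr>
     carrier = {T \<in> linear_maps E E \<inter> extensional (carrier E).
                  \<exists>C. \<forall>\<xi>\<in>carrier E. nrm E (T \<xi>) \<le> C * nrm E \<xi>},
     mult = compose (carrier E),
     one = (\<lambda>\<xi>\<in>carrier E. \<xi>),
     zero = (\<lambda>\<xi>\<in>carrier E. \<zero>\<^bsub>E\<^esub>),
     add = (\<lambda>S T. \<lambda>\<xi>\<in>carrier E. S \<xi> \<oplus>\<^bsub>E\<^esub> T \<xi>),
     smult = (\<lambda>c T. \<lambda>\<xi>\<in>carrier E. c \<odot>\<^bsub>E\<^esub> T \<xi>),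
     nrm = (\<lambda>T. Inf {C. 0 \<le> C \<and> (\<forall>\<xi>\<in>carrier E. nrm E (T \<xi>) \<le> C * nrm E \<xi>)})\<rparr>"

definition representation :: "'b cnormed \<Rightarrow> 'e cnormed \<Rightarrow> ('b \<Rightarrow> 'e \<Rightarrow> 'e) \<Rightarrow> bool" where
  "representation F E \<psi> \<longleftrightarrow>
     \<psi> \<in> alg_hom F (bounded_operators E) \<inter> linear_contractions F (bounded_operators E)"

text \<open>Finite sums of vectors \<open>\<psi> b \<xi>\<close> form the linear span, since scalars can be absorbed in \<open>\<xi>\<close>.\<close>

definition nondegenerate :: "'b cnormed \<Rightarrow> 'e cnormed \<Rightarrow> ('b \<Rightarrow> 'e \<Rightarrow> 'e) \<Rightarrow> bool" where
  "nondegenerate F E \<psi> \<longleftrightarrow>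
     nclosure E {\<Oplus>\<^bsub>E\<^esub>i\<in>{..<n}. \<psi> (b i) (\<xi> i) | (n::nat) b \<xi>.
       b \<in> {..<n} \<rightarrow> carrier F \<and> \<xi> \<in> {..<n} \<rightarrow> carrier E} = carrier E"

definition C0 :: "'x topology \<Rightarrow> ('x \<Rightarrow> complex) cnormed" where
  "C0 X = \<lparr>
     carrier = {a. continuous_map X euclidean a \<and>
                   (\<forall>\<epsilon>>0. compactin X {x \<in> topspace X. \<epsilon> \<le> cmod (a x)}) \<and>
                   (\<forall>x. x \<notin> topspace X \<longrightarrow> a x = 0)},
     mult = (\<lambda>a b x. a x * b x), one = undefined, zero = (\<lambda>x. 0), add = (\<lambda>a b x. a x + b x),
     smult = (\<lambda>c a x. c * a x), nrm = (\<lambda>a. SUP x. cmod (a x))\<rparr>"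

text \<open>Integrable functions modulo equality almost everywhere; the norm of a class is the common
  seminorm of its members.\<close>

definition L1 :: "'m measure \<Rightarrow> ('m \<Rightarrow> complex) set cnormed" where
  "L1 M = nquot
     \<lparr>carrier = {f. integrable M f}, mult = undefined, one = undefined,
      zero = (\<lambda>x. 0), add = (\<lambda>f g x. f x + g x), smult = (\<lambda>c f x. c * f x),
      nrm = (\<lambda>f. integral\<^sup>L M (\<lambda>x. cmod (f x)))\<rparr>
     {f. integrable M f \<and> (AE x in M. f x = 0)}"

text \<open>
  A supremum over all \<open>L\<^sup>1\<close>-spaces would range over measure spaces of all types. Here it ranges over
  all measure spaces whose points are in \<open>'g + 'm\<close>, where \<open>'m\<close> is a parameter to be chosen as large as
  desired. The summand \<open>'g\<close> makes room for the representations on \<open>\<ell>\<^sup>1(G)\<close> induced from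
  points of \<open>X\<close>, whatever \<open>'m\<close> is. Likewise for \<open>C\<^sub>0\<close>-spaces. Since \<open>\<psi>\<close> can be transported
  along isometries, it is enough to let it act on the spaces \<open>L\<^sup>1(\<mu>)\<close> and \<open>C\<^sub>0(\<Omega>)\<close> themselves.
\<close>

definition L1_rep_norm ::
    "'m itself \<Rightarrow> ('g \<Rightarrow> 'x \<Rightarrow> complex) cnormed \<Rightarrow> ('g \<Rightarrow> 'x \<Rightarrow> complex) \<Rightarrow> real" where
  "L1_rep_norm m F b = Sup {nrm (bounded_operators (L1 M)) (\<psi> b) | (M :: ('g + 'm) measure) \<psi>.
     representation F (L1 M) \<psi> \<and> nondegenerate F (L1 M) \<psi>}"

definition Linf_rep_norm ::
    "'m itself \<Rightarrow> ('g \<Rightarrow> 'x \<Rightarrow> complex) cnormed \<Rightarrow> ('g \<Rightarrow> 'x \<Rightarrow> complex) \<Rightarrow> real" where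
  "Linf_rep_norm m F b = Sup {nrm (bounded_operators (C0 \<Omega>)) (\<psi> b) | (\<Omega> :: ('g + 'm) topology) \<psi>.
     representation F (C0 \<Omega>) \<psi> \<and> nondegenerate F (C0 \<Omega>) \<psi>}"

definition P_norm :: "'m itself \<Rightarrow> ereal set \<Rightarrow> ('g \<Rightarrow> 'x \<Rightarrow> complex) cnormed
    \<Rightarrow> ('g \<Rightarrow> 'x \<Rightarrow> complex) \<Rightarrow> real" where
  "P_norm m P F b = (if P = {} then nrm F b
     else Max ((\<lambda>p. if p = 1 then L1_rep_norm m F b else Linf_rep_norm m F b) ` P))"


section \<open>Twisted actions and their crossed products\<close>

text \<open>The action is a homomorphism into \<^term>\<open>BijGroup (topspace X)\<close> with values in the
  homeomorphisms. A twist is a function on \<open>topspace X\<close>; its values elsewhere are ignored.\<close>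

definition dual_action ::
    "('g, 'z) monoid_scheme \<Rightarrow> 'x topology \<Rightarrow> ('g \<Rightarrow> 'x \<Rightarrow> 'x) \<Rightarrow> 'g \<Rightarrow> ('x \<Rightarrow> complex) \<Rightarrow> 'x \<Rightarrow> complex"
  where "dual_action G X \<phi> s a = (\<lambda>x. if x \<in> topspace X then a (\<phi> (inv\<^bsub>G\<^esub> s) x) else 0)"

locale twisted_action = group_action G "topspace X" \<phi>
  for G :: "('g, 'z) monoid_scheme" (structure) and X :: "'x topology" and \<phi> :: "'g \<Rightarrow> 'x \<Rightarrow> 'x" +
  fixes u :: "'g \<Rightarrow> 'g \<Rightarrow> 'x \<Rightarrow> complex"
  assumes locally_compact: "locally_compact_space X"
    and Hausdorff: "Hausdorff_space X"
    and homeomorphism: "t \<in> carrier G \<Longrightarrow> homeomorphic_map X X (\<phi> t)"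
    and twist_continuous: "\<lbrakk>s \<in> carrier G; t \<in> carrier G\<rbrakk> \<Longrightarrow> continuous_map X euclidean (u s t)"
    and twist_unimodular:
      "\<lbrakk>s \<in> carrier G; t \<in> carrier G; x \<in> topspace X\<rbrakk> \<Longrightarrow> cmod (u s t x) = 1"
    and twist_cocycle:
      "\<lbrakk>r \<in> carrier G; s \<in> carrier G; t \<in> carrier G; x \<in> topspace X\<rbrakk> \<Longrightarrow>
        dual_action G X \<phi> r (u s t) x * u r (s \<otimes> t) x = u r s x * u (r \<otimes> s) t x"
    and twist_normalised: "x \<in> topspace X \<Longrightarrow> u \<one> \<one> x = 1"

definition invariant :: "('g, 'z) monoid_scheme \<Rightarrow> ('g \<Rightarrow> 'x \<Rightarrow> 'x) \<Rightarrow> 'x set \<Rightarrow> bool" where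
  "invariant G \<phi> V \<longleftrightarrow> (\<forall>t\<in>carrier G. \<phi> t ` V = V)"

definition restrict_action :: "('g \<Rightarrow> 'x \<Rightarrow> 'x) \<Rightarrow> 'x set \<Rightarrow> 'g \<Rightarrow> 'x \<Rightarrow> 'x" where
  "restrict_action \<phi> V = (\<lambda>t. restrict (\<phi> t) V)"

definition restrict_twist ::
    "('g \<Rightarrow> 'g \<Rightarrow> 'x \<Rightarrow> complex) \<Rightarrow> 'x set \<Rightarrow> 'g \<Rightarrow> 'g \<Rightarrow> 'x \<Rightarrow> complex" where
  "restrict_twist u V = (\<lambda>s t. restrict (u s t) V)"

text \<open>
  The algebra \<open>\<ell>\<^sup>1(G, C\<^sub>0(X))\<close>. The sum in the product is absolutely convergent in \<open>C\<^sub>0(X)\<close>, so it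
  may be taken pointwise. Elements of \<open>C\<^sub>0(X)\<close> vanish off \<open>topspace X\<close>, so that for open \<open>U\<close>
  the inclusion of \<open>C\<^sub>0(U)\<close> in \<open>C\<^sub>0(X)\<close> is an inclusion of sets.
\<close>

definition F_alg :: "('g, 'z) monoid_scheme \<Rightarrow> 'x topology \<Rightarrow> ('g \<Rightarrow> 'x \<Rightarrow> 'x)
    \<Rightarrow> ('g \<Rightarrow> 'g \<Rightarrow> 'x \<Rightarrow> complex) \<Rightarrow> ('g \<Rightarrow> 'x \<Rightarrow> complex) cnormed" where
  "F_alg G X \<phi> u = \<lparr>
     carrier = {b. (\<forall>t\<in>carrier G. b t \<in> carrier (C0 X)) \<and> (\<forall>t. t \<notin> carrier G \<longrightarrow> b t = (\<lambda>x. 0)) \<and>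
                   (\<lambda>t. nrm (C0 X) (b t)) summable_on carrier G},
     mult = (\<lambda>a b r x. \<Sum>\<^sub>\<infinity>(s, t)\<in>{(s, t). s \<in> carrier G \<and> t \<in> carrier G \<and> s \<otimes>\<^bsub>G\<^esub> t = r}.
                 a s x * dual_action G X \<phi> s (b t) x * u s t x),
     one = undefined, zero = (\<lambda>t x. 0), add = (\<lambda>a b t x. a t x + b t x),
     smult = (\<lambda>c b t x. c * b t x), nrm = (\<lambda>b. \<Sum>\<^sub>\<infinity>t\<in>carrier G. nrm (C0 X) (b t))\<rparr>"

text \<open>
  \<open>(A, \<iota>)\<close> is \<open>F\<^bsub>R\<^esub>(\<alpha>, u)\<close> for some separating family \<open>R\<close> of representations, and \<open>E\<^sub>1\<close> extends to a
  contraction on it. It is no restriction to let \<open>R\<close> consist of representations on Banach spaces of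
  the type of \<open>A\<close>: a contractive approximate unit of \<open>C\<^sub>0(X)\<close> shows that the norm of \<open>A\<close> is
  already given by left multiplication on \<open>A\<close>.
\<close>

definition separating_family ::
    "'b cnormed \<Rightarrow> ('e cnormed \<times> ('b \<Rightarrow> 'e \<Rightarrow> 'e)) set \<Rightarrow> bool" where
  "separating_family F R \<longleftrightarrow>
     (\<forall>(E, \<psi>)\<in>R. banach_space E \<and> representation F E \<psi>) \<and>
     (\<forall>b\<in>carrier F. b \<noteq> \<zero>\<^bsub>F\<^esub> \<longrightarrow> (\<exists>(E, \<psi>)\<in>R. \<psi> b \<noteq> \<zero>\<^bsub>bounded_operators E\<^esub>))"

definition family_norm ::
    "('e cnormed \<times> ('b \<Rightarrow> 'e \<Rightarrow> 'e)) set \<Rightarrow> 'b \<Rightarrow> real" where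
  "family_norm R b = Sup (insert 0 {nrm (bounded_operators E) (\<psi> b) | E \<psi>. (E, \<psi>) \<in> R})"

definition crossed_product :: "('g, 'z) monoid_scheme \<Rightarrow> 'x topology \<Rightarrow> ('g \<Rightarrow> 'x \<Rightarrow> 'x)
    \<Rightarrow> ('g \<Rightarrow> 'g \<Rightarrow> 'x \<Rightarrow> complex) \<Rightarrow> 'a cnormed \<Rightarrow> (('g \<Rightarrow> 'x \<Rightarrow> complex) \<Rightarrow> 'a) \<Rightarrow> bool" where
  "crossed_product G X \<phi> u A \<iota> \<longleftrightarrow>
     (\<exists>R :: ('a cnormed \<times> (('g \<Rightarrow> 'x \<Rightarrow> complex) \<Rightarrow> 'a \<Rightarrow> 'a)) set.
        separating_family (F_alg G X \<phi> u) R \<and>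
        is_completion (F_alg G X \<phi> u) (family_norm R) A \<iota>) \<and>
     (\<exists>E1\<in>linear_contractions A (C0 X). \<forall>b\<in>carrier (F_alg G X \<phi> u). E1 (\<iota> b) = b \<one>\<^bsub>G\<^esub>)"

definition reduced_crossed_product :: "('g, 'z) monoid_scheme \<Rightarrow> 'x topology \<Rightarrow> ('g \<Rightarrow> 'x \<Rightarrow> 'x)
    \<Rightarrow> ('g \<Rightarrow> 'g \<Rightarrow> 'x \<Rightarrow> complex) \<Rightarrow> 'a cnormed \<Rightarrow> (('g \<Rightarrow> 'x \<Rightarrow> complex) \<Rightarrow> 'a) \<Rightarrow> bool" where
  "reduced_crossed_product G X \<phi> u A \<iota> \<longleftrightarrow> crossed_product G X \<phi> u A \<iota> \<and>
     (\<exists>E. (\<forall>t\<in>carrier G. E t \<in> linear_contractions A (C0 X) \<and>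
                        (\<forall>b\<in>carrier (F_alg G X \<phi> u). E t (\<iota> b) = b t)) \<and>
          {a \<in> carrier A. \<forall>t\<in>carrier G. E t a = \<zero>\<^bsub>C0 X\<^esub>} = {\<zero>\<^bsub>A\<^esub>})"

definition F_sub :: "('g, 'z) monoid_scheme \<Rightarrow> 'x topology \<Rightarrow> ('g \<Rightarrow> 'x \<Rightarrow> 'x)
    \<Rightarrow> ('g \<Rightarrow> 'g \<Rightarrow> 'x \<Rightarrow> complex) \<Rightarrow> 'x set \<Rightarrow> ('g \<Rightarrow> 'x \<Rightarrow> complex) cnormed" where
  "F_sub G X \<phi> u V = F_alg G (subtopology X V) (restrict_action \<phi> V) (restrict_twist u V)"

definition restrict_fun :: "'x set \<Rightarrow> ('g \<Rightarrow> 'x \<Rightarrow> complex) \<Rightarrow> 'g \<Rightarrow> 'x \<Rightarrow> complex" where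
  "restrict_fun Y b = (\<lambda>t x. if x \<in> Y then b t x else 0)"

definition residually_reduced :: "('g, 'z) monoid_scheme \<Rightarrow> 'x topology \<Rightarrow> ('g \<Rightarrow> 'x \<Rightarrow> 'x)
    \<Rightarrow> ('g \<Rightarrow> 'g \<Rightarrow> 'x \<Rightarrow> complex) \<Rightarrow> 'a cnormed \<Rightarrow> (('g \<Rightarrow> 'x \<Rightarrow> complex) \<Rightarrow> 'a) \<Rightarrow> bool" where
  "residually_reduced G X \<phi> u A \<iota> \<longleftrightarrow> crossed_product G X \<phi> u A \<iota> \<and>
     (\<forall>U. openin X U \<and> invariant G \<phi> U \<longrightarrow>
       (let Y = topspace X - U; I = nclosure A (\<iota> ` carrier (F_sub G X \<phi> u U))
        in \<exists>\<iota>Y. (\<forall>b\<in>carrier (F_alg G X \<phi> u). \<iota>Y (restrict_fun Y b) = I +>\<^bsub>A\<^esub> \<iota> b) \<and>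
             reduced_crossed_product G (subtopology X Y) (restrict_action \<phi> Y)
               (restrict_twist u Y) (nquot A I) \<iota>Y))"

text \<open>For \<open>P = {}\<close> the norm is \<open>\<parallel>_\<parallel>\<^sub>1\<close>, in which \<open>F\<close> with the identity is a completion of itself.\<close>

definition is_FP :: "'m itself \<Rightarrow> ereal set \<Rightarrow> ('g \<Rightarrow> 'x \<Rightarrow> complex) cnormed
    \<Rightarrow> 'a cnormed \<Rightarrow> (('g \<Rightarrow> 'x \<Rightarrow> complex) \<Rightarrow> 'a) \<Rightarrow> bool" where
  "is_FP m P F A \<iota> \<longleftrightarrow> is_completion F (P_norm m P F) A \<iota>"

end

theory Submission
  imports Defs
begin

text \<open>
  A real function \<open>a\<close> acts in a non-degenerate representation as a Hermitian operator \<open>\<pi>(a)\<close>: up to terms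
  of second order in \<open>t\<close>, \<open>1 + i t \<pi>(a)\<close> is a contraction. On \<open>L\<^sup>1\<close>- and \<open>C\<^sub>0\<close>-spaces this forces \<open>\<pi>(a)\<close> to be
  local, hence to act as multiplication by a function, and therefore the norm of \<open>\<psi>(b)\<close> is at most the
  supremum of the column sums \<open>\<Sum>\<^sub>t |b(t)(\<phi>\<^sub>t(x))|\<close> on \<open>L\<^sup>1\<close>-spaces, and \<open>\<Sum>\<^sub>t |b(t)(x)|\<close> on \<open>C\<^sub>0\<close>-spaces. The
  regular representations at the points \<open>x\<close> show that these bounds are attained.

  So the norm \<open>N\<close> of \<open>F\<^sup>P\<close> is a maximum of suprema over the points of \<open>X\<close>. If \<open>N(b|\<^sub>Y) < M\<close>, multiplying \<open>b\<close> by
  a function \<open>h\<close> with values in \<open>[0, 1]\<close> that vanishes on \<open>Y\<close> and is close to \<open>1\<close> where the column sums are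
  large gives an element \<open>h b\<close> of \<open>\<ell>\<^sup>1(G, C\<^sub>0(U))\<close> with \<open>N(b - h b) \<le> M\<close>. Hence the quotient norm of the class
  of \<open>b\<close> is \<open>N(b|\<^sub>Y)\<close>, and restriction to \<open>Y\<close> is onto by Tietze's theorem. Finally, truncation to finite
  subsets of \<open>G\<close> is contractive for \<open>N\<close> and converges to the identity, so that an element of the
  completion is determined by its coefficients.
\<close>


section \<open>Seminormed spaces and completeness\<close>

text \<open>Neither C0(X) nor F need have a unit, so every argument that wants one uses functions e
  = g/(g + \<eta>), with g a sum of moduli of the coefficients at hand. The quotient argument sees
  only the formula \<open>concrete_norm\<close>; representations serve to identify it with
  \<open>P_norm\<close>. The columns for p = 1 follow orbits, |b(t)(\<phi>_t(x))|, those for p =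
  \<infinity> stay at x. When both occur, one cutoff has to serve both, so the multiplier of b
  depends on t: at y it is max(h1(\<phi>_t^{-1}(y)), h2(y)). Invariance of U, not of h1 or h2, keeps
  the product in F over U. For empty P each coefficient is cut off by itself at the height
  ||b(t)|_Y||. Since \<Omega> is an arbitrary topological space, test functions at a point are built
  from functions already known to be nonzero there; on L1-spaces the pointwise statements hold
  almost everywhere, and countably many phases replace all of them. The completion A is given
  abstractly with \<iota>, so maps out of it are obtained as closures of graphs over
  \<iota>(F).\<close>

lemma complex_ring_simps [simp]:
  "carrier complex_ring = UNIV" "mult complex_ring = (*)" "one complex_ring = 1"
  "zero complex_ring = 0" "add complex_ring = (+)"
  by (simp_all add: complex_ring_def)

lemma cring_complex_ring: "cring complex_ring"
proof (rule cringI)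
  show "abelian_group complex_ring"
    by (rule abelian_groupI) (auto simp: algebra_simps intro: exI[of _ "- x" for x])
  show "comm_monoid complex_ring"
    by (rule comm_monoidI) (auto simp: algebra_simps)
qed (simp add: algebra_simps)

lemma a_inv_complex_ring [simp]: "\<ominus>\<^bsub>complex_ring\<^esub> c = - c"
proof -
  interpret cring complex_ring by (rule cring_complex_ring)
  show ?thesis using minus_equality[of "- c" c] by simp
qed

text \<open>Definiteness is kept apart because two spaces used below may lack it: the integrable
  functions before almost everywhere equality is divided out, and a quotient by a subspace that need
  not be closed.\<close>

locale seminormed_space = Module.module complex_ring E
  for E :: "'b cnormed" (structure) +
  assumes norm_smult: "x \<in> carrier E \<Longrightarrow> nrm E (c \<odot> x) = cmod c * nrm E x"
    and norm_triangle:
      "\<lbrakk>x \<in> carrier E; y \<in> carrier E\<rbrakk> \<Longrightarrow> nrm E (x \<oplus> y) \<le> nrm E x + nrm E y"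
begin

lemma smult_mem [simp, intro]: "x \<in> carrier E \<Longrightarrow> c \<odot> x \<in> carrier E"
  by simp

lemma smult_one' [simp]: "x \<in> carrier E \<Longrightarrow> 1 \<odot> x = x"
  using smult_one by simp

lemma smult_null [simp]: "x \<in> carrier E \<Longrightarrow> 0 \<odot> x = \<zero>"
  using smult_l_null by simp

lemma smult_zero' [simp]: "c \<odot> \<zero> = \<zero>"
  using smult_r_null by simp

lemma smult_add_left: "x \<in> carrier E \<Longrightarrow> (a + b) \<odot> x = a \<odot> x \<oplus> b \<odot> x"
  using smult_l_distr[of a b x] by simp

lemma smult_smult: "x \<in> carrier E \<Longrightarrow> a \<odot> (b \<odot> x) = (a * b) \<odot> x"
  using smult_assoc1[of a b x] by simp

lemma smult_add_right:
  "\<lbrakk>x \<in> carrier E; y \<in> carrier E\<rbrakk> \<Longrightarrow> c \<odot> (x \<oplus> y) = c \<odot> x \<oplus> c \<odot> y"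
  using smult_r_distr[of c x y] by simp

lemma neg_eq_smult: "x \<in> carrier E \<Longrightarrow> \<ominus> x = (-1) \<odot> x"
  using smult_l_minus[of 1 x] by simp

lemma diff_eq_smult: "x \<in> carrier E \<Longrightarrow> y \<in> carrier E \<Longrightarrow> x \<ominus> y = x \<oplus> (-1) \<odot> y"
  by (simp add: neg_eq_smult M.minus_eq)

lemma smult_diff:
  "\<lbrakk>x \<in> carrier E; y \<in> carrier E\<rbrakk> \<Longrightarrow> c \<odot> (x \<ominus> y) = c \<odot> x \<ominus> c \<odot> y"
  by (simp add: diff_eq_smult smult_add_right smult_smult)

lemma norm_zero [simp]: "nrm E \<zero> = 0"
  using norm_smult[of \<zero> 0] by simp

lemma norm_neg: "x \<in> carrier E \<Longrightarrow> nrm E (\<ominus> x) = nrm E x"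
  by (simp add: neg_eq_smult norm_smult)

lemma norm_nonneg: "x \<in> carrier E \<Longrightarrow> 0 \<le> nrm E x"
  using norm_triangle[of x "\<ominus> x"] norm_neg[of x] by (simp add: M.r_neg)

lemma diff_self [simp]: "x \<in> carrier E \<Longrightarrow> x \<ominus> x = \<zero>"
  by (simp add: M.minus_eq M.r_neg)

lemma diff_zero [simp]: "x \<in> carrier E \<Longrightarrow> x \<ominus> \<zero> = x"
  by (simp add: M.minus_eq)

lemma diff_diff_swap: "\<lbrakk>x \<in> carrier E; y \<in> carrier E\<rbrakk> \<Longrightarrow> \<ominus> (x \<ominus> y) = y \<ominus> x"
  by (simp add: M.minus_eq M.minus_add M.a_comm)

lemma norm_diff_commute:
  "\<lbrakk>x \<in> carrier E; y \<in> carrier E\<rbrakk> \<Longrightarrow> nrm E (x \<ominus> y) = nrm E (y \<ominus> x)"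
  using norm_neg[of "x \<ominus> y"] by (simp add: diff_diff_swap)

lemma diff_add_diff: "\<lbrakk>x \<in> carrier E; y \<in> carrier E; z \<in> carrier E\<rbrakk>
    \<Longrightarrow> (x \<ominus> y) \<oplus> (y \<ominus> z) = x \<ominus> z"
  by (simp add: M.minus_eq M.a_assoc M.r_neg1)

lemma norm_diff_triangle: "\<lbrakk>x \<in> carrier E; y \<in> carrier E; z \<in> carrier E\<rbrakk>
    \<Longrightarrow> nrm E (x \<ominus> z) \<le> nrm E (x \<ominus> y) + nrm E (y \<ominus> z)"
  using norm_triangle[of "x \<ominus> y" "y \<ominus> z"] by (simp add: diff_add_diff)

lemma add_diff_add: "\<lbrakk>x \<in> carrier E; y \<in> carrier E; x' \<in> carrier E; y' \<in> carrier E\<rbrakk>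
    \<Longrightarrow> (x \<oplus> y) \<ominus> (x' \<oplus> y') = (x \<ominus> x') \<oplus> (y \<ominus> y')"
  by (simp add: M.minus_eq M.minus_add M.a_ac)

lemma norm_add_diff: "\<lbrakk>x \<in> carrier E; y \<in> carrier E; x' \<in> carrier E; y' \<in> carrier E\<rbrakk>
    \<Longrightarrow> nrm E ((x \<oplus> y) \<ominus> (x' \<oplus> y')) \<le> nrm E (x \<ominus> x') + nrm E (y \<ominus> y')"
  by (simp add: add_diff_add norm_triangle)

lemma diff_add_cancel: "\<lbrakk>x \<in> carrier E; y \<in> carrier E\<rbrakk> \<Longrightarrow> (x \<ominus> y) \<oplus> y = x"
  by (simp add: M.minus_eq M.a_assoc M.l_neg)

lemma norm_le_add_diff: "\<lbrakk>x \<in> carrier E; y \<in> carrier E\<rbrakk> \<Longrightarrow> nrm E x \<le> nrm E y + nrm E (x \<ominus> y)"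
  using norm_triangle[of "x \<ominus> y" y] by (simp add: diff_add_cancel)

lemma norm_diff_smult: "\<lbrakk>x \<in> carrier E; y \<in> carrier E\<rbrakk>
    \<Longrightarrow> nrm E (c \<odot> x \<ominus> c \<odot> y) = cmod c * nrm E (x \<ominus> y)"
  by (simp add: smult_diff[symmetric] norm_smult)

end

locale normed_space = seminormed_space +
  assumes norm_eq_0_iff: "x \<in> carrier E \<Longrightarrow> nrm E x = 0 \<longleftrightarrow> x = \<zero>"
begin

lemma diff_eq_zero_iff: "\<lbrakk>x \<in> carrier E; y \<in> carrier E\<rbrakk> \<Longrightarrow> x \<ominus> y = \<zero> \<longleftrightarrow> x = y"
  by (metis diff_add_cancel M.l_zero diff_self)

lemma eqI_norm_diff:
  assumes "x \<in> carrier E" "y \<in> carrier E" "\<And>\<epsilon>. \<epsilon> > 0 \<Longrightarrow> nrm E (x \<ominus> y) \<le> \<epsilon>"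
  shows "x = y"
proof -
  have "nrm E (x \<ominus> y) \<le> 0" using assms(3) field_le_epsilon[of "nrm E (x \<ominus> y)" 0] by simp
  then show ?thesis
    using assms norm_nonneg[of "x \<ominus> y"] norm_eq_0_iff[of "x \<ominus> y"] diff_eq_zero_iff by simp
qed

sublocale metric: Metric_space "carrier E" "ndist E"
proof
  fix x y z
  show "0 \<le> ndist E x y" by (simp add: ndist_def norm_nonneg)
  show "ndist E x y = ndist E y x" by (simp add: ndist_def norm_diff_commute)
  show "ndist E x y = 0 \<longleftrightarrow> x = y" if "x \<in> carrier E" "y \<in> carrier E"
    using that by (simp add: ndist_def norm_eq_0_iff diff_eq_zero_iff)
  show "ndist E x z \<le> ndist E x y + ndist E y z"
    if "x \<in> carrier E" "y \<in> carrier E" "z \<in> carrier E"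
    using that by (simp add: ndist_def norm_diff_triangle)
qed

lemma mem_nclosure_iff:
  assumes "S \<subseteq> carrier E"
  shows "x \<in> nclosure E S \<longleftrightarrow> x \<in> carrier E \<and> (\<forall>\<epsilon>>0. \<exists>y\<in>S. nrm E (x \<ominus> y) < \<epsilon>)"
proof -
  have "y \<in> metric.mball x r \<longleftrightarrow> nrm E (x \<ominus> y) < r" if "x \<in> carrier E" "y \<in> S" for y r
    using that assms by (auto simp: ndist_def)
  then show ?thesis
    using assms unfolding nclosure_def metric.metric_closure_of by blast
qed

lemma nclosure_subset: "nclosure E S \<subseteq> carrier E"
  unfolding nclosure_def using closure_of_subset_topspace by fastforce

lemma subset_nclosure: "S \<subseteq> carrier E \<Longrightarrow> S \<subseteq> nclosure E S"
  unfolding nclosure_def by (simp add: closure_of_subset)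

lemma nclosure_idem: "nclosure E (nclosure E S) = nclosure E S"
  unfolding nclosure_def by simp

lemma MCauchy_iff: "metric.MCauchy \<sigma> \<longleftrightarrow> range \<sigma> \<subseteq> carrier E \<and>
    (\<forall>\<epsilon>>0. \<exists>N. \<forall>n\<ge>N. \<forall>m\<ge>N. nrm E (\<sigma> n \<ominus> \<sigma> m) < \<epsilon>)"
proof -
  have "ndist E (\<sigma> n) (\<sigma> m) = nrm E (\<sigma> n \<ominus> \<sigma> m)" if "range \<sigma> \<subseteq> carrier E" for n m
    using that by (auto simp: ndist_def)
  then show ?thesis unfolding metric.MCauchy_def by auto
qed

lemma limitin_iff:
  assumes "range \<sigma> \<subseteq> carrier E"
  shows "limitin metric.mtopology \<sigma> x sequentially \<longleftrightarrow>
    x \<in> carrier E \<and> (\<lambda>n. nrm E (\<sigma> n \<ominus> x)) \<longlonglongrightarrow> 0"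
proof -
  have *: "ndist E (\<sigma> n) x = nrm E (\<sigma> n \<ominus> x)" if "x \<in> carrier E" for n
    using that assms by (auto simp: ndist_def)
  have n: "0 \<le> nrm E (\<sigma> n \<ominus> x)" if "x \<in> carrier E" for n
    using that assms by (auto intro: norm_nonneg)
  have mem: "\<sigma> n \<in> carrier E" for n using assms by auto
  show ?thesis unfolding metric.limitin_metric tendsto_iff
    by (auto simp: * mem dist_real_def n)
qed

end

context banach_space begin

sublocale normed_space
  by unfold_locales (simp_all add: nrm_smult nrm_triangle nrm_eq_0_iff)

lemma Cauchy_limit:
  assumes "\<And>n. \<sigma> n \<in> carrier E" "\<And>\<epsilon>. \<epsilon> > 0 \<Longrightarrow> \<exists>N. \<forall>n\<ge>N. \<forall>m\<ge>N. nrm E (\<sigma> n \<ominus> \<sigma> m) < \<epsilon>"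
  obtains x where "x \<in> carrier E" "(\<lambda>n. nrm E (\<sigma> n \<ominus> x)) \<longlonglongrightarrow> 0"
proof -
  have "metric.MCauchy \<sigma>" using assms by (auto simp: MCauchy_iff)
  then obtain x where "limitin metric.mtopology \<sigma> x sequentially"
    using complete unfolding metric.mcomplete_def by blast
  then show thesis using that assms(1) by (auto simp: limitin_iff image_subset_iff)
qed

end

lemma (in normed_space) banach_spaceI:
  assumes "\<And>\<sigma>. \<lbrakk>\<And>n. \<sigma> n \<in> carrier E; \<And>\<epsilon>. \<epsilon> > 0 \<Longrightarrow> \<exists>N. \<forall>n\<ge>N. \<forall>m\<ge>N. nrm E (\<sigma> n \<ominus> \<sigma> m) < \<epsilon>\<rbrakk>
    \<Longrightarrow> \<exists>x\<in>carrier E. (\<lambda>n. nrm E (\<sigma> n \<ominus> x)) \<longlonglongrightarrow> 0"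
  shows "banach_space E"
proof unfold_locales
  show "metric.mcomplete"
    unfolding metric.mcomplete_def
  proof (intro allI impI)
    fix \<sigma> assume c: "metric.MCauchy \<sigma>"
    then have "\<exists>x\<in>carrier E. (\<lambda>n. nrm E (\<sigma> n \<ominus> x)) \<longlonglongrightarrow> 0"
      by (intro assms) (auto simp: MCauchy_iff)
    then show "\<exists>x. limitin metric.mtopology \<sigma> x sequentially"
      using c by (auto simp: MCauchy_iff limitin_iff)
  qed
qed (simp_all add: norm_smult norm_triangle norm_eq_0_iff)


section \<open>Extension of maps from dense subspaces\<close>

lemma linear_mapsD:
  assumes "f \<in> linear_maps E F"
  shows "x \<in> carrier E \<Longrightarrow> f x \<in> carrier F"
    and "\<lbrakk>x \<in> carrier E; y \<in> carrier E\<rbrakk> \<Longrightarrow> f (x \<oplus>\<^bsub>E\<^esub> y) = f x \<oplus>\<^bsub>F\<^esub> f y"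
    and "x \<in> carrier E \<Longrightarrow> f (c \<odot>\<^bsub>E\<^esub> x) = c \<odot>\<^bsub>F\<^esub> f x"
  using assms by (auto simp: linear_maps_def)

lemma linear_maps_diff:
  assumes "f \<in> linear_maps E F" "seminormed_space E" "seminormed_space F"
    "x \<in> carrier E" "y \<in> carrier E"
  shows "f (x \<ominus>\<^bsub>E\<^esub> y) = f x \<ominus>\<^bsub>F\<^esub> f y"
proof -
  interpret E: seminormed_space E by fact
  interpret F: seminormed_space F by fact
  show ?thesis
    using assms(4,5) linear_mapsD[OF assms(1)] by (simp add: E.diff_eq_smult F.diff_eq_smult)
qed

lemma linear_maps_zero:
  assumes "f \<in> linear_maps E F" "seminormed_space E" "seminormed_space F"
  shows "f \<zero>\<^bsub>E\<^esub> = \<zero>\<^bsub>F\<^esub>"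
proof -
  interpret E: seminormed_space E by fact
  interpret F: seminormed_space F by fact
  have "f (0 \<odot>\<^bsub>E\<^esub> \<zero>\<^bsub>E\<^esub>) = 0 \<odot>\<^bsub>F\<^esub> f \<zero>\<^bsub>E\<^esub>"
    by (rule linear_mapsD(3)[OF assms(1)]) simp
  moreover have "f \<zero>\<^bsub>E\<^esub> \<in> carrier F" by (rule linear_mapsD(1)[OF assms(1)]) simp
  ultimately show ?thesis by simp
qed

text \<open>Extension by continuity from a dense image. \<open>T\<close> is required to be a
  contraction for the seminorm pulled back from \<open>A\<close>, not for the norm of
  \<open>F\<close>: only then does \<open>T b\<close> depend on \<open>\<iota> b\<close>
  alone.\<close>

locale dense_map = F: seminormed_space F + A: banach_space A + C: banach_space C
  for F :: "'f cnormed" and A :: "'a cnormed" and C :: "'c cnormed" +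
  fixes \<iota> :: "'f \<Rightarrow> 'a" and T :: "'f \<Rightarrow> 'c"
  assumes \<iota>_linear: "\<iota> \<in> linear_maps F A" and T_linear: "T \<in> linear_maps F C"
    and T_bound: "b \<in> carrier F \<Longrightarrow> nrm C (T b) \<le> nrm A (\<iota> b)"
    and \<iota>_dense: "nclosure A (\<iota> ` carrier F) = carrier A"
begin

lemmas \<iota>_simps = linear_mapsD[OF \<iota>_linear]
  linear_maps_diff[OF \<iota>_linear F.seminormed_space_axioms A.seminormed_space_axioms]
lemmas T_simps = linear_mapsD[OF T_linear]
  linear_maps_diff[OF T_linear F.seminormed_space_axioms C.seminormed_space_axioms]

text \<open>The closure of the graph of the relation \<open>\<iota> b \<mapsto> T b\<close>; it is the graph of the extension of \<open>T\<close>.\<close>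

definition graph :: "'a \<Rightarrow> 'c \<Rightarrow> bool" where
  "graph a c \<longleftrightarrow> a \<in> carrier A \<and> c \<in> carrier C \<and>
     (\<forall>\<epsilon>>0. \<exists>b\<in>carrier F. nrm A (a \<ominus>\<^bsub>A\<^esub> \<iota> b) < \<epsilon> \<and> nrm C (c \<ominus>\<^bsub>C\<^esub> T b) < \<epsilon>)"

lemma graphD:
  assumes "graph a c"
  shows "a \<in> carrier A" "c \<in> carrier C"
  using assms by (auto simp: graph_def)

lemma graphE:
  assumes "graph a c" "\<epsilon> > 0"
  obtains b where "b \<in> carrier F" "nrm A (a \<ominus>\<^bsub>A\<^esub> \<iota> b) < \<epsilon>" "nrm C (c \<ominus>\<^bsub>C\<^esub> T b) < \<epsilon>"
  using assms by (auto simp: graph_def)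

lemma graph_\<iota>: "b \<in> carrier F \<Longrightarrow> graph (\<iota> b) (T b)"
  by (auto simp: graph_def \<iota>_simps T_simps intro!: bexI[of _ b])

lemma approx:
  assumes "a \<in> carrier A" "\<epsilon> > 0"
  obtains b where "b \<in> carrier F" "nrm A (a \<ominus>\<^bsub>A\<^esub> \<iota> b) < \<epsilon>"
proof -
  have "\<iota> ` carrier F \<subseteq> carrier A" by (auto simp: \<iota>_simps)
  then show thesis using that assms \<iota>_dense A.mem_nclosure_iff by blast
qed

lemma T_diff_bound:
  "\<lbrakk>b \<in> carrier F; b' \<in> carrier F\<rbrakk> \<Longrightarrow> nrm C (T b \<ominus>\<^bsub>C\<^esub> T b') \<le> nrm A (\<iota> b \<ominus>\<^bsub>A\<^esub> \<iota> b')"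
  using T_bound[of "b \<ominus>\<^bsub>F\<^esub> b'"] by (simp add: \<iota>_simps T_simps)

text \<open>Completeness of \<open>C\<close> enters here: if \<open>\<iota> (b n)\<close> tends to
  \<open>a\<close>, then \<open>T (b n)\<close> is a Cauchy sequence, and its limit is the second
  coordinate.\<close>

lemma graph_exists:
  assumes a: "a \<in> carrier A"
  shows "\<exists>c. graph a c"
proof -
  have "\<exists>b. b \<in> carrier F \<and> nrm A (a \<ominus>\<^bsub>A\<^esub> \<iota> b) < inverse (real (Suc n))" for n
    using approx[OF a] by (metis inverse_positive_iff_positive of_nat_0_less_iff zero_less_Suc)
  then obtain b where b: "\<And>n. b n \<in> carrier F"
      "\<And>n. nrm A (a \<ominus>\<^bsub>A\<^esub> \<iota> (b n)) < inverse (real (Suc n))"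
    by metis
  have small: "\<exists>N. \<forall>n\<ge>N. nrm A (a \<ominus>\<^bsub>A\<^esub> \<iota> (b n)) < \<epsilon>" if "\<epsilon> > 0" for \<epsilon>
  proof -
    obtain N where "inverse (real (Suc N)) < \<epsilon>" using reals_Archimedean[OF \<open>\<epsilon> > 0\<close>] by auto
    moreover have "inverse (real (Suc n)) \<le> inverse (real (Suc N))" if "n \<ge> N" for n
      using that by (simp add: le_imp_inverse_le)
    ultimately show ?thesis using b(2) by (meson less_le_trans less_trans)
  qed
  obtain c where c: "c \<in> carrier C" "(\<lambda>n. nrm C (T (b n) \<ominus>\<^bsub>C\<^esub> c)) \<longlonglongrightarrow> 0"
  proof (rule C.Cauchy_limit)
    show "T (b n) \<in> carrier C" for n using b by (simp add: T_simps)
    fix \<epsilon> :: real assume "\<epsilon> > 0"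
    then obtain N where N: "\<And>n. n \<ge> N \<Longrightarrow> nrm A (a \<ominus>\<^bsub>A\<^esub> \<iota> (b n)) < \<epsilon>/2"
      using small[of "\<epsilon>/2"] by auto
    have "nrm C (T (b n) \<ominus>\<^bsub>C\<^esub> T (b m)) < \<epsilon>" if "n \<ge> N" "m \<ge> N" for n m
    proof -
      have "nrm C (T (b n) \<ominus>\<^bsub>C\<^esub> T (b m)) \<le> nrm A (\<iota> (b n) \<ominus>\<^bsub>A\<^esub> \<iota> (b m))"
        using b by (simp add: T_diff_bound)
      also have "\<dots> \<le> nrm A (\<iota> (b n) \<ominus>\<^bsub>A\<^esub> a) + nrm A (a \<ominus>\<^bsub>A\<^esub> \<iota> (b m))"
        using a b by (intro A.norm_diff_triangle) (auto simp: \<iota>_simps)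
      finally show ?thesis
        using N[OF that(1)] N[OF that(2)] A.norm_diff_commute[OF a, of "\<iota> (b n)"] b
        by (auto simp: \<iota>_simps)
    qed
    then show "\<exists>N. \<forall>n\<ge>N. \<forall>m\<ge>N. nrm C (T (b n) \<ominus>\<^bsub>C\<^esub> T (b m)) < \<epsilon>" by auto
  qed
  have "graph a c"
    unfolding graph_def
  proof (intro conjI allI impI a c(1))
    fix \<epsilon> :: real assume "\<epsilon> > 0"
    then obtain N where N: "\<And>n. n \<ge> N \<Longrightarrow> nrm A (a \<ominus>\<^bsub>A\<^esub> \<iota> (b n)) < \<epsilon>" using small by auto
    have "\<forall>\<^sub>F n in sequentially. nrm C (T (b n) \<ominus>\<^bsub>C\<^esub> c) < \<epsilon>"
      using c(2) \<open>\<epsilon> > 0\<close> by (rule order_tendstoD)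
    then obtain N' where "\<And>n. n \<ge> N' \<Longrightarrow> nrm C (T (b n) \<ominus>\<^bsub>C\<^esub> c) < \<epsilon>"
      by (auto simp: eventually_sequentially)
    then obtain n where "n \<ge> N" "nrm C (T (b n) \<ominus>\<^bsub>C\<^esub> c) < \<epsilon>"
      using max.cobounded1 max.cobounded2 by blast
    then show "\<exists>b\<in>carrier F. nrm A (a \<ominus>\<^bsub>A\<^esub> \<iota> b) < \<epsilon> \<and> nrm C (c \<ominus>\<^bsub>C\<^esub> T b) < \<epsilon>"
      using N b(1) c(1) by (intro bexI[of _ "b n"]) (auto simp: C.norm_diff_commute T_simps)
  qed
  then show ?thesis ..
qed

text \<open>The two approximating elements b and b' may differ, but their images under
  \<open>\<iota>\<close> are both close to \<open>a\<close>, so \<open>T b\<close> and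
  \<open>T b'\<close> are close. Four errors arise, each below \<epsilon>/4.\<close>

lemma graph_unique:
  assumes "graph a c" "graph a c'"
  shows "c = c'"
proof (rule C.eqI_norm_diff)
  show mem: "c \<in> carrier C" "c' \<in> carrier C" using assms by (auto simp: graphD)
  fix \<epsilon> :: real assume "\<epsilon> > 0"
  obtain b where b: "b \<in> carrier F" "nrm A (a \<ominus>\<^bsub>A\<^esub> \<iota> b) < \<epsilon>/4" "nrm C (c \<ominus>\<^bsub>C\<^esub> T b) < \<epsilon>/4"
    using graphE[OF assms(1), of "\<epsilon>/4"] \<open>\<epsilon> > 0\<close> by auto
  obtain b' where b': "b' \<in> carrier F" "nrm A (a \<ominus>\<^bsub>A\<^esub> \<iota> b') < \<epsilon>/4" "nrm C (c' \<ominus>\<^bsub>C\<^esub> T b') < \<epsilon>/4"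
    using graphE[OF assms(2), of "\<epsilon>/4"] \<open>\<epsilon> > 0\<close> by auto
  have a: "a \<in> carrier A" using assms by (simp add: graphD)
  note m = mem a b(1) b'(1) T_simps(1)[OF b(1)] T_simps(1)[OF b'(1)]
    \<iota>_simps(1)[OF b(1)] \<iota>_simps(1)[OF b'(1)]
  have "nrm C (c \<ominus>\<^bsub>C\<^esub> c') \<le> nrm C (c \<ominus>\<^bsub>C\<^esub> T b) + nrm C (T b \<ominus>\<^bsub>C\<^esub> c')"
    using m by (intro C.norm_diff_triangle) auto
  moreover have "nrm C (T b \<ominus>\<^bsub>C\<^esub> c') \<le> nrm C (T b \<ominus>\<^bsub>C\<^esub> T b') + nrm C (T b' \<ominus>\<^bsub>C\<^esub> c')"
    using m by (intro C.norm_diff_triangle) auto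
  moreover have "nrm C (T b \<ominus>\<^bsub>C\<^esub> T b') \<le> nrm A (\<iota> b \<ominus>\<^bsub>A\<^esub> \<iota> b')"
    using m by (simp add: T_diff_bound)
  moreover have "nrm A (\<iota> b \<ominus>\<^bsub>A\<^esub> \<iota> b') \<le> nrm A (\<iota> b \<ominus>\<^bsub>A\<^esub> a) + nrm A (a \<ominus>\<^bsub>A\<^esub> \<iota> b')"
    using m by (intro A.norm_diff_triangle) auto
  moreover have "nrm A (\<iota> b \<ominus>\<^bsub>A\<^esub> a) = nrm A (a \<ominus>\<^bsub>A\<^esub> \<iota> b)" "nrm C (T b' \<ominus>\<^bsub>C\<^esub> c') = nrm C (c' \<ominus>\<^bsub>C\<^esub> T b')"
    using m by (auto intro: A.norm_diff_commute C.norm_diff_commute)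
  ultimately show "nrm C (c \<ominus>\<^bsub>C\<^esub> c') \<le> \<epsilon>" using b b' by linarith
qed

lemma graph_add:
  assumes "graph a c" "graph a' c'"
  shows "graph (a \<oplus>\<^bsub>A\<^esub> a') (c \<oplus>\<^bsub>C\<^esub> c')"
  unfolding graph_def
proof (intro conjI allI impI)
  note m = graphD[OF assms(1)] graphD[OF assms(2)]
  show "a \<oplus>\<^bsub>A\<^esub> a' \<in> carrier A" "c \<oplus>\<^bsub>C\<^esub> c' \<in> carrier C" using m by auto
  fix \<epsilon> :: real assume "\<epsilon> > 0"
  obtain b where b: "b \<in> carrier F" "nrm A (a \<ominus>\<^bsub>A\<^esub> \<iota> b) < \<epsilon>/2" "nrm C (c \<ominus>\<^bsub>C\<^esub> T b) < \<epsilon>/2"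
    using graphE[OF assms(1), of "\<epsilon>/2"] \<open>\<epsilon> > 0\<close> by auto
  obtain b' where b': "b' \<in> carrier F" "nrm A (a' \<ominus>\<^bsub>A\<^esub> \<iota> b') < \<epsilon>/2" "nrm C (c' \<ominus>\<^bsub>C\<^esub> T b') < \<epsilon>/2"
    using graphE[OF assms(2), of "\<epsilon>/2"] \<open>\<epsilon> > 0\<close> by auto
  have "nrm A ((a \<oplus>\<^bsub>A\<^esub> a') \<ominus>\<^bsub>A\<^esub> \<iota> (b \<oplus>\<^bsub>F\<^esub> b')) \<le> nrm A (a \<ominus>\<^bsub>A\<^esub> \<iota> b) + nrm A (a' \<ominus>\<^bsub>A\<^esub> \<iota> b')"
    using m b(1) b'(1) by (simp add: \<iota>_simps A.norm_add_diff)
  moreover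
  have "nrm C ((c \<oplus>\<^bsub>C\<^esub> c') \<ominus>\<^bsub>C\<^esub> T (b \<oplus>\<^bsub>F\<^esub> b')) \<le> nrm C (c \<ominus>\<^bsub>C\<^esub> T b) + nrm C (c' \<ominus>\<^bsub>C\<^esub> T b')"
    using m b(1) b'(1) by (simp add: T_simps C.norm_add_diff)
  ultimately show "\<exists>b\<in>carrier F. nrm A ((a \<oplus>\<^bsub>A\<^esub> a') \<ominus>\<^bsub>A\<^esub> \<iota> b) < \<epsilon> \<and> nrm C ((c \<oplus>\<^bsub>C\<^esub> c') \<ominus>\<^bsub>C\<^esub> T b) < \<epsilon>"
    using b b' by (intro bexI[of _ "b \<oplus>\<^bsub>F\<^esub> b'"]) auto
qed

lemma graph_smult:
  assumes "graph a c"
  shows "graph (k \<odot>\<^bsub>A\<^esub> a) (k \<odot>\<^bsub>C\<^esub> c)"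
  unfolding graph_def
proof (intro conjI allI impI)
  note m = graphD[OF assms(1)]
  show "k \<odot>\<^bsub>A\<^esub> a \<in> carrier A" "k \<odot>\<^bsub>C\<^esub> c \<in> carrier C" using m by auto
  fix \<epsilon> :: real assume "\<epsilon> > 0"
  \<comment> \<open>The added 1 keeps the denominator positive for \<open>k = 0\<close>.\<close>
  define \<delta> where "\<delta> = \<epsilon> / (cmod k + 1)"
  have "cmod k + 1 > 0" using norm_ge_zero[of k] by linarith
  then have \<delta>: "\<delta> > 0" "(cmod k + 1) * \<delta> = \<epsilon>" using \<open>\<epsilon> > 0\<close> by (auto simp: \<delta>_def)
  obtain b where b: "b \<in> carrier F" "nrm A (a \<ominus>\<^bsub>A\<^esub> \<iota> b) < \<delta>" "nrm C (c \<ominus>\<^bsub>C\<^esub> T b) < \<delta>"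
    using graphE[OF assms(1) \<delta>(1)] by auto
  have *: "cmod k * x < \<epsilon>" if "x < \<delta>" for x
  proof -
    have "cmod k * x \<le> cmod k * \<delta>" using that by (simp add: mult_left_mono)
    also have "\<dots> < \<epsilon>" using \<delta> by (simp add: distrib_right)
    finally show ?thesis .
  qed
  show "\<exists>b\<in>carrier F. nrm A (k \<odot>\<^bsub>A\<^esub> a \<ominus>\<^bsub>A\<^esub> \<iota> b) < \<epsilon> \<and> nrm C (k \<odot>\<^bsub>C\<^esub> c \<ominus>\<^bsub>C\<^esub> T b) < \<epsilon>"
    using b m by (intro bexI[of _ "k \<odot>\<^bsub>F\<^esub> b"])
      (auto simp: \<iota>_simps T_simps A.norm_diff_smult C.norm_diff_smult *)
qed

lemma graph_norm_le:
  assumes "graph a c"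
  shows "nrm C c \<le> nrm A a"
proof (rule field_le_epsilon)
  note m = graphD[OF assms(1)]
  fix \<epsilon> :: real assume "\<epsilon> > 0"
  obtain b where b: "b \<in> carrier F" "nrm A (a \<ominus>\<^bsub>A\<^esub> \<iota> b) < \<epsilon>/2" "nrm C (c \<ominus>\<^bsub>C\<^esub> T b) < \<epsilon>/2"
    using graphE[OF assms(1), of "\<epsilon>/2"] \<open>\<epsilon> > 0\<close> by auto
  note m = m b(1) \<iota>_simps(1)[OF b(1)] T_simps(1)[OF b(1)]
  have "nrm C c \<le> nrm C (T b) + nrm C (c \<ominus>\<^bsub>C\<^esub> T b)" using m by (intro C.norm_le_add_diff)
  moreover have "nrm A (\<iota> b) \<le> nrm A a + nrm A (\<iota> b \<ominus>\<^bsub>A\<^esub> a)" using m by (intro A.norm_le_add_diff)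
  moreover have "nrm A (\<iota> b \<ominus>\<^bsub>A\<^esub> a) = nrm A (a \<ominus>\<^bsub>A\<^esub> \<iota> b)" using m by (simp add: A.norm_diff_commute)
  ultimately show "nrm C c \<le> nrm A a + \<epsilon>" using T_bound[OF b(1)] b by linarith
qed

definition extension :: "'a \<Rightarrow> 'c" where "extension a = (SOME c. graph a c)"

lemma graph_extension: "a \<in> carrier A \<Longrightarrow> graph a (extension a)"
  unfolding extension_def by (rule someI_ex) (rule graph_exists)

lemma extension_eqI: "graph a c \<Longrightarrow> extension a = c"
  using graph_extension graph_unique graphD by blast

lemma extension_\<iota>: "b \<in> carrier F \<Longrightarrow> extension (\<iota> b) = T b"
  by (simp add: extension_eqI graph_\<iota>)

lemma extension_linear_contraction: "extension \<in> linear_contractions A C"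
proof -
  have "extension (x \<oplus>\<^bsub>A\<^esub> y) = extension x \<oplus>\<^bsub>C\<^esub> extension y"
    if "x \<in> carrier A" "y \<in> carrier A" for x y
    using that by (simp add: extension_eqI graph_add graph_extension)
  moreover have "extension (k \<odot>\<^bsub>A\<^esub> x) = k \<odot>\<^bsub>C\<^esub> extension x" if "x \<in> carrier A" for k x
    using that by (simp add: extension_eqI graph_smult graph_extension)
  moreover have "nrm C (extension x) \<le> nrm A x" "extension x \<in> carrier C" if "x \<in> carrier A" for x
    using graph_norm_le[OF graph_extension[OF that]] graphD(2)[OF graph_extension[OF that]] .
  ultimately show ?thesis
    by (simp add: linear_contractions_def linear_maps_def)
qed

end

locale dense_isometry = dense_map +
  assumes T_isometric: "b \<in> carrier F \<Longrightarrow> nrm C (T b) = nrm A (\<iota> b)"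
begin

lemma graph_norm_eq:
  assumes "graph a c"
  shows "nrm C c = nrm A a"
proof (rule antisym[OF graph_norm_le[OF assms]], rule field_le_epsilon)
  fix \<epsilon> :: real assume "\<epsilon> > 0"
  obtain b where b: "b \<in> carrier F" "nrm A (a \<ominus>\<^bsub>A\<^esub> \<iota> b) < \<epsilon>/2" "nrm C (c \<ominus>\<^bsub>C\<^esub> T b) < \<epsilon>/2"
    using graphE[OF assms(1), of "\<epsilon>/2"] \<open>\<epsilon> > 0\<close> by auto
  note m = graphD[OF assms(1)] b(1) \<iota>_simps(1)[OF b(1)] T_simps(1)[OF b(1)]
  have "nrm A a \<le> nrm A (\<iota> b) + nrm A (a \<ominus>\<^bsub>A\<^esub> \<iota> b)" using m by (intro A.norm_le_add_diff)
  moreover have "nrm C (T b) \<le> nrm C c + nrm C (T b \<ominus>\<^bsub>C\<^esub> c)" using m by (intro C.norm_le_add_diff)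
  moreover have "nrm C (T b \<ominus>\<^bsub>C\<^esub> c) = nrm C (c \<ominus>\<^bsub>C\<^esub> T b)" using m by (simp add: C.norm_diff_commute)
  ultimately show "nrm A a \<le> nrm C c + \<epsilon>" using T_isometric[OF b(1)] b by linarith
qed

text \<open>If a sequence \<open>T (b n)\<close> converges in \<open>C\<close>, then
  \<open>\<iota> (b n)\<close> is Cauchy by isometry, and its limit in the complete space
  \<open>A\<close> is a preimage. Thus the image is closed, which later turns the completion over U
  into a closed ideal of the completion over X and gives surjectivity where the image of
  \<open>T\<close> is dense.\<close>

lemma extension_image: "extension ` carrier A = nclosure C (T ` carrier F)"
proof -
  have sub: "T ` carrier F \<subseteq> carrier C" by (auto simp: T_simps)
  show ?thesis
  proof (intro equalityI subsetI)
    fix c assume "c \<in> extension ` carrier A"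
    then obtain a where a: "a \<in> carrier A" "c = extension a" by auto
    then show "c \<in> nclosure C (T ` carrier F)"
      using graph_extension[OF a(1)] by (auto simp: C.mem_nclosure_iff[OF sub] graph_def)
  next
    fix c assume c: "c \<in> nclosure C (T ` carrier F)"
    have cc: "c \<in> carrier C" using c by (simp add: C.mem_nclosure_iff[OF sub])
    have "\<exists>b. b \<in> carrier F \<and> nrm C (c \<ominus>\<^bsub>C\<^esub> T b) < inverse (real (Suc n))" for n
    proof -
      have "inverse (real (Suc n)) > 0" by simp
      then show ?thesis using c unfolding C.mem_nclosure_iff[OF sub] by blast
    qed
    then obtain b where b: "\<And>n. b n \<in> carrier F"
      "\<And>n. nrm C (c \<ominus>\<^bsub>C\<^esub> T (b n)) < inverse (real (Suc n))"
      by metis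
    have small: "\<exists>N. \<forall>n\<ge>N. nrm C (c \<ominus>\<^bsub>C\<^esub> T (b n)) < \<epsilon>" if "\<epsilon> > 0" for \<epsilon>
    proof -
      obtain N where "inverse (real (Suc N)) < \<epsilon>" using reals_Archimedean[OF \<open>\<epsilon> > 0\<close>] by auto
      moreover have "inverse (real (Suc n)) \<le> inverse (real (Suc N))" if "n \<ge> N" for n
        using that by (simp add: le_imp_inverse_le)
      ultimately show ?thesis using b(2) by (meson less_le_trans less_trans)
    qed
    obtain a where a: "a \<in> carrier A" "(\<lambda>n. nrm A (\<iota> (b n) \<ominus>\<^bsub>A\<^esub> a)) \<longlonglongrightarrow> 0"
    proof (rule A.Cauchy_limit)
      show "\<iota> (b n) \<in> carrier A" for n using b by (simp add: \<iota>_simps)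
      fix \<epsilon> :: real assume "\<epsilon> > 0"
      then obtain N where N: "\<And>n. n \<ge> N \<Longrightarrow> nrm C (c \<ominus>\<^bsub>C\<^esub> T (b n)) < \<epsilon>/2"
        using small[of "\<epsilon>/2"] by auto
      have "nrm A (\<iota> (b n) \<ominus>\<^bsub>A\<^esub> \<iota> (b m)) < \<epsilon>" if "n \<ge> N" "m \<ge> N" for n m
      proof -
        have "nrm A (\<iota> (b n) \<ominus>\<^bsub>A\<^esub> \<iota> (b m)) = nrm C (T (b n) \<ominus>\<^bsub>C\<^esub> T (b m))"
          using b T_isometric[of "b n \<ominus>\<^bsub>F\<^esub> b m"] by (simp add: \<iota>_simps T_simps)
        also have "\<dots> \<le> nrm C (T (b n) \<ominus>\<^bsub>C\<^esub> c) + nrm C (c \<ominus>\<^bsub>C\<^esub> T (b m))"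
          using cc b by (intro C.norm_diff_triangle) (auto simp: T_simps)
        finally show ?thesis
          using N[OF that(1)] N[OF that(2)] C.norm_diff_commute[OF cc, of "T (b n)"] b
          by (auto simp: T_simps)
      qed
      then show "\<exists>N. \<forall>n\<ge>N. \<forall>m\<ge>N. nrm A (\<iota> (b n) \<ominus>\<^bsub>A\<^esub> \<iota> (b m)) < \<epsilon>" by auto
    qed
    have "graph a c"
      unfolding graph_def
    proof (intro conjI allI impI a cc)
      fix \<epsilon> :: real assume "\<epsilon> > 0"
      then obtain N where N: "\<And>n. n \<ge> N \<Longrightarrow> nrm C (c \<ominus>\<^bsub>C\<^esub> T (b n)) < \<epsilon>" using small by auto
      have "\<forall>\<^sub>F n in sequentially. nrm A (\<iota> (b n) \<ominus>\<^bsub>A\<^esub> a) < \<epsilon>"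
        using a(2) \<open>\<epsilon> > 0\<close> by (rule order_tendstoD)
    then obtain N' where "\<And>n. n \<ge> N' \<Longrightarrow> nrm A (\<iota> (b n) \<ominus>\<^bsub>A\<^esub> a) < \<epsilon>"
      by (auto simp: eventually_sequentially)
    then obtain n where "n \<ge> N" "nrm A (\<iota> (b n) \<ominus>\<^bsub>A\<^esub> a) < \<epsilon>"
      using max.cobounded1 max.cobounded2 by blast
      then show "\<exists>b\<in>carrier F. nrm A (a \<ominus>\<^bsub>A\<^esub> \<iota> b) < \<epsilon> \<and> nrm C (c \<ominus>\<^bsub>C\<^esub> T b) < \<epsilon>"
        using N b(1) a(1) by (intro bexI[of _ "b n"]) (auto simp: A.norm_diff_commute \<iota>_simps)
    qed
    then show "c \<in> extension ` carrier A" using extension_eqI a(1) by (metis imageI)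
  qed
qed

end

lemma (in banach_algebra) norm_mult_diff:
  assumes "x \<in> carrier A" "y \<in> carrier A" "x' \<in> carrier A" "y' \<in> carrier A"
  shows "nrm A (x \<otimes> y \<ominus> x' \<otimes> y') \<le> nrm A (x \<ominus> x') * nrm A y + nrm A x' * nrm A (y \<ominus> y')"
proof -
  have 1: "x \<otimes> y \<ominus> x' \<otimes> y = (x \<ominus> x') \<otimes> y"
    using assms by (simp add: diff_eq_smult mult_add_left smult_mult_left mult_closed)
  have 2: "x' \<otimes> y \<ominus> x' \<otimes> y' = x' \<otimes> (y \<ominus> y')"
    using assms by (simp add: diff_eq_smult mult_add_right smult_mult_right mult_closed)
  have "nrm A (x \<otimes> y \<ominus> x' \<otimes> y') \<le> nrm A (x \<otimes> y \<ominus> x' \<otimes> y) + nrm A (x' \<otimes> y \<ominus> x' \<otimes> y')"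
    using assms by (intro norm_diff_triangle) (auto simp: mult_closed)
  then show ?thesis
    unfolding 1 2
    using nrm_mult[of "x \<ominus> x'" y] nrm_mult[of x' "y \<ominus> y'"] assms by simp
qed

locale dense_algebra_isometry = dense_isometry + A: banach_algebra A + C: banach_algebra C +
  assumes F_mult: "\<lbrakk>b \<in> carrier F; b' \<in> carrier F\<rbrakk> \<Longrightarrow> b \<otimes>\<^bsub>F\<^esub> b' \<in> carrier F"
    and \<iota>_mult: "\<lbrakk>b \<in> carrier F; b' \<in> carrier F\<rbrakk> \<Longrightarrow> \<iota> (b \<otimes>\<^bsub>F\<^esub> b') = \<iota> b \<otimes>\<^bsub>A\<^esub> \<iota> b'"
    and T_mult: "\<lbrakk>b \<in> carrier F; b' \<in> carrier F\<rbrakk> \<Longrightarrow> T (b \<otimes>\<^bsub>F\<^esub> b') = T b \<otimes>\<^bsub>C\<^esub> T b'"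
begin

text \<open>Multiplication is uniformly continuous only on bounded sets. Isometry gives
  \<open>nrm C c = nrm A a\<close>, so the same constant works on both sides.\<close>

lemma graph_mult:
  assumes "graph a c" "graph a' c'"
  shows "graph (a \<otimes>\<^bsub>A\<^esub> a') (c \<otimes>\<^bsub>C\<^esub> c')"
  unfolding graph_def
proof (intro conjI allI impI)
  note m = graphD[OF assms(1)] graphD[OF assms(2)]
  show "a \<otimes>\<^bsub>A\<^esub> a' \<in> carrier A" "c \<otimes>\<^bsub>C\<^esub> c' \<in> carrier C"
    using m by (auto simp: A.mult_closed C.mult_closed)
  fix \<epsilon> :: real assume "\<epsilon> > 0"
  \<comment> \<open>The error is at most \<delta> ||a'|| + (||a|| + 1) \<delta> = (K - 1) \<delta>,
    where ||a|| + 1 bounds ||\<iota> b|| because \<delta> \<le> 1; the spare \<delta> makes the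
    inequality strict.\<close>
  define K where "K = nrm A a + nrm A a' + 2"
  have K: "K > 0" using A.norm_nonneg[OF m(1)] A.norm_nonneg[OF m(3)] by (simp add: K_def)
  have nc: "nrm C c = nrm A a" "nrm C c' = nrm A a'" using assms graph_norm_eq by auto
  define \<delta> where "\<delta> = min 1 (\<epsilon>/K)"
  have \<delta>: "\<delta> > 0" "\<delta> \<le> 1" "\<delta> * K \<le> \<epsilon>" using \<open>\<epsilon> > 0\<close> K by (auto simp: \<delta>_def min_def field_simps)
  obtain b where b: "b \<in> carrier F" "nrm A (a \<ominus>\<^bsub>A\<^esub> \<iota> b) < \<delta>" "nrm C (c \<ominus>\<^bsub>C\<^esub> T b) < \<delta>"
    using graphE[OF assms(1) \<delta>(1)] by auto
  obtain b' where b': "b' \<in> carrier F" "nrm A (a' \<ominus>\<^bsub>A\<^esub> \<iota> b') < \<delta>" "nrm C (c' \<ominus>\<^bsub>C\<^esub> T b') < \<delta>"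
    using graphE[OF assms(2) \<delta>(1)] by auto
  note m = m b(1) b'(1) T_simps(1)[OF b(1)] T_simps(1)[OF b'(1)]
    \<iota>_simps(1)[OF b(1)] \<iota>_simps(1)[OF b'(1)]
  have est: "p * s' + t * q < \<epsilon>"
    if "p < \<delta>" "q < \<delta>" "0 \<le> p" "0 \<le> q" "s' = nrm A a'" "0 \<le> t" "t \<le> nrm A a + 1" for p q s' t :: real
  proof -
    have "p * s' \<le> \<delta> * nrm A a'" using that A.norm_nonneg[OF m(3)] by (intro mult_mono) auto
    moreover have "t * q \<le> (nrm A a + 1) * \<delta>" using that A.norm_nonneg[OF m(1)] by (intro mult_mono) auto
    moreover have "\<delta> * K = \<delta> * nrm A a' + (nrm A a + 1) * \<delta> + \<delta>" by (simp add: K_def algebra_simps)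
    ultimately show ?thesis using \<delta> by linarith
  qed
  have "nrm A (a \<otimes>\<^bsub>A\<^esub> a' \<ominus>\<^bsub>A\<^esub> \<iota> (b \<otimes>\<^bsub>F\<^esub> b')) \<le> nrm A (a \<ominus>\<^bsub>A\<^esub> \<iota> b) * nrm A a' + nrm A (\<iota> b) * nrm A (a' \<ominus>\<^bsub>A\<^esub> \<iota> b')"
    using m by (simp add: \<iota>_mult A.norm_mult_diff)
  moreover have t: "nrm A (\<iota> b) \<le> nrm A a + 1"
    using A.norm_le_add_diff[of "\<iota> b" a] A.norm_diff_commute[of "\<iota> b" a] m b(2) \<delta>(2) by simp
  moreover
  have "nrm C (c \<otimes>\<^bsub>C\<^esub> c' \<ominus>\<^bsub>C\<^esub> T (b \<otimes>\<^bsub>F\<^esub> b')) \<le> nrm C (c \<ominus>\<^bsub>C\<^esub> T b) * nrm C c' + nrm C (T b) * nrm C (c' \<ominus>\<^bsub>C\<^esub> T b')"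
    using m by (simp add: T_mult C.norm_mult_diff)
  moreover have "nrm A (a \<ominus>\<^bsub>A\<^esub> \<iota> b) * nrm A a' + nrm A (\<iota> b) * nrm A (a' \<ominus>\<^bsub>A\<^esub> \<iota> b') < \<epsilon>"
    using m t b b' by (intro est) (auto simp: A.norm_nonneg)
  moreover have "nrm C (c \<ominus>\<^bsub>C\<^esub> T b) * nrm C c' + nrm C (T b) * nrm C (c' \<ominus>\<^bsub>C\<^esub> T b') < \<epsilon>"
    using m t b b' nc by (intro est) (auto simp: C.norm_nonneg T_isometric A.norm_nonneg)
  ultimately show "\<exists>b\<in>carrier F. nrm A (a \<otimes>\<^bsub>A\<^esub> a' \<ominus>\<^bsub>A\<^esub> \<iota> b) < \<epsilon> \<and> nrm C (c \<otimes>\<^bsub>C\<^esub> c' \<ominus>\<^bsub>C\<^esub> T b) < \<epsilon>"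
    using m F_mult by (intro bexI[of _ "b \<otimes>\<^bsub>F\<^esub> b'"]) auto
qed

lemma extension_isometric_hom: "extension \<in> isometric_hom A C"
proof -
  have "extension (x \<otimes>\<^bsub>A\<^esub> y) = extension x \<otimes>\<^bsub>C\<^esub> extension y"
    if "x \<in> carrier A" "y \<in> carrier A" for x y
    using that by (simp add: extension_eqI graph_mult graph_extension)
  moreover have "nrm C (extension x) = nrm A x" if "x \<in> carrier A" for x
    using graph_norm_eq[OF graph_extension[OF that]] .
  ultimately show ?thesis
    using extension_linear_contraction
    by (simp add: isometric_hom_def alg_hom_def linear_contractions_def)
qed

text \<open>Injectivity is isometry; surjectivity is density together with the closed image.\<close>

lemma extension_isometric_iso:
  assumes "nclosure C (T ` carrier F) = carrier C"
  shows "extension \<in> isometric_iso A C"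
proof -
  have "x = y" if "x \<in> carrier A" "y \<in> carrier A" "extension x = extension y" for x y
  proof (rule A.eqI_norm_diff[OF that(1,2)])
    have lin: "extension \<in> linear_maps A C"
      using extension_linear_contraction by (auto simp: linear_contractions_def)
    have "nrm A (x \<ominus>\<^bsub>A\<^esub> y) = nrm C (extension (x \<ominus>\<^bsub>A\<^esub> y))"
      using that graph_norm_eq[OF graph_extension] by simp
    also have "extension (x \<ominus>\<^bsub>A\<^esub> y) = extension x \<ominus>\<^bsub>C\<^esub> extension y"
      using that lin by (intro linear_maps_diff A.seminormed_space_axioms C.seminormed_space_axioms)
    also have "\<dots> = \<zero>\<^bsub>C\<^esub>" using that linear_mapsD(1)[OF lin] by simp
    finally show "nrm A (x \<ominus>\<^bsub>A\<^esub> y) \<le> \<epsilon>" if "\<epsilon> > 0" for \<epsilon> using that by simp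
  qed
  then show ?thesis
    using extension_isometric_hom extension_image assms
    by (auto simp: isometric_iso_def bij_betw_def inj_on_def)
qed

end


section \<open>Quotients by closed ideals\<close>

locale quotient_space = seminormed_space +
  fixes I
  assumes I_subset: "I \<subseteq> carrier E" and I_zero: "\<zero> \<in> I"
    and I_add: "\<lbrakk>x \<in> I; y \<in> I\<rbrakk> \<Longrightarrow> x \<oplus> y \<in> I"
    and I_smult: "x \<in> I \<Longrightarrow> c \<odot> x \<in> I"
begin

abbreviation "Q \<equiv> nquot E I"

lemma I_mem: "x \<in> I \<Longrightarrow> x \<in> carrier E" using I_subset by auto

lemma I_neg: "x \<in> I \<Longrightarrow> \<ominus> x \<in> I"
  using I_smult[of x "-1"] I_mem[of x] by (simp add: neg_eq_smult)

sublocale I: abelian_subgroup I E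
proof (rule abelian_subgroupI3)
  show "additive_subgroup I E"
    by (rule additive_subgroupI, rule M.add.subgroupI)
      (use I_subset I_zero I_add I_neg in \<open>auto simp: a_inv_def[symmetric]\<close>)
qed unfold_locales

lemma mem_coset_iff: "x \<in> carrier E \<Longrightarrow> y \<in> I +> x \<longleftrightarrow> y \<in> carrier E \<and> y \<ominus> x \<in> I"
  using I.a_rcos_module[of x y] I.a_elemrcos_carrier[of x y] by (auto simp: M.minus_eq)

lemma coset_eq_iff:
  assumes "x \<in> carrier E" "y \<in> carrier E"
  shows "I +> x = I +> y \<longleftrightarrow> x \<ominus> y \<in> I"
proof
  assume "I +> x = I +> y"
  then show "x \<ominus> y \<in> I"
    using assms mem_coset_iff I_zero by (metis diff_self)
next
  assume "x \<ominus> y \<in> I"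
  then have "x \<in> I +> y" using assms by (simp add: mem_coset_iff)
  then show "I +> x = I +> y" using I.a_repr_independence' assms by simp
qed

lemma coset_self: "x \<in> carrier E \<Longrightarrow> x \<in> I +> x"
  by (simp add: mem_coset_iff I_zero)

lemma carrier_quot: "carrier Q = (\<lambda>x. I +> x) ` carrier E"
  by (auto simp: nquot_def A_RCOSETS_def')

lemma coset_mem: "x \<in> carrier E \<Longrightarrow> I +> x \<in> carrier Q"
  by (simp add: carrier_quot)

lemma zero_quot: "zero Q = I +> \<zero>"
  using I.a_rcos_const[OF I_zero] by (simp add: nquot_def)

lemma add_quot:
  "\<lbrakk>x \<in> carrier E; y \<in> carrier E\<rbrakk> \<Longrightarrow> (I +> x) \<oplus>\<^bsub>Q\<^esub> (I +> y) = I +> (x \<oplus> y)"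
  by (simp add: nquot_def I.a_rcos_sum)

text \<open>All cosets in the union that defines the scalar multiple coincide. Taking cosets of the
  products also makes 0 times a coset equal to \<open>I\<close> and not to the singleton of
  zero.\<close>

lemma smult_quot:
  assumes x: "x \<in> carrier E"
  shows "c \<odot>\<^bsub>Q\<^esub> (I +> x) = I +> (c \<odot> x)"
proof -
  have *: "I +> (c \<odot> y) = I +> (c \<odot> x)" if "y \<in> I +> x" for y
    using that x I_smult[of "y \<ominus> x" c] by (subst coset_eq_iff) (auto simp: mem_coset_iff smult_diff)
  have "c \<odot>\<^bsub>Q\<^esub> (I +> x) = (\<Union>y\<in>I +> x. I +> (c \<odot> y))" by (simp add: nquot_def)
  also have "\<dots> = (\<Union>y\<in>I +> x. I +> (c \<odot> x))" by (intro SUP_cong refl *)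
  also have "\<dots> = I +> (c \<odot> x)" using coset_self[OF x] by (intro SUP_eq_const) auto
  finally show ?thesis .
qed

lemma norm_quot: "nrm Q K = (INF x\<in>K. nrm E x)"
  by (simp add: nquot_def)

lemma coset_carrier: "x \<in> carrier E \<Longrightarrow> y \<in> I +> x \<Longrightarrow> y \<in> carrier E"
  by (simp add: mem_coset_iff)

lemma coset_eq: "x \<in> carrier E \<Longrightarrow> y \<in> I +> x \<Longrightarrow> I +> y = I +> x"
  using I.a_repr_independence' by simp

lemma bdd_below_coset: "x \<in> carrier E \<Longrightarrow> bdd_below (nrm E ` (I +> x))"
  by (intro bdd_belowI[of _ 0]) (auto dest: coset_carrier simp: norm_nonneg)

lemma norm_quot_le: "x \<in> carrier E \<Longrightarrow> nrm Q (I +> x) \<le> nrm E x"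
  unfolding norm_quot by (rule cINF_lower[OF bdd_below_coset coset_self])

lemma norm_quot_ge:
  "x \<in> carrier E \<Longrightarrow> (\<And>y. y \<in> I +> x \<Longrightarrow> B \<le> nrm E y) \<Longrightarrow> B \<le> nrm Q (I +> x)"
  unfolding norm_quot using coset_self by (intro cINF_greatest) auto

lemma norm_quot_geI:
  assumes "x \<in> carrier E" "\<And>i. i \<in> I \<Longrightarrow> B \<le> nrm E (x \<ominus> i)"
  shows "B \<le> nrm Q (I +> x)"
proof (rule norm_quot_ge[OF assms(1)])
  fix y assume "y \<in> I +> x"
  then have y: "y \<in> carrier E" "y \<ominus> x \<in> I" using assms(1) by (auto simp: mem_coset_iff)
  have "x \<ominus> (x \<ominus> y) = y"
    using y(1) assms(1) by (simp add: M.minus_eq M.minus_add M.r_neg1 M.a_assoc[symmetric] M.r_neg)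
  moreover have "x \<ominus> y \<in> I" using I_neg[OF y(2)] y(1) assms(1) by (simp add: diff_diff_swap)
  ultimately show "B \<le> nrm E y" using assms(2) by metis
qed

lemma norm_quot_approx:
  assumes "x \<in> carrier E" "nrm Q (I +> x) < B"
  obtains y where "y \<in> carrier E" "I +> y = I +> x" "nrm E y < B"
proof -
  have "\<exists>y\<in>I +> x. nrm E y < B"
    using assms coset_self bdd_below_coset unfolding norm_quot by (subst (asm) cINF_less_iff) auto
  then show thesis using that coset_eq coset_carrier assms(1) by blast
qed

lemma norm_quot_approx_diff:
  assumes "x \<in> carrier E" "nrm Q (I +> x) < B"
  obtains i where "i \<in> I" "nrm E (x \<ominus> i) < B"
proof -
  obtain y where y: "y \<in> carrier E" "I +> y = I +> x" "nrm E y < B"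
    using norm_quot_approx[OF assms] .
  then have "x \<ominus> y \<in> I" using assms(1) coset_eq_iff[of x y] by simp
  moreover have "x \<ominus> (x \<ominus> y) = y"
    using y(1) assms(1) by (simp add: M.minus_eq M.minus_add M.r_neg1 M.a_assoc[symmetric] M.r_neg)
  ultimately show thesis using that y(3) by metis
qed

lemma norm_quot_nonneg: "x \<in> carrier E \<Longrightarrow> 0 \<le> nrm Q (I +> x)"
  by (rule norm_quot_ge) (auto dest: coset_carrier simp: norm_nonneg)

lemma quotE:
  assumes "K \<in> carrier Q"
  obtains x where "x \<in> carrier E" "K = I +> x"
  using assms by (auto simp: carrier_quot)

lemma seminormed_space_quot: "seminormed_space Q"
proof (intro seminormed_space.intro moduleI seminormed_space_axioms.intro)
  show "cring complex_ring" by (rule cring_complex_ring)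
  show "abelian_group Q"
  proof (rule abelian_groupI)
    fix x assume "x \<in> carrier Q"
    then obtain a where a: "a \<in> carrier E" "x = I +> a" by (rule quotE)
    then have "(I +> (\<ominus> a)) \<oplus>\<^bsub>Q\<^esub> x = zero Q" by (simp add: add_quot zero_quot M.l_neg)
    then show "\<exists>y\<in>carrier Q. y \<oplus>\<^bsub>Q\<^esub> x = \<zero>\<^bsub>Q\<^esub>" using a coset_mem by blast
  next
    fix x y assume "x \<in> carrier Q" "y \<in> carrier Q"
    then show "x \<oplus>\<^bsub>Q\<^esub> y \<in> carrier Q" "x \<oplus>\<^bsub>Q\<^esub> y = y \<oplus>\<^bsub>Q\<^esub> x"
      by (metis quotE add_quot coset_mem M.a_closed M.a_comm)+
  next
    fix x y z assume "x \<in> carrier Q" "y \<in> carrier Q" "z \<in> carrier Q"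
    then show "x \<oplus>\<^bsub>Q\<^esub> y \<oplus>\<^bsub>Q\<^esub> z = x \<oplus>\<^bsub>Q\<^esub> (y \<oplus>\<^bsub>Q\<^esub> z)"
      by (metis quotE add_quot M.a_closed M.a_assoc)
  next
    show "\<zero>\<^bsub>Q\<^esub> \<in> carrier Q" by (simp add: zero_quot coset_mem)
    show "\<zero>\<^bsub>Q\<^esub> \<oplus>\<^bsub>Q\<^esub> x = x" if "x \<in> carrier Q" for x
      using that by (metis quotE zero_quot add_quot M.zero_closed M.l_zero)
  qed
  show "c \<odot>\<^bsub>Q\<^esub> x \<in> carrier Q" if "x \<in> carrier Q" for c x
    using that by (metis quotE smult_quot coset_mem smult_mem)
  show "\<one>\<^bsub>complex_ring\<^esub> \<odot>\<^bsub>Q\<^esub> x = x" if "x \<in> carrier Q" for x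
    using that by (metis quotE smult_quot smult_one complex_ring_simps(3))
  show "nrm Q (x \<oplus>\<^bsub>Q\<^esub> y) \<le> nrm Q x + nrm Q y" if x: "x \<in> carrier Q" and y: "y \<in> carrier Q" for x y
  proof -
    obtain a b where ab: "a \<in> carrier E" "x = I +> a" "b \<in> carrier E" "y = I +> b"
      using quotE[OF x] quotE[OF y] by metis
    show ?thesis
    proof (rule field_le_epsilon)
      fix \<epsilon> :: real assume "\<epsilon> > 0"
      obtain a' where a': "a' \<in> carrier E" "I +> a' = I +> a" "nrm E a' < nrm Q x + \<epsilon>/2"
        using norm_quot_approx[OF ab(1), of "nrm Q x + \<epsilon>/2"] ab \<open>\<epsilon> > 0\<close> by auto
      obtain b' where b': "b' \<in> carrier E" "I +> b' = I +> b" "nrm E b' < nrm Q y + \<epsilon>/2"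
        using norm_quot_approx[OF ab(3), of "nrm Q y + \<epsilon>/2"] ab \<open>\<epsilon> > 0\<close> by auto
      have "x \<oplus>\<^bsub>Q\<^esub> y = I +> (a' \<oplus> b')" using a' b' ab add_quot[of a' b'] by simp
      then have "nrm Q (x \<oplus>\<^bsub>Q\<^esub> y) \<le> nrm E (a' \<oplus> b')" using norm_quot_le a' b' by simp
      also have "\<dots> \<le> nrm E a' + nrm E b'" using a' b' by (simp add: norm_triangle)
      finally show "nrm Q (x \<oplus>\<^bsub>Q\<^esub> y) \<le> nrm Q x + nrm Q y + \<epsilon>" using a' b' by simp
    qed
  qed
  \<comment> \<open>Representatives give only this inequality; the reverse one follows below by
    applying it to \<open>inverse c\<close>.\<close>
  have le: "nrm Q (c \<odot>\<^bsub>Q\<^esub> x) \<le> cmod c * nrm Q x" if "x \<in> carrier Q" for c x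
  proof -
    obtain a where a: "a \<in> carrier E" "x = I +> a" using \<open>x \<in> carrier Q\<close> by (rule quotE)
    show ?thesis
    proof (rule field_le_epsilon)
      fix \<epsilon> :: real assume "\<epsilon> > 0"
      define \<delta> where "\<delta> = \<epsilon> / (cmod c + 1)"
      have "cmod c + 1 > 0" using norm_ge_zero[of c] by linarith
      then have \<delta>: "\<delta> > 0" "(cmod c + 1) * \<delta> = \<epsilon>" using \<open>\<epsilon> > 0\<close> by (auto simp: \<delta>_def)
      obtain a' where a': "a' \<in> carrier E" "I +> a' = I +> a" "nrm E a' < nrm Q x + \<delta>"
        using norm_quot_approx[OF a(1), of "nrm Q x + \<delta>"] a \<delta> by auto
      have "c \<odot>\<^bsub>Q\<^esub> x = I +> (c \<odot> a')" using a a' smult_quot[of a' c] by simp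
      then have "nrm Q (c \<odot>\<^bsub>Q\<^esub> x) \<le> cmod c * nrm E a'"
        using norm_quot_le[of "c \<odot> a'"] a' by (simp add: norm_smult)
      also have "\<dots> \<le> cmod c * (nrm Q x + \<delta>)" using a' by (intro mult_left_mono) auto
      also have "\<dots> \<le> cmod c * nrm Q x + \<epsilon>" using \<delta> by (simp add: algebra_simps)
      finally show "nrm Q (c \<odot>\<^bsub>Q\<^esub> x) \<le> cmod c * nrm Q x + \<epsilon>" .
    qed
  qed
  show "nrm Q (c \<odot>\<^bsub>Q\<^esub> x) = cmod c * nrm Q x" if x: "x \<in> carrier Q" for c x
  proof (cases "c = 0")
    case True
    obtain a where a: "a \<in> carrier E" "x = I +> a" using x by (rule quotE)
    then have "nrm Q (0 \<odot>\<^bsub>Q\<^esub> x) = 0"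
      using norm_quot_nonneg[of \<zero>] norm_quot_le[of \<zero>] by (simp add: smult_quot)
    then show ?thesis using True by simp
  next
    case False
    have "c \<odot>\<^bsub>Q\<^esub> x \<in> carrier Q" "inverse c \<odot>\<^bsub>Q\<^esub> (c \<odot>\<^bsub>Q\<^esub> x) = x"
    proof -
      obtain a where a: "a \<in> carrier E" "x = I +> a" using x by (rule quotE)
      then show "c \<odot>\<^bsub>Q\<^esub> x \<in> carrier Q" "inverse c \<odot>\<^bsub>Q\<^esub> (c \<odot>\<^bsub>Q\<^esub> x) = x"
        using False by (simp_all add: smult_quot coset_mem smult_smult)
    qed
    then have "nrm Q x \<le> cmod (inverse c) * nrm Q (c \<odot>\<^bsub>Q\<^esub> x)" using le by metis
    then have "cmod c * nrm Q x \<le> nrm Q (c \<odot>\<^bsub>Q\<^esub> x)"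
      using False by (simp add: norm_divide norm_inverse field_simps)
    then show ?thesis using le[OF x, of c] by simp
  qed
next
  fix a b x assume "a \<in> carrier complex_ring" "b \<in> carrier complex_ring" "x \<in> carrier Q"
  then obtain z where z: "z \<in> carrier E" "x = I +> z" using quotE by metis
  show "(a \<oplus>\<^bsub>complex_ring\<^esub> b) \<odot>\<^bsub>Q\<^esub> x = a \<odot>\<^bsub>Q\<^esub> x \<oplus>\<^bsub>Q\<^esub> b \<odot>\<^bsub>Q\<^esub> x"
    "(a \<otimes>\<^bsub>complex_ring\<^esub> b) \<odot>\<^bsub>Q\<^esub> x = a \<odot>\<^bsub>Q\<^esub> (b \<odot>\<^bsub>Q\<^esub> x)"
    using z by (simp_all add: add_quot smult_quot smult_add_left smult_smult)
next
  fix a x y assume "x \<in> carrier Q" "y \<in> carrier Q"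
  then obtain z w where "z \<in> carrier E" "x = I +> z" "w \<in> carrier E" "y = I +> w"
    using quotE by metis
  then show "a \<odot>\<^bsub>Q\<^esub> (x \<oplus>\<^bsub>Q\<^esub> y) = a \<odot>\<^bsub>Q\<^esub> x \<oplus>\<^bsub>Q\<^esub> a \<odot>\<^bsub>Q\<^esub> y"
    by (simp add: add_quot smult_quot smult_add_right)
qed

lemma diff_quot:
  assumes "x \<in> carrier E" "y \<in> carrier E"
  shows "(I +> x) \<ominus>\<^bsub>Q\<^esub> (I +> y) = I +> (x \<ominus> y)"
proof -
  interpret Q: seminormed_space Q by (rule seminormed_space_quot)
  show ?thesis using assms
    by (simp add: Q.diff_eq_smult coset_mem smult_quot add_quot diff_eq_smult)
qed

text \<open>Closedness of \<open>I\<close> is phrased by approximation and not by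
  \<open>nclosure\<close>, since \<open>E\<close> may be merely seminormed and \<open>ndist\<close>
  is then no metric. This is the form needed for the null functions in L1.\<close>

lemma normed_space_quot:
  assumes closed: "\<And>x. x \<in> carrier E \<Longrightarrow> (\<And>\<epsilon>. \<epsilon> > 0 \<Longrightarrow> \<exists>i\<in>I. nrm E (x \<ominus> i) < \<epsilon>) \<Longrightarrow> x \<in> I"
  shows "normed_space Q"
proof (intro normed_space.intro seminormed_space_quot normed_space_axioms.intro)
  fix K assume "K \<in> carrier Q"
  then obtain x where x: "x \<in> carrier E" "K = I +> x" by (rule quotE)
  have "x \<in> I" if "nrm Q K = 0"
  proof (rule closed[OF x(1)])
    fix \<epsilon> :: real assume "\<epsilon> > 0"
    then show "\<exists>i\<in>I. nrm E (x \<ominus> i) < \<epsilon>" using norm_quot_approx_diff[OF x(1), of \<epsilon>] that x by auto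
  qed
  moreover have "nrm Q \<zero>\<^bsub>Q\<^esub> = 0"
    by (simp add: seminormed_space.norm_zero seminormed_space_quot)
  ultimately show "nrm Q K = 0 \<longleftrightarrow> K = \<zero>\<^bsub>Q\<^esub>"
    using coset_eq_iff[OF x(1) M.zero_closed] by (auto simp: x zero_quot)
qed

end

text \<open>The subtracted term makes the bound the exact partial geometric sum, so that the
  induction closes without slack.\<close>

lemma (in seminormed_space) telescope_bound:
  assumes "\<And>k. x k \<in> carrier E" "\<And>k. nrm E (x (Suc k) \<ominus> x k) \<le> (1/2)^k" "m \<le> n"
  shows "nrm E (x n \<ominus> x m) \<le> 2 * (1/2)^m - 2 * (1/2)^n"
  using assms(3)
proof (induction n rule: dec_induct)
  case (step n)
  then show ?case
    using norm_diff_triangle[of "x (Suc n)" "x n" "x m"] assms(1,2)[of n] assms(1) by simp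
qed (use assms(1) in simp)

locale banach_quotient = banach_space + quotient_space +
  assumes I_closed: "nclosure E I = I"
begin

lemma mem_IJ: "x \<in> carrier E \<Longrightarrow> (\<And>\<epsilon>. \<epsilon> > 0 \<Longrightarrow> \<exists>i\<in>I. nrm E (x \<ominus> i) < \<epsilon>) \<Longrightarrow> x \<in> I"
  using mem_nclosure_iff[OF I_subset, of x] unfolding I_closed by simp

sublocale Q: normed_space Q
  by (rule normed_space_quot) (rule mem_IJ)

text \<open>A Cauchy sequence of cosets has a fast subsequence, whose members are lifted one after
  the other so that the lifts form a Cauchy sequence in \<open>E\<close>. The coset of their limit
  is the limit of the whole sequence.\<close>

lemma banach_space_quot: "banach_space Q"
proof (rule Q.banach_spaceI)
  fix \<sigma> :: "nat \<Rightarrow> 'a set" assume \<sigma>: "\<And>n. \<sigma> n \<in> carrier Q"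
    and "\<And>\<epsilon>. \<epsilon> > 0 \<Longrightarrow> \<exists>N. \<forall>n\<ge>N. \<forall>m\<ge>N. nrm Q (\<sigma> n \<ominus>\<^bsub>Q\<^esub> \<sigma> m) < \<epsilon>"
  then have "\<exists>N. \<forall>n\<ge>N. \<forall>m\<ge>N. nrm Q (\<sigma> n \<ominus>\<^bsub>Q\<^esub> \<sigma> m) < (1/2)^k" for k by simp
  then obtain N :: "nat \<Rightarrow> nat" where N: "\<And>k n m. n \<ge> N k \<Longrightarrow> m \<ge> N k \<Longrightarrow> nrm Q (\<sigma> n \<ominus>\<^bsub>Q\<^esub> \<sigma> m) < (1/2)^k"
    by metis
  \<comment> \<open>Partial sums dominate \<open>N\<close> and are monotone, whatever
    \<open>N\<close> is.\<close>
  define r where "r k = (\<Sum>i\<le>k. N i)" for k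
  have r: "r k \<ge> N k" "r (Suc k) \<ge> r k" for k by (auto simp: r_def sum.atMost_Suc intro!: member_le_sum)
  have "\<exists>x. \<forall>n. (x n \<in> carrier E \<and> I +> x n = \<sigma> (r n)) \<and> nrm E (x (Suc n) \<ominus> x n) < (1/2)^n"
  proof (rule dependent_nat_choice)
    show "\<exists>x. x \<in> carrier E \<and> I +> x = \<sigma> (r 0)" using \<sigma>[of "r 0"] by (metis quotE)
  next
    fix x n assume x: "x \<in> carrier E \<and> I +> x = \<sigma> (r n)"
    obtain z where z: "z \<in> carrier E" "I +> z = \<sigma> (r (Suc n))" using \<sigma>[of "r (Suc n)"] by (metis quotE)
    have "nrm Q (I +> (z \<ominus> x)) < (1/2)^n"
      using N[of n "r (Suc n)" "r n"] r[of n] x z by (simp add: diff_quot[symmetric])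
    \<comment> \<open>An arbitrary lift \<open>z\<close> of the next coset is corrected by an
      element of \<open>I\<close> that brings it close to the previous lift
      \<open>x\<close>.\<close>
    then obtain i where i: "i \<in> I" "nrm E (z \<ominus> x \<ominus> i) < (1/2)^n"
      using norm_quot_approx_diff[of "z \<ominus> x" "(1/2)^n"] x z by auto
    have im: "i \<in> carrier E" using i I_mem by simp
    have "(z \<ominus> i) \<ominus> x = z \<ominus> x \<ominus> i" using im x z by (simp add: M.minus_eq M.a_ac)
    moreover have "I +> (z \<ominus> i) = I +> z"
    proof -
      have "(z \<ominus> i) \<ominus> z = \<ominus> i"
        using im z by (simp add: M.minus_eq M.a_comm[of z] M.a_assoc M.r_neg)
      then show ?thesis using im z I_neg[OF i(1)] by (subst coset_eq_iff) auto
    qed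
    ultimately show "\<exists>y. (y \<in> carrier E \<and> I +> y = \<sigma> (r (Suc n))) \<and> nrm E (y \<ominus> x) < (1/2)^n"
      using z i im by (intro exI[of _ "z \<ominus> i"]) auto
  qed
  then obtain x where x: "\<And>n. x n \<in> carrier E" "\<And>n. I +> x n = \<sigma> (r n)"
      "\<And>n. nrm E (x (Suc n) \<ominus> x n) < (1/2)^n"
    by auto
  have tb: "nrm E (x n \<ominus> x m) \<le> 2 * (1/2)^m" if "m \<le> n" for m n
  proof -
    have "nrm E (x n \<ominus> x m) \<le> 2 * (1/2)^m - 2 * (1/2)^n"
      using x(1) x(3)[THEN less_imp_le] that by (rule telescope_bound)
    moreover have "(0::real) \<le> (1/2)^n" by simp
    ultimately show ?thesis by linarith
  qed
  obtain y where y: "y \<in> carrier E" "(\<lambda>n. nrm E (x n \<ominus> y)) \<longlonglongrightarrow> 0"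
  proof (rule Cauchy_limit[of x])
    fix \<epsilon> :: real assume "\<epsilon> > 0"
    then obtain m where m: "(1/2)^m < \<epsilon>/4" using real_arch_pow_inv[of "\<epsilon>/4" "1/2"] by auto
    have "nrm E (x n \<ominus> x n') < \<epsilon>" if "n \<ge> m" "n' \<ge> m" for n n'
    proof -
      have "nrm E (x n \<ominus> x n') \<le> nrm E (x n \<ominus> x m) + nrm E (x m \<ominus> x n')"
        using x(1) by (intro norm_diff_triangle)
      then show ?thesis using tb[OF that(1)] tb[OF that(2)] norm_diff_commute[of "x m" "x n'"] x(1) m by simp
    qed
    then show "\<exists>N. \<forall>n\<ge>N. \<forall>n'\<ge>N. nrm E (x n \<ominus> x n') < \<epsilon>" by blast
  qed (rule x)
  show "\<exists>K\<in>carrier Q. (\<lambda>n. nrm Q (\<sigma> n \<ominus>\<^bsub>Q\<^esub> K)) \<longlonglongrightarrow> 0"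
  proof (intro bexI[of _ "I +> y"] coset_mem y LIMSEQ_I)
    fix \<epsilon> :: real assume "\<epsilon> > 0"
    then obtain m where m: "(1/2)^m < \<epsilon>/2" using real_arch_pow_inv[of "\<epsilon>/2" "1/2"] by auto
    obtain k where k: "\<And>n. n \<ge> k \<Longrightarrow> nrm E (x n \<ominus> y) < \<epsilon>/2"
      using order_tendstoD(2)[OF y(2), of "\<epsilon>/2"] \<open>\<epsilon> > 0\<close> by (auto simp: eventually_sequentially)
    define j where "j = max k m"
    have "r j \<ge> N m"
    proof -
      have "r m \<le> r j" using lift_Suc_mono_le[of r m j] r(2) by (simp add: j_def)
      then show ?thesis using r(1)[of m] by simp
    qed
    have "norm (nrm Q (\<sigma> n \<ominus>\<^bsub>Q\<^esub> (I +> y)) - 0) < \<epsilon>" if n: "n \<ge> N m" for n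
    proof -
      have "nrm Q (\<sigma> n \<ominus>\<^bsub>Q\<^esub> (I +> y)) \<le> nrm Q (\<sigma> n \<ominus>\<^bsub>Q\<^esub> \<sigma> (r j)) + nrm Q (\<sigma> (r j) \<ominus>\<^bsub>Q\<^esub> (I +> y))"
        using \<sigma> y coset_mem by (intro Q.norm_diff_triangle) auto
      also have "nrm Q (\<sigma> n \<ominus>\<^bsub>Q\<^esub> \<sigma> (r j)) < \<epsilon>/2" using N[OF n \<open>r j \<ge> N m\<close>] m by simp
      also have "nrm Q (\<sigma> (r j) \<ominus>\<^bsub>Q\<^esub> (I +> y)) \<le> nrm E (x j \<ominus> y)"
        using x(1) y(1) norm_quot_le[of "x j \<ominus> y"] by (simp add: x(2)[symmetric] diff_quot)
      also have "\<dots> < \<epsilon>/2" using k[of j] by (simp add: j_def)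
      finally have "nrm Q (\<sigma> n \<ominus>\<^bsub>Q\<^esub> (I +> y)) < \<epsilon>" by simp
      moreover have "0 \<le> nrm Q (\<sigma> n \<ominus>\<^bsub>Q\<^esub> (I +> y))"
        using \<sigma> y coset_mem by (intro Q.norm_nonneg) auto
      ultimately show ?thesis by simp
    qed
    then show "\<exists>no. \<forall>n\<ge>no. norm (nrm Q (\<sigma> n \<ominus>\<^bsub>Q\<^esub> (I +> y)) - 0) < \<epsilon>" by blast
  qed
qed

end

text \<open>For submultiplicativity of the quotient norm, where two infima are only
  approached.\<close>

lemma le_mult_epsilon:
  fixes p q s :: real
  assumes "\<And>\<epsilon>. \<epsilon> > 0 \<Longrightarrow> s \<le> (p + \<epsilon>) * (q + \<epsilon>)"
  shows "s \<le> p * q"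
proof (rule tendsto_lowerbound)
  have "((\<lambda>\<epsilon>. (p + \<epsilon>) * (q + \<epsilon>)) \<longlongrightarrow> (p + 0) * (q + 0)) (at_right 0)"
    by (intro tendsto_intros)
  then show "((\<lambda>\<epsilon>. (p + \<epsilon>) * (q + \<epsilon>)) \<longlongrightarrow> p * q) (at_right 0)" by simp
  show "\<forall>\<^sub>F \<epsilon> in at_right 0. s \<le> (p + \<epsilon>) * (q + \<epsilon>)"
    using assms by (auto simp: eventually_at_right_field intro!: exI[of _ 1])
qed simp

locale algebra_quotient = banach_algebra E + banach_quotient E I for E I +
  assumes I_left: "\<lbrakk>x \<in> carrier E; i \<in> I\<rbrakk> \<Longrightarrow> x \<otimes>\<^bsub>E\<^esub> i \<in> I"
    and I_right: "\<lbrakk>x \<in> carrier E; i \<in> I\<rbrakk> \<Longrightarrow> i \<otimes>\<^bsub>E\<^esub> x \<in> I"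
begin

lemma mult_quot:
  assumes x: "x \<in> carrier E" and y: "y \<in> carrier E"
  shows "(I +>\<^bsub>E\<^esub> x) \<otimes>\<^bsub>Q\<^esub> (I +>\<^bsub>E\<^esub> y) = I +>\<^bsub>E\<^esub> (x \<otimes>\<^bsub>E\<^esub> y)"
proof -
  have *: "I +>\<^bsub>E\<^esub> (x' \<otimes>\<^bsub>E\<^esub> y') = I +>\<^bsub>E\<^esub> (x \<otimes>\<^bsub>E\<^esub> y)" if "x' \<in> I +>\<^bsub>E\<^esub> x" "y' \<in> I +>\<^bsub>E\<^esub> y" for x' y'
  proof -
    have x': "x' \<in> carrier E" "x' \<ominus>\<^bsub>E\<^esub> x \<in> I" and y': "y' \<in> carrier E" "y' \<ominus>\<^bsub>E\<^esub> y \<in> I"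
      using that mem_coset_iff[OF x] mem_coset_iff[OF y] by simp_all
    have "x' \<otimes>\<^bsub>E\<^esub> y' \<ominus>\<^bsub>E\<^esub> x \<otimes>\<^bsub>E\<^esub> y = (x' \<otimes>\<^bsub>E\<^esub> y' \<ominus>\<^bsub>E\<^esub> x \<otimes>\<^bsub>E\<^esub> y') \<oplus>\<^bsub>E\<^esub> (x \<otimes>\<^bsub>E\<^esub> y' \<ominus>\<^bsub>E\<^esub> x \<otimes>\<^bsub>E\<^esub> y)"
      using x y x' y' by (simp add: diff_add_diff mult_closed)
    also have "x' \<otimes>\<^bsub>E\<^esub> y' \<ominus>\<^bsub>E\<^esub> x \<otimes>\<^bsub>E\<^esub> y' = (x' \<ominus>\<^bsub>E\<^esub> x) \<otimes>\<^bsub>E\<^esub> y'"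
      using x x' y' by (simp add: diff_eq_smult mult_add_left smult_mult_left mult_closed)
    also have "x \<otimes>\<^bsub>E\<^esub> y' \<ominus>\<^bsub>E\<^esub> x \<otimes>\<^bsub>E\<^esub> y = x \<otimes>\<^bsub>E\<^esub> (y' \<ominus>\<^bsub>E\<^esub> y)"
      using x y y' by (simp add: diff_eq_smult mult_add_right smult_mult_right mult_closed)
    also have "(x' \<ominus>\<^bsub>E\<^esub> x) \<otimes>\<^bsub>E\<^esub> y' \<oplus>\<^bsub>E\<^esub> x \<otimes>\<^bsub>E\<^esub> (y' \<ominus>\<^bsub>E\<^esub> y) \<in> I"
      using x x' y' by (intro I_add I_left I_right)
    finally show ?thesis
      using x y x' y' by (subst coset_eq_iff) (auto simp: mult_closed)
  qed
  have "(I +>\<^bsub>E\<^esub> x) \<otimes>\<^bsub>Q\<^esub> (I +>\<^bsub>E\<^esub> y) =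
      (\<Union>x'\<in>I +>\<^bsub>E\<^esub> x. \<Union>y'\<in>I +>\<^bsub>E\<^esub> y. I +>\<^bsub>E\<^esub> (x' \<otimes>\<^bsub>E\<^esub> y'))"
    by (simp add: nquot_def rcoset_mult_def)
  also have "\<dots> = (\<Union>x'\<in>I +>\<^bsub>E\<^esub> x. \<Union>y'\<in>I +>\<^bsub>E\<^esub> y. I +>\<^bsub>E\<^esub> (x \<otimes>\<^bsub>E\<^esub> y))"
    by (intro SUP_cong refl *)
  also have "\<dots> = I +>\<^bsub>E\<^esub> (x \<otimes>\<^bsub>E\<^esub> y)"
    using coset_self[OF x] coset_self[OF y] by (subst SUP_eq_const, auto)+
  finally show ?thesis .
qed

lemma banach_algebra_quot: "banach_algebra Q"
proof (intro banach_algebra.intro banach_space_quot banach_algebra_axioms.intro)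
  fix K L assume KL: "K \<in> carrier Q" "L \<in> carrier Q"
  obtain x where x: "x \<in> carrier E" "K = I +>\<^bsub>E\<^esub> x" using KL(1) by (rule quotE)
  obtain y where y: "y \<in> carrier E" "L = I +>\<^bsub>E\<^esub> y" using KL(2) by (rule quotE)
  show "nrm Q (K \<otimes>\<^bsub>Q\<^esub> L) \<le> nrm Q K * nrm Q L"
  proof (rule le_mult_epsilon)
    fix \<epsilon> :: real assume "\<epsilon> > 0"
    obtain x' where x': "x' \<in> carrier E" "I +>\<^bsub>E\<^esub> x' = K" "nrm E x' < nrm Q K + \<epsilon>"
      using norm_quot_approx[OF x(1), of "nrm Q K + \<epsilon>"] x \<open>\<epsilon> > 0\<close> by auto
    obtain y' where y': "y' \<in> carrier E" "I +>\<^bsub>E\<^esub> y' = L" "nrm E y' < nrm Q L + \<epsilon>"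
      using norm_quot_approx[OF y(1), of "nrm Q L + \<epsilon>"] y \<open>\<epsilon> > 0\<close> by auto
    have "nrm Q (K \<otimes>\<^bsub>Q\<^esub> L) \<le> nrm E (x' \<otimes>\<^bsub>E\<^esub> y')"
      using x' y' mult_quot[of x' y'] norm_quot_le[of "x' \<otimes>\<^bsub>E\<^esub> y'"] by (simp add: mult_closed)
    also have "\<dots> \<le> nrm E x' * nrm E y'" using x' y' by (intro nrm_mult)
    also have "\<dots> \<le> (nrm Q K + \<epsilon>) * (nrm Q L + \<epsilon>)"
      using x' y' norm_nonneg[of x'] norm_nonneg[of y'] by (intro mult_mono) auto
    finally show "nrm Q (K \<otimes>\<^bsub>Q\<^esub> L) \<le> (nrm Q K + \<epsilon>) * (nrm Q L + \<epsilon>)" .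
  qed
next
  fix K L M c assume "K \<in> carrier Q" "L \<in> carrier Q" "M \<in> carrier Q"
  then obtain x y z where xyz: "x \<in> carrier E" "K = I +>\<^bsub>E\<^esub> x" "y \<in> carrier E" "L = I +>\<^bsub>E\<^esub> y"
    "z \<in> carrier E" "M = I +>\<^bsub>E\<^esub> z" using quotE by metis
  show "K \<otimes>\<^bsub>Q\<^esub> L \<otimes>\<^bsub>Q\<^esub> M = K \<otimes>\<^bsub>Q\<^esub> (L \<otimes>\<^bsub>Q\<^esub> M)"
    "(K \<oplus>\<^bsub>Q\<^esub> L) \<otimes>\<^bsub>Q\<^esub> M = K \<otimes>\<^bsub>Q\<^esub> M \<oplus>\<^bsub>Q\<^esub> L \<otimes>\<^bsub>Q\<^esub> M"
    "K \<otimes>\<^bsub>Q\<^esub> (L \<oplus>\<^bsub>Q\<^esub> M) = K \<otimes>\<^bsub>Q\<^esub> L \<oplus>\<^bsub>Q\<^esub> K \<otimes>\<^bsub>Q\<^esub> M"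
    using xyz by (simp_all add: mult_quot add_quot mult_closed mult_assoc mult_add_left mult_add_right)
next
  fix K L c assume "K \<in> carrier Q" "L \<in> carrier Q"
  then obtain x y where xy: "x \<in> carrier E" "K = I +>\<^bsub>E\<^esub> x" "y \<in> carrier E" "L = I +>\<^bsub>E\<^esub> y"
    using quotE by metis
  show "K \<otimes>\<^bsub>Q\<^esub> L \<in> carrier Q" "c \<odot>\<^bsub>Q\<^esub> K \<otimes>\<^bsub>Q\<^esub> L = c \<odot>\<^bsub>Q\<^esub> (K \<otimes>\<^bsub>Q\<^esub> L)"
    "K \<otimes>\<^bsub>Q\<^esub> (c \<odot>\<^bsub>Q\<^esub> L) = c \<odot>\<^bsub>Q\<^esub> (K \<otimes>\<^bsub>Q\<^esub> L)"
    using xy by (simp_all add: mult_quot smult_quot coset_mem mult_closed smult_mult_left smult_mult_right)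
qed

end


section \<open>Functions vanishing at infinity\<close>

lemma C0_simps [simp]:
  "a \<oplus>\<^bsub>C0 X\<^esub> b = (\<lambda>x. a x + b x)" "a \<otimes>\<^bsub>C0 X\<^esub> b = (\<lambda>x. a x * b x)"
  "c \<odot>\<^bsub>C0 X\<^esub> a = (\<lambda>x. c * a x)" "\<zero>\<^bsub>C0 X\<^esub> = (\<lambda>x. 0)"
  by (simp_all add: C0_def)

lemma norm_C0: "nrm (C0 X) a = (SUP x. cmod (a x))"
  by (simp add: C0_def)

lemma C0_D:
  assumes "a \<in> carrier (C0 X)"
  shows "continuous_map X euclidean a"
    and "\<epsilon> > 0 \<Longrightarrow> compactin X {x \<in> topspace X. \<epsilon> \<le> cmod (a x)}"
    and "x \<notin> topspace X \<Longrightarrow> a x = 0"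
  using assms by (auto simp: C0_def)

lemma closedin_superlevel:
  fixes f :: "'x \<Rightarrow> 'c::real_normed_vector"
  assumes "continuous_map X euclidean f"
  shows "closedin X {x \<in> topspace X. \<epsilon> \<le> norm (f x)}"
proof -
  have "closedin X {x \<in> topspace X. norm (f x) \<in> {\<epsilon>..}}"
    by (rule closedin_continuous_map_preimage[of _ euclideanreal])
      (use assms in \<open>auto intro: continuous_map_norm\<close>)
  then show ?thesis by simp
qed

text \<open>Superlevel sets of the modulus are closed, so enclosing them in compact sets is
  enough.\<close>

lemma C0_I:
  assumes "continuous_map X euclidean f" "\<And>x. x \<notin> topspace X \<Longrightarrow> f x = 0"
    and "\<And>\<epsilon>. \<epsilon> > 0 \<Longrightarrow> \<exists>K. compactin X K \<and> {x \<in> topspace X. \<epsilon> \<le> cmod (f x)} \<subseteq> K"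
  shows "f \<in> carrier (C0 X)"
proof -
  have "compactin X {x \<in> topspace X. \<epsilon> \<le> cmod (f x)}" if "\<epsilon> > 0" for \<epsilon>
    using assms(3)[OF that] closedin_superlevel[OF assms(1)] closed_compactin by blast
  then show ?thesis using assms by (simp add: C0_def)
qed

lemma C0_dominated:
  assumes "continuous_map X euclidean f" "\<And>x. x \<notin> topspace X \<Longrightarrow> f x = 0"
    and "a \<in> carrier (C0 X)" "\<And>x. x \<in> topspace X \<Longrightarrow> cmod (f x) \<le> cmod (a x)"
  shows "f \<in> carrier (C0 X)"
proof (rule C0_I[OF assms(1,2)])
  fix \<epsilon> :: real assume "\<epsilon> > 0"
  then show "\<exists>K. compactin X K \<and> {x \<in> topspace X. \<epsilon> \<le> cmod (f x)} \<subseteq> K"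
    using assms(4) by (intro exI[of _ "{x \<in> topspace X. \<epsilon> \<le> cmod (a x)}"])
      (auto intro: C0_D[OF assms(3)] order_trans)
qed

lemma C0_bdd_above:
  assumes "a \<in> carrier (C0 X)"
  shows "bdd_above (range (\<lambda>x. cmod (a x)))"
proof -
  let ?K = "{x \<in> topspace X. 1 \<le> cmod (a x)}"
  have "compactin euclidean (a ` ?K)"
    using C0_D[OF assms] by (intro image_compactin) auto
  then have "bounded (a ` ?K)" using compact_imp_bounded by simp
  then obtain B where B: "\<And>x. x \<in> ?K \<Longrightarrow> cmod (a x) \<le> B" by (auto simp: bounded_iff)
  have "cmod (a x) \<le> max 1 B" for x
    using B[of x] C0_D(3)[OF assms, of x]
    by (cases "x \<in> topspace X"; cases "1 \<le> cmod (a x)") (auto simp: le_max_iff_disj)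
  then show ?thesis by (intro bdd_aboveI[of _ "max 1 B"]) auto
qed

lemma C0_le_norm: "a \<in> carrier (C0 X) \<Longrightarrow> cmod (a x) \<le> nrm (C0 X) a"
  unfolding norm_C0 by (rule cSUP_upper[OF UNIV_I C0_bdd_above])

lemma C0_norm_le:
  assumes "a \<in> carrier (C0 X)" "0 \<le> B" "\<And>x. x \<in> topspace X \<Longrightarrow> cmod (a x) \<le> B"
  shows "nrm (C0 X) a \<le> B"
  unfolding norm_C0
proof (rule cSUP_least)
  show "cmod (a x) \<le> B" for x
    using assms C0_D(3)[OF assms(1), of x] by (cases "x \<in> topspace X") auto
qed simp

lemma C0_norm_nonneg: "a \<in> carrier (C0 X) \<Longrightarrow> 0 \<le> nrm (C0 X) a"
  using C0_le_norm[of a X undefined] norm_ge_zero order_trans by blast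

lemma C0_zero [simp]: "(\<lambda>x. 0) \<in> carrier (C0 X)"
  by (rule C0_I) (auto intro!: exI[of _ "{}"])

lemma C0_norm_zero [simp]: "nrm (C0 X) (\<lambda>x. 0) = 0"
  by (simp add: norm_C0)

lemma C0_add [simp, intro]:
  assumes "a \<in> carrier (C0 X)" "b \<in> carrier (C0 X)"
  shows "(\<lambda>x. a x + b x) \<in> carrier (C0 X)"
proof (rule C0_I)
  fix \<epsilon> :: real assume "\<epsilon> > 0"
  let ?K = "{x \<in> topspace X. \<epsilon>/2 \<le> cmod (a x)} \<union> {x \<in> topspace X. \<epsilon>/2 \<le> cmod (b x)}"
  have "compactin X ?K" using \<open>\<epsilon> > 0\<close> by (intro compactin_Un C0_D assms) auto
  moreover have "{x \<in> topspace X. \<epsilon> \<le> cmod (a x + b x)} \<subseteq> ?K"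
  proof (safe, goal_cases)
    case (1 x)
    then show ?case using norm_triangle_ineq[of "a x" "b x"] by linarith
  qed
  ultimately show "\<exists>K. compactin X K \<and> {x \<in> topspace X. \<epsilon> \<le> cmod (a x + b x)} \<subseteq> K" by blast
qed (use C0_D[OF assms(1)] C0_D[OF assms(2)] in \<open>auto intro: continuous_map_add\<close>)

lemma continuous_map_mult_complex [continuous_intros]:
  fixes f g :: "'x \<Rightarrow> complex"
  shows "\<lbrakk>continuous_map X euclidean f; continuous_map X euclidean g\<rbrakk>
    \<Longrightarrow> continuous_map X euclidean (\<lambda>x. f x * g x)"
  by (simp add: continuous_map_atin tendsto_mult)

lemma continuous_map_of_real [continuous_intros]:
  "continuous_map X euclideanreal f \<Longrightarrow> continuous_map X euclidean (\<lambda>x. complex_of_real (f x))"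
  by (simp add: continuous_map_atin tendsto_of_real)

lemma C0_mult_bounded:
  assumes a: "a \<in> carrier (C0 X)" and h: "continuous_map X euclidean h"
    and B: "\<And>x. x \<in> topspace X \<Longrightarrow> cmod (h x) \<le> B"
  shows "(\<lambda>x. h x * a x) \<in> carrier (C0 X)" (is "?f \<in> _")
proof (rule C0_I)
  fix \<epsilon> :: real assume "\<epsilon> > 0"
  \<comment> \<open>\<open>B\<close> may be 0 or, over the empty space, negative; a positive bound
    is needed to divide by.\<close>
  define C where "C = max B 1"
  have C: "C > 0" "\<And>x. x \<in> topspace X \<Longrightarrow> cmod (h x) \<le> C" using B by (auto simp: C_def le_max_iff_disj)
  have "{x \<in> topspace X. \<epsilon> \<le> cmod (?f x)} \<subseteq> {x \<in> topspace X. \<epsilon>/C \<le> cmod (a x)}"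
  proof (safe, goal_cases)
    case (1 x)
    have "\<epsilon> \<le> C * cmod (a x)"
      using 1 mult_right_mono[OF C(2)[OF 1(1)] norm_ge_zero[of "a x"]] by (simp add: norm_mult)
    then show ?case using C(1) by (simp add: field_simps)
  qed
  moreover have "compactin X {x \<in> topspace X. \<epsilon>/C \<le> cmod (a x)}"
    using \<open>\<epsilon> > 0\<close> C by (intro C0_D[OF a]) auto
  ultimately show "\<exists>K. compactin X K \<and> {x \<in> topspace X. \<epsilon> \<le> cmod (?f x)} \<subseteq> K" by blast
qed (use C0_D[OF a] h in \<open>auto intro: continuous_map_mult_complex\<close>)

lemma C0_smult [simp, intro]: "a \<in> carrier (C0 X) \<Longrightarrow> (\<lambda>x. c * a x) \<in> carrier (C0 X)"
  by (rule C0_mult_bounded[where B = "cmod c"]) auto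

lemma C0_mult [simp, intro]:
  assumes "a \<in> carrier (C0 X)" "b \<in> carrier (C0 X)"
  shows "(\<lambda>x. a x * b x) \<in> carrier (C0 X)"
  using C0_le_norm[OF assms(1)] by (intro C0_mult_bounded[OF assms(2)] C0_D(1)[OF assms(1)])

lemma C0_diff [simp, intro]:
  assumes "a \<in> carrier (C0 X)" "b \<in> carrier (C0 X)"
  shows "(\<lambda>x. a x - b x) \<in> carrier (C0 X)"
  using C0_add[OF assms(1) C0_smult[OF assms(2), of "-1"]] by simp

lemma C0_sum [simp, intro]:
  assumes "\<And>i. i \<in> I \<Longrightarrow> f i \<in> carrier (C0 X)"
  shows "(\<lambda>x. \<Sum>i\<in>I. f i x) \<in> carrier (C0 X)"
  using assms by (induction I rule: infinite_finite_induct) auto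

lemma C0_cmod: "a \<in> carrier (C0 X) \<Longrightarrow> (\<lambda>x. complex_of_real (cmod (a x))) \<in> carrier (C0 X)"
  by (rule C0_dominated[of _ _ a]) (auto intro!: continuous_map_of_real continuous_map_norm dest: C0_D)

lemma C0_norm_smult: "a \<in> carrier (C0 X) \<Longrightarrow> nrm (C0 X) (\<lambda>x. c * a x) \<le> cmod c * nrm (C0 X) a"
  by (rule C0_norm_le) (auto simp: norm_mult C0_norm_nonneg intro!: mult_left_mono C0_le_norm)

lemma seminormed_space_C0: "seminormed_space (C0 X)"
proof (intro seminormed_space.intro moduleI seminormed_space_axioms.intro)
  show "cring complex_ring" by (rule cring_complex_ring)
  show "abelian_group (C0 X)"
  proof (rule abelian_groupI)
    fix a assume "a \<in> carrier (C0 X)"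
    then show "\<exists>y\<in>carrier (C0 X). y \<oplus>\<^bsub>C0 X\<^esub> a = \<zero>\<^bsub>C0 X\<^esub>"
      using C0_smult[of a X "-1"] by (intro bexI[of _ "\<lambda>x. (-1) * a x"]) auto
  qed (auto simp: algebra_simps)
  fix a b c assume a: "a \<in> carrier (C0 X)"
  show "nrm (C0 X) (c \<odot>\<^bsub>C0 X\<^esub> a) = cmod c * nrm (C0 X) a"
  proof (cases "c = 0")
    case False
    have "nrm (C0 X) (\<lambda>x. inverse c * (c * a x)) \<le> cmod (inverse c) * nrm (C0 X) (\<lambda>x. c * a x)"
      using a by (intro C0_norm_smult) auto
    also have "(\<lambda>x. inverse c * (c * a x)) = a" using False by auto
    finally have "cmod c * nrm (C0 X) a \<le> nrm (C0 X) (\<lambda>x. c * a x)"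
      using False by (simp add: norm_divide norm_inverse field_simps)
    then show ?thesis using C0_norm_smult[OF a, of c] by simp
  qed simp
  assume b: "b \<in> carrier (C0 X)"
  show "nrm (C0 X) (a \<oplus>\<^bsub>C0 X\<^esub> b) \<le> nrm (C0 X) a + nrm (C0 X) b"
    using a b C0_add[OF a b] by (auto intro!: C0_norm_le C0_norm_nonneg add_nonneg_nonneg
        order_trans[OF norm_triangle_ineq] add_mono C0_le_norm)
qed (auto simp: algebra_simps)

lemma normed_space_C0: "normed_space (C0 X)"
proof (intro normed_space.intro seminormed_space_C0 normed_space_axioms.intro)
  fix a assume a: "a \<in> carrier (C0 X)"
  have "a = (\<lambda>x. 0)" if "nrm (C0 X) a = 0"
    using C0_le_norm[OF a] that by (auto simp: fun_eq_iff)
  then show "nrm (C0 X) a = 0 \<longleftrightarrow> a = \<zero>\<^bsub>C0 X\<^esub>" by auto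
qed

lemma C0_minus [simp]:
  assumes "a \<in> carrier (C0 X)" "b \<in> carrier (C0 X)"
  shows "a \<ominus>\<^bsub>C0 X\<^esub> b = (\<lambda>x. a x - b x)"
proof -
  interpret seminormed_space "C0 X" by (rule seminormed_space_C0)
  show ?thesis using assms by (simp add: diff_eq_smult)
qed

text \<open>Serves both the completeness of C0(X) and the pointwise definition of infinite sums.
  Continuity is tested in the metric topology of the plane.\<close>

lemma C0_uniform_limit:
  assumes "\<And>\<epsilon>. \<epsilon> > 0 \<Longrightarrow> \<exists>b\<in>carrier (C0 X). \<forall>x. cmod (f x - b x) \<le> \<epsilon>"
  shows "f \<in> carrier (C0 X)"
proof (rule C0_I)
  have "continuous_map X Met_TC.mtopology f"
    unfolding Met_TC.continuous_map_to_metric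
  proof (intro ballI allI impI)
    fix x and \<epsilon> :: real assume x: "x \<in> topspace X" and "\<epsilon> > 0"
    then obtain b where b: "b \<in> carrier (C0 X)" "\<And>x. cmod (f x - b x) \<le> \<epsilon>/4"
      using assms[of "\<epsilon>/4"] by auto
    have "continuous_map X Met_TC.mtopology b" using C0_D(1)[OF b(1)] by simp
    then obtain U where U: "openin X U" "x \<in> U" "\<And>y. y \<in> U \<Longrightarrow> cmod (b x - b y) < \<epsilon>/4"
      using x \<open>\<epsilon> > 0\<close> unfolding Met_TC.continuous_map_to_metric
      by (metis Met_TC.in_mball dist_norm half_gt_zero_iff field_sum_of_halves zero_less_divide_iff zero_less_numeral)
    have "f y \<in> Met_TC.mball (f x) \<epsilon>" if "y \<in> U" for y
    proof -
      have "cmod (f x - f y) \<le> cmod (f x - b x) + cmod (b x - b y) + cmod (b y - f y)"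
        by norm
      then show ?thesis using b(2)[of x] b(2)[of y] U(3)[OF that] \<open>\<epsilon> > 0\<close>
        by (simp add: dist_norm norm_minus_commute)
    qed
    then show "\<exists>U. openin X U \<and> x \<in> U \<and> (\<forall>y\<in>U. f y \<in> Met_TC.mball (f x) \<epsilon>)" using U by blast
  qed
  then show "continuous_map X euclidean f" by simp
  show "f x = 0" if "x \<notin> topspace X" for x
  proof -
    have "cmod (f x) \<le> \<epsilon>" if "\<epsilon> > 0" for \<epsilon>
    proof -
      obtain b where "b \<in> carrier (C0 X)" "cmod (f x - b x) \<le> \<epsilon>" using assms[OF \<open>\<epsilon> > 0\<close>] by auto
      then show ?thesis using C0_D(3)[of b X x] \<open>x \<notin> topspace X\<close> by simp
    qed
    then have "cmod (f x) \<le> 0" using field_le_epsilon[of "cmod (f x)" 0] by simp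
    then show ?thesis by simp
  qed
  fix \<epsilon> :: real assume "\<epsilon> > 0"
  then obtain b where b: "b \<in> carrier (C0 X)" "\<And>x. cmod (f x - b x) \<le> \<epsilon>/2"
    using assms[of "\<epsilon>/2"] by auto
  have "{x \<in> topspace X. \<epsilon> \<le> cmod (f x)} \<subseteq> {x \<in> topspace X. \<epsilon>/2 \<le> cmod (b x)}"
  proof (safe, goal_cases)
    case (1 x)
    then show ?case using b(2)[of x] norm_triangle_ineq2[of "f x" "b x"] by linarith
  qed
  then show "\<exists>K. compactin X K \<and> {x \<in> topspace X. \<epsilon> \<le> cmod (f x)} \<subseteq> K"
    using C0_D(2)[OF b(1), of "\<epsilon>/2"] \<open>\<epsilon> > 0\<close> by auto
qed

lemma banach_space_C0: "banach_space (C0 X)"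
proof -
  interpret normed_space "C0 X" by (rule normed_space_C0)
  show ?thesis
  proof (rule banach_spaceI)
    fix \<sigma> :: "nat \<Rightarrow> 'a \<Rightarrow> complex"
    assume \<sigma>: "\<And>n. \<sigma> n \<in> carrier (C0 X)"
      and C: "\<And>\<epsilon>. \<epsilon> > 0 \<Longrightarrow> \<exists>N. \<forall>n\<ge>N. \<forall>m\<ge>N. nrm (C0 X) (\<sigma> n \<ominus>\<^bsub>C0 X\<^esub> \<sigma> m) < \<epsilon>"
    have le: "cmod (\<sigma> n x - \<sigma> m x) \<le> nrm (C0 X) (\<sigma> n \<ominus>\<^bsub>C0 X\<^esub> \<sigma> m)" for n m x
      using C0_le_norm[OF C0_diff[OF \<sigma>[of n] \<sigma>[of m]]] \<sigma> by simp
    have "Cauchy (\<lambda>n. \<sigma> n x)" for x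
    proof (rule CauchyI)
      fix \<epsilon> :: real assume "\<epsilon> > 0"
      then obtain N where "\<forall>n\<ge>N. \<forall>m\<ge>N. nrm (C0 X) (\<sigma> n \<ominus>\<^bsub>C0 X\<^esub> \<sigma> m) < \<epsilon>" using C by blast
      then show "\<exists>M. \<forall>m\<ge>M. \<forall>n\<ge>M. norm (\<sigma> m x - \<sigma> n x) < \<epsilon>"
        using le by (meson le_less_trans)
    qed
    then have "\<exists>l. (\<lambda>n. \<sigma> n x) \<longlonglongrightarrow> l" for x using Cauchy_convergent_iff convergent_def by blast
    then obtain f where f: "\<And>x. (\<lambda>n. \<sigma> n x) \<longlonglongrightarrow> f x" by metis
    have unif: "\<exists>N. \<forall>n\<ge>N. \<forall>x. cmod (\<sigma> n x - f x) \<le> \<epsilon>" if "\<epsilon> > 0" for \<epsilon>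
    proof -
      obtain N where N: "\<And>n m. n \<ge> N \<Longrightarrow> m \<ge> N \<Longrightarrow> nrm (C0 X) (\<sigma> n \<ominus>\<^bsub>C0 X\<^esub> \<sigma> m) < \<epsilon>"
        using C[OF \<open>\<epsilon> > 0\<close>] by auto
      have "cmod (\<sigma> n x - f x) \<le> \<epsilon>" if "n \<ge> N" for n x
      proof (rule tendsto_upperbound)
        show "(\<lambda>m. cmod (\<sigma> n x - \<sigma> m x)) \<longlonglongrightarrow> cmod (\<sigma> n x - f x)" by (intro tendsto_intros f)
        show "\<forall>\<^sub>F m in sequentially. cmod (\<sigma> n x - \<sigma> m x) \<le> \<epsilon>"
          using N[OF that] le by (auto simp: eventually_sequentially intro!: exI[of _ N])
            (meson less_imp_le order_trans)
      qed simp
      then show ?thesis by blast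
    qed
    have f0: "f \<in> carrier (C0 X)"
    proof (rule C0_uniform_limit)
      fix \<epsilon> :: real assume "\<epsilon> > 0"
      then obtain N where "\<forall>x. cmod (\<sigma> N x - f x) \<le> \<epsilon>" using unif by blast
      then show "\<exists>b\<in>carrier (C0 X). \<forall>x. cmod (f x - b x) \<le> \<epsilon>"
        using \<sigma> by (intro bexI[of _ "\<sigma> N"]) (auto simp: norm_minus_commute)
    qed
    moreover have "(\<lambda>n. nrm (C0 X) (\<sigma> n \<ominus>\<^bsub>C0 X\<^esub> f)) \<longlonglongrightarrow> 0"
    proof (rule LIMSEQ_I)
      fix \<epsilon> :: real assume "\<epsilon> > 0"
      then obtain N where N: "\<And>n x. n \<ge> N \<Longrightarrow> cmod (\<sigma> n x - f x) \<le> \<epsilon>/2"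
        using unif[of "\<epsilon>/2"] by auto
      have "norm (nrm (C0 X) (\<sigma> n \<ominus>\<^bsub>C0 X\<^esub> f) - 0) < \<epsilon>" if "n \<ge> N" for n
      proof -
        have "nrm (C0 X) (\<lambda>x. \<sigma> n x - f x) \<le> \<epsilon>/2"
          using N[OF that] \<sigma> f0 \<open>\<epsilon> > 0\<close> by (intro C0_norm_le) auto
        moreover have "0 \<le> nrm (C0 X) (\<lambda>x. \<sigma> n x - f x)" using \<sigma> f0 by (intro C0_norm_nonneg) auto
        ultimately show ?thesis using \<sigma> f0 \<open>\<epsilon> > 0\<close> by simp
      qed
      then show "\<exists>no. \<forall>n\<ge>no. norm (nrm (C0 X) (\<sigma> n \<ominus>\<^bsub>C0 X\<^esub> f) - 0) < \<epsilon>" by blast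
    qed
    ultimately show "\<exists>x\<in>carrier (C0 X). (\<lambda>n. nrm (C0 X) (\<sigma> n \<ominus>\<^bsub>C0 X\<^esub> x)) \<longlonglongrightarrow> 0" by blast
  qed
qed

lemma C0_abs_summable:
  assumes "\<And>i. i \<in> I \<Longrightarrow> f i \<in> carrier (C0 X)" "(\<lambda>i. nrm (C0 X) (f i)) summable_on I"
  shows "(\<lambda>i. cmod (f i x)) summable_on I"
  by (rule summable_on_comparison_test[OF assms(2)]) (auto intro: C0_le_norm assms(1))

text \<open>The pointwise sum is also the limit in norm: outside a finite index set the error at
  every point is at most the tail of the norms, uniformly in the point.\<close>

lemma C0_infsum:
  assumes f: "\<And>i. i \<in> I \<Longrightarrow> f i \<in> carrier (C0 X)" and s: "(\<lambda>i. nrm (C0 X) (f i)) summable_on I"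
  shows "(\<lambda>x. \<Sum>\<^sub>\<infinity>i\<in>I. f i x) \<in> carrier (C0 X)"
    and "nrm (C0 X) (\<lambda>x. \<Sum>\<^sub>\<infinity>i\<in>I. f i x) \<le> (\<Sum>\<^sub>\<infinity>i\<in>I. nrm (C0 X) (f i))"
proof -
  have abs: "(\<lambda>i. cmod (f i x)) summable_on J" if "J \<subseteq> I" for x J
    using C0_abs_summable[OF f s] summable_on_subset_banach that by blast
  show mem: "(\<lambda>x. \<Sum>\<^sub>\<infinity>i\<in>I. f i x) \<in> carrier (C0 X)"
  proof (rule C0_uniform_limit)
    fix \<epsilon> :: real assume "\<epsilon> > 0"
    then obtain S where S: "finite S" "S \<subseteq> I"
        "dist (\<Sum>i\<in>S. nrm (C0 X) (f i)) (\<Sum>\<^sub>\<infinity>i\<in>I. nrm (C0 X) (f i)) \<le> \<epsilon>"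
      using infsum_finite_approximation[OF s] by blast
    have sD: "(\<lambda>i. nrm (C0 X) (f i)) summable_on (I - S)" by (rule summable_on_subset_banach[OF s]) auto
    have split: "(\<Sum>\<^sub>\<infinity>i\<in>I. nrm (C0 X) (f i)) = (\<Sum>i\<in>S. nrm (C0 X) (f i)) + (\<Sum>\<^sub>\<infinity>i\<in>I - S. nrm (C0 X) (f i))"
      using infsum_Un_disjoint[of "\<lambda>i. nrm (C0 X) (f i)" S "I - S"] S sD
      by (simp add: Un_absorb1)
    have "cmod ((\<Sum>\<^sub>\<infinity>i\<in>I. f i x) - (\<Sum>i\<in>S. f i x)) \<le> \<epsilon>" for x
    proof -
      have "(\<Sum>\<^sub>\<infinity>i\<in>I. f i x) = (\<Sum>i\<in>S. f i x) + (\<Sum>\<^sub>\<infinity>i\<in>I - S. f i x)"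
        using infsum_Un_disjoint[of "\<lambda>i. f i x" S "I - S"] S abs_summable_summable[OF abs[of "I - S" x]]
        by (simp add: Un_absorb1)
      then have "cmod ((\<Sum>\<^sub>\<infinity>i\<in>I. f i x) - (\<Sum>i\<in>S. f i x)) \<le> (\<Sum>\<^sub>\<infinity>i\<in>I - S. cmod (f i x))"
        using norm_infsum_bound[OF abs[of "I - S" x]] by simp
      also have "\<dots> \<le> (\<Sum>\<^sub>\<infinity>i\<in>I - S. nrm (C0 X) (f i))"
        using abs[of "I - S" x] sD f by (intro infsum_mono C0_le_norm) auto
      also have "\<dots> \<le> \<epsilon>" using S(3) split by (simp add: dist_real_def)
      finally show ?thesis .
    qed
    then show "\<exists>b\<in>carrier (C0 X). \<forall>x. cmod ((\<Sum>\<^sub>\<infinity>i\<in>I. f i x) - b x) \<le> \<epsilon>"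
      using f S by (intro bexI[of _ "\<lambda>x. \<Sum>i\<in>S. f i x"]) auto
  qed
  show "nrm (C0 X) (\<lambda>x. \<Sum>\<^sub>\<infinity>i\<in>I. f i x) \<le> (\<Sum>\<^sub>\<infinity>i\<in>I. nrm (C0 X) (f i))"
  proof (rule C0_norm_le[OF mem])
    show "0 \<le> (\<Sum>\<^sub>\<infinity>i\<in>I. nrm (C0 X) (f i))" using f C0_norm_nonneg by (intro infsum_nonneg) blast
    fix x
    have "cmod (\<Sum>\<^sub>\<infinity>i\<in>I. f i x) \<le> (\<Sum>\<^sub>\<infinity>i\<in>I. cmod (f i x))" by (rule norm_infsum_bound[OF abs]) simp
    also have "\<dots> \<le> (\<Sum>\<^sub>\<infinity>i\<in>I. nrm (C0 X) (f i))"
      using abs[of I x] s f by (intro infsum_mono C0_le_norm) auto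
    finally show "cmod (\<Sum>\<^sub>\<infinity>i\<in>I. f i x) \<le> (\<Sum>\<^sub>\<infinity>i\<in>I. nrm (C0 X) (f i))" .
  qed
qed

lemma C0_compose_homeomorphism:
  assumes a: "a \<in> carrier (C0 X)" and h: "homeomorphic_map X X h"
  shows "(\<lambda>x. if x \<in> topspace X then a (h x) else 0) \<in> carrier (C0 X)" (is "?f \<in> _")
    and "nrm (C0 X) (\<lambda>x. if x \<in> topspace X then a (h x) else 0) = nrm (C0 X) a"
proof -
  obtain g where g: "homeomorphic_maps X X h g" using h homeomorphic_map_maps by blast
  have hg: "h x \<in> topspace X" "g x \<in> topspace X" "g (h x) = x" "h (g x) = x" if "x \<in> topspace X" for x
    using g that by (auto simp: homeomorphic_maps_def continuous_map_def)
  show mem: "?f \<in> carrier (C0 X)"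
  proof (rule C0_I)
    have "continuous_map X euclidean (a \<circ> h)"
      using h homeomorphic_imp_continuous_map C0_D(1)[OF a] continuous_map_compose by blast
    then show "continuous_map X euclidean ?f"
      by (rule continuous_map_eq) auto
    fix \<epsilon> :: real assume "\<epsilon> > 0"
    let ?K = "{x \<in> topspace X. \<epsilon> \<le> cmod (a x)}"
    have "compactin X (g ` ?K)"
      using C0_D(2)[OF a \<open>\<epsilon> > 0\<close>] g by (auto intro!: image_compactin simp: homeomorphic_maps_def)
    moreover have "{x \<in> topspace X. \<epsilon> \<le> cmod (?f x)} \<subseteq> g ` ?K"
    proof
      fix x assume "x \<in> {x \<in> topspace X. \<epsilon> \<le> cmod (?f x)}"
      then have "x = g (h x)" "h x \<in> ?K" using hg by auto
      then show "x \<in> g ` ?K" by blast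
    qed
    ultimately show "\<exists>K. compactin X K \<and> {x \<in> topspace X. \<epsilon> \<le> cmod (?f x)} \<subseteq> K" by blast
  qed auto
  have "cmod (a x) \<le> nrm (C0 X) ?f" if "x \<in> topspace X" for x
    using C0_le_norm[OF mem, of "g x"] hg[OF that] by simp
  then show "nrm (C0 X) ?f = nrm (C0 X) a"
    using a mem C0_le_norm[OF a] by (intro antisym C0_norm_le) (auto simp: C0_norm_nonneg)
qed

lemma C0_restrict_closed:
  assumes a: "a \<in> carrier (C0 X)" and Y: "closedin X Y"
  shows "(\<lambda>x. if x \<in> Y then a x else 0) \<in> carrier (C0 (subtopology X Y))" (is "?f \<in> _")
proof (rule C0_I)
  show "continuous_map (subtopology X Y) euclidean ?f"
    using continuous_map_from_subtopology[OF C0_D(1)[OF a], of Y]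
    by (rule continuous_map_eq) auto
  fix \<epsilon> :: real assume "\<epsilon> > 0"
  have "compactin X (Y \<inter> {x \<in> topspace X. \<epsilon> \<le> cmod (a x)})"
    using Y C0_D(2)[OF a \<open>\<epsilon> > 0\<close>] by (rule closed_Int_compactin)
  then show "\<exists>K. compactin (subtopology X Y) K \<and>
      {x \<in> topspace (subtopology X Y). \<epsilon> \<le> cmod (?f x)} \<subseteq> K"
    by (intro exI[of _ "Y \<inter> {x \<in> topspace X. \<epsilon> \<le> cmod (a x)}"])
      (auto simp: compactin_subtopology)
qed (use Y closedin_subset in auto)

text \<open>Extension by zero stays continuous at points off \<open>U\<close>: each superlevel set
  is compact in \<open>U\<close>, hence compact in \<open>X\<close> and closed there because
  \<open>X\<close> is Hausdorff, so its complement is a neighbourhood of such a point on which the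
  function is small.\<close>

lemma C0_open_iff:
  assumes X: "Hausdorff_space X" and U: "openin X U"
  shows "a \<in> carrier (C0 (subtopology X U)) \<longleftrightarrow> a \<in> carrier (C0 X) \<and> (\<forall>x. x \<notin> U \<longrightarrow> a x = 0)"
proof -
  have UX: "U \<subseteq> topspace X" using U openin_subset by blast
  show ?thesis
  proof
    assume a: "a \<in> carrier (C0 (subtopology X U))"
    have off: "a x = 0" if "x \<notin> U" for x using C0_D(3)[OF a, of x] that by simp
    have K: "compactin X {x \<in> topspace X. \<epsilon> \<le> cmod (a x)}" if "\<epsilon> > 0" for \<epsilon>
    proof -
      have "{x \<in> topspace (subtopology X U). \<epsilon> \<le> cmod (a x)} = {x \<in> topspace X. \<epsilon> \<le> cmod (a x)}"
        using off that by (auto, metis norm_zero not_le)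
      then show ?thesis using C0_D(2)[OF a that] by (simp add: compactin_subtopology)
    qed
    have "continuous_map X Met_TC.mtopology a"
      unfolding Met_TC.continuous_map_to_metric
    proof (intro ballI allI impI)
      fix x and \<epsilon> :: real assume x: "x \<in> topspace X" and e: "\<epsilon> > 0"
      show "\<exists>V. openin X V \<and> x \<in> V \<and> (\<forall>y\<in>V. a y \<in> Met_TC.mball (a x) \<epsilon>)"
      proof (cases "x \<in> U")
        case True
        have xs: "x \<in> topspace (subtopology X U)" using True x by simp
        have "continuous_map (subtopology X U) Met_TC.mtopology a" using C0_D(1)[OF a] by simp
        then obtain V where "openin (subtopology X U) V" "x \<in> V" "\<forall>y\<in>V. a y \<in> Met_TC.mball (a x) \<epsilon>"
          using e xs unfolding Met_TC.continuous_map_to_metric by blast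
        then show ?thesis using U by (auto simp: openin_open_subtopology)
      next
        case False
        have "closedin X {x \<in> topspace X. \<epsilon> \<le> cmod (a x)}"
          using K[OF e] X compactin_imp_closedin by blast
        then have "openin X (topspace X - {x \<in> topspace X. \<epsilon> \<le> cmod (a x)})" by blast
        then show ?thesis
          using False x e off[OF False]
          by (intro exI[of _ "topspace X - {x \<in> topspace X. \<epsilon> \<le> cmod (a x)}"]) auto
      qed
    qed
    then show "a \<in> carrier (C0 X) \<and> (\<forall>x. x \<notin> U \<longrightarrow> a x = 0)"
      using K off UX by (auto simp: C0_def)
  next
    assume a: "a \<in> carrier (C0 X) \<and> (\<forall>x. x \<notin> U \<longrightarrow> a x = 0)"
    have "compactin (subtopology X U) {x \<in> topspace (subtopology X U). \<epsilon> \<le> cmod (a x)}" if "\<epsilon> > 0" for \<epsilon>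
    proof -
      have sub: "x \<in> U" if "\<epsilon> \<le> cmod (a x)" for x
        using that a \<open>\<epsilon> > 0\<close> by (cases "x \<in> U") auto
      have "{x \<in> topspace (subtopology X U). \<epsilon> \<le> cmod (a x)} = {x \<in> topspace X. \<epsilon> \<le> cmod (a x)}"
        using sub by auto
      moreover have "\<dots> \<subseteq> U" using sub by auto
      ultimately show ?thesis using C0_D(2)[of a X, OF _ that] a by (simp add: compactin_subtopology)
    qed
    then show "a \<in> carrier (C0 (subtopology X U))"
      using a continuous_map_from_subtopology C0_D(1)[of a X] by (auto simp: C0_def)
  qed
qed

lemma C0_Re_Im:
  assumes "a \<in> carrier (C0 X)"
  shows "(\<lambda>x. complex_of_real (Re (a x))) \<in> carrier (C0 X)"
    and "(\<lambda>x. complex_of_real (Im (a x))) \<in> carrier (C0 X)"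
proof -
  have cont: "continuous_map X euclidean (\<lambda>x. complex_of_real (h (a x)))"
    if "continuous_on UNIV h" for h :: "complex \<Rightarrow> real"
  proof -
    have "continuous_map X euclideanreal (h \<circ> a)"
      using C0_D(1)[OF assms] that by (intro continuous_map_compose[of _ euclidean]) auto
    then show ?thesis using continuous_map_of_real[of _ "h \<circ> a"] by simp
  qed
  show "(\<lambda>x. complex_of_real (Re (a x))) \<in> carrier (C0 X)"
    using C0_D(3)[OF assms] by (intro C0_dominated[OF cont _ assms])
      (auto simp: abs_Re_le_cmod intro!: continuous_intros)
  show "(\<lambda>x. complex_of_real (Im (a x))) \<in> carrier (C0 X)"
    using C0_D(3)[OF assms] by (intro C0_dominated[OF cont _ assms])
      (auto simp: abs_Im_le_cmod intro!: continuous_intros)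
qed


section \<open>The algebra \<open>\<ell>\<^sup>1(G, C\<^sub>0(X))\<close>\<close>

lemma summable_on_small_tail:
  fixes \<beta> :: "'s \<Rightarrow> real"
  assumes \<beta>: "\<beta> summable_on A" "\<And>s. s \<in> A \<Longrightarrow> 0 \<le> \<beta> s" and "\<epsilon> > 0"
  obtains S where "finite S" "S \<subseteq> A" "(\<lambda>s. if s \<in> S then 0 else \<beta> s) summable_on A"
    "(\<Sum>\<^sub>\<infinity>s\<in>A. if s \<in> S then 0 else \<beta> s) < \<epsilon>"
proof -
  obtain S where S: "finite S" "S \<subseteq> A" "dist (sum \<beta> S) (infsum \<beta> A) \<le> \<epsilon>/2"
    using infsum_finite_approximation[OF \<beta>(1), of "\<epsilon>/2"] \<open>\<epsilon> > 0\<close> by auto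
  have s: "(\<lambda>s. if s \<in> S then 0 else \<beta> s) summable_on A"
    by (rule summable_on_comparison_test[OF \<beta>(1)]) (use \<beta>(2) in auto)
  have fS: "(\<lambda>s. if s \<in> S then \<beta> s else 0) summable_on A"
    by (rule summable_on_comparison_test[OF \<beta>(1)]) (use \<beta>(2) in auto)
  have "infsum \<beta> A = (\<Sum>\<^sub>\<infinity>s\<in>A. (if s \<in> S then \<beta> s else 0) + (if s \<in> S then 0 else \<beta> s))"
    by (intro infsum_cong) auto
  also have "\<dots> = (\<Sum>\<^sub>\<infinity>s\<in>A. if s \<in> S then \<beta> s else 0) + (\<Sum>\<^sub>\<infinity>s\<in>A. if s \<in> S then 0 else \<beta> s)"
    by (rule infsum_add[OF fS s])
  also have "(\<Sum>\<^sub>\<infinity>s\<in>A. if s \<in> S then \<beta> s else 0) = infsum \<beta> S"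
    using S(2) by (intro infsum_cong_neutral) auto
  also have "infsum \<beta> S = sum \<beta> S" using S(1) by simp
  finally have "(\<Sum>\<^sub>\<infinity>s\<in>A. if s \<in> S then 0 else \<beta> s) \<le> \<epsilon>/2"
    using S(3) by (simp add: dist_real_def)
  then show thesis using that[OF S(1,2) s] \<open>\<epsilon> > 0\<close> by simp
qed

lemma summable_on_product_real:
  fixes f :: "'s \<Rightarrow> real" and g :: "'t \<Rightarrow> real"
  assumes "f summable_on A" "g summable_on B" "\<And>s. s \<in> A \<Longrightarrow> 0 \<le> f s" "\<And>t. t \<in> B \<Longrightarrow> 0 \<le> g t"
  shows "(\<lambda>(s, t). f s * g t) summable_on A \<times> B"
proof (rule summable_on_SigmaI[where g = "\<lambda>s. f s * infsum g B"])
  show "((\<lambda>t. case (s, t) of (s, t) \<Rightarrow> f s * g t) has_sum f s * infsum g B) B" for s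
    using assms(2) by (simp add: has_sum_cmult_right)
  show "(\<lambda>s. f s * infsum g B) summable_on A" using assms(1) by (rule summable_on_cmult_left)
qed (use assms in auto)

lemma infsum_eq_single:
  fixes f :: "'s \<Rightarrow> 'c::{comm_monoid_add, t2_space}"
  assumes "a \<in> A" "\<And>x. x \<in> A \<Longrightarrow> x \<noteq> a \<Longrightarrow> f x = 0"
  shows "infsum f A = f a"
proof -
  have "infsum f A = infsum f {a}" by (rule infsum_cong_neutral) (use assms in auto)
  then show ?thesis by simp
qed

text \<open>Dominated convergence with a uniform modulus: \<eta> depends on f and \<delta> only. The
  tail of f takes care of all but a finite set S, and on S the bound \<eta> takes care of each of
  the finitely many terms.\<close>

lemma summable_on_dominated_small:
  fixes f :: "'s \<Rightarrow> real"
  assumes f: "f summable_on A" and "\<And>t. t \<in> A \<Longrightarrow> 0 \<le> f t" and "\<delta> > 0"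
  obtains \<eta> where "\<eta> > 0"
    "\<And>g. (\<And>t. t \<in> A \<Longrightarrow> 0 \<le> g t \<and> g t \<le> f t \<and> g t \<le> \<eta>) \<Longrightarrow> infsum g A < \<delta>"
proof -
  obtain S where S: "finite S" "S \<subseteq> A" "dist (sum f S) (infsum f A) \<le> \<delta>/4"
    using infsum_finite_approximation[OF f, of "\<delta>/4"] \<open>\<delta> > 0\<close> by auto
  have fD: "f summable_on (A - S)" by (rule summable_on_subset_banach[OF f]) auto
  have "infsum f A = sum f S + infsum f (A - S)"
    using infsum_Un_disjoint[of f S "A - S"] S fD by (simp add: Un_absorb1)
  then have tail: "infsum f (A - S) \<le> \<delta>/4" using S(3) by (simp add: dist_real_def)
  \<comment> \<open>The denominator counts one term more than \<open>S\<close> has, so that an empty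
    \<open>S\<close> causes no division by zero.\<close>
  define \<eta> where "\<eta> = \<delta> / (4 * (real (card S) + 1))"
  have \<eta>: "\<eta> > 0" using \<open>\<delta> > 0\<close> by (simp add: \<eta>_def add_pos_nonneg)
  have \<eta>S: "real (card S) * \<eta> \<le> \<delta>/4"
  proof -
    have "(real (card S) + 1) * \<eta> = \<delta>/4" by (simp add: \<eta>_def field_simps)
    then show ?thesis using \<eta> by (simp add: algebra_simps)
  qed
  have "infsum g A < \<delta>" if g: "\<And>t. t \<in> A \<Longrightarrow> 0 \<le> g t \<and> g t \<le> f t \<and> g t \<le> \<eta>" for g
  proof -
    have gA: "g summable_on A" by (rule summable_on_comparison_test[OF f]) (use g in auto)
    have gD: "g summable_on (A - S)" by (rule summable_on_subset_banach[OF gA]) auto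
    have "infsum g A = sum g S + infsum g (A - S)"
      using infsum_Un_disjoint[of g S "A - S"] S gD by (simp add: Un_absorb1)
    moreover have "infsum g (A - S) \<le> infsum f (A - S)" using gD fD g by (intro infsum_mono) auto
    moreover have "sum g S \<le> real (card S) * \<eta>" using g S by (intro sum_bounded_above) auto
    ultimately show ?thesis using tail \<eta>S \<open>\<delta> > 0\<close> by linarith
  qed
  then show thesis using that \<eta> by blast
qed

lemma F_alg_simps [simp]:
  "a \<oplus>\<^bsub>F_alg G X \<phi> u\<^esub> b = (\<lambda>t x. a t x + b t x)"
  "c \<odot>\<^bsub>F_alg G X \<phi> u\<^esub> b = (\<lambda>t x. c * b t x)" "\<zero>\<^bsub>F_alg G X \<phi> u\<^esub> = (\<lambda>t x. 0)"
  by (simp_all add: F_alg_def)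

lemma norm_F: "nrm (F_alg G X \<phi> u) b = (\<Sum>\<^sub>\<infinity>t\<in>carrier G. nrm (C0 X) (b t))"
  by (simp add: F_alg_def)

lemma mem_F_iff: "b \<in> carrier (F_alg G X \<phi> u) \<longleftrightarrow> (\<forall>t\<in>carrier G. b t \<in> carrier (C0 X)) \<and>
    (\<forall>t. t \<notin> carrier G \<longrightarrow> b t = (\<lambda>x. 0)) \<and> (\<lambda>t. nrm (C0 X) (b t)) summable_on carrier G"
  by (simp add: F_alg_def)

lemma F_D:
  assumes "b \<in> carrier (F_alg G X \<phi> u)"
  shows "b t \<in> carrier (C0 X)" "t \<notin> carrier G \<Longrightarrow> b t x = 0" "x \<notin> topspace X \<Longrightarrow> b t x = 0"
    "(\<lambda>t. nrm (C0 X) (b t)) summable_on carrier G"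
    "(\<lambda>t. cmod (b t x)) summable_on carrier G"
proof -
  show 1: "b t \<in> carrier (C0 X)" for t using assms by (cases "t \<in> carrier G") (auto simp: mem_F_iff)
  show s: "(\<lambda>t. nrm (C0 X) (b t)) summable_on carrier G"
    and "t \<notin> carrier G \<Longrightarrow> b t x = 0" using assms by (auto simp: mem_F_iff)
  show "x \<notin> topspace X \<Longrightarrow> b t x = 0" using C0_D(3)[OF 1] .
  show "(\<lambda>t. cmod (b t x)) summable_on carrier G"
    by (rule summable_on_comparison_test[OF s]) (auto intro: C0_le_norm 1)
qed

lemma F_I:
  assumes "\<And>t. t \<in> carrier G \<Longrightarrow> b t \<in> carrier (C0 X)" "\<And>t. t \<notin> carrier G \<Longrightarrow> b t = (\<lambda>x. 0)"
    and "c summable_on carrier G" "\<And>t. t \<in> carrier G \<Longrightarrow> nrm (C0 X) (b t) \<le> c t"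
  shows "b \<in> carrier (F_alg G X \<phi> u)"
  using assms summable_on_comparison_test[OF assms(3), of "\<lambda>t. nrm (C0 X) (b t)"]
  by (auto simp: mem_F_iff C0_norm_nonneg)

lemma F_norm_nonneg: "b \<in> carrier (F_alg G X \<phi> u) \<Longrightarrow> 0 \<le> nrm (F_alg G X \<phi> u) b"
  unfolding norm_F by (intro infsum_nonneg) (auto intro: C0_norm_nonneg F_D)

lemma F_norm_le:
  assumes "b \<in> carrier (F_alg G X \<phi> u)" "c summable_on carrier G"
    "\<And>t. t \<in> carrier G \<Longrightarrow> nrm (C0 X) (b t) \<le> c t"
  shows "nrm (F_alg G X \<phi> u) b \<le> infsum c (carrier G)"
  unfolding norm_F using assms by (intro infsum_mono) (auto intro: F_D)

lemma F_coeff_le_norm: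
  assumes "b \<in> carrier (F_alg G X \<phi> u)"
  shows "nrm (C0 X) (b t) \<le> nrm (F_alg G X \<phi> u) b"
proof (cases "t \<in> carrier G")
  case True
  have "sum (\<lambda>t. nrm (C0 X) (b t)) {t} \<le> (\<Sum>\<^sub>\<infinity>t\<in>carrier G. nrm (C0 X) (b t))"
    using True by (intro finite_sum_le_infsum) (auto intro: C0_norm_nonneg F_D[OF assms])
  then show ?thesis by (simp add: norm_F)
next
  case False
  then have "b t = (\<lambda>x. 0)" using assms by (simp add: mem_F_iff)
  then show ?thesis using F_norm_nonneg[OF assms] by simp
qed

lemma F_add [simp, intro]:
  assumes "a \<in> carrier (F_alg G X \<phi> u)" "b \<in> carrier (F_alg G X \<phi> u)"
  shows "(\<lambda>t x. a t x + b t x) \<in> carrier (F_alg G X \<phi> u)"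
    and "nrm (F_alg G X \<phi> u) (\<lambda>t x. a t x + b t x) \<le> nrm (F_alg G X \<phi> u) a + nrm (F_alg G X \<phi> u) b"
proof -
  have s: "(\<lambda>t. nrm (C0 X) (a t) + nrm (C0 X) (b t)) summable_on carrier G"
    by (intro summable_on_add F_D[OF assms(1)] F_D[OF assms(2)])
  have le: "nrm (C0 X) (\<lambda>x. a t x + b t x) \<le> nrm (C0 X) (a t) + nrm (C0 X) (b t)" for t
    using seminormed_space.norm_triangle[OF seminormed_space_C0, of "a t" X "b t"] F_D(1)[OF assms(1)]
      F_D(1)[OF assms(2)] by simp
  show mem: "(\<lambda>t x. a t x + b t x) \<in> carrier (F_alg G X \<phi> u)"
    by (rule F_I[OF _ _ s le]) (auto intro: F_D[OF assms(1)] F_D[OF assms(2)]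
        simp: F_D(2)[OF assms(1)] F_D(2)[OF assms(2)])
  have "nrm (F_alg G X \<phi> u) (\<lambda>t x. a t x + b t x) \<le> (\<Sum>\<^sub>\<infinity>t\<in>carrier G. nrm (C0 X) (a t) + nrm (C0 X) (b t))"
    by (rule F_norm_le[OF mem s le])
  also have "\<dots> = nrm (F_alg G X \<phi> u) a + nrm (F_alg G X \<phi> u) b"
    unfolding norm_F by (intro infsum_add F_D[OF assms(1)] F_D[OF assms(2)])
  finally show "nrm (F_alg G X \<phi> u) (\<lambda>t x. a t x + b t x) \<le> nrm (F_alg G X \<phi> u) a + nrm (F_alg G X \<phi> u) b" .
qed

lemma F_smult:
  assumes "b \<in> carrier (F_alg G X \<phi> u)"
  shows "(\<lambda>t x. c * b t x) \<in> carrier (F_alg G X \<phi> u)"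
    and "nrm (F_alg G X \<phi> u) (\<lambda>t x. c * b t x) = cmod c * nrm (F_alg G X \<phi> u) b"
proof -
  have eq: "nrm (C0 X) (\<lambda>x. c * b t x) = cmod c * nrm (C0 X) (b t)" for t
    using seminormed_space.norm_smult[OF seminormed_space_C0, of "b t" X c] F_D(1)[OF assms] by simp
  have s: "(\<lambda>t. cmod c * nrm (C0 X) (b t)) summable_on carrier G"
    by (intro summable_on_cmult_right F_D[OF assms])
  show "(\<lambda>t x. c * b t x) \<in> carrier (F_alg G X \<phi> u)"
    by (rule F_I[OF _ _ s]) (auto intro: F_D[OF assms] simp: F_D(2)[OF assms] eq)
  show "nrm (F_alg G X \<phi> u) (\<lambda>t x. c * b t x) = cmod c * nrm (F_alg G X \<phi> u) b"
    unfolding norm_F eq by (intro infsum_cmult_right F_D[OF assms])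
qed

lemma F_zero [simp]: "(\<lambda>t x. 0) \<in> carrier (F_alg G X \<phi> u)"
  by (simp add: mem_F_iff)

lemma normed_space_F: "normed_space (F_alg G X \<phi> u)" (is "normed_space ?F")
proof (intro normed_space.intro seminormed_space.intro moduleI
    seminormed_space_axioms.intro normed_space_axioms.intro)
  show "cring complex_ring" by (rule cring_complex_ring)
  show "abelian_group ?F"
  proof (rule abelian_groupI)
    fix a assume "a \<in> carrier ?F"
    then show "\<exists>y\<in>carrier ?F. y \<oplus>\<^bsub>?F\<^esub> a = \<zero>\<^bsub>?F\<^esub>"
      using F_smult(1)[of a G X \<phi> u "-1"] by (intro bexI[of _ "\<lambda>t x. (-1) * a t x"]) auto
  qed (auto simp: algebra_simps)
  fix b assume b: "b \<in> carrier ?F"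
  have "b = (\<lambda>t x. 0)" if "nrm ?F b = 0"
  proof (intro ext)
    fix t x
    have "cmod (b t x) \<le> 0"
      using F_coeff_le_norm[OF b, of t] C0_le_norm[OF F_D(1)[OF b], of t x] that by linarith
    then show "b t x = 0" by simp
  qed
  then show "nrm ?F b = 0 \<longleftrightarrow> b = \<zero>\<^bsub>?F\<^esub>" by (auto simp: norm_F)
qed (auto simp: algebra_simps F_smult)

lemma F_minus [simp]:
  assumes "a \<in> carrier (F_alg G X \<phi> u)" "b \<in> carrier (F_alg G X \<phi> u)"
  shows "a \<ominus>\<^bsub>F_alg G X \<phi> u\<^esub> b = (\<lambda>t x. a t x - b t x)"
proof -
  interpret normed_space "F_alg G X \<phi> u" by (rule normed_space_F)
  show ?thesis using assms by (simp add: diff_eq_smult)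
qed

lemma F_diff [simp, intro]:
  assumes "a \<in> carrier (F_alg G X \<phi> u)" "b \<in> carrier (F_alg G X \<phi> u)"
  shows "(\<lambda>t x. a t x - b t x) \<in> carrier (F_alg G X \<phi> u)"
  using F_add(1)[OF assms(1) F_smult(1)[OF assms(2), of "-1"]] by simp

text \<open>Uniform smallness alone does not make the l1-norm small; together with domination by the
  fixed b it does. Approximate units need exactly this, since b - e b is dominated by b and
  uniformly small.\<close>

lemma F_norm_small:
  assumes b: "b \<in> carrier (F_alg G X \<phi> u)" and "\<delta> > 0"
  obtains \<eta> where "\<eta> > 0"
    "\<And>c. \<lbrakk>c \<in> carrier (F_alg G X \<phi> u);
        \<And>t x. cmod (c t x) \<le> cmod (b t x) \<and> cmod (c t x) \<le> \<eta>\<rbrakk> \<Longrightarrow> nrm (F_alg G X \<phi> u) c < \<delta>"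
proof -
  obtain \<eta> where \<eta>: "\<eta> > 0"
    "\<And>g. (\<And>t. t \<in> carrier G \<Longrightarrow> 0 \<le> g t \<and> g t \<le> nrm (C0 X) (b t) \<and> g t \<le> \<eta>) \<Longrightarrow> infsum g (carrier G) < \<delta>"
    using summable_on_dominated_small[OF F_D(4)[OF b] _ \<open>\<delta> > 0\<close>] C0_norm_nonneg F_D(1)[OF b] by metis
  show thesis
  proof (rule that[OF \<eta>(1)])
    fix c assume c: "c \<in> carrier (F_alg G X \<phi> u)"
      and le: "\<And>t x. cmod (c t x) \<le> cmod (b t x) \<and> cmod (c t x) \<le> \<eta>"
    have "nrm (C0 X) (c t) \<le> nrm (C0 X) (b t)" "nrm (C0 X) (c t) \<le> \<eta>" for t
      using le \<eta>(1) F_D(1)[OF b] F_D(1)[OF c]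
      by (auto intro!: C0_norm_le C0_norm_nonneg intro: order_trans[OF _ C0_le_norm])
    then show "nrm (F_alg G X \<phi> u) c < \<delta>"
      unfolding norm_F using F_D(1)[OF c] by (intro \<eta>(2)) (auto simp: C0_norm_nonneg)
  qed
qed

text \<open>Usually written a\<delta>_s. Those at the group unit embed C0(X) in F.\<close>

definition monomial :: "'g \<Rightarrow> ('x \<Rightarrow> complex) \<Rightarrow> 'g \<Rightarrow> 'x \<Rightarrow> complex" where
  "monomial s a = (\<lambda>t. if t = s then a else (\<lambda>x. 0))"

lemma monomial_mem:
  assumes "s \<in> carrier G" "a \<in> carrier (C0 X)"
  shows "monomial s a \<in> carrier (F_alg G X \<phi> u)"
    and "nrm (F_alg G X \<phi> u) (monomial s a) = nrm (C0 X) a"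
proof -
  have "(\<lambda>t. nrm (C0 X) (monomial s a t)) summable_on carrier G"
    by (rule finite_nonzero_values_imp_summable_on)
      (rule finite_subset[of _ "{s}"], auto simp: monomial_def)
  then show "monomial s a \<in> carrier (F_alg G X \<phi> u)" using assms by (auto simp: mem_F_iff monomial_def)
  show "nrm (F_alg G X \<phi> u) (monomial s a) = nrm (C0 X) a"
    unfolding norm_F using assms by (subst infsum_eq_single[of s]) (auto simp: monomial_def)
qed

lemma F_truncate:
  assumes b: "b \<in> carrier (F_alg G X \<phi> u)"
  shows "(\<lambda>t x. if t \<in> S then b t x else 0) \<in> carrier (F_alg G X \<phi> u)"
proof (rule F_I[OF _ _ F_D(4)[OF b]])
  fix t
  have "(\<lambda>x. if t \<in> S then b t x else 0) = (if t \<in> S then b t else (\<lambda>x. 0))" by auto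
  then show "(\<lambda>x. if t \<in> S then b t x else 0) \<in> carrier (C0 X)"
    "nrm (C0 X) (\<lambda>x. if t \<in> S then b t x else 0) \<le> nrm (C0 X) (b t)"
    using F_D(1)[OF b] by (auto simp: C0_norm_nonneg)
qed (use F_D(2)[OF b] in auto)

lemma F_finite_approx:
  assumes b: "b \<in> carrier (F_alg G X \<phi> u)" and "\<epsilon> > 0"
  obtains S where "finite S" "S \<subseteq> carrier G"
    "nrm (F_alg G X \<phi> u) (\<lambda>t x. b t x - (if t \<in> S then b t x else 0)) < \<epsilon>"
proof -
  obtain S where S: "finite S" "S \<subseteq> carrier G" "(\<Sum>\<^sub>\<infinity>t\<in>carrier G. if t \<in> S then 0 else nrm (C0 X) (b t)) < \<epsilon>"
    by (rule summable_on_small_tail[OF F_D(4)[OF b] C0_norm_nonneg[OF F_D(1)[OF b]] \<open>\<epsilon> > 0\<close>]) blast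
  have "nrm (F_alg G X \<phi> u) (\<lambda>t x. b t x - (if t \<in> S then b t x else 0))
      = (\<Sum>\<^sub>\<infinity>t\<in>carrier G. if t \<in> S then 0 else nrm (C0 X) (b t))"
    unfolding norm_F by (intro infsum_cong) auto
  then show thesis using that[OF S(1,2)] S(3) by simp
qed

section \<open>Twisted convolution\<close>

context twisted_action begin

abbreviation (input) "F \<equiv> F_alg G X \<phi> u"
abbreviation (input) "\<alpha> \<equiv> dual_action G X \<phi>"

lemma is_group: "group G"
  using group_hom by (simp add: group_hom_def)

sublocale GG: group G by (rule is_group)

lemma \<phi>_mem: "\<lbrakk>t \<in> carrier G; x \<in> topspace X\<rbrakk> \<Longrightarrow> \<phi> t x \<in> topspace X"
  using element_image by blast

lemma \<phi>_one: "x \<in> topspace X \<Longrightarrow> \<phi> \<one> x = x"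
  using id_eq_one by (metis restrict_apply')

lemma \<phi>_mult: "\<lbrakk>s \<in> carrier G; t \<in> carrier G; x \<in> topspace X\<rbrakk> \<Longrightarrow> \<phi> (s \<otimes> t) x = \<phi> s (\<phi> t x)"
  using composition_rule by blast

lemma \<phi>_inv [simp]:
  assumes "t \<in> carrier G" "x \<in> topspace X"
  shows "\<phi> (inv t) (\<phi> t x) = x" "\<phi> t (\<phi> (inv t) x) = x"
  using assms by (simp_all add: \<phi>_mult[symmetric] \<phi>_one)

lemma u_nonzero: "\<lbrakk>s \<in> carrier G; t \<in> carrier G; x \<in> topspace X\<rbrakk> \<Longrightarrow> u s t x \<noteq> 0"
  using twist_unimodular[of s t x] by auto

text \<open>The cocycle identity at (1, 1, t) reads u(1,t) u(1,t) = u(1,1) u(1,t), and the values of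
  u can be cancelled. The identity at (t, 1, 1) gives the companion
  \<open>u_one_right\<close>.\<close>

lemma u_one_left: "\<lbrakk>t \<in> carrier G; x \<in> topspace X\<rbrakk> \<Longrightarrow> u \<one> t x = 1"
  using twist_cocycle[of \<one> \<one> t x] u_nonzero[of \<one> t x] twist_normalised[of x]
  by (simp add: dual_action_def \<phi>_one)

lemma u_one_right: "\<lbrakk>t \<in> carrier G; x \<in> topspace X\<rbrakk> \<Longrightarrow> u t \<one> x = 1"
  using twist_cocycle[of t \<one> \<one> x] u_nonzero[of t \<one> x] twist_normalised[of "\<phi> (inv t) x"]
  by (simp add: dual_action_def \<phi>_mem)

lemma \<alpha>_mem:
  assumes "a \<in> carrier (C0 X)" "s \<in> carrier G"
  shows "\<alpha> s a \<in> carrier (C0 X)" "nrm (C0 X) (\<alpha> s a) = nrm (C0 X) a"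
  using C0_compose_homeomorphism[OF assms(1) homeomorphism, of "inv s"] assms(2)
  by (simp_all add: dual_action_def)

text \<open>The pairs with product r are parametrised by their first entry s, the second being
  s^{-1} r; for r outside the group there are none.\<close>

lemma mult_F: "(a \<otimes>\<^bsub>F\<^esub> b) r x = (if r \<in> carrier G
    then \<Sum>\<^sub>\<infinity>s\<in>carrier G. a s x * \<alpha> s (b (inv s \<otimes> r)) x * u s (inv s \<otimes> r) x else 0)"
proof -
  let ?P = "{(s, t). s \<in> carrier G \<and> t \<in> carrier G \<and> s \<otimes> t = r}"
  have "(a \<otimes>\<^bsub>F\<^esub> b) r x = (\<Sum>\<^sub>\<infinity>(s, t)\<in>?P. a s x * \<alpha> s (b t) x * u s t x)"
    by (simp add: F_alg_def)
  also have "\<dots> = (if r \<in> carrier G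
    then \<Sum>\<^sub>\<infinity>s\<in>carrier G. a s x * \<alpha> s (b (inv s \<otimes> r)) x * u s (inv s \<otimes> r) x else 0)"
  proof (cases "r \<in> carrier G")
    case True
    have "bij_betw (\<lambda>s. (s, inv s \<otimes> r)) (carrier G) ?P"
      by (rule bij_betwI[where g = fst])
        (use True in \<open>auto simp: GG.m_assoc[symmetric] GG.inv_solve_left'\<close>)
    then show ?thesis
      using True infsum_reindex_bij_betw[of "\<lambda>s. (s, inv s \<otimes> r)" "carrier G" ?P
        "\<lambda>(s, t). a s x * \<alpha> s (b t) x * u s t x"] by simp
  next
    case False
    then have "?P = {}" by auto
    then show ?thesis using False by (simp only: infsum_empty if_False)
  qed
  finally show ?thesis .
qed

lemma mult_term_mem:
  assumes "a \<in> carrier (C0 X)" "b \<in> carrier (C0 X)" "s \<in> carrier G" "t \<in> carrier G"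
  shows "(\<lambda>x. a x * \<alpha> s b x * u s t x) \<in> carrier (C0 X)"
    and "nrm (C0 X) (\<lambda>x. a x * \<alpha> s b x * u s t x) \<le> nrm (C0 X) a * nrm (C0 X) b"
proof -
  have "(\<lambda>x. u s t x * (a x * \<alpha> s b x)) \<in> carrier (C0 X)"
    using assms twist_continuous twist_unimodular
    by (intro C0_mult_bounded[where B = 1] C0_mult \<alpha>_mem) auto
  then show mem: "(\<lambda>x. a x * \<alpha> s b x * u s t x) \<in> carrier (C0 X)" by (simp add: mult_ac)
  show "nrm (C0 X) (\<lambda>x. a x * \<alpha> s b x * u s t x) \<le> nrm (C0 X) a * nrm (C0 X) b"
  proof (rule C0_norm_le[OF mem])
    fix x assume "x \<in> topspace X"
    then have "cmod (a x * \<alpha> s b x * u s t x) = cmod (a x) * cmod (\<alpha> s b x)"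
      using assms twist_unimodular by (simp add: norm_mult)
    also have "\<dots> \<le> nrm (C0 X) a * nrm (C0 X) b"
      using assms C0_le_norm[OF assms(1)] C0_le_norm[OF \<alpha>_mem(1)[OF assms(2,3)]] \<alpha>_mem(2)[OF assms(2,3)]
      by (intro mult_mono) (auto simp: C0_norm_nonneg)
    finally show "cmod (a x * \<alpha> s b x * u s t x) \<le> nrm (C0 X) a * nrm (C0 X) b" .
  qed (use assms in \<open>simp add: C0_norm_nonneg\<close>)
qed

text \<open>The substitution (r, s) to (s, s^{-1} r) is a bijection that turns the convolution into
  a product family.\<close>

lemma convolution_summable:
  fixes f g :: "'g \<Rightarrow> real"
  assumes "f summable_on carrier G" "g summable_on carrier G"
    "\<And>s. s \<in> carrier G \<Longrightarrow> 0 \<le> f s" "\<And>s. s \<in> carrier G \<Longrightarrow> 0 \<le> g s"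
  shows "(\<lambda>(r, s). f s * g (inv s \<otimes> r)) summable_on carrier G \<times> carrier G"
proof -
  have "bij_betw (\<lambda>(r, s). (s, inv s \<otimes> r)) (carrier G \<times> carrier G) (carrier G \<times> carrier G)"
    by (rule bij_betwI[where g = "\<lambda>(s, t). (s \<otimes> t, s)"]) (auto simp: GG.m_assoc[symmetric])
  from summable_on_reindex_bij_betw[OF this, of "\<lambda>(s, t). f s * g t"]
  show ?thesis using summable_on_product_real[OF assms] by (simp add: case_prod_unfold)
qed

lemma F_mult:
  assumes a: "a \<in> carrier F" and b: "b \<in> carrier F"
  shows "a \<otimes>\<^bsub>F\<^esub> b \<in> carrier F"
proof -
  let ?f = "\<lambda>s. nrm (C0 X) (a s)" and ?g = "\<lambda>s. nrm (C0 X) (b s)"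
  have s: "(\<lambda>(r, s). ?f s * ?g (inv s \<otimes> r)) summable_on carrier G \<times> carrier G"
    by (intro convolution_summable F_D[OF a] F_D[OF b] C0_norm_nonneg)
  have sr: "(\<lambda>s. ?f s * ?g (inv s \<otimes> r)) summable_on carrier G" if "r \<in> carrier G" for r
    using summable_on_SigmaD1[OF s that] .
  have ss: "(\<lambda>r. \<Sum>\<^sub>\<infinity>s\<in>carrier G. ?f s * ?g (inv s \<otimes> r)) summable_on carrier G"
    using summable_on_SigmaD[OF s] sr by simp
  have t: "(\<lambda>x. a s x * \<alpha> s (b (inv s \<otimes> r)) x * u s (inv s \<otimes> r) x) \<in> carrier (C0 X)"
    "nrm (C0 X) (\<lambda>x. a s x * \<alpha> s (b (inv s \<otimes> r)) x * u s (inv s \<otimes> r) x) \<le> ?f s * ?g (inv s \<otimes> r)"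
    if "r \<in> carrier G" "s \<in> carrier G" for r s
    using that by (auto intro!: mult_term_mem F_D(1)[OF a] F_D(1)[OF b])
  have st: "(\<lambda>s. nrm (C0 X) (\<lambda>x. a s x * \<alpha> s (b (inv s \<otimes> r)) x * u s (inv s \<otimes> r) x)) summable_on carrier G"
    if "r \<in> carrier G" for r
    by (rule summable_on_comparison_test[OF sr[OF that]]) (use that in \<open>auto intro: t C0_norm_nonneg\<close>)
  show ?thesis
  proof (rule F_I[OF _ _ ss])
    fix r assume r: "r \<in> carrier G"
    have eq: "(a \<otimes>\<^bsub>F\<^esub> b) r = (\<lambda>x. \<Sum>\<^sub>\<infinity>s\<in>carrier G. a s x * \<alpha> s (b (inv s \<otimes> r)) x * u s (inv s \<otimes> r) x)"
      using r by (simp add: mult_F fun_eq_iff)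
    note c = C0_infsum[of "carrier G" "\<lambda>s x. a s x * \<alpha> s (b (inv s \<otimes> r)) x * u s (inv s \<otimes> r) x" X, OF _ st[OF r]]
    show "(a \<otimes>\<^bsub>F\<^esub> b) r \<in> carrier (C0 X)" unfolding eq using t[OF r] by (intro c(1)) auto
    have "nrm (C0 X) ((a \<otimes>\<^bsub>F\<^esub> b) r) \<le> (\<Sum>\<^sub>\<infinity>s\<in>carrier G. nrm (C0 X) (\<lambda>x. a s x * \<alpha> s (b (inv s \<otimes> r)) x * u s (inv s \<otimes> r) x))"
      unfolding eq using t[OF r] by (intro c(2)) auto
    also have "\<dots> \<le> (\<Sum>\<^sub>\<infinity>s\<in>carrier G. ?f s * ?g (inv s \<otimes> r))"
      using r by (intro infsum_mono st sr t)
    finally show "nrm (C0 X) ((a \<otimes>\<^bsub>F\<^esub> b) r) \<le> (\<Sum>\<^sub>\<infinity>s\<in>carrier G. ?f s * ?g (inv s \<otimes> r))" .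
  qed (simp add: mult_F fun_eq_iff)
qed

lemma monomial_mult:
  assumes "s \<in> carrier G" "r \<in> carrier G"
  shows "(monomial s a \<otimes>\<^bsub>F\<^esub> b) r x = a x * \<alpha> s (b (inv s \<otimes> r)) x * u s (inv s \<otimes> r) x"
proof -
  have "(monomial s a \<otimes>\<^bsub>F\<^esub> b) r x = (\<Sum>\<^sub>\<infinity>t\<in>carrier G. monomial s a t x * \<alpha> t (b (inv t \<otimes> r)) x * u t (inv t \<otimes> r) x)"
    using assms by (simp add: mult_F)
  also have "\<dots> = monomial s a s x * \<alpha> s (b (inv s \<otimes> r)) x * u s (inv s \<otimes> r) x"
    using assms by (intro infsum_eq_single) (auto simp: monomial_def)
  finally show ?thesis by (simp add: monomial_def)
qed

lemma monomial_one_mult: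
  assumes b: "b \<in> carrier F"
  shows "monomial \<one> a \<otimes>\<^bsub>F\<^esub> b = (\<lambda>r x. a x * b r x)"
proof (intro ext)
  fix r x
  show "(monomial \<one> a \<otimes>\<^bsub>F\<^esub> b) r x = a x * b r x"
  proof (cases "r \<in> carrier G \<and> x \<in> topspace X")
    case True
    then show ?thesis by (simp add: monomial_mult dual_action_def \<phi>_one u_one_left)
  next
    case False
    then show ?thesis using F_D(2,3)[OF b]
      by (cases "r \<in> carrier G") (auto simp: mult_F monomial_mult dual_action_def)
  qed
qed

lemma monomial_mult_monomial:
  assumes "s \<in> carrier G" "t \<in> carrier G"
  shows "monomial s a \<otimes>\<^bsub>F\<^esub> monomial t b = monomial (s \<otimes> t) (\<lambda>x. a x * \<alpha> s b x * u s t x)"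
proof (intro ext)
  fix r x
  show "(monomial s a \<otimes>\<^bsub>F\<^esub> monomial t b) r x = monomial (s \<otimes> t) (\<lambda>x. a x * \<alpha> s b x * u s t x) r x"
  proof (cases "r \<in> carrier G")
    case True
    have "inv s \<otimes> r = t \<longleftrightarrow> r = s \<otimes> t" using assms True by (metis GG.inv_solve_left)
    then show ?thesis using assms True by (auto simp: monomial_mult) (auto simp: monomial_def dual_action_def)
  qed (use assms in \<open>auto simp: mult_F monomial_def\<close>)
qed

text \<open>Multiplication by a function on the left is pointwise, but on the right the function is
  moved by \<alpha>_r. Hence right approximate units have to be adapted to the values
  |b(t)(\<phi>_t(x))| and left ones to |b(t)(x)|.\<close>

lemma mult_monomial_one:
  assumes b: "b \<in> carrier F"
  shows "b \<otimes>\<^bsub>F\<^esub> monomial \<one> e = (\<lambda>r x. b r x * \<alpha> r e x)"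
proof (intro ext)
  fix r x
  show "(b \<otimes>\<^bsub>F\<^esub> monomial \<one> e) r x = b r x * \<alpha> r e x"
  proof (cases "r \<in> carrier G")
    case True
    have *: "inv s \<otimes> r \<noteq> \<one>" if "s \<in> carrier G" "s \<noteq> r" for s
      using that True by (metis GG.inv_solve_left' GG.one_closed GG.r_one)
    have "(b \<otimes>\<^bsub>F\<^esub> monomial \<one> e) r x
        = (\<Sum>\<^sub>\<infinity>s\<in>carrier G. b s x * \<alpha> s (monomial \<one> e (inv s \<otimes> r)) x * u s (inv s \<otimes> r) x)"
      using True by (simp only: mult_F if_True)
    also have "\<dots> = b r x * \<alpha> r (monomial \<one> e (inv r \<otimes> r)) x * u r (inv r \<otimes> r) x"
      by (rule infsum_eq_single[OF True]) (simp add: * monomial_def dual_action_def)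
    finally have "(b \<otimes>\<^bsub>F\<^esub> monomial \<one> e) r x = \<dots>" .
    then show ?thesis using True u_one_right[OF True, of x] F_D(3)[OF b]
      by (cases "x \<in> topspace X") (auto simp: monomial_def)
  qed (use F_D(2)[OF b] in \<open>simp add: mult_F\<close>)
qed

end


section \<open>Tietze extension and column sums\<close>

text \<open>A locally compact Hausdorff space need not be normal, but its one-point compactification
  is. The function is extended from Y together with the point at infinity, where it is given the
  value 0; this forces the extension to vanish at infinity.\<close>

lemma C0_Tietze_real:
  assumes lc: "locally_compact_space X" and X: "Hausdorff_space X" and Y: "closedin X Y"
    and c: "c \<in> carrier (C0 (subtopology X Y))" and real: "\<And>x. c x \<in> \<real>"
    and m: "\<And>x. cmod (c x) \<le> m"
  obtains a where "a \<in> carrier (C0 X)" "\<And>x. x \<in> Y \<Longrightarrow> a x = c x" "\<And>x. cmod (a x) \<le> m"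
proof -
  define Z where "Z = Alexandroff_compactification X"
  define S where "S = insert None (Some ` Y)"
  define f where "f z = (case z of None \<Rightarrow> 0 | Some x \<Rightarrow> Re (c x))" for z
  have YX: "Y \<subseteq> topspace X" using Y closedin_subset by blast
  have m0: "0 \<le> m" using m[of undefined] norm_ge_zero order_trans by blast
  have topZ: "topspace Z = insert None (Some ` topspace X)" by (simp add: Z_def)
  have normal: "normal_space Z"
    using lc X by (auto simp: Z_def Hausdorff_space_Alexandroff_compactification
        intro!: compact_Hausdorff_or_regular_imp_normal_space)
  have clS: "closedin Z S"
  proof -
    have "topspace Z - S = Some ` (topspace X - Y)" by (auto simp: topZ S_def)
    moreover have "openin X (topspace X - Y)" using Y by blast
    ultimately have "openin Z (topspace Z - S)" by (simp add: Z_def)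
    then show ?thesis using YX by (auto simp: closedin_def topZ S_def)
  qed
  have contf: "continuous_map (subtopology Z S) euclideanreal f"
  proof -
    have "continuous_map (subtopology Z S) Met_TC.mtopology f"
      unfolding Met_TC.continuous_map_to_metric
    proof (intro ballI allI impI)
      fix z and \<epsilon> :: real assume z: "z \<in> topspace (subtopology Z S)" and e: "\<epsilon> > 0"
      show "\<exists>V. openin (subtopology Z S) V \<and> z \<in> V \<and> (\<forall>w\<in>V. f w \<in> Met_TC.mball (f z) \<epsilon>)"
      proof (cases z)
        case None
        \<comment> \<open>Continuity at infinity: outside the compact superlevel set
          \<open>K\<close> the values of c on Y are smaller than \<epsilon>, and the complement of
          \<open>K\<close> with the added point is open.\<close>
        define K where "K = {x \<in> topspace (subtopology X Y). \<epsilon> \<le> cmod (c x)}"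
        have "compactin X K" using C0_D(2)[OF c e] by (simp add: K_def compactin_subtopology)
        then have "openin Z (insert None (Some ` (topspace X - K)))"
          using compactin_imp_closedin[OF X] unfolding Z_def openin_Alexandroff_compactification by blast
        then have "openin (subtopology Z S) (S \<inter> insert None (Some ` (topspace X - K)))"
          by (simp add: openin_subtopology_Int2)
        moreover have "f w \<in> Met_TC.mball (f z) \<epsilon>" if "w \<in> S \<inter> insert None (Some ` (topspace X - K))" for w
        proof (cases w)
          case (Some x)
          then have "x \<in> Y" "x \<notin> K" using that by (auto simp: S_def)
          then have "cmod (c x) < \<epsilon>" using YX by (auto simp: K_def)
          then show ?thesis using Some None abs_Re_le_cmod[of "c x"] by (simp add: f_def dist_real_def)
        qed (use None e in \<open>simp add: f_def\<close>)
        ultimately show ?thesis using None by (intro exI[of _ "S \<inter> insert None (Some ` (topspace X - K))"]) (auto simp: S_def)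
      next
        case (Some x)
        have x: "x \<in> topspace (subtopology X Y)" using z Some by (auto simp: topZ S_def)
        have "continuous_map (subtopology X Y) Met_TC.mtopology c" using C0_D(1)[OF c] by simp
        then obtain V where V: "openin (subtopology X Y) V" "x \<in> V" "\<forall>y\<in>V. c y \<in> Met_TC.mball (c x) \<epsilon>"
          using x e unfolding Met_TC.continuous_map_to_metric by blast
        obtain W where W: "openin X W" "V = W \<inter> Y" using V(1) by (auto simp: openin_subtopology)
        have "openin (subtopology Z S) (S \<inter> Some ` W)"
          using W(1) by (simp add: openin_subtopology_Int2 Z_def)
        moreover have "f w \<in> Met_TC.mball (f z) \<epsilon>" if w: "w \<in> S \<inter> Some ` W" for w
        proof -
          obtain y where y: "w = Some y" "y \<in> V" using w W(2) by (auto simp: S_def)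
          have "\<bar>Re (c x) - Re (c y)\<bar> \<le> cmod (c x - c y)" using abs_Re_le_cmod[of "c x - c y"] by simp
          then show ?thesis using y V(3) Some by (auto simp: f_def dist_real_def dist_norm)
        qed
        ultimately show ?thesis using Some V(2) W(2)
          by (intro exI[of _ "S \<inter> Some ` W"]) (auto simp: S_def)
      qed
    qed
    then show ?thesis by simp
  qed
  have "f ` S \<subseteq> {-m..m}"
  proof
    fix r assume "r \<in> f ` S"
    then obtain z where z: "z \<in> S" "r = f z" by auto
    have "\<bar>f z\<bar> \<le> m"
      using m0 order_trans[OF abs_Re_le_cmod m] by (cases z) (auto simp: f_def)
    then show "r \<in> {-m..m}" using z by auto
  qed
  then obtain g where g: "continuous_map Z euclideanreal g" "\<And>z. z \<in> S \<Longrightarrow> g z = f z"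
      "g ` topspace Z \<subseteq> {-m..m}"
    using Tietze_extension_closed_real_interval[OF normal clS contf, of "-m" m] m0 by auto
  define a where "a x = (if x \<in> topspace X then complex_of_real (g (Some x)) else 0)" for x
  have cont: "continuous_map X euclideanreal (g \<circ> Some)"
    using continuous_map_Some g(1) continuous_map_compose unfolding Z_def by blast
  have a0: "a \<in> carrier (C0 X)"
  proof (rule C0_I)
    have "continuous_map X euclidean (\<lambda>x. complex_of_real ((g \<circ> Some) x))"
      using cont by (rule continuous_map_of_real)
    then show "continuous_map X euclidean a"
      by (rule continuous_map_eq) (simp add: a_def)
    fix \<epsilon> :: real assume e: "\<epsilon> > 0"
    define K where "K = {x \<in> topspace X. \<epsilon> \<le> cmod (a x)}"
    \<comment> \<open>This closed set misses the added point since \<open>g None = 0\<close>, and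
      closed subsets of the compactification that miss it are compact in \<open>X\<close>.\<close>
    have "{z \<in> topspace Z. \<epsilon> \<le> norm (g z)} = Some ` K"
      using g(2)[of None] e by (auto simp: topZ S_def f_def K_def a_def)
    then have "closedin Z (Some ` K)" using closedin_superlevel[OF g(1), of \<epsilon>] by simp
    then show "\<exists>K. compactin X K \<and> {x \<in> topspace X. \<epsilon> \<le> cmod (a x)} \<subseteq> K"
      unfolding Z_def closedin_Alexandroff_compactification_image_Some K_def by auto
  qed (simp add: a_def)
  show thesis
  proof (rule that[OF a0])
    fix x
    show "a x = c x" if "x \<in> Y"
    proof -
      have "complex_of_real (Re (c x)) = c x" using real[of x] by (simp add: complex_is_Real_iff complex_eq_iff)
      then show ?thesis using that YX g(2)[of "Some x"] by (auto simp: a_def S_def f_def)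
    qed
    have "g (Some x) \<in> {-m..m}" if "x \<in> topspace X" using g(3) that by (auto simp: topZ image_subset_iff)
    then show "cmod (a x) \<le> m" using m0 by (auto simp: a_def)
  qed
qed

text \<open>The factor 2 comes from extending real and imaginary parts separately. It is harmless:
  it only has to keep lifted coefficients summable, and the exact quotient norm is obtained by
  cutting off.\<close>

lemma C0_Tietze:
  assumes "locally_compact_space X" "Hausdorff_space X" "closedin X Y"
    and c: "c \<in> carrier (C0 (subtopology X Y))"
  obtains a where "a \<in> carrier (C0 X)" "\<And>x. x \<in> Y \<Longrightarrow> a x = c x"
    "nrm (C0 X) a \<le> 2 * nrm (C0 (subtopology X Y)) c"
proof -
  let ?m = "nrm (C0 (subtopology X Y)) c"
  obtain a where a: "a \<in> carrier (C0 X)" "\<And>x. x \<in> Y \<Longrightarrow> a x = complex_of_real (Re (c x))" "\<And>x. cmod (a x) \<le> ?m"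
    using C0_Tietze_real[OF assms(1-3) C0_Re_Im(1)[OF c], of ?m]
      order_trans[OF abs_Re_le_cmod C0_le_norm[OF c]] by auto
  obtain b where b: "b \<in> carrier (C0 X)" "\<And>x. x \<in> Y \<Longrightarrow> b x = complex_of_real (Im (c x))" "\<And>x. cmod (b x) \<le> ?m"
    using C0_Tietze_real[OF assms(1-3) C0_Re_Im(2)[OF c], of ?m]
      order_trans[OF abs_Im_le_cmod C0_le_norm[OF c]] by auto
  show thesis
  proof (rule that[of "\<lambda>x. a x + \<i> * b x"])
    show mem: "(\<lambda>x. a x + \<i> * b x) \<in> carrier (C0 X)" using a b by auto
    show "a x + \<i> * b x = c x" if "x \<in> Y" for x using a(2)[OF that] b(2)[OF that] by (simp add: complex_eq_iff)
    show "nrm (C0 X) (\<lambda>x. a x + \<i> * b x) \<le> 2 * ?m"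
    proof (rule C0_norm_le[OF mem])
      show "cmod (a x + \<i> * b x) \<le> 2 * ?m" for x
        using norm_triangle_ineq[of "a x" "\<i> * b x"] a(3)[of x] b(3)[of x] by (simp add: norm_mult)
    qed (simp add: C0_norm_nonneg[OF c])
  qed
qed

lemma C0_nonvanishing:
  assumes "locally_compact_space X" "Hausdorff_space X" "x \<in> topspace X"
  obtains a where "a \<in> carrier (C0 X)" "a x = 1"
proof -
  have cl: "closedin X {x}" using assms(2,3) by (simp add: closedin_Hausdorff_singleton)
  have mem: "(\<lambda>y. if y = x then 1 else 0) \<in> carrier (C0 (subtopology X {x}))"
  proof (rule C0_I)
    have "continuous_map (subtopology X {x}) euclidean (\<lambda>y. 1::complex)" by simp
    then show "continuous_map (subtopology X {x}) euclidean (\<lambda>y. if y = x then 1 else 0 :: complex)"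
      by (rule continuous_map_eq) auto
    have "compactin (subtopology X {x}) {x}"
      using assms(3) by (simp add: compactin_subtopology)
    moreover have "{y \<in> topspace (subtopology X {x}). \<epsilon> \<le> cmod (if y = x then 1 else 0)} \<subseteq> {x}" for \<epsilon>
      by auto
    ultimately show "\<exists>K. compactin (subtopology X {x}) K \<and>
      {y \<in> topspace (subtopology X {x}). \<epsilon> \<le> cmod (if y = x then 1 else 0)} \<subseteq> K" for \<epsilon> by blast
    show "(if y = x then 1 else 0 :: complex) = 0" if "y \<notin> topspace (subtopology X {x})" for y
      using that assms(3) by auto
  qed
  show thesis
  proof (rule C0_Tietze[OF assms(1,2) cl mem])
    fix a assume "a \<in> carrier (C0 X)" "\<And>y. y \<in> {x} \<Longrightarrow> a y = (if y = x then 1 else 0)"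
    then show thesis using that[of a] by simp
  qed
qed

text \<open>For \<open>\<rho> = \<phi>\<close> and for the trivial family \<open>\<rho>\<close> this turns out to be the norm given by the
  representations on \<open>L\<^sup>1\<close>-spaces and on \<open>C\<^sub>0\<close>-spaces, respectively.\<close>

definition column_norm :: "('g, 'z) monoid_scheme \<Rightarrow> 'x topology \<Rightarrow> ('g \<Rightarrow> 'x \<Rightarrow> 'x)
    \<Rightarrow> ('g \<Rightarrow> 'x \<Rightarrow> complex) \<Rightarrow> real" where
  "column_norm G X \<rho> b = Sup (insert 0 ((\<lambda>x. \<Sum>\<^sub>\<infinity>t\<in>carrier G. cmod (b t (\<rho> t x))) ` topspace X))"

text \<open>Covers the two families at once, \<phi> for p = 1 and the trivial one for p =
  \<infinity>. What matters for column sums is each single homeomorphism, so no group law is asked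
  for.\<close>

locale homeomorphism_family =
  fixes G :: "('g, 'z) monoid_scheme" and X :: "'x topology" and \<rho> :: "'g \<Rightarrow> 'x \<Rightarrow> 'x"
  assumes \<rho>_homeo: "t \<in> carrier G \<Longrightarrow> homeomorphic_map X X (\<rho> t)"
begin

lemma \<rho>_surj:
  assumes "t \<in> carrier G" "y \<in> topspace X"
  obtains x where "x \<in> topspace X" "\<rho> t x = y"
  using \<rho>_homeo homeomorphic_imp_surjective_map assms by (metis imageE)

lemma column_summable:
  assumes b: "b \<in> carrier (F_alg G X \<phi> u)"
  shows "(\<lambda>t. cmod (b t (\<rho> t x))) summable_on carrier G"
  by (rule summable_on_comparison_test[OF F_D(4)[OF b]]) (auto intro: C0_le_norm F_D(1)[OF b])

lemma column_sum_le_norm: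
  assumes b: "b \<in> carrier (F_alg G X \<phi> u)"
  shows "(\<Sum>\<^sub>\<infinity>t\<in>carrier G. cmod (b t (\<rho> t x))) \<le> nrm (F_alg G X \<phi> u) b"
  unfolding norm_F by (intro infsum_mono column_summable[OF b] F_D(4)[OF b]) (auto intro: C0_le_norm F_D(1)[OF b])

lemma column_bdd:
  assumes b: "b \<in> carrier (F_alg G X \<phi> u)"
  shows "bdd_above (insert 0 ((\<lambda>x. \<Sum>\<^sub>\<infinity>t\<in>carrier G. cmod (b t (\<rho> t x))) ` topspace X))"
  using column_sum_le_norm[OF b] F_norm_nonneg[OF b] by (intro bdd_aboveI[of _ "nrm (F_alg G X \<phi> u) b"]) auto

lemma column_sum_le:
  assumes b: "b \<in> carrier (F_alg G X \<phi> u)" and "x \<in> topspace X"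
  shows "(\<Sum>\<^sub>\<infinity>t\<in>carrier G. cmod (b t (\<rho> t x))) \<le> column_norm G X \<rho> b"
  unfolding column_norm_def using assms(2) by (intro cSup_upper column_bdd[OF b]) auto

lemma column_norm_nonneg:
  assumes b: "b \<in> carrier (F_alg G X \<phi> u)"
  shows "0 \<le> column_norm G X \<rho> b"
  unfolding column_norm_def by (intro cSup_upper column_bdd[OF b]) auto

lemma column_norm_leI:
  assumes "0 \<le> B" "\<And>x. x \<in> topspace X \<Longrightarrow> (\<Sum>\<^sub>\<infinity>t\<in>carrier G. cmod (b t (\<rho> t x))) \<le> B"
  shows "column_norm G X \<rho> b \<le> B"
  unfolding column_norm_def using assms by (intro cSup_least) auto

lemma column_norm_le_norm:
  assumes b: "b \<in> carrier (F_alg G X \<phi> u)"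
  shows "column_norm G X \<rho> b \<le> nrm (F_alg G X \<phi> u) b"
  by (intro column_norm_leI F_norm_nonneg[OF b] column_sum_le_norm[OF b])

lemma column_finite_sum_le:
  assumes b: "b \<in> carrier (F_alg G X \<phi> u)" and "x \<in> topspace X" "finite S" "S \<subseteq> carrier G"
  shows "(\<Sum>t\<in>S. cmod (b t (\<rho> t x))) \<le> column_norm G X \<rho> b"
  by (rule order_trans[OF finite_sum_le_infsum[OF column_summable[OF b]] column_sum_le[OF b assms(2)]])
    (use assms in auto)

lemma coeff_le_column_norm:
  assumes b: "b \<in> carrier (F_alg G X \<phi> u)" and t: "t \<in> carrier G"
  shows "nrm (C0 X) (b t) \<le> column_norm G X \<rho> b"
proof (rule C0_norm_le[OF F_D(1)[OF b] column_norm_nonneg[OF b]])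
  fix y assume "y \<in> topspace X"
  then obtain x where x: "x \<in> topspace X" "\<rho> t x = y" using \<rho>_surj[OF t] by metis
  then show "cmod (b t y) \<le> column_norm G X \<rho> b"
    using column_finite_sum_le[OF b x(1), of "{t}"] t by simp
qed

lemma column_norm_mono:
  assumes b: "b \<in> carrier (F_alg G X \<phi> u)" and c: "c \<in> carrier (F_alg G X \<phi> u)"
    and le: "\<And>t x. cmod (c t x) \<le> cmod (b t x)"
  shows "column_norm G X \<rho> c \<le> column_norm G X \<rho> b"
proof (intro column_norm_leI column_norm_nonneg[OF b])
  fix x assume x: "x \<in> topspace X"
  have "(\<Sum>\<^sub>\<infinity>t\<in>carrier G. cmod (c t (\<rho> t x))) \<le> (\<Sum>\<^sub>\<infinity>t\<in>carrier G. cmod (b t (\<rho> t x)))"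
    by (intro infsum_mono column_summable[OF b] column_summable[OF c] le)
  then show "(\<Sum>\<^sub>\<infinity>t\<in>carrier G. cmod (c t (\<rho> t x))) \<le> column_norm G X \<rho> b"
    using column_sum_le[OF b x] by linarith
qed

text \<open>Each function |b(t)(\<rho>_t(x))| of x lies in C0(X) and has the norm of b(t), so the
  column sums form an absolutely convergent series there. They are thus continuous, as the cutoff
  requires, and vanish at infinity, as approximate units require.\<close>

lemma column_function_C0:
  assumes b: "b \<in> carrier (F_alg G X \<phi> u)"
  shows "(\<lambda>x. if x \<in> topspace X then complex_of_real (\<Sum>\<^sub>\<infinity>t\<in>carrier G. cmod (b t (\<rho> t x))) else 0)
    \<in> carrier (C0 X)"
proof -
  define f where "f t x = complex_of_real (cmod (if x \<in> topspace X then b t (\<rho> t x) else 0))" for t x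
  have f: "f t \<in> carrier (C0 X)" "nrm (C0 X) (f t) = nrm (C0 X) (b t)" if "t \<in> carrier G" for t
    using C0_cmod[OF C0_compose_homeomorphism(1)[OF F_D(1)[OF b] \<rho>_homeo[OF that]]]
      C0_compose_homeomorphism(2)[OF F_D(1)[OF b] \<rho>_homeo[OF that], of t]
    by (simp_all add: f_def[abs_def] norm_C0)
  have "(\<lambda>t. nrm (C0 X) (f t)) summable_on carrier G"
    using F_D(4)[OF b] f(2) by (simp cong: summable_on_cong)
  then have "(\<lambda>x. \<Sum>\<^sub>\<infinity>t\<in>carrier G. f t x) \<in> carrier (C0 X)" using f(1) by (intro C0_infsum(1)) auto
  moreover have "(\<Sum>\<^sub>\<infinity>t\<in>carrier G. f t x) = (if x \<in> topspace X then complex_of_real (\<Sum>\<^sub>\<infinity>t\<in>carrier G. cmod (b t (\<rho> t x))) else 0)" for x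
  proof -
    have "((\<lambda>t. complex_of_real (cmod (b t (\<rho> t x)))) has_sum
        complex_of_real (\<Sum>\<^sub>\<infinity>t\<in>carrier G. cmod (b t (\<rho> t x)))) (carrier G)"
      unfolding has_sum_of_real_iff by (rule has_sum_infsum[OF column_summable[OF b]])
    then show ?thesis by (auto simp: f_def dest: infsumI)
  qed
  ultimately show ?thesis by simp
qed

text \<open>The function \<open>h\<close> is obtained by truncating the column sums \<open>g\<close> at the height \<open>M\<close>.\<close>

lemma column_cutoff:
  assumes b: "b \<in> carrier (F_alg G X \<phi> u)" and M: "M > 0"
    and U: "\<And>x. x \<in> topspace X - U \<Longrightarrow> (\<Sum>\<^sub>\<infinity>t\<in>carrier G. cmod (b t (\<rho> t x))) \<le> M"
  obtains h where "continuous_map X euclideanreal h" "\<And>x. 0 \<le> h x \<and> h x \<le> 1"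
    "\<And>x. x \<in> topspace X - U \<Longrightarrow> h x = 0"
    "\<And>x. x \<in> topspace X \<Longrightarrow> (1 - h x) * (\<Sum>\<^sub>\<infinity>t\<in>carrier G. cmod (b t (\<rho> t x))) \<le> M"
proof -
  define g where "g x = (if x \<in> topspace X then \<Sum>\<^sub>\<infinity>t\<in>carrier G. cmod (b t (\<rho> t x)) else 0)" for x
  have "(\<lambda>x. complex_of_real (g x)) \<in> carrier (C0 X)"
    using column_function_C0[OF b] by (simp add: g_def if_distrib cong: if_cong)
  then have "continuous_map X euclideanreal (\<lambda>x. cmod (complex_of_real (g x)))"
    by (intro continuous_map_norm C0_D)
  moreover have g0: "0 \<le> g x" for x by (simp add: g_def infsum_nonneg)
  ultimately have g: "continuous_map X euclideanreal g" by simp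
  \<comment> \<open>Where g > M this makes 1 - h = M/g, and h = 0 elsewhere. Positivity of M keeps
    the denominator away from 0.\<close>
  define h where "h x = max 0 (g x - M) / max (g x) M" for x
  have p: "max (g x) M > 0" for x using M by simp
  have p0: "max (g x) M \<noteq> 0" for x using p[of x] by simp
  show thesis
  proof (rule that[of h])
    show "continuous_map X euclideanreal h"
      unfolding h_def
      by (intro continuous_map_real_divide continuous_map_real_max continuous_map_diff g p0) auto
    show "0 \<le> h x \<and> h x \<le> 1" for x
      using p[of x] M g0[of x] by (auto simp: h_def divide_simps)
    show "h x = 0" if "x \<in> topspace X - U" for x
      using U[OF that] that by (simp add: h_def g_def)
    show "(1 - h x) * (\<Sum>\<^sub>\<infinity>t\<in>carrier G. cmod (b t (\<rho> t x))) \<le> M" if "x \<in> topspace X" for x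
    proof -
      have "(1 - h x) * g x \<le> M"
      proof (cases "g x \<le> M")
        case True
        then show ?thesis by (simp add: h_def)
      next
        case False
        then have "(1 - h x) * g x = M" using M by (simp add: h_def max_def field_simps)
        then show ?thesis by simp
      qed
      then show ?thesis using that by (simp add: g_def)
    qed
  qed
qed

end


section \<open>Restriction to invariant subsets\<close>

text \<open>The explicit formula for the norm, free of representations and of the type that bounds
  their spaces. Any p other than 1 is treated as \<infinity>, as in \<open>P_norm\<close>.\<close>

definition concrete_norm :: "('g, 'z) monoid_scheme \<Rightarrow> 'x topology \<Rightarrow> ('g \<Rightarrow> 'x \<Rightarrow> 'x)
    \<Rightarrow> ereal set \<Rightarrow> ('g \<Rightarrow> 'x \<Rightarrow> complex) \<Rightarrow> real" where
  "concrete_norm G X \<phi> P b = (if P = {} then \<Sum>\<^sub>\<infinity>t\<in>carrier G. nrm (C0 X) (b t)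
     else Max ((\<lambda>p. column_norm G X (if p = 1 then \<phi> else (\<lambda>t x. x)) b) ` P))"

lemma (in twisted_action) homeomorphism_family_p:
  "homeomorphism_family G X (if p = (1::ereal) then \<phi> else (\<lambda>t x. x))"
  using homeomorphism homeomorphic_map_id[of X X] by unfold_locales (auto simp: id_def)

context twisted_action begin

context
  fixes P :: "ereal set"
  assumes P: "P \<subseteq> {1, \<infinity>}"
begin

lemma finite_P: "finite P"
  using P by (rule finite_subset) simp

lemma concrete_norm_le_norm:
  assumes b: "b \<in> carrier F"
  shows "concrete_norm G X \<phi> P b \<le> nrm F b"
  using homeomorphism_family.column_norm_le_norm[OF homeomorphism_family_p b] finite_P
  by (auto simp: concrete_norm_def norm_F)

text \<open>Every value b(t)(y) occurs in some column, since \<rho>_t is onto. This makes the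
  coefficient maps contractive on the completion.\<close>

lemma coeff_le_concrete_norm:
  assumes b: "b \<in> carrier F" and t: "t \<in> carrier G"
  shows "nrm (C0 X) (b t) \<le> concrete_norm G X \<phi> P b"
  using homeomorphism_family.coeff_le_column_norm[OF homeomorphism_family_p b t] finite_P
    F_coeff_le_norm[OF b, of t]
  by (auto simp: concrete_norm_def norm_F Max_ge_iff)

text \<open>The formula sees only the moduli of the coefficients. Truncation to a subset of G is
  therefore contractive.\<close>

lemma concrete_norm_mono:
  assumes b: "b \<in> carrier F" and c: "c \<in> carrier F"
    and le: "\<And>t x. cmod (c t x) \<le> cmod (b t x)"
  shows "concrete_norm G X \<phi> P c \<le> concrete_norm G X \<phi> P b"
proof (cases "P = {}")
  case True
  have "nrm (C0 X) (c t) \<le> nrm (C0 X) (b t)" for t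
    using le F_D(1)[OF b] F_D(1)[OF c]
    by (auto intro!: C0_norm_le C0_norm_nonneg intro: order_trans[OF _ C0_le_norm])
  then show ?thesis using True F_D(4)[OF b] F_D(4)[OF c] by (simp add: concrete_norm_def infsum_mono)
next
  case False
  have "column_norm G X (if p = 1 then \<phi> else (\<lambda>t x. x)) c
      \<le> Max ((\<lambda>p. column_norm G X (if p = 1 then \<phi> else (\<lambda>t x. x)) b) ` P)" if "p \<in> P" for p
  proof -
    have "column_norm G X (if p = 1 then \<phi> else (\<lambda>t x. x)) c
      \<le> column_norm G X (if p = 1 then \<phi> else (\<lambda>t x. x)) b"
      by (rule homeomorphism_family.column_norm_mono[OF homeomorphism_family_p b c le])
    also have "\<dots> \<le> Max ((\<lambda>p. column_norm G X (if p = 1 then \<phi> else (\<lambda>t x. x)) b) ` P)"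
      using that finite_P by (intro Max_ge) auto
    finally show ?thesis .
  qed
  then show ?thesis using False finite_P by (simp add: concrete_norm_def)
qed

end

section \<open>Restricted actions\<close>

lemma invariant_iff:
  assumes "invariant G \<phi> V" "V \<subseteq> topspace X" "t \<in> carrier G" "x \<in> topspace X"
  shows "\<phi> t x \<in> V \<longleftrightarrow> x \<in> V"
proof
  assume "\<phi> t x \<in> V"
  then have "\<phi> (inv t) (\<phi> t x) \<in> \<phi> (inv t) ` V" by (rule imageI)
  also have "\<phi> (inv t) ` V = V" using assms by (simp add: invariant_def)
  finally show "x \<in> V" using assms by simp
next
  assume "x \<in> V"
  then have "\<phi> t x \<in> \<phi> t ` V" by (rule imageI)
  then show "\<phi> t x \<in> V" using assms by (simp add: invariant_def)
qed

lemma invariant_Diff: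
  assumes "invariant G \<phi> U" "U \<subseteq> topspace X"
  shows "invariant G \<phi> (topspace X - U)"
  unfolding invariant_def
proof (intro ballI equalityI subsetI)
  fix t y assume t: "t \<in> carrier G"
  show "y \<in> topspace X - U" if "y \<in> \<phi> t ` (topspace X - U)"
    using that t invariant_iff[OF assms t] \<phi>_mem[OF t] by auto
  assume y: "y \<in> topspace X - U"
  then have "\<phi> (inv t) y \<in> topspace X - U" "y = \<phi> t (\<phi> (inv t) y)"
    using t invariant_iff[OF assms, of "inv t" y] \<phi>_mem[of "inv t" y] by auto
  then show "y \<in> \<phi> t ` (topspace X - U)" by blast
qed

text \<open>Open and closed subsets inherit local compactness from X, which arbitrary subsets need
  not; invariance makes the restricted maps bijections of V.\<close>

lemma subaction:
  assumes V: "openin X V \<or> closedin X V" and inv: "invariant G \<phi> V"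
  shows "twisted_action G (subtopology X V) (restrict_action \<phi> V) (restrict_twist u V)"
proof -
  have VX: "V \<subseteq> topspace X" using V openin_subset closedin_subset by blast
  have top: "topspace (subtopology X V) = V" using VX by auto
  have mem: "\<phi> t x \<in> V" if "t \<in> carrier G" "x \<in> V" for t x using that inv by (auto simp: invariant_def)
  have bij: "restrict_action \<phi> V t \<in> Bij V" if "t \<in> carrier G" for t
  proof -
    have "inj_on (\<phi> t) V" using inj_prop[OF that] VX inj_on_subset by blast
    then have "bij_betw (\<phi> t) V V" using inv that by (simp add: bij_betw_def invariant_def)
    then show ?thesis by (simp add: Bij_def restrict_action_def bij_betw_def inj_on_def)
  qed
  have ga: "group_action G V (restrict_action \<phi> V)"
  proof (intro group_action.intro group_hom.intro group_hom_axioms.intro is_group group_BijGroup)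
    show "restrict_action \<phi> V \<in> hom G (BijGroup V)"
    proof (rule homI)
      show "restrict_action \<phi> V t \<in> carrier (BijGroup V)" if "t \<in> carrier G" for t
        using bij[OF that] by (simp add: BijGroup_def)
      show "restrict_action \<phi> V (s \<otimes> t) = restrict_action \<phi> V s \<otimes>\<^bsub>BijGroup V\<^esub> restrict_action \<phi> V t"
        if "s \<in> carrier G" "t \<in> carrier G" for s t
        using that bij VX mem
        by (auto simp: BijGroup_def compose_def restrict_action_def fun_eq_iff restrict_def \<phi>_mult subset_iff)
    qed
  qed
  show ?thesis
  proof (intro twisted_action.intro twisted_action_axioms.intro)
    show "group_action G (topspace (subtopology X V)) (restrict_action \<phi> V)" unfolding top by (rule ga)
    show "locally_compact_space (subtopology X V)"
      using V locally_compact Hausdorff locally_compact_space_open_subset locally_compact_space_closed_subset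
      by blast
    show "Hausdorff_space (subtopology X V)" using Hausdorff by (rule Hausdorff_space_subtopology)
    fix t assume t: "t \<in> carrier G"
    have "homeomorphic_map (subtopology X V) (subtopology X V) (\<phi> t)"
      using homeomorphism[OF t] VX inv t
      by (intro homeomorphic_map_subtopologies) (auto simp: invariant_def Int_absorb1)
    then show "homeomorphic_map (subtopology X V) (subtopology X V) (restrict_action \<phi> V t)"
      by (rule homeomorphic_map_eq) (simp add: top restrict_action_def)
  next
    fix s t assume st: "s \<in> carrier G" "t \<in> carrier G"
    have "continuous_map (subtopology X V) euclidean (u s t)"
      using twist_continuous[OF st] by (rule continuous_map_from_subtopology)
    then show "continuous_map (subtopology X V) euclidean (restrict_twist u V s t)"
      by (rule continuous_map_eq) (simp add: top restrict_twist_def)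
    show "cmod (restrict_twist u V s t x) = 1" if "x \<in> topspace (subtopology X V)" for x
      using that VX st twist_unimodular by (auto simp: restrict_twist_def)
  next
    fix r s t x assume rst: "r \<in> carrier G" "s \<in> carrier G" "t \<in> carrier G" and "x \<in> topspace (subtopology X V)"
    then have x: "x \<in> V" "x \<in> topspace X" using VX by auto
    then show "dual_action G (subtopology X V) (restrict_action \<phi> V) r (restrict_twist u V s t) x *
        restrict_twist u V r (s \<otimes> t) x = restrict_twist u V r s x * restrict_twist u V (r \<otimes> s) t x"
      using twist_cocycle[OF rst x(2)] mem[OF GG.inv_closed[OF rst(1)] x(1)]
      by (simp add: dual_action_def restrict_twist_def restrict_action_def)
  next
    show "restrict_twist u V \<one> \<one> x = 1" if "x \<in> topspace (subtopology X V)" for x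
      using that VX twist_normalised by (auto simp: restrict_twist_def)
  qed
qed

end

locale twisted_subaction = twisted_action +
  fixes U
  assumes U_open: "openin X U" and U_invariant: "invariant G \<phi> U"
begin

abbreviation (input) "Y \<equiv> topspace X - U"
abbreviation (input) "FU \<equiv> F_sub G X \<phi> u U"
abbreviation (input) "FY \<equiv> F_sub G X \<phi> u Y"

lemma U_subset: "U \<subseteq> topspace X" using U_open openin_subset by blast
lemma Y_closed: "closedin X Y" using U_open by blast
lemma Y_invariant: "invariant G \<phi> Y" using invariant_Diff U_invariant U_subset by blast

lemma top_Y: "topspace (subtopology X Y) = Y" by auto

sublocale Uact: twisted_action G "subtopology X U" "restrict_action \<phi> U" "restrict_twist u U"
  using subaction U_open U_invariant by blast

sublocale Yact: twisted_action G "subtopology X Y" "restrict_action \<phi> Y" "restrict_twist u Y"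
  using subaction Y_closed Y_invariant by blast

text \<open>Functions over U are extended by zero as they stand, and norms are suprema over the
  whole type, so both summability conditions are literally the same.\<close>

lemma mem_FU_iff: "b \<in> carrier FU \<longleftrightarrow> b \<in> carrier F \<and> (\<forall>t x. x \<notin> U \<longrightarrow> b t x = 0)"
proof -
  have "(\<forall>t\<in>carrier G. b t \<in> carrier (C0 (subtopology X U))) \<longleftrightarrow>
    (\<forall>t\<in>carrier G. b t \<in> carrier (C0 X) \<and> (\<forall>x. x \<notin> U \<longrightarrow> b t x = 0))"
    using C0_open_iff[OF Hausdorff U_open] by simp
  moreover have "b t x = 0" if "b t = (\<lambda>x. 0)" for t x using that by simp
  ultimately show ?thesis unfolding F_sub_def mem_F_iff norm_C0 by blast
qed

text \<open>Off U the restricted twist has an arbitrary value, but there the factor from a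
  vanishes.\<close>

lemma mult_FU:
  assumes a: "a \<in> carrier FU"
  shows "a \<otimes>\<^bsub>FU\<^esub> b = a \<otimes>\<^bsub>F\<^esub> b"
proof (intro ext)
  fix r x
  have "a s x * dual_action G (subtopology X U) (restrict_action \<phi> U) s (b t) x * restrict_twist u U s t x
      = a s x * \<alpha> s (b t) x * u s t x" if "s \<in> carrier G" for s t
  proof (cases "x \<in> U")
    case True
    then show ?thesis using U_subset that
      by (auto simp: dual_action_def restrict_action_def restrict_twist_def)
  next
    case False
    then show ?thesis using a by (simp add: mem_FU_iff)
  qed
  then show "(a \<otimes>\<^bsub>FU\<^esub> b) r x = (a \<otimes>\<^bsub>F\<^esub> b) r x"
    unfolding F_sub_def F_alg_def by (auto intro!: infsum_cong)
qed

lemma restrict_mem: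
  assumes b: "b \<in> carrier F"
  shows "restrict_fun Y b \<in> carrier FY"
  unfolding F_sub_def
proof (rule F_I[OF _ _ F_D(4)[OF b]])
  fix t assume "t \<in> carrier G"
  show mem: "restrict_fun Y b t \<in> carrier (C0 (subtopology X Y))"
    unfolding restrict_fun_def by (rule C0_restrict_closed[OF F_D(1)[OF b] Y_closed])
  show "nrm (C0 (subtopology X Y)) (restrict_fun Y b t) \<le> nrm (C0 X) (b t)"
    using F_D(1)[OF b] by (intro C0_norm_le[OF mem]) (auto simp: restrict_fun_def C0_norm_nonneg C0_le_norm)
qed (use F_D(2)[OF b] in \<open>auto simp: restrict_fun_def fun_eq_iff\<close>)

text \<open>Invariance of Y means that \<alpha>_s(b(t)) on Y depends only on b(t) on Y.\<close>

lemma restrict_mult: "restrict_fun Y (a \<otimes>\<^bsub>F\<^esub> b) = restrict_fun Y a \<otimes>\<^bsub>FY\<^esub> restrict_fun Y b"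
proof (intro ext)
  fix r x
  show "restrict_fun Y (a \<otimes>\<^bsub>F\<^esub> b) r x = (restrict_fun Y a \<otimes>\<^bsub>FY\<^esub> restrict_fun Y b) r x"
  proof (cases "x \<in> Y")
    case True
    have "restrict_fun Y a s x * dual_action G (subtopology X Y) (restrict_action \<phi> Y) s (restrict_fun Y b t) x
        * restrict_twist u Y s t x = a s x * \<alpha> s (b t) x * u s t x" if "s \<in> carrier G" for s t
    proof -
      have "\<phi> (inv s) x \<in> Y"
        using invariant_iff[OF Y_invariant _ GG.inv_closed[OF that], of x] True by blast
      then show ?thesis using True
        by (simp add: dual_action_def restrict_action_def restrict_twist_def restrict_fun_def)
    qed
    then have "(restrict_fun Y a \<otimes>\<^bsub>FY\<^esub> restrict_fun Y b) r x = (a \<otimes>\<^bsub>F\<^esub> b) r x"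
      unfolding F_sub_def F_alg_def by (auto intro!: infsum_cong)
    then show ?thesis using True by (simp add: restrict_fun_def)
  next
    case False
    then have "(restrict_fun Y a \<otimes>\<^bsub>FY\<^esub> restrict_fun Y b) r x = 0"
      unfolding F_sub_def F_alg_def by (auto intro!: infsum_0 simp: restrict_fun_def)
    moreover have "restrict_fun Y (a \<otimes>\<^bsub>F\<^esub> b) r x = 0"
      by (simp only: restrict_fun_def if_not_P[OF False])
    ultimately show ?thesis by (simp only:)
  qed
qed

text \<open>Tietze extension in each coefficient; the uniform factor 2 keeps the norms
  summable.\<close>

lemma restrict_lift:
  assumes c: "c \<in> carrier FY"
  obtains b where "b \<in> carrier F" "restrict_fun Y b = c"
proof -
  have c': "c t \<in> carrier (C0 (subtopology X Y))" for t using F_D(1) c by (simp add: F_sub_def)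
  have "\<exists>a. a \<in> carrier (C0 X) \<and> (\<forall>x\<in>Y. a x = c t x) \<and> nrm (C0 X) a \<le> 2 * nrm (C0 (subtopology X Y)) (c t)" for t
    by (rule C0_Tietze[OF locally_compact Hausdorff Y_closed c'[of t]]) blast
  then obtain a where a: "\<And>t. a t \<in> carrier (C0 X)" "\<And>t x. x \<in> Y \<Longrightarrow> a t x = c t x"
      "\<And>t. nrm (C0 X) (a t) \<le> 2 * nrm (C0 (subtopology X Y)) (c t)" by metis
  define b where "b t = (if t \<in> carrier G then a t else (\<lambda>x. 0))" for t
  have s: "(\<lambda>t. 2 * nrm (C0 (subtopology X Y)) (c t)) summable_on carrier G"
    using F_D(4) c by (intro summable_on_cmult_right) (simp add: F_sub_def)
  have "b \<in> carrier F" by (rule F_I[OF _ _ s]) (auto simp: b_def a)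
  moreover have "restrict_fun Y b = c"
  proof (intro ext)
    fix t x
    show "restrict_fun Y b t x = c t x"
      using a(2)[of x t] F_D(2,3) c C0_D(3)[OF c'[of t], of x]
      by (cases "x \<in> Y") (auto simp: restrict_fun_def b_def F_sub_def mem_F_iff)
  qed
  ultimately show thesis using that by blast
qed

lemma restrict_eq_iff:
  assumes a: "a \<in> carrier F" and b: "b \<in> carrier F"
  shows "restrict_fun Y a = restrict_fun Y b \<longleftrightarrow> (\<lambda>t x. a t x - b t x) \<in> carrier FU"
proof -
  have "(\<lambda>t x. a t x - b t x) \<in> carrier FU \<longleftrightarrow> (\<forall>t x. x \<notin> U \<longrightarrow> a t x = b t x)"
    using a b by (simp add: mem_FU_iff F_diff)
  also have "\<dots> \<longleftrightarrow> (\<forall>t x. x \<in> Y \<longrightarrow> a t x = b t x)"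
    using F_D(3)[OF a] F_D(3)[OF b] by auto metis
  also have "\<dots> \<longleftrightarrow> restrict_fun Y a = restrict_fun Y b"
    by (auto simp: restrict_fun_def fun_eq_iff)
  finally show ?thesis ..
qed

lemma \<rho>_restrict:
  assumes "t \<in> carrier G" "x \<in> V" "V = U \<or> V = Y"
  shows "(if p = (1::ereal) then restrict_action \<phi> V else (\<lambda>t x. x)) t x = (if p = 1 then \<phi> else (\<lambda>t x. x)) t x"
    and "(if p = (1::ereal) then \<phi> else (\<lambda>t x. x)) t x \<in> V"
  using assms invariant_iff[OF U_invariant U_subset assms(1), of x] U_subset \<phi>_mem[OF assms(1), of x]
  by (auto simp: restrict_action_def)

lemma column_norm_Y:
  assumes b: "b \<in> carrier F"
  shows "column_norm G (subtopology X Y) (if p = (1::ereal) then restrict_action \<phi> Y else (\<lambda>t x. x)) (restrict_fun Y b)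
    = Sup (insert 0 ((\<lambda>x. \<Sum>\<^sub>\<infinity>t\<in>carrier G. cmod (b t ((if p = 1 then \<phi> else (\<lambda>t x. x)) t x))) ` Y))"
proof -
  have "(\<Sum>\<^sub>\<infinity>t\<in>carrier G. cmod (restrict_fun Y b t ((if p = 1 then restrict_action \<phi> Y else (\<lambda>t x. x)) t x)))
      = (\<Sum>\<^sub>\<infinity>t\<in>carrier G. cmod (b t ((if p = 1 then \<phi> else (\<lambda>t x. x)) t x)))" if "x \<in> Y" for x
    using \<rho>_restrict[OF _ that, of _ p] by (intro infsum_cong) (simp add: restrict_fun_def)
  then show ?thesis unfolding column_norm_def top_Y by (simp cong: image_cong_simp)
qed

text \<open>Orbits of points off U stay off U, where b vanishes, so these points contribute only
  zero columns.\<close>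

lemma column_norm_U:
  assumes b: "b \<in> carrier FU"
  shows "column_norm G (subtopology X U) (if p = (1::ereal) then restrict_action \<phi> U else (\<lambda>t x. x)) b
    = column_norm G X (if p = 1 then \<phi> else (\<lambda>t x. x)) b"
proof -
  let ?\<rho> = "if p = 1 then \<phi> else (\<lambda>t x. x)"
  interpret H: homeomorphism_family G X ?\<rho> by (rule homeomorphism_family_p)
  interpret HU: homeomorphism_family G "subtopology X U" "if p = 1 then restrict_action \<phi> U else (\<lambda>t x. x)"
    by (rule Uact.homeomorphism_family_p)
  have bF: "b \<in> carrier F" and b0: "\<And>t x. x \<notin> U \<Longrightarrow> b t x = 0" using b by (auto simp: mem_FU_iff)
  have bU: "b \<in> carrier (F_alg G (subtopology X U) (restrict_action \<phi> U) (restrict_twist u U))"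
    using b by (simp add: F_sub_def)
  have eq: "(\<Sum>\<^sub>\<infinity>t\<in>carrier G. cmod (b t ((if p = 1 then restrict_action \<phi> U else (\<lambda>t x. x)) t x)))
      = (\<Sum>\<^sub>\<infinity>t\<in>carrier G. cmod (b t (?\<rho> t x)))" if "x \<in> U" for x
    using \<rho>_restrict(1)[OF _ that, of _ p] by (intro infsum_cong) simp
  show ?thesis
  proof (rule antisym)
    show "column_norm G (subtopology X U) (if p = 1 then restrict_action \<phi> U else (\<lambda>t x. x)) b
        \<le> column_norm G X ?\<rho> b"
    proof (rule HU.column_norm_leI)
      fix x assume "x \<in> topspace (subtopology X U)"
      then show "(\<Sum>\<^sub>\<infinity>t\<in>carrier G. cmod (b t ((if p = 1 then restrict_action \<phi> U else (\<lambda>t x. x)) t x)))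
          \<le> column_norm G X ?\<rho> b" using eq[of x] H.column_sum_le[OF bF, of x] by simp
    qed (rule H.column_norm_nonneg[OF bF])
    show "column_norm G X ?\<rho> b
        \<le> column_norm G (subtopology X U) (if p = 1 then restrict_action \<phi> U else (\<lambda>t x. x)) b"
    proof (rule H.column_norm_leI)
      fix x assume x: "x \<in> topspace X"
      show "(\<Sum>\<^sub>\<infinity>t\<in>carrier G. cmod (b t (?\<rho> t x)))
        \<le> column_norm G (subtopology X U) (if p = 1 then restrict_action \<phi> U else (\<lambda>t x. x)) b"
      proof (cases "x \<in> U")
        case True
        show ?thesis
          unfolding eq[OF True, symmetric]
          by (rule HU.column_sum_le[OF bU]) (use True U_subset in auto)
      next
        case False
        then have "b t (?\<rho> t x) = 0" if "t \<in> carrier G" for t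
          using \<rho>_restrict(2)[OF that, of x Y p] x b0 by auto
        then have "(\<Sum>\<^sub>\<infinity>t\<in>carrier G. cmod (b t (?\<rho> t x))) = 0" by (intro infsum_0) simp
        then show ?thesis using HU.column_norm_nonneg[OF bU] by simp
      qed
    qed (rule HU.column_norm_nonneg[OF bU])
  qed
qed

lemma concrete_norm_U:
  assumes b: "b \<in> carrier FU"
  shows "concrete_norm G (subtopology X U) (restrict_action \<phi> U) P b = concrete_norm G X \<phi> P b"
  unfolding concrete_norm_def column_norm_U[OF b] by (simp add: norm_C0)

lemma column_norm_Y_le:
  assumes b: "b \<in> carrier F"
  shows "column_norm G (subtopology X Y) (if p = (1::ereal) then restrict_action \<phi> Y else (\<lambda>t x. x)) (restrict_fun Y b)
    \<le> column_norm G X (if p = 1 then \<phi> else (\<lambda>t x. x)) b"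
proof -
  interpret H: homeomorphism_family G X "if p = 1 then \<phi> else (\<lambda>t x. x)" by (rule homeomorphism_family_p)
  show ?thesis unfolding column_norm_Y[OF b]
  proof (rule cSup_least, blast, elim insertE imageE)
    fix y x
    assume y: "y = (\<Sum>\<^sub>\<infinity>t\<in>carrier G. cmod (b t ((if p = 1 then \<phi> else (\<lambda>t x. x)) t x)))"
      and x: "x \<in> Y"
    show "y \<le> column_norm G X (if p = 1 then \<phi> else (\<lambda>t x. x)) b"
      unfolding y by (rule H.column_sum_le[OF b]) (use x in blast)
  qed (simp only: H.column_norm_nonneg[OF b])
qed

lemma concrete_norm_Y_le:
  assumes P: "P \<subseteq> {1, \<infinity>}" and b: "b \<in> carrier F"
  shows "concrete_norm G (subtopology X Y) (restrict_action \<phi> Y) P (restrict_fun Y b) \<le> concrete_norm G X \<phi> P b"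
proof (cases "P = {}")
  case True
  have "nrm (C0 (subtopology X Y)) (restrict_fun Y b t) \<le> nrm (C0 X) (b t)" for t
    using F_D(1)[OF b] F_D(1)[OF restrict_mem[OF b, unfolded F_sub_def]]
    by (intro C0_norm_le) (auto simp: restrict_fun_def C0_norm_nonneg C0_le_norm)
  then show ?thesis
    using True F_D(4)[OF b] F_D(4)[OF restrict_mem[OF b, unfolded F_sub_def]]
    by (simp add: concrete_norm_def infsum_mono)
next
  case False
  have "column_norm G (subtopology X Y) (if p = 1 then restrict_action \<phi> Y else (\<lambda>t x. x)) (restrict_fun Y b)
      \<le> Max ((\<lambda>p. column_norm G X (if p = 1 then \<phi> else (\<lambda>t x. x)) b) ` P)" if "p \<in> P" for p
    using that finite_P[OF P] by (intro order_trans[OF column_norm_Y_le[OF b]] Max_ge) auto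
  then show ?thesis using False finite_P[OF P] by (simp add: concrete_norm_def)
qed

text \<open>Here the norm is a sum of suprema, so each coefficient can be cut off at its own height
  ||b(t)|_Y||. What remains of it is bounded by that height, so no \<epsilon> is lost.\<close>

lemma cutoff_l1:
  assumes b: "b \<in> carrier F"
  obtains c where "c \<in> carrier FU"
    "(\<Sum>\<^sub>\<infinity>t\<in>carrier G. nrm (C0 X) (\<lambda>x. b t x - c t x)) \<le>
     (\<Sum>\<^sub>\<infinity>t\<in>carrier G. nrm (C0 (subtopology X Y)) (restrict_fun Y b t))"
proof -
  define M where "M t = nrm (C0 (subtopology X Y)) (restrict_fun Y b t)" for t
  have bY: "restrict_fun Y b \<in> carrier (F_alg G (subtopology X Y) (restrict_action \<phi> Y) (restrict_twist u Y))"
    using restrict_mem[OF b] by (simp add: F_sub_def)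
  have M0: "0 \<le> M t" for t by (simp add: M_def C0_norm_nonneg F_D(1)[OF bY])
  \<comment> \<open>The radial retraction of the values of b(t) onto the disc of radius
    \<open>M t\<close>. If \<open>M t = 0\<close> the quotient is 0, also where it reads 0/0, and
    \<open>d t = 0\<close>.\<close>
  define d where "d t x = b t x * complex_of_real (M t / max (M t) (cmod (b t x)))" for t x
  define c where "c t x = b t x - d t x" for t x
  have dM: "cmod (d t x) \<le> M t" for t x
  proof -
    have "cmod (d t x) = cmod (b t x) * M t / max (M t) (cmod (b t x))"
      using M0[of t] by (simp add: d_def norm_mult norm_divide)
    also have "\<dots> \<le> M t"
      using M0[of t] by (cases "max (M t) (cmod (b t x)) = 0") (auto simp: divide_simps mult_right_mono max_def mult_left_mono mult.commute)
    finally show ?thesis .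
  qed
  have db: "cmod (d t x) \<le> cmod (b t x)" for t x
  proof -
    have "M t / max (M t) (cmod (b t x)) \<le> 1" "0 \<le> M t / max (M t) (cmod (b t x))"
      using M0[of t] by (auto simp: divide_le_eq_1)
    then have "cmod (b t x) * \<bar>M t / max (M t) (cmod (b t x))\<bar> \<le> cmod (b t x) * 1"
      by (intro mult_left_mono) auto
    then show ?thesis by (simp add: d_def norm_mult norm_divide)
  qed
  have dmem: "d t \<in> carrier (C0 X)" for t
  proof (rule C0_dominated[OF _ _ F_D(1)[OF b] db])
    show "continuous_map X euclidean (d t)"
    proof (cases "M t = 0")
      case True
      then show ?thesis by (simp add: d_def[abs_def])
    next
      case False
      then have "M t > 0" using M0[of t] by simp
      then show ?thesis unfolding d_def[abs_def]
        by (intro continuous_map_mult_complex continuous_map_of_real continuous_map_real_divide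
            continuous_map_real_max continuous_map_norm C0_D(1)[OF F_D(1)[OF b]]) auto
    qed
    show "d t x = 0" if "x \<notin> topspace X" for x using F_D(3)[OF b that] by (simp add: d_def)
  qed
  have dF: "d \<in> carrier F"
  proof (rule F_I[OF dmem _ F_D(4)[OF b]])
    show "d t = (\<lambda>x. 0)" if "t \<notin> carrier G" for t using F_D(2)[OF b that] by (simp add: d_def fun_eq_iff)
    show "nrm (C0 X) (d t) \<le> nrm (C0 X) (b t)" for t
      using F_D(1)[OF b] by (intro C0_norm_le[OF dmem]) (auto simp: C0_norm_nonneg intro: order_trans[OF db C0_le_norm[OF F_D(1)[OF b]]])
  qed
  have "c t x = 0" if "x \<notin> U" for t x
  proof (cases "x \<in> topspace X")
    case True
    have "cmod (restrict_fun Y b t x) \<le> M t" unfolding M_def by (rule C0_le_norm[OF F_D(1)[OF bY]])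
    then have "cmod (b t x) \<le> M t" using True that by (simp add: restrict_fun_def)
    then show ?thesis by (cases "M t = 0") (auto simp: c_def d_def max_def)
  qed (use F_D(3)[OF b] in \<open>simp add: c_def d_def\<close>)
  then have "c \<in> carrier FU" using F_diff[OF b dF] by (simp add: mem_FU_iff c_def[abs_def])
  moreover have "(\<Sum>\<^sub>\<infinity>t\<in>carrier G. nrm (C0 X) (d t)) \<le> infsum M (carrier G)"
    using F_D(4)[OF dF] F_D(4)[OF bY] dM M0 dmem
    by (intro infsum_mono C0_norm_le) (auto simp: M_def[abs_def])
  moreover have "(\<lambda>x. b t x - c t x) = d t" for t by (simp add: c_def)
  ultimately show thesis using that[of c] by (simp add: M_def[abs_def])
qed

text \<open>One c must serve p = 1 and p = \<infinity> simultaneously, since the norm of b - c may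
  be a maximum over both. The \<epsilon> keeps the truncation heights positive when b vanishes on
  Y.\<close>

lemma cutoff_columns:
  assumes b: "b \<in> carrier F" and \<epsilon>: "\<epsilon> > 0"
  obtains c where "c \<in> carrier FU"
    "\<And>p. column_norm G X (if p = (1::ereal) then \<phi> else (\<lambda>t x. x)) (\<lambda>t x. b t x - c t x) \<le>
      column_norm G (subtopology X Y) (if p = 1 then restrict_action \<phi> Y else (\<lambda>t x. x)) (restrict_fun Y b) + \<epsilon>"
proof -
  define M where "M p = column_norm G (subtopology X Y) (if p = (1::ereal) then restrict_action \<phi> Y else (\<lambda>t x. x)) (restrict_fun Y b)" for p
  have bY: "restrict_fun Y b \<in> carrier (F_alg G (subtopology X Y) (restrict_action \<phi> Y) (restrict_twist u Y))"
    using restrict_mem[OF b] by (simp add: F_sub_def)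
  have M0: "0 \<le> M p" for p
    unfolding M_def by (rule homeomorphism_family.column_norm_nonneg[OF Yact.homeomorphism_family_p bY])
  have le: "(\<Sum>\<^sub>\<infinity>t\<in>carrier G. cmod (b t ((if p = (1::ereal) then \<phi> else (\<lambda>t x. x)) t x))) \<le> M p + \<epsilon>"
    if x: "x \<in> topspace X - U" for x p
  proof -
    have "(\<Sum>\<^sub>\<infinity>t\<in>carrier G. cmod (restrict_fun Y b t ((if p = 1 then restrict_action \<phi> Y else (\<lambda>t x. x)) t x))) \<le> M p"
      unfolding M_def
      using homeomorphism_family.column_sum_le[OF Yact.homeomorphism_family_p bY, of x p] x by simp
    moreover have "(\<Sum>\<^sub>\<infinity>t\<in>carrier G. cmod (restrict_fun Y b t ((if p = 1 then restrict_action \<phi> Y else (\<lambda>t x. x)) t x)))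
      = (\<Sum>\<^sub>\<infinity>t\<in>carrier G. cmod (b t ((if p = 1 then \<phi> else (\<lambda>t x. x)) t x)))"
      using \<rho>_restrict[OF _ x, of _ p] by (intro infsum_cong) (simp add: restrict_fun_def)
    ultimately show ?thesis using \<epsilon> by simp
  qed
  have h_ex: "\<exists>h. continuous_map X euclideanreal h \<and> (\<forall>x. 0 \<le> h x \<and> h x \<le> 1) \<and>
      (\<forall>x\<in>topspace X - U. h x = 0) \<and> (\<forall>x\<in>topspace X.
        (1 - h x) * (\<Sum>\<^sub>\<infinity>t\<in>carrier G. cmod (b t ((if p = 1 then \<phi> else (\<lambda>t x. x)) t x))) \<le> M p + \<epsilon>)" for p :: ereal
    by (rule homeomorphism_family.column_cutoff[OF homeomorphism_family_p b, of "M p + \<epsilon>" U p])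
      (use le M0[of p] \<epsilon> in \<open>auto\<close>)
  obtain h1 where h1: "continuous_map X euclideanreal h1" "\<And>x. 0 \<le> h1 x \<and> h1 x \<le> 1"
    "\<And>x. x \<in> topspace X - U \<Longrightarrow> h1 x = 0"
    "\<And>x. x \<in> topspace X \<Longrightarrow> (1 - h1 x) * (\<Sum>\<^sub>\<infinity>t\<in>carrier G. cmod (b t (\<phi> t x))) \<le> M 1 + \<epsilon>"
    using h_ex[of 1] by auto
  obtain h2 where h2: "continuous_map X euclideanreal h2" "\<And>x. 0 \<le> h2 x \<and> h2 x \<le> 1"
    "\<And>x. x \<in> topspace X - U \<Longrightarrow> h2 x = 0"
    "\<And>x. x \<in> topspace X \<Longrightarrow> (1 - h2 x) * (\<Sum>\<^sub>\<infinity>t\<in>carrier G. cmod (b t x)) \<le> M \<infinity> + \<epsilon>"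
    using h_ex[of \<infinity>] by auto
  \<comment> \<open>In the column through x for p = 1 the coefficient b(t) is evaluated at
    \<phi>_t(x), so h1 has to be transported by \<phi>_t^{-1} to appear there as h1(x); for p =
    \<infinity> it is evaluated at x itself. The larger weight reduces b at least as much as each of
    the two requires.\<close>
  define w where "w t x = max (h1 (\<phi> (inv t) x)) (h2 x)" for t x
  have w: "0 \<le> w t x \<and> w t x \<le> 1" for t x using h1(2) h2(2) by (auto simp: w_def le_max_iff_disj)
  define c where "c t x = complex_of_real (w t x) * b t x" for t x
  have cmem: "c t \<in> carrier (C0 X)" if t: "t \<in> carrier G" for t
    unfolding c_def
  proof (rule C0_mult_bounded[OF F_D(1)[OF b], where B = 1])
    have "continuous_map X euclideanreal (h1 \<circ> \<phi> (inv t))"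
      using homeomorphism[of "inv t"] t h1(1) homeomorphic_imp_continuous_map continuous_map_compose
      by (metis GG.inv_closed)
    then show "continuous_map X euclidean (\<lambda>x. complex_of_real (w t x))"
      unfolding w_def using h2(1) by (intro continuous_map_of_real continuous_map_real_max) (auto simp: o_def)
    show "cmod (complex_of_real (w t x)) \<le> 1" for x using w[of t x] by simp
  qed
  have cb: "cmod (c t x) \<le> cmod (b t x)" for t x
    using w[of t x] mult_right_mono[of "w t x" 1 "cmod (b t x)"] by (simp add: c_def norm_mult)
  have cF: "c \<in> carrier F"
  proof (rule F_I[OF cmem _ F_D(4)[OF b]])
    show "c t = (\<lambda>x. 0)" if "t \<notin> carrier G" for t using F_D(2)[OF b that] by (simp add: c_def fun_eq_iff)
    show "nrm (C0 X) (c t) \<le> nrm (C0 X) (b t)" if "t \<in> carrier G" for t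
      using F_D(1)[OF b] by (intro C0_norm_le[OF cmem[OF that]]) (auto simp: C0_norm_nonneg intro: order_trans[OF cb C0_le_norm[OF F_D(1)[OF b]]])
  qed
  have c0: "c t x = 0" if "x \<notin> U" for t x
  proof (cases "t \<in> carrier G \<and> x \<in> topspace X")
    case True
    then have "\<phi> (inv t) x \<in> topspace X - U"
      using that invariant_iff[OF U_invariant U_subset, of "inv t" x] \<phi>_mem[of "inv t" x] by auto
    then show ?thesis using True that h1(3) h2(3) by (simp add: c_def w_def)
  next
    case False
    then show ?thesis using F_D(2,3)[OF b] by (auto simp: c_def)
  qed
  have dn: "cmod (b t x - c t x) = (1 - w t x) * cmod (b t x)" for t x
  proof -
    have "b t x - c t x = complex_of_real (1 - w t x) * b t x" by (simp add: c_def algebra_simps)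
    moreover have "cmod (complex_of_real (1 - w t x)) = 1 - w t x"
      unfolding norm_of_real using w[of t x] by simp
    ultimately show ?thesis by (simp only: norm_mult)
  qed
  have dF: "(\<lambda>t x. b t x - c t x) \<in> carrier F" by (rule F_diff[OF b cF])
  \<comment> \<open>Common to both norms: if w is at least h(x) along the column through x, then
    passing from b to b - c shrinks that column at least by the factor 1 - h(x).\<close>
  have bound: "column_norm G X \<rho> (\<lambda>t x. b t x - c t x) \<le> B"
    if \<rho>: "homeomorphism_family G X \<rho>" and B: "0 \<le> B"
      and g: "\<And>x. x \<in> topspace X \<Longrightarrow> (1 - h x) * (\<Sum>\<^sub>\<infinity>t\<in>carrier G. cmod (b t (\<rho> t x))) \<le> B"
      and hw: "\<And>t x. t \<in> carrier G \<Longrightarrow> x \<in> topspace X \<Longrightarrow> h x \<le> w t (\<rho> t x)" for \<rho> h B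
  proof -
    interpret H: homeomorphism_family G X \<rho> by fact
    show ?thesis
    proof (rule H.column_norm_leI[OF B])
      fix x assume x: "x \<in> topspace X"
      have "(\<Sum>\<^sub>\<infinity>t\<in>carrier G. cmod (b t (\<rho> t x) - c t (\<rho> t x))) \<le> (\<Sum>\<^sub>\<infinity>t\<in>carrier G. (1 - h x) * cmod (b t (\<rho> t x)))"
        using H.column_summable[OF dF] H.column_summable[OF b]
      proof (intro infsum_mono summable_on_cmult_right)
        fix t assume "t \<in> carrier G"
        then show "cmod (b t (\<rho> t x) - c t (\<rho> t x)) \<le> (1 - h x) * cmod (b t (\<rho> t x))"
          unfolding dn using hw x by (intro mult_right_mono) auto
      qed
      also have "\<dots> = (1 - h x) * (\<Sum>\<^sub>\<infinity>t\<in>carrier G. cmod (b t (\<rho> t x)))"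
        by (rule infsum_cmult_right[OF H.column_summable[OF b]])
      finally show "(\<Sum>\<^sub>\<infinity>t\<in>carrier G. cmod (b t (\<rho> t x) - c t (\<rho> t x))) \<le> B" using g[OF x] by simp
    qed
  qed
  show thesis
  proof (rule that[of c])
    show "c \<in> carrier FU" using cF c0 by (simp add: mem_FU_iff)
    have 1: "column_norm G X \<phi> (\<lambda>t x. b t x - c t x) \<le> M 1 + \<epsilon>"
      using homeomorphism_family_p[of 1] M0[of 1] \<epsilon> h1(4) by (intro bound[of _ _ h1]) (auto simp: w_def)
    have 2: "column_norm G X (\<lambda>t x. x) (\<lambda>t x. b t x - c t x) \<le> M \<infinity> + \<epsilon>"
      using homeomorphism_family_p[of \<infinity>] M0[of \<infinity>] \<epsilon> h2(4) by (intro bound[of _ _ h2]) (auto simp: w_def)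
    have Mp: "M p = M \<infinity>" if "p \<noteq> 1" for p using that by (simp add: M_def)
    show "column_norm G X (if p = (1::ereal) then \<phi> else (\<lambda>t x. x)) (\<lambda>t x. b t x - c t x) \<le>
      column_norm G (subtopology X Y) (if p = 1 then restrict_action \<phi> Y else (\<lambda>t x. x)) (restrict_fun Y b) + \<epsilon>" for p
    proof (cases "p = 1")
      case True
      show ?thesis unfolding M_def[symmetric] using 1 by (simp only: True refl if_True)
    next
      case False
      show ?thesis unfolding M_def[symmetric] Mp[OF False] using 2 by (simp only: False if_False)
    qed
  qed
qed

lemma cutoff:
  assumes P: "P \<subseteq> {1, \<infinity>}" and b: "b \<in> carrier F" and \<epsilon>: "\<epsilon> > 0"
  obtains c where "c \<in> carrier FU" "concrete_norm G X \<phi> P (\<lambda>t x. b t x - c t x) \<le>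
    concrete_norm G (subtopology X Y) (restrict_action \<phi> Y) P (restrict_fun Y b) + \<epsilon>"
proof (cases "P = {}")
  case True
  obtain c where "c \<in> carrier FU" "(\<Sum>\<^sub>\<infinity>t\<in>carrier G. nrm (C0 X) (\<lambda>x. b t x - c t x)) \<le>
     (\<Sum>\<^sub>\<infinity>t\<in>carrier G. nrm (C0 (subtopology X Y)) (restrict_fun Y b t))"
    by (rule cutoff_l1[OF b])
  then show thesis using that[of c] True \<epsilon> by (simp add: concrete_norm_def)
next
  case False
  obtain c where c: "c \<in> carrier FU"
    and cp: "\<And>p. column_norm G X (if p = (1::ereal) then \<phi> else (\<lambda>t x. x)) (\<lambda>t x. b t x - c t x) \<le>
      column_norm G (subtopology X Y) (if p = 1 then restrict_action \<phi> Y else (\<lambda>t x. x)) (restrict_fun Y b) + \<epsilon>"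
    by (rule cutoff_columns[OF b \<epsilon>]) blast
  have "column_norm G X (if p = (1::ereal) then \<phi> else (\<lambda>t x. x)) (\<lambda>t x. b t x - c t x)
      \<le> Max ((\<lambda>p. column_norm G (subtopology X Y) (if p = 1 then restrict_action \<phi> Y else (\<lambda>t x. x)) (restrict_fun Y b)) ` P) + \<epsilon>"
    if "p \<in> P" for p
    using that finite_P[OF P] by (intro order_trans[OF cp] add_right_mono Max_ge) auto
  then show thesis using that[OF c] False finite_P[OF P] by (simp add: concrete_norm_def)
qed

end


section \<open>Crossed products and their quotients\<close>

lemma norm_bounded_operators: "nrm (bounded_operators E) T
    = Inf {C. 0 \<le> C \<and> (\<forall>\<xi>\<in>carrier E. nrm E (T \<xi>) \<le> C * nrm E \<xi>)}"
  by (simp add: bounded_operators_def)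

lemma operator_norm_le:
  assumes "0 \<le> C" "\<And>\<xi>. \<xi> \<in> carrier E \<Longrightarrow> nrm E (T \<xi>) \<le> C * nrm E \<xi>"
  shows "nrm (bounded_operators E) T \<le> C"
  unfolding norm_bounded_operators using assms by (intro cInf_lower bdd_belowI[of _ 0]) auto

context seminormed_space begin

lemma operator_bounded_nonneg:
  assumes "T \<in> carrier (bounded_operators E)"
  obtains C where "0 \<le> C" "\<And>\<xi>. \<xi> \<in> carrier E \<Longrightarrow> nrm E (T \<xi>) \<le> C * nrm E \<xi>"
proof -
  obtain C where C: "\<And>\<xi>. \<xi> \<in> carrier E \<Longrightarrow> nrm E (T \<xi>) \<le> C * nrm E \<xi>"
    using assms by (auto simp: bounded_operators_def)
  have "nrm E (T \<xi>) \<le> max 0 C * nrm E \<xi>" if "\<xi> \<in> carrier E" for \<xi>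
    by (rule order_trans[OF C[OF that]]) (intro mult_right_mono norm_nonneg that, simp)
  then show thesis using that[of "max 0 C"] by simp
qed

lemma operator_norm_nonneg:
  assumes "T \<in> carrier (bounded_operators E)"
  shows "0 \<le> nrm (bounded_operators E) T"
proof -
  obtain C where "0 \<le> C" "\<And>\<xi>. \<xi> \<in> carrier E \<Longrightarrow> nrm E (T \<xi>) \<le> C * nrm E \<xi>"
    by (rule operator_bounded_nonneg[OF assms]) blast
  then show ?thesis unfolding norm_bounded_operators by (intro cInf_greatest) auto
qed

text \<open>The infimum is attained. Vectors of seminorm 0 are covered by any bound C, the others by
  dividing.\<close>

lemma operator_norm_bound:
  assumes T: "T \<in> carrier (bounded_operators E)" and \<xi>: "\<xi> \<in> carrier E"
  shows "nrm E (T \<xi>) \<le> nrm (bounded_operators E) T * nrm E \<xi>"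
proof -
  obtain C where C: "0 \<le> C" "\<And>\<xi>. \<xi> \<in> carrier E \<Longrightarrow> nrm E (T \<xi>) \<le> C * nrm E \<xi>"
    by (rule operator_bounded_nonneg[OF T]) blast
  show ?thesis
  proof (cases "nrm E \<xi> = 0")
    case True
    then show ?thesis using C(2)[OF \<xi>] by simp
  next
    case False
    then have p: "nrm E \<xi> > 0" using norm_nonneg[OF \<xi>] by simp
    have "nrm E (T \<xi>) / nrm E \<xi> \<le> nrm (bounded_operators E) T"
      unfolding norm_bounded_operators
      using C p \<xi> by (intro cInf_greatest) (auto simp: divide_le_eq)
    then show ?thesis using p by (simp add: divide_le_eq)
  qed
qed

end

text \<open>With e = g/(g + \<eta>) one has z - z e = z \<eta>/(g + \<eta>), which is at most \<eta>
  in modulus as soon as |z| \<le> g. A single majorant g thus controls many coefficients at once; z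
  is left free so that it may be a value of any of them.\<close>

lemma C0_approximate_unit:
  assumes g: "(\<lambda>x. complex_of_real (g x)) \<in> carrier (C0 X)" and g0: "\<And>x. 0 \<le> g x" and \<eta>: "\<eta> > 0"
  defines "e \<equiv> \<lambda>x. complex_of_real (g x / (g x + \<eta>))"
  shows "e \<in> carrier (C0 X)" "nrm (C0 X) e \<le> 1" "0 \<le> g x / (g x + \<eta>)" "g x / (g x + \<eta>) \<le> 1"
    "cmod z \<le> g x \<Longrightarrow> cmod (z - z * e x) \<le> \<eta>" "cmod (z - z * e x) \<le> cmod z"
proof -
  have p: "g x + \<eta> > 0" "g x + \<eta> \<noteq> 0" for x using g0[of x] \<eta> by auto
  have cont: "continuous_map X euclideanreal g"
  proof -
    have "continuous_map X euclideanreal (\<lambda>x. cmod (complex_of_real (g x)))"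
      by (intro continuous_map_norm C0_D(1)[OF g])
    then show ?thesis using g0 by simp
  qed
  have cont': "continuous_map X euclidean (\<lambda>x. complex_of_real (inverse (g x + \<eta>)))"
  proof -
    have "continuous_map X euclideanreal (\<lambda>x. 1 / (g x + \<eta>))"
      using p by (intro continuous_map_real_divide continuous_map_add cont) auto
    then show ?thesis unfolding inverse_eq_divide by (rule continuous_map_of_real)
  qed
  have "(\<lambda>x. complex_of_real (inverse (g x + \<eta>)) * complex_of_real (g x)) \<in> carrier (C0 X)"
  proof (rule C0_mult_bounded[OF g cont', where B = "inverse \<eta>"])
    show "cmod (complex_of_real (inverse (g x + \<eta>))) \<le> inverse \<eta>" for x
      unfolding norm_of_real using g0[of x] \<eta> p(1)[of x] by (simp add: le_imp_inverse_le)
  qed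
  then show e: "e \<in> carrier (C0 X)" unfolding e_def by (simp add: divide_inverse mult.commute)
  have r: "0 \<le> g x / (g x + \<eta>)" "g x / (g x + \<eta>) \<le> 1" for x using g0[of x] \<eta> by auto
  then show "0 \<le> g x / (g x + \<eta>)" "g x / (g x + \<eta>) \<le> 1" by auto
  show "nrm (C0 X) e \<le> 1"
    by (rule C0_norm_le[OF e]) (use r in \<open>auto simp only: e_def norm_of_real abs_of_nonneg zero_le_one\<close>)
  have eq: "cmod (z - z * e x) = cmod z * (\<eta> / (g x + \<eta>))"
  proof -
    have "z - z * e x = z * complex_of_real (1 - g x / (g x + \<eta>))" by (simp add: e_def algebra_simps)
    also have "1 - g x / (g x + \<eta>) = \<eta> / (g x + \<eta>)" using p[of x] by (simp add: field_simps)
    finally show ?thesis using \<eta> g0[of x] by (simp only: norm_mult norm_of_real) simp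
  qed
  have "\<eta> / (g x + \<eta>) \<le> 1" using g0[of x] \<eta> by auto
  then show "cmod (z - z * e x) \<le> cmod z"
    unfolding eq using mult_left_mono[of "\<eta> / (g x + \<eta>)" 1 "cmod z"] by simp
  assume z: "cmod z \<le> g x"
  have "cmod z * (\<eta> / (g x + \<eta>)) \<le> (g x + \<eta>) * (\<eta> / (g x + \<eta>))"
    using z \<eta> g0[of x] by (intro mult_right_mono) auto
  then show "cmod (z - z * e x) \<le> \<eta>" unfolding eq using p[of x] by simp
qed

context twisted_action begin

text \<open>Right multiplication evaluates e at y = \<phi>_t^{-1}(x), so the majorant at y has to
  bound b(t)(\<phi>_t(y)): it is the column sum for \<phi>.\<close>

lemma approximate_unit_right:
  assumes b: "b \<in> carrier F" and \<delta>: "\<delta> > 0"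
  obtains e where "e \<in> carrier (C0 X)" "nrm (C0 X) e \<le> 1"
    "nrm F (\<lambda>t x. b t x - (b \<otimes>\<^bsub>F\<^esub> monomial \<one> e) t x) < \<delta>"
proof -
  interpret H: homeomorphism_family G X \<phi> using homeomorphism by unfold_locales
  define g where "g x = (if x \<in> topspace X then \<Sum>\<^sub>\<infinity>t\<in>carrier G. cmod (b t (\<phi> t x)) else 0)" for x
  have g: "(\<lambda>x. complex_of_real (g x)) \<in> carrier (C0 X)"
    using H.column_function_C0[OF b] by (simp add: g_def if_distrib cong: if_cong)
  have g0: "0 \<le> g x" for x by (simp add: g_def infsum_nonneg)
  obtain \<eta> where \<eta>: "\<eta> > 0" "\<And>c. c \<in> carrier F \<Longrightarrow>
      (\<And>t x. cmod (c t x) \<le> cmod (b t x) \<and> cmod (c t x) \<le> \<eta>) \<Longrightarrow> nrm F c < \<delta>"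
    using F_norm_small[OF b \<delta>] by metis
  define e where "e = (\<lambda>x. complex_of_real (g x / (g x + \<eta>)))"
  note e = C0_approximate_unit[OF g g0 \<eta>(1), folded e_def]
  have m: "monomial \<one> e \<in> carrier F" by (rule monomial_mem(1)) (simp_all add: e(1))
  have "cmod (b t x - b t x * \<alpha> t e x) \<le> cmod (b t x) \<and> cmod (b t x - b t x * \<alpha> t e x) \<le> \<eta>" for t x
  proof (cases "t \<in> carrier G \<and> x \<in> topspace X")
    case True
    define y where "y = \<phi> (inv t) x"
    have y: "y \<in> topspace X" "\<phi> t y = x" using True by (auto simp: y_def \<phi>_mem)
    have "cmod (b t (\<phi> t y)) \<le> g y"
      using finite_sum_le_infsum[OF H.column_summable[OF b, of y], of "{t}"] True y by (simp add: g_def)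
    then show ?thesis using e(5)[of "b t x" y] e(6)[of "b t x" y] True y
      by (simp add: dual_action_def y_def e_def)
  next
    case False
    then have "b t x = 0" using F_D(2,3)[OF b] by auto
    then show ?thesis using \<eta>(1) by simp
  qed
  then have "nrm F (\<lambda>t x. b t x - (b \<otimes>\<^bsub>F\<^esub> monomial \<one> e) t x) < \<delta>"
    using F_diff[OF b F_mult[OF b m]] by (intro \<eta>(2)) (auto simp: mult_monomial_one[OF b])
  then show thesis using that e(1,2) by blast
qed

text \<open>One e for a finite family, because vectors are approximated by finite sums of
  \<psi>(b_i)\<xi>_i. The values of e are recorded to lie in [0,1], which the Hermitian estimate
  uses.\<close>

lemma approximate_unit_left:
  assumes "finite I" and b: "\<And>i. i \<in> I \<Longrightarrow> b i \<in> carrier F" and \<delta>: "\<delta> > 0"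
  obtains e where "e \<in> carrier (C0 X)" "nrm (C0 X) e \<le> 1" "\<And>x. \<exists>r. 0 \<le> r \<and> r \<le> 1 \<and> e x = complex_of_real r"
    "\<And>i. i \<in> I \<Longrightarrow> nrm F (\<lambda>t x. b i t x - (monomial \<one> e \<otimes>\<^bsub>F\<^esub> b i) t x) < \<delta>"
proof -
  interpret H: homeomorphism_family G X "\<lambda>t x. x" using homeomorphic_map_id[of X X] by unfold_locales (auto simp: id_def)
  define g where "g x = (\<Sum>i\<in>I. if x \<in> topspace X then \<Sum>\<^sub>\<infinity>t\<in>carrier G. cmod (b i t x) else 0)" for x
  have g: "(\<lambda>x. complex_of_real (g x)) \<in> carrier (C0 X)"
  proof -
    have "(\<lambda>x. \<Sum>i\<in>I. if x \<in> topspace X then complex_of_real (\<Sum>\<^sub>\<infinity>t\<in>carrier G. cmod (b i t x)) else 0) \<in> carrier (C0 X)"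
      using H.column_function_C0[OF b] by (intro C0_sum) auto
    then show ?thesis by (simp add: g_def if_distrib cong: if_cong)
  qed
  have g0: "0 \<le> g x" for x by (auto simp: g_def intro!: sum_nonneg infsum_nonneg)
  have "\<exists>\<eta>>0. \<forall>c\<in>carrier F. (\<forall>t x. cmod (c t x) \<le> cmod (b i t x) \<and> cmod (c t x) \<le> \<eta>) \<longrightarrow> nrm F c < \<delta>"
    if "i \<in> I" for i
    by (rule F_norm_small[OF b[OF that] \<delta>]) blast
  then obtain \<eta>0 where \<eta>0: "\<And>i. i \<in> I \<Longrightarrow> \<eta>0 i > 0"
    "\<And>i c. i \<in> I \<Longrightarrow> c \<in> carrier F \<Longrightarrow>
      (\<And>t x. cmod (c t x) \<le> cmod (b i t x) \<and> cmod (c t x) \<le> \<eta>0 i) \<Longrightarrow> nrm F c < \<delta>" by metis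
  define \<eta> where "\<eta> = Min (insert 1 (\<eta>0 ` I))"
  have \<eta>: "\<eta> > 0" "\<And>i. i \<in> I \<Longrightarrow> \<eta> \<le> \<eta>0 i" using \<eta>0(1) \<open>finite I\<close> by (auto simp: \<eta>_def)
  define e where "e = (\<lambda>x. complex_of_real (g x / (g x + \<eta>)))"
  note e = C0_approximate_unit[OF g g0 \<eta>(1), folded e_def]
  have m: "monomial \<one> e \<in> carrier F" by (rule monomial_mem(1)) (simp_all add: e(1))
  show thesis
  proof (rule that[OF e(1,2)])
    show "\<exists>r. 0 \<le> r \<and> r \<le> 1 \<and> e x = complex_of_real r" for x
      using e(3,4) by (intro exI[of _ "g x / (g x + \<eta>)"]) (simp add: e_def)
    fix i assume i: "i \<in> I"
    have "cmod (b i t x - e x * b i t x) \<le> cmod (b i t x) \<and> cmod (b i t x - e x * b i t x) \<le> \<eta>0 i" for t x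
    proof (cases "t \<in> carrier G \<and> x \<in> topspace X")
      case True
      have "cmod (b i t x) \<le> (\<Sum>\<^sub>\<infinity>t\<in>carrier G. cmod (b i t x))"
        using finite_sum_le_infsum[OF F_D(5)[OF b[OF i]], of "{t}"] True by simp
      also have "\<dots> = (if x \<in> topspace X then \<Sum>\<^sub>\<infinity>t\<in>carrier G. cmod (b i t x) else 0)" using True by simp
      also have "\<dots> \<le> g x" unfolding g_def
        using i \<open>finite I\<close> by (intro member_le_sum) (auto intro!: infsum_nonneg)
      finally show ?thesis using e(5)[of "b i t x" x] e(6)[of "b i t x" x] \<eta>(2)[OF i]
        by (simp add: mult.commute e_def)
    next
      case False
      then have "b i t x = 0" using F_D(2,3)[OF b[OF i]] by auto
      then show ?thesis using \<eta>0(1)[OF i] by simp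
    qed
    then show "nrm F (\<lambda>t x. b i t x - (monomial \<one> e \<otimes>\<^bsub>F\<^esub> b i) t x) < \<delta>"
      using F_diff[OF b[OF i] F_mult[OF m b[OF i]]] i by (intro \<eta>0(2)) (auto simp: monomial_one_mult[OF b[OF i]])
  qed
qed

end

section \<open>Completions of F\<close>

lemma is_completion_cong:
  "is_completion F N A \<iota> \<Longrightarrow> (\<And>b. b \<in> carrier F \<Longrightarrow> N' b = N b) \<Longrightarrow> is_completion F N' A \<iota>"
  by (simp add: is_completion_def)

text \<open>The norm enters through two inequalities. Domination by the l1-norm carries approximate
  units from F over to A, and domination of the coefficients produces the maps E_t. The locale is
  used over X, over U and over Y, and also for the quotient.\<close>

locale F_completion = twisted_action G X \<phi> u + A: banach_algebra A
  for G :: "('g, 'z) monoid_scheme" (structure) and X :: "'x topology" and \<phi> u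
    and A :: "'a cnormed" +
  fixes \<iota> :: "('g \<Rightarrow> 'x \<Rightarrow> complex) \<Rightarrow> 'a" and N :: "('g \<Rightarrow> 'x \<Rightarrow> complex) \<Rightarrow> real"
  assumes completion: "is_completion (F_alg G X \<phi> u) N A \<iota>"
    and N_le: "b \<in> carrier (F_alg G X \<phi> u) \<Longrightarrow> N b \<le> nrm (F_alg G X \<phi> u) b"
    and coeff_le_N: "\<lbrakk>b \<in> carrier (F_alg G X \<phi> u); t \<in> carrier G\<rbrakk> \<Longrightarrow> nrm (C0 X) (b t) \<le> N b"
begin

lemma \<iota>_hom: "\<iota> \<in> alg_hom F A" and \<iota>_norm: "b \<in> carrier F \<Longrightarrow> nrm A (\<iota> b) = N b"
  and \<iota>_dense: "nclosure A (\<iota> ` carrier F) = carrier A"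
  using completion by (auto simp: is_completion_def)

lemma \<iota>_linear: "\<iota> \<in> linear_maps F A" using \<iota>_hom by (simp add: alg_hom_def)

lemma \<iota>_mult: "\<lbrakk>a \<in> carrier F; b \<in> carrier F\<rbrakk> \<Longrightarrow> \<iota> (a \<otimes>\<^bsub>F\<^esub> b) = \<iota> a \<otimes>\<^bsub>A\<^esub> \<iota> b"
  using \<iota>_hom by (simp add: alg_hom_def)

lemmas \<iota>_mem = linear_mapsD(1)[OF \<iota>_linear]

lemma \<iota>_add: "\<lbrakk>a \<in> carrier F; b \<in> carrier F\<rbrakk> \<Longrightarrow> \<iota> (\<lambda>t x. a t x + b t x) = \<iota> a \<oplus>\<^bsub>A\<^esub> \<iota> b"
  using linear_mapsD(2)[OF \<iota>_linear] by simp

lemma \<iota>_smult: "b \<in> carrier F \<Longrightarrow> \<iota> (\<lambda>t x. c * b t x) = c \<odot>\<^bsub>A\<^esub> \<iota> b"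
  using linear_mapsD(3)[OF \<iota>_linear] by simp

lemma \<iota>_diff: "\<lbrakk>a \<in> carrier F; b \<in> carrier F\<rbrakk> \<Longrightarrow> \<iota> (\<lambda>t x. a t x - b t x) = \<iota> a \<ominus>\<^bsub>A\<^esub> \<iota> b"
  using linear_maps_diff[OF \<iota>_linear normed_space.axioms(1)[OF normed_space_F] A.seminormed_space_axioms]
  by simp

lemma N_add: "\<lbrakk>a \<in> carrier F; b \<in> carrier F\<rbrakk> \<Longrightarrow> N (\<lambda>t x. a t x + b t x) \<le> N a + N b"
  using A.norm_triangle[of "\<iota> a" "\<iota> b"] \<iota>_norm[of a] \<iota>_norm[of b]
    \<iota>_norm[OF F_add(1), of a b] \<iota>_add[of a b] \<iota>_mem[of a] \<iota>_mem[of b] by simp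

lemma \<iota>_image_subset: "\<iota> ` carrier F \<subseteq> carrier A" using \<iota>_mem by blast

lemma \<iota>_approx:
  assumes "a \<in> carrier A" "\<epsilon> > 0"
  obtains b where "b \<in> carrier F" "nrm A (a \<ominus>\<^bsub>A\<^esub> \<iota> b) < \<epsilon>"
  using assms \<iota>_dense A.mem_nclosure_iff[OF \<iota>_image_subset] by blast

definition left_mult :: "('g \<Rightarrow> 'x \<Rightarrow> complex) \<Rightarrow> 'a \<Rightarrow> 'a" where
  "left_mult b = (\<lambda>\<xi>\<in>carrier A. \<iota> b \<otimes>\<^bsub>A\<^esub> \<xi>)"

lemma left_mult_bounded:
  assumes b: "b \<in> carrier F"
  shows "left_mult b \<in> carrier (bounded_operators A)"
proof -
  have "left_mult b \<in> linear_maps A A"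
    using \<iota>_mem[OF b] by (auto simp: linear_maps_def left_mult_def A.mult_closed A.mult_add_right A.smult_mult_right)
  moreover have "nrm A (left_mult b \<xi>) \<le> nrm A (\<iota> b) * nrm A \<xi>" if "\<xi> \<in> carrier A" for \<xi>
    using that \<iota>_mem[OF b] A.nrm_mult by (simp add: left_mult_def)
  ultimately show ?thesis unfolding bounded_operators_def by (auto simp: left_mult_def)
qed

text \<open>A need not have a unit, so the lower bound is tested on \<iota>(e) for a contractive
  right approximate unit e: \<iota>(b e) is close to \<iota>(b), and \<iota>(e) has norm at most
  1.\<close>

lemma norm_left_mult:
  assumes b: "b \<in> carrier F"
  shows "nrm (bounded_operators A) (left_mult b) = N b"
proof (rule antisym)
  have "0 \<le> N b" using \<iota>_norm[OF b] A.norm_nonneg[OF \<iota>_mem[OF b]] by simp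
  then show "nrm (bounded_operators A) (left_mult b) \<le> N b"
    using \<iota>_mem[OF b] A.nrm_mult[of "\<iota> b"] \<iota>_norm[OF b]
    by (intro operator_norm_le) (auto simp: left_mult_def)
  show "N b \<le> nrm (bounded_operators A) (left_mult b)"
  proof (rule field_le_epsilon)
    fix \<delta> :: real assume "\<delta> > 0"
    then obtain e where e: "e \<in> carrier (C0 X)" "nrm (C0 X) e \<le> 1"
      "nrm F (\<lambda>t x. b t x - (b \<otimes>\<^bsub>F\<^esub> monomial \<one> e) t x) < \<delta>"
      using approximate_unit_right[OF b] by blast
    have m: "monomial \<one> e \<in> carrier F" "nrm F (monomial \<one> e) \<le> 1"
      using monomial_mem[of \<one> G e X] e by auto
    have bm: "b \<otimes>\<^bsub>F\<^esub> monomial \<one> e \<in> carrier F" using F_mult[OF b m(1)] .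
    have "nrm A (\<iota> b) \<le> nrm A (\<iota> (b \<otimes>\<^bsub>F\<^esub> monomial \<one> e)) + nrm A (\<iota> b \<ominus>\<^bsub>A\<^esub> \<iota> (b \<otimes>\<^bsub>F\<^esub> monomial \<one> e))"
      using \<iota>_mem[OF b] \<iota>_mem[OF bm] by (rule A.norm_le_add_diff)
    moreover have "nrm A (\<iota> b \<ominus>\<^bsub>A\<^esub> \<iota> (b \<otimes>\<^bsub>F\<^esub> monomial \<one> e)) < \<delta>"
      using \<iota>_diff[OF b bm] \<iota>_norm[OF F_diff[OF b bm]] N_le[OF F_diff[OF b bm]] e(3) by simp
    moreover have "nrm A (\<iota> (b \<otimes>\<^bsub>F\<^esub> monomial \<one> e)) \<le> nrm (bounded_operators A) (left_mult b)"
    proof -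
      have "nrm A (\<iota> (b \<otimes>\<^bsub>F\<^esub> monomial \<one> e)) = nrm A (left_mult b (\<iota> (monomial \<one> e)))"
        using \<iota>_mult[OF b m(1)] \<iota>_mem[OF m(1)] by (simp add: left_mult_def)
      also have "\<dots> \<le> nrm (bounded_operators A) (left_mult b) * nrm A (\<iota> (monomial \<one> e))"
        using left_mult_bounded[OF b] \<iota>_mem[OF m(1)] by (rule A.operator_norm_bound)
      also have "\<dots> \<le> nrm (bounded_operators A) (left_mult b) * 1"
        using A.operator_norm_nonneg[OF left_mult_bounded[OF b]] \<iota>_norm[OF m(1)] N_le[OF m(1)] m(2)
        by (intro mult_left_mono) auto
      finally show ?thesis by simp
    qed
    ultimately show "N b \<le> nrm (bounded_operators A) (left_mult b) + \<delta>" using \<iota>_norm[OF b] by simp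
  qed
qed

lemma representation_left_mult: "representation F A left_mult"
proof -
  have add: "left_mult (a \<oplus>\<^bsub>F\<^esub> b) = left_mult a \<oplus>\<^bsub>bounded_operators A\<^esub> left_mult b"
    if "a \<in> carrier F" "b \<in> carrier F" for a b
    using that \<iota>_mem by (auto simp: bounded_operators_def left_mult_def \<iota>_add A.mult_add_left fun_eq_iff restrict_def)
  have smult: "left_mult (c \<odot>\<^bsub>F\<^esub> b) = c \<odot>\<^bsub>bounded_operators A\<^esub> left_mult b"
    if "b \<in> carrier F" for b c
    using that \<iota>_mem by (auto simp: bounded_operators_def left_mult_def \<iota>_smult A.smult_mult_left fun_eq_iff restrict_def)
  have mult: "left_mult (a \<otimes>\<^bsub>F\<^esub> b) = left_mult a \<otimes>\<^bsub>bounded_operators A\<^esub> left_mult b"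
    if "a \<in> carrier F" "b \<in> carrier F" for a b
    using that \<iota>_mem by (auto simp: bounded_operators_def left_mult_def \<iota>_mult A.mult_assoc A.mult_closed
        fun_eq_iff restrict_def compose_def)
  show ?thesis
    unfolding representation_def alg_hom_def linear_contractions_def linear_maps_def
    using add smult mult left_mult_bounded norm_left_mult N_le by auto
qed

lemma zero_operator_norm: "nrm (bounded_operators A) \<zero>\<^bsub>bounded_operators A\<^esub> \<le> 0"
  by (rule operator_norm_le) (auto simp: bounded_operators_def)

definition coefficient :: "'g \<Rightarrow> 'a \<Rightarrow> 'x \<Rightarrow> complex" where
  "coefficient t = dense_map.extension F A (C0 X) \<iota> (\<lambda>b. b t)"

lemma dense_map_coefficient:
  assumes "t \<in> carrier G"
  shows "dense_map F A (C0 X) \<iota> (\<lambda>b. b t)"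
proof (intro dense_map.intro dense_map_axioms.intro)
  show "seminormed_space F" by (rule normed_space.axioms(1)[OF normed_space_F])
  show "(\<lambda>b. b t) \<in> linear_maps F (C0 X)" using F_D(1) by (auto simp: linear_maps_def)
qed (use banach_space_C0 A.banach_space_axioms \<iota>_linear \<iota>_dense \<iota>_norm coeff_le_N assms in auto)

lemma coefficient_contraction: "t \<in> carrier G \<Longrightarrow> coefficient t \<in> linear_contractions A (C0 X)"
  unfolding coefficient_def by (rule dense_map.extension_linear_contraction[OF dense_map_coefficient])

lemma coefficient_norm_le:
  "t \<in> carrier G \<Longrightarrow> a \<in> carrier A \<Longrightarrow> nrm (C0 X) (coefficient t a) \<le> nrm A a"
  using coefficient_contraction by (simp add: linear_contractions_def)

lemma coefficient_\<iota>: "t \<in> carrier G \<Longrightarrow> b \<in> carrier F \<Longrightarrow> coefficient t (\<iota> b) = b t"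
  unfolding coefficient_def by (rule dense_map.extension_\<iota>[OF dense_map_coefficient])

text \<open>Left multiplication on A alone is a family of representations that induces the norm; it
  separates points because the norm dominates the coefficients.\<close>

lemma crossed_product: "crossed_product G X \<phi> u A \<iota>"
  unfolding crossed_product_def
proof (intro conjI exI[of _ "{(A, left_mult)}"] bexI[of _ "coefficient \<one>"])
  show "separating_family F {(A, left_mult)}"
    unfolding separating_family_def
  proof (intro conjI ballI impI)
    fix b assume b: "b \<in> carrier F" "b \<noteq> \<zero>\<^bsub>F\<^esub>"
    have "\<exists>t x. b t x \<noteq> 0" using b(2) by (auto simp: fun_eq_iff)
    then obtain t x where tx: "b t x \<noteq> 0" by blast
    then have t: "t \<in> carrier G" using F_D(2)[OF b(1)] by blast
    have "0 < cmod (b t x)" using tx by simp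
    also have "\<dots> \<le> nrm (C0 X) (b t)" by (rule C0_le_norm[OF F_D(1)[OF b(1)]])
    also have "\<dots> \<le> N b" by (rule coeff_le_N[OF b(1) t])
    finally have "left_mult b \<noteq> \<zero>\<^bsub>bounded_operators A\<^esub>"
      using norm_left_mult[OF b(1)] zero_operator_norm by auto
    then show "\<exists>(E, \<psi>)\<in>{(A, left_mult)}. \<psi> b \<noteq> \<zero>\<^bsub>bounded_operators E\<^esub>" by simp
  qed (use A.banach_space_axioms representation_left_mult in auto)
  have "family_norm {(A, left_mult)} b = N b" if "b \<in> carrier F" for b
  proof -
    have "family_norm {(A, left_mult)} b = Sup {0, N b}"
      using norm_left_mult[OF that] by (simp add: family_norm_def)
    also have "\<dots> = max 0 (N b)" by (subst cSup_eq_Max) auto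
    finally show ?thesis using \<iota>_norm[OF that] A.norm_nonneg[OF \<iota>_mem[OF that]] by simp
  qed
  then show "is_completion F (family_norm {(A, left_mult)}) A \<iota>"
    using completion by (rule is_completion_cong[rotated])
qed (use coefficient_contraction coefficient_\<iota> in auto)

text \<open>Suppose all coefficients of a vanish. Elements c near a then have small coefficients,
  hence a small truncation to a fixed finite S. An approximation b of a differs little from its own
  truncation if S is large, and contractivity of truncation transfers the closeness of b and c to
  their truncations with no loss depending on S. So b, and with it a, is small.\<close>

lemma reduced_crossed_product:
  assumes N_truncate: "\<And>b S. b \<in> carrier F \<Longrightarrow> N (\<lambda>t x. if t \<in> S then b t x else 0) \<le> N b"
  shows "reduced_crossed_product G X \<phi> u A \<iota>"
  unfolding reduced_crossed_product_def
proof (intro conjI crossed_product exI[of _ coefficient] ballI equalityI subsetI)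
  have lin: "coefficient t \<in> linear_maps A (C0 X)" if "t \<in> carrier G" for t
    using coefficient_contraction[OF that] by (simp add: linear_contractions_def)
  fix a
  assume "a \<in> {\<zero>\<^bsub>A\<^esub>}"
  then show "a \<in> {a \<in> carrier A. \<forall>t\<in>carrier G. coefficient t a = \<zero>\<^bsub>C0 X\<^esub>}"
    using linear_maps_zero[OF lin A.seminormed_space_axioms seminormed_space_C0] by auto
next
  fix a
  assume "a \<in> {a \<in> carrier A. \<forall>t\<in>carrier G. coefficient t a = \<zero>\<^bsub>C0 X\<^esub>}"
  then have a: "a \<in> carrier A" and a0: "\<And>t. t \<in> carrier G \<Longrightarrow> coefficient t a = \<zero>\<^bsub>C0 X\<^esub>" by auto
  have "nrm A a \<le> 0 + \<epsilon>" if "\<epsilon> > 0" for \<epsilon>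
  proof -
    define \<delta> where "\<delta> = \<epsilon>/5"
    have \<delta>: "\<delta> > 0" using \<open>\<epsilon> > 0\<close> by (simp add: \<delta>_def)
    obtain b where b: "b \<in> carrier F" "nrm A (a \<ominus>\<^bsub>A\<^esub> \<iota> b) < \<delta>" using \<iota>_approx[OF a \<delta>] .
    obtain S where S: "finite S" "S \<subseteq> carrier G"
      "nrm F (\<lambda>t x. b t x - (if t \<in> S then b t x else 0)) < \<delta>" using F_finite_approx[OF b(1) \<delta>] .
    \<comment> \<open>Chosen after S, so that card(S) coefficients of size \<eta> add up to at most
      \<delta>; this is why a second approximation c is taken besides b.\<close>
    define \<eta> where "\<eta> = \<delta> / (real (card S) + 1)"
    have \<eta>: "\<eta> > 0" "real (card S) * \<eta> \<le> \<delta>" "\<eta> \<le> \<delta>"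
      using \<delta> by (auto simp: \<eta>_def field_simps add_pos_nonneg)
    obtain c where c: "c \<in> carrier F" "nrm A (a \<ominus>\<^bsub>A\<^esub> \<iota> c) < \<eta>" using \<iota>_approx[OF a \<eta>(1)] .
    have ct: "nrm (C0 X) (c t) \<le> \<eta>" if t: "t \<in> carrier G" for t
    proof -
      \<comment> \<open>Since the coefficients of a vanish, those of c are, up to sign, those of a -
        \<iota>(c).\<close>
      have "coefficient t (a \<ominus>\<^bsub>A\<^esub> \<iota> c) = coefficient t a \<ominus>\<^bsub>C0 X\<^esub> coefficient t (\<iota> c)"
        using coefficient_contraction[OF t] a \<iota>_mem[OF c(1)]
        by (intro linear_maps_diff A.seminormed_space_axioms seminormed_space_C0) (auto simp: linear_contractions_def)
      also have "\<dots> = (\<lambda>x. - c t x)" using a0[OF t] coefficient_\<iota>[OF t c(1)] F_D(1)[OF c(1)] by simp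
      finally have "nrm (C0 X) (\<lambda>x. - c t x) \<le> nrm A (a \<ominus>\<^bsub>A\<^esub> \<iota> c)"
        using coefficient_norm_le[OF t, of "a \<ominus>\<^bsub>A\<^esub> \<iota> c"] a \<iota>_mem[OF c(1)] by simp
      then show ?thesis using c(2) by (simp add: norm_C0)
    qed
    let ?tr = "\<lambda>b t x. if t \<in> S then b t x else (0::complex)"
    have bc: "(\<lambda>t x. b t x - c t x) \<in> carrier F" using b(1) c(1) by (rule F_diff)
    note trb = F_truncate[OF b(1), of S] and trc = F_truncate[OF c(1), of S] and trbc = F_truncate[OF bc, of S]
    have "N (?tr c) \<le> nrm F (?tr c)" by (rule N_le[OF trc])
    also have "\<dots> = (\<Sum>\<^sub>\<infinity>t\<in>S. nrm (C0 X) (c t))" unfolding norm_F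
      using S by (intro infsum_cong_neutral) auto
    also have "\<dots> \<le> real (card S) * \<eta>" using S ct by (simp, intro sum_bounded_above) auto
    finally have 1: "N (?tr c) \<le> \<delta>" using \<eta>(2) by simp
    have "N (?tr (\<lambda>t x. b t x - c t x)) \<le> N (\<lambda>t x. b t x - c t x)" by (rule N_truncate[OF bc])
    also have "\<dots> = nrm A (\<iota> b \<ominus>\<^bsub>A\<^esub> \<iota> c)" using \<iota>_norm[OF bc] \<iota>_diff[OF b(1) c(1)] by simp
    also have "\<dots> \<le> nrm A (\<iota> b \<ominus>\<^bsub>A\<^esub> a) + nrm A (a \<ominus>\<^bsub>A\<^esub> \<iota> c)"
      using a \<iota>_mem[OF b(1)] \<iota>_mem[OF c(1)] by (intro A.norm_diff_triangle)
    also have "\<dots> \<le> \<delta> + \<delta>" using b(2) c(2) \<eta>(3) A.norm_diff_commute[OF a \<iota>_mem[OF b(1)]] by simp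
    finally have 2: "N (?tr (\<lambda>t x. b t x - c t x)) \<le> \<delta> + \<delta>" .
    have "?tr b = (\<lambda>t x. ?tr (\<lambda>t x. b t x - c t x) t x + ?tr c t x)" by (auto simp: fun_eq_iff)
    then have 3: "N (?tr b) \<le> N (?tr (\<lambda>t x. b t x - c t x)) + N (?tr c)" using N_add[OF trbc trc] by simp
    have "nrm A (\<iota> b) \<le> nrm A (\<iota> (?tr b)) + nrm A (\<iota> b \<ominus>\<^bsub>A\<^esub> \<iota> (?tr b))"
      using \<iota>_mem[OF b(1)] \<iota>_mem[OF trb] by (rule A.norm_le_add_diff)
    also have "nrm A (\<iota> (?tr b)) = N (?tr b)" by (rule \<iota>_norm[OF trb])
    also have "nrm A (\<iota> b \<ominus>\<^bsub>A\<^esub> \<iota> (?tr b)) = N (\<lambda>t x. b t x - ?tr b t x)"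
      using \<iota>_diff[OF b(1) trb] \<iota>_norm[OF F_diff[OF b(1) trb]] by simp
    also have "\<dots> < \<delta>" using N_le[OF F_diff[OF b(1) trb]] S(3) by simp
    finally have "nrm A (\<iota> b) \<le> 4 * \<delta>" using 1 2 3 by simp
    then show ?thesis using A.norm_le_add_diff[OF a \<iota>_mem[OF b(1)]] b(2) by (simp add: \<delta>_def)
  qed
  then have "nrm A a \<le> 0" by (rule field_le_epsilon)
  then show "a \<in> {\<zero>\<^bsub>A\<^esub>}" using A.norm_eq_0_iff[OF a] A.norm_nonneg[OF a] by simp
qed (use coefficient_contraction coefficient_\<iota> in auto)

end

lemma (in twisted_action) F_completion_concrete:
  assumes "P \<subseteq> {1, \<infinity>}" "is_completion F (concrete_norm G X \<phi> P) A \<iota>"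
  shows "F_completion G X \<phi> u A \<iota> (concrete_norm G X \<phi> P)"
proof (intro F_completion.intro F_completion_axioms.intro twisted_action_axioms)
  show "banach_algebra A" using assms(2) by (simp add: is_completion_def)
qed (use assms concrete_norm_le_norm coeff_le_concrete_norm in auto)

section \<open>The closed ideal of U and the quotient by it\<close>

context normed_space begin

lemma nclosure_add:
  assumes S: "S \<subseteq> carrier E" and add: "\<And>x y. \<lbrakk>x \<in> S; y \<in> S\<rbrakk> \<Longrightarrow> x \<oplus> y \<in> S"
    and x: "x \<in> nclosure E S" and y: "y \<in> nclosure E S"
  shows "x \<oplus> y \<in> nclosure E S"
proof -
  have xy: "x \<in> carrier E" "y \<in> carrier E" using x y nclosure_subset by auto
  have "\<exists>z\<in>S. nrm E (x \<oplus> y \<ominus> z) < \<epsilon>" if "\<epsilon> > 0" for \<epsilon>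
  proof -
    have "\<epsilon>/2 > 0" using that by simp
    then obtain x' y' where xy': "x' \<in> S" "nrm E (x \<ominus> x') < \<epsilon>/2" "y' \<in> S" "nrm E (y \<ominus> y') < \<epsilon>/2"
      using x y unfolding mem_nclosure_iff[OF S] by blast
    then have "nrm E (x \<oplus> y \<ominus> (x' \<oplus> y')) < \<epsilon>"
      using norm_add_diff[of x y x' y'] xy S by (auto simp: subset_iff)
    then show ?thesis using add xy' by blast
  qed
  then show ?thesis using xy by (simp add: mem_nclosure_iff[OF S])
qed

lemma nclosure_smult:
  assumes S: "S \<subseteq> carrier E" and smult: "\<And>x. x \<in> S \<Longrightarrow> c \<odot> x \<in> S" and x: "x \<in> nclosure E S"
  shows "c \<odot> x \<in> nclosure E S"
proof -
  have xE: "x \<in> carrier E" using x nclosure_subset by auto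
  have "\<exists>z\<in>S. nrm E (c \<odot> x \<ominus> z) < \<epsilon>" if "\<epsilon> > 0" for \<epsilon>
  proof -
    have p: "cmod c + 1 > 0" using norm_ge_zero[of c] by linarith
    then have "\<epsilon> / (cmod c + 1) > 0" using that by simp
    then obtain x' where x': "x' \<in> S" "nrm E (x \<ominus> x') < \<epsilon> / (cmod c + 1)"
      using x unfolding mem_nclosure_iff[OF S] by blast
    have "x' \<in> carrier E" using x' S by auto
    then have "nrm E (c \<odot> x \<ominus> c \<odot> x') = cmod c * nrm E (x \<ominus> x')" "0 \<le> nrm E (x \<ominus> x')"
      using xE by (simp_all add: norm_diff_smult norm_nonneg)
    moreover have "cmod c * nrm E (x \<ominus> x') \<le> (cmod c + 1) * nrm E (x \<ominus> x')"
      using calculation(2) by (simp add: mult_right_mono)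
    moreover have "(cmod c + 1) * nrm E (x \<ominus> x') < \<epsilon>" using x'(2) p by (simp add: field_simps)
    ultimately show ?thesis using smult[OF x'(1)] by force
  qed
  then show ?thesis using xE by (simp add: mem_nclosure_iff[OF S])
qed

end

text \<open>Three sets, so that one of the factors can run through the dense image of F and the
  ideal property passes to the closure on either side.\<close>

lemma (in banach_algebra) nclosure_mult:
  assumes S: "S \<subseteq> carrier A" and T: "T \<subseteq> carrier A" and R: "R \<subseteq> carrier A"
    and mult: "\<And>x y. \<lbrakk>x \<in> S; y \<in> T\<rbrakk> \<Longrightarrow> x \<otimes> y \<in> R"
    and x: "x \<in> nclosure A S" and y: "y \<in> nclosure A T"
  shows "x \<otimes> y \<in> nclosure A R"
proof -
  have xy: "x \<in> carrier A" "y \<in> carrier A" using x y nclosure_subset by auto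
  have "\<exists>z\<in>R. nrm A (x \<otimes> y \<ominus> z) < \<epsilon>" if "\<epsilon> > 0" for \<epsilon>
  proof -
    define K where "K = nrm A x + nrm A y + 2"
    have K: "K > 0" "nrm A x \<ge> 0" "nrm A y \<ge> 0" using norm_nonneg xy by (simp_all add: K_def add_nonneg_pos)
    define \<delta> where "\<delta> = min 1 (\<epsilon>/K)"
    have \<delta>: "\<delta> > 0" "\<delta> \<le> 1" "\<delta> * K \<le> \<epsilon>" using that K(1) by (auto simp: \<delta>_def min_def field_simps)
    obtain x' where x': "x' \<in> S" "nrm A (x \<ominus> x') < \<delta>" using x \<delta>(1) unfolding mem_nclosure_iff[OF S] by blast
    obtain y' where y': "y' \<in> T" "nrm A (y \<ominus> y') < \<delta>" using y \<delta>(1) unfolding mem_nclosure_iff[OF T] by blast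
    have m: "x' \<in> carrier A" "y' \<in> carrier A" using x' y' S T by auto
    have nx': "nrm A x' \<le> nrm A x + 1"
      using norm_le_add_diff[of x' x] norm_diff_commute[of x' x] m xy x'(2) \<delta>(2) by simp
    have "nrm A (x \<otimes> y \<ominus> x' \<otimes> y') \<le> nrm A (x \<ominus> x') * nrm A y + nrm A x' * nrm A (y \<ominus> y')"
      using xy m by (intro norm_mult_diff)
    also have "\<dots> \<le> \<delta> * nrm A y + (nrm A x + 1) * \<delta>"
      using x'(2) y'(2) nx' K m xy norm_nonneg \<delta>(1) by (intro add_mono mult_mono) auto
    also have "\<dots> < \<delta> * K" using \<delta>(1) by (simp add: K_def algebra_simps)
    finally show ?thesis using mult[OF x'(1) y'(1)] \<delta>(3) by force
  qed
  then show ?thesis using xy by (simp add: mem_nclosure_iff[OF R] mult_closed)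
qed

locale concrete_completion = twisted_subaction G X \<phi> u U
  for G :: "('g, 'z) monoid_scheme" (structure) and X :: "'x topology" and \<phi> u U +
  fixes A :: "'a cnormed" and \<iota> and P :: "ereal set"
  assumes P: "P \<subseteq> {1, \<infinity>}"
    and completion_A: "is_completion (F_alg G X \<phi> u) (concrete_norm G X \<phi> P) A \<iota>"
begin

sublocale FA: F_completion G X \<phi> u A \<iota> "concrete_norm G X \<phi> P"
  using P completion_A by (rule F_completion_concrete)

abbreviation (input) "I \<equiv> nclosure A (\<iota> ` carrier FU)"
abbreviation (input) "NY \<equiv> concrete_norm G (subtopology X Y) (restrict_action \<phi> Y) P"

lemma FU_subset: "carrier FU \<subseteq> carrier F" by (auto simp: mem_FU_iff)

lemma FU_image: "\<iota> ` carrier FU \<subseteq> carrier A" using FU_subset FA.\<iota>_image_subset by blast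

text \<open>Invariance of U makes \<alpha>_s(c(t)) vanish off U, so each term of either product
  does.\<close>

lemma FU_ideal:
  assumes "b \<in> carrier F" "c \<in> carrier FU"
  shows "b \<otimes>\<^bsub>F\<^esub> c \<in> carrier FU" "c \<otimes>\<^bsub>F\<^esub> b \<in> carrier FU"
proof -
  have c: "c \<in> carrier F" "\<And>t x. x \<notin> U \<Longrightarrow> c t x = 0" using assms(2) by (auto simp: mem_FU_iff)
  have "dual_action G X \<phi> s (c t) x = 0" if "x \<notin> U" "s \<in> carrier G" for s t x
    using that c(2) invariant_iff[OF U_invariant U_subset, of "inv s" x]
    by (auto simp: dual_action_def)
  then show "b \<otimes>\<^bsub>F\<^esub> c \<in> carrier FU" "c \<otimes>\<^bsub>F\<^esub> b \<in> carrier FU"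
    using F_mult[OF assms(1) c(1)] F_mult[OF c(1) assms(1)] c(2)
    by (auto simp: mem_FU_iff mult_F intro!: infsum_0)
qed

sublocale algebra_quotient A I
proof -
  have 0: "\<zero>\<^bsub>A\<^esub> \<in> \<iota> ` carrier FU"
  proof
    show "\<zero>\<^bsub>A\<^esub> = \<iota> (\<lambda>t x. 0)" using FA.\<iota>_smult[of "\<lambda>t x. 0" 0] FA.\<iota>_mem[OF F_zero] by simp
    show "(\<lambda>t x. 0) \<in> carrier FU" by (simp add: mem_FU_iff)
  qed
  have add: "x \<oplus>\<^bsub>A\<^esub> y \<in> \<iota> ` carrier FU" if xy: "x \<in> \<iota> ` carrier FU" "y \<in> \<iota> ` carrier FU" for x y
  proof -
    obtain b c where bc: "b \<in> carrier FU" "c \<in> carrier FU" "x = \<iota> b" "y = \<iota> c" using xy by blast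
    then have "x \<oplus>\<^bsub>A\<^esub> y = \<iota> (\<lambda>t x. b t x + c t x)" using FU_subset by (simp add: FA.\<iota>_add subset_iff)
    moreover have "(\<lambda>t x. b t x + c t x) \<in> carrier FU" using bc by (simp add: mem_FU_iff)
    ultimately show ?thesis by blast
  qed
  have smult: "k \<odot>\<^bsub>A\<^esub> x \<in> \<iota> ` carrier FU" if x: "x \<in> \<iota> ` carrier FU" for k x
  proof -
    obtain b where b: "b \<in> carrier FU" "x = \<iota> b" using x by blast
    then have "k \<odot>\<^bsub>A\<^esub> x = \<iota> (\<lambda>t x. k * b t x)" using FU_subset by (simp add: FA.\<iota>_smult subset_iff)
    moreover have "(\<lambda>t x. k * b t x) \<in> carrier FU" using b by (simp add: mem_FU_iff F_smult)
    ultimately show ?thesis by blast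
  qed
  have left: "x \<otimes>\<^bsub>A\<^esub> y \<in> \<iota> ` carrier FU" if "x \<in> \<iota> ` carrier F" "y \<in> \<iota> ` carrier FU" for x y
    using that FU_ideal FU_subset FA.\<iota>_mult by (smt (verit) imageE imageI subsetD)
  have right: "x \<otimes>\<^bsub>A\<^esub> y \<in> \<iota> ` carrier FU" if "x \<in> \<iota> ` carrier FU" "y \<in> \<iota> ` carrier F" for x y
    using that FU_ideal FU_subset FA.\<iota>_mult by (smt (verit) imageE imageI subsetD)
  show "algebra_quotient A I"
  proof (unfold_locales)
    show "I \<subseteq> carrier A" by (rule FA.A.nclosure_subset)
    show "\<zero>\<^bsub>A\<^esub> \<in> I" using 0 FA.A.subset_nclosure[OF FU_image] by blast
    show "x \<oplus>\<^bsub>A\<^esub> y \<in> I" if "x \<in> I" "y \<in> I" for x y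
      using FU_image add that by (rule FA.A.nclosure_add)
    show "k \<odot>\<^bsub>A\<^esub> x \<in> I" if "x \<in> I" for k x
      using FU_image smult that by (rule FA.A.nclosure_smult)
    show "nclosure A I = I" by (rule FA.A.nclosure_idem)
    show "x \<otimes>\<^bsub>A\<^esub> i \<in> I" if "x \<in> carrier A" "i \<in> I" for x i
      using FA.\<iota>_image_subset FU_image FU_image left
      by (rule FA.A.nclosure_mult) (use that FA.\<iota>_dense in auto)
    show "i \<otimes>\<^bsub>A\<^esub> x \<in> I" if "x \<in> carrier A" "i \<in> I" for x i
      using FU_image FA.\<iota>_image_subset FU_image right
      by (rule FA.A.nclosure_mult) (use that FA.\<iota>_dense in auto)
  qed
qed

text \<open>The cutoff provides elements of the coset whose norm is at most that of b|_Y up to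
  \<epsilon>. Conversely, subtracting an element of F over U changes nothing on Y, and restriction
  to Y never increases the norm; approximation extends this to the closure.\<close>

lemma norm_coset:
  assumes b: "b \<in> carrier F"
  shows "nrm (nquot A I) (I +>\<^bsub>A\<^esub> \<iota> b) = NY (restrict_fun Y b)"
proof (rule antisym)
  show "nrm (nquot A I) (I +>\<^bsub>A\<^esub> \<iota> b) \<le> NY (restrict_fun Y b)"
  proof (rule field_le_epsilon)
    fix \<epsilon> :: real assume "\<epsilon> > 0"
    obtain c where c: "c \<in> carrier FU" "concrete_norm G X \<phi> P (\<lambda>t x. b t x - c t x) \<le> NY (restrict_fun Y b) + \<epsilon>"
      by (rule cutoff[OF P b \<open>\<epsilon> > 0\<close>])
    have cF: "c \<in> carrier F" and cI: "\<iota> c \<in> I"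
      using c(1) FU_subset FA.A.subset_nclosure[OF FU_image] by auto
    have m: "\<iota> b \<in> carrier A" "\<iota> c \<in> carrier A" using FA.\<iota>_mem b cF by auto
    have "\<iota> b \<ominus>\<^bsub>A\<^esub> (\<iota> b \<ominus>\<^bsub>A\<^esub> \<iota> c) = \<iota> c"
      using m by (simp add: FA.A.M.minus_eq FA.A.M.minus_add FA.A.M.r_neg1 FA.A.M.a_assoc[symmetric] FA.A.M.r_neg)
    then have "I +>\<^bsub>A\<^esub> \<iota> b = I +>\<^bsub>A\<^esub> (\<iota> b \<ominus>\<^bsub>A\<^esub> \<iota> c)"
      using m cI by (subst coset_eq_iff) auto
    then have "nrm (nquot A I) (I +>\<^bsub>A\<^esub> \<iota> b) \<le> nrm A (\<iota> b \<ominus>\<^bsub>A\<^esub> \<iota> c)"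
      using m norm_quot_le[of "\<iota> b \<ominus>\<^bsub>A\<^esub> \<iota> c"] by simp
    also have "\<dots> = concrete_norm G X \<phi> P (\<lambda>t x. b t x - c t x)"
      using FA.\<iota>_diff[OF b cF] FA.\<iota>_norm[OF F_diff[OF b cF]] by simp
    finally show "nrm (nquot A I) (I +>\<^bsub>A\<^esub> \<iota> b) \<le> NY (restrict_fun Y b) + \<epsilon>" using c(2) by simp
  qed
  show "NY (restrict_fun Y b) \<le> nrm (nquot A I) (I +>\<^bsub>A\<^esub> \<iota> b)"
  proof (rule norm_quot_geI)
    show "\<iota> b \<in> carrier A" using b by (rule FA.\<iota>_mem)
    fix i assume i: "i \<in> I"
    then have iA: "i \<in> carrier A" using FA.A.nclosure_subset by blast
    show "NY (restrict_fun Y b) \<le> nrm A (\<iota> b \<ominus>\<^bsub>A\<^esub> i)"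
    proof (rule field_le_epsilon)
      fix \<epsilon> :: real assume "\<epsilon> > 0"
      then obtain c where c: "c \<in> carrier FU" "nrm A (i \<ominus>\<^bsub>A\<^esub> \<iota> c) < \<epsilon>"
        using i unfolding FA.A.mem_nclosure_iff[OF FU_image] by blast
      have cF: "c \<in> carrier F" using c(1) FU_subset by auto
      have "restrict_fun Y b = restrict_fun Y (\<lambda>t x. b t x - c t x)"
        using c(1) by (auto simp: restrict_fun_def mem_FU_iff fun_eq_iff)
      then have "NY (restrict_fun Y b) \<le> concrete_norm G X \<phi> P (\<lambda>t x. b t x - c t x)"
        using concrete_norm_Y_le[OF P F_diff[OF b cF]] by simp
      also have "\<dots> = nrm A (\<iota> b \<ominus>\<^bsub>A\<^esub> \<iota> c)"
        using FA.\<iota>_diff[OF b cF] FA.\<iota>_norm[OF F_diff[OF b cF]] by simp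
      also have "\<dots> \<le> nrm A (\<iota> b \<ominus>\<^bsub>A\<^esub> i) + nrm A (i \<ominus>\<^bsub>A\<^esub> \<iota> c)"
        using FA.\<iota>_mem b cF iA by (intro FA.A.norm_diff_triangle) auto
      finally show "NY (restrict_fun Y b) \<le> nrm A (\<iota> b \<ominus>\<^bsub>A\<^esub> i) + \<epsilon>" using c(2) by simp
    qed
  qed
qed

text \<open>A function on F over Y is wanted, so an extension to X is chosen;
  \<open>\<iota>Q_restrict\<close> shows that the coset does not depend on it.\<close>

definition \<iota>Q :: "('g \<Rightarrow> 'x \<Rightarrow> complex) \<Rightarrow> 'a set" where
  "\<iota>Q c = I +>\<^bsub>A\<^esub> \<iota> (SOME b. b \<in> carrier F \<and> restrict_fun Y b = c)"

lemma \<iota>Q_restrict: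
  assumes b: "b \<in> carrier F"
  shows "\<iota>Q (restrict_fun Y b) = I +>\<^bsub>A\<^esub> \<iota> b"
proof -
  define b' where "b' = (SOME b'. b' \<in> carrier F \<and> restrict_fun Y b' = restrict_fun Y b)"
  have b': "b' \<in> carrier F \<and> restrict_fun Y b' = restrict_fun Y b"
    unfolding b'_def by (rule someI[of _ b]) (simp add: b)
  then have "(\<lambda>t x. b' t x - b t x) \<in> carrier FU" using restrict_eq_iff[of b' b] b by simp
  then have "\<iota> (\<lambda>t x. b' t x - b t x) \<in> \<iota> ` carrier FU" by (rule imageI)
  also have "\<iota> (\<lambda>t x. b' t x - b t x) = \<iota> b' \<ominus>\<^bsub>A\<^esub> \<iota> b"
    using FA.\<iota>_diff[of b' b] b b' by simp
  finally have "\<iota> b' \<ominus>\<^bsub>A\<^esub> \<iota> b \<in> \<iota> ` carrier FU" .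
  then have "\<iota> b' \<ominus>\<^bsub>A\<^esub> \<iota> b \<in> I" using FA.A.subset_nclosure[OF FU_image] by blast
  then show ?thesis
    using coset_eq_iff[of "\<iota> b'" "\<iota> b"] FA.\<iota>_mem b b' by (simp add: \<iota>Q_def b'_def[symmetric])
qed

lemma restrict_ops:
  "restrict_fun Y (\<lambda>t x. a t x + b t x) = restrict_fun Y a \<oplus>\<^bsub>FY\<^esub> restrict_fun Y b"
  "restrict_fun Y (\<lambda>t x. k * b t x) = k \<odot>\<^bsub>FY\<^esub> restrict_fun Y b"
  by (auto simp: restrict_fun_def F_sub_def fun_eq_iff)

text \<open>Every element of F over Y is a restriction, so each algebraic law is checked on lifts,
  and \<open>norm_coset\<close> supplies the norm.\<close>

lemma completion_Q: "is_completion FY NY (nquot A I) \<iota>Q"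
  unfolding is_completion_def
proof (intro conjI ballI)
  show "banach_algebra (nquot A I)" by (rule banach_algebra_quot)
  have mem: "\<iota>Q c \<in> carrier (nquot A I)" if c: "c \<in> carrier FY" for c
  proof -
    obtain b where b: "b \<in> carrier F" "restrict_fun Y b = c" by (rule restrict_lift[OF c])
    show ?thesis unfolding b(2)[symmetric] \<iota>Q_restrict[OF b(1)] by (intro coset_mem FA.\<iota>_mem b(1))
  qed
  show "\<iota>Q \<in> alg_hom FY (nquot A I)"
    unfolding alg_hom_def linear_maps_def
  proof (intro CollectI conjI ballI allI funcsetI mem)
    fix c d assume cd: "c \<in> carrier FY" "d \<in> carrier FY"
    obtain a where a: "a \<in> carrier F" "restrict_fun Y a = c" by (rule restrict_lift[OF cd(1)])
    obtain b where b: "b \<in> carrier F" "restrict_fun Y b = d" by (rule restrict_lift[OF cd(2)])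
    show "\<iota>Q (c \<oplus>\<^bsub>FY\<^esub> d) = \<iota>Q c \<oplus>\<^bsub>nquot A I\<^esub> \<iota>Q d"
      using a b \<iota>Q_restrict[OF F_add(1)[OF a(1) b(1)]] \<iota>Q_restrict[OF a(1)] \<iota>Q_restrict[OF b(1)]
        FA.\<iota>_mem by (simp add: restrict_ops FA.\<iota>_add add_quot)
    show "\<iota>Q (c \<otimes>\<^bsub>FY\<^esub> d) = \<iota>Q c \<otimes>\<^bsub>nquot A I\<^esub> \<iota>Q d"
      using a b \<iota>Q_restrict[OF F_mult[OF a(1) b(1)]] \<iota>Q_restrict[OF a(1)] \<iota>Q_restrict[OF b(1)]
        FA.\<iota>_mem by (simp add: restrict_mult FA.\<iota>_mult mult_quot)
  next
    fix k c assume c: "c \<in> carrier FY"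
    obtain b where b: "b \<in> carrier F" "restrict_fun Y b = c" by (rule restrict_lift[OF c])
    show "\<iota>Q (k \<odot>\<^bsub>FY\<^esub> c) = k \<odot>\<^bsub>nquot A I\<^esub> \<iota>Q c"
      using b \<iota>Q_restrict[OF F_smult(1)[OF b(1), of k]] \<iota>Q_restrict[OF b(1)]
        FA.\<iota>_mem by (simp add: restrict_ops FA.\<iota>_smult smult_quot)
  qed
  show "nrm (nquot A I) (\<iota>Q c) = NY c" if c: "c \<in> carrier FY" for c
  proof -
    obtain b where b: "b \<in> carrier F" "restrict_fun Y b = c" by (rule restrict_lift[OF c])
    show ?thesis unfolding b(2)[symmetric] \<iota>Q_restrict[OF b(1)] by (rule norm_coset[OF b(1)])
  qed
  have sub: "\<iota>Q ` carrier FY \<subseteq> carrier (nquot A I)" using mem by blast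
  show "nclosure (nquot A I) (\<iota>Q ` carrier FY) = carrier (nquot A I)"
  proof (intro equalityI Q.nclosure_subset subsetI)
    fix K assume K: "K \<in> carrier (nquot A I)"
    then obtain a where a: "a \<in> carrier A" "K = I +>\<^bsub>A\<^esub> a" by (rule quotE)
    have "\<exists>L\<in>\<iota>Q ` carrier FY. nrm (nquot A I) (K \<ominus>\<^bsub>nquot A I\<^esub> L) < \<epsilon>" if "\<epsilon> > 0" for \<epsilon>
    proof -
      obtain b where b: "b \<in> carrier F" "nrm A (a \<ominus>\<^bsub>A\<^esub> \<iota> b) < \<epsilon>" by (rule FA.\<iota>_approx[OF a(1) \<open>\<epsilon> > 0\<close>])
      have "nrm (nquot A I) (K \<ominus>\<^bsub>nquot A I\<^esub> \<iota>Q (restrict_fun Y b)) \<le> nrm A (a \<ominus>\<^bsub>A\<^esub> \<iota> b)"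
        using a FA.\<iota>_mem[OF b(1)] norm_quot_le[of "a \<ominus>\<^bsub>A\<^esub> \<iota> b"] by (simp add: \<iota>Q_restrict[OF b(1)] diff_quot)
      then have "nrm (nquot A I) (K \<ominus>\<^bsub>nquot A I\<^esub> \<iota>Q (restrict_fun Y b)) < \<epsilon>" using b(2) by simp
      then show ?thesis by (rule bexI) (intro imageI restrict_mem b(1))
    qed
    then show "K \<in> nclosure (nquot A I) (\<iota>Q ` carrier FY)" using K by (simp add: Q.mem_nclosure_iff[OF sub])
  qed
qed

text \<open>By \<open>completion_Q\<close> the quotient carries the norm formula over Y, and
  monotonicity of that formula makes truncation contractive.\<close>

lemma reduced_Q: "reduced_crossed_product G (subtopology X Y) (restrict_action \<phi> Y)
    (restrict_twist u Y) (nquot A I) \<iota>Q"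
proof -
  interpret FQ: F_completion G "subtopology X Y" "restrict_action \<phi> Y" "restrict_twist u Y" "nquot A I" \<iota>Q NY
    using P completion_Q unfolding F_sub_def by (rule Yact.F_completion_concrete)
  show ?thesis
    by (rule FQ.reduced_crossed_product, rule Yact.concrete_norm_mono[OF P _ F_truncate]) auto
qed

text \<open>On elements supported in U the norms over U and over X agree, so \<iota> itself extends
  isometrically from the completion over U; its image is closed and hence equals I.\<close>

lemma ideal_isometry:
  fixes AU :: "'d cnormed"
  assumes AU: "is_completion FU (concrete_norm G (subtopology X U) (restrict_action \<phi> U) P) AU \<iota>U"
  obtains j where "j \<in> isometric_hom AU A" "\<And>b. b \<in> carrier FU \<Longrightarrow> j (\<iota>U b) = \<iota> b" "j ` carrier AU = I"
proof -
  interpret FAU: F_completion G "subtopology X U" "restrict_action \<phi> U" "restrict_twist u U" AU \<iota>U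
    "concrete_norm G (subtopology X U) (restrict_action \<phi> U) P"
    using P AU unfolding F_sub_def by (rule Uact.F_completion_concrete)
  have lin: "\<iota> \<in> linear_maps FU A"
    unfolding linear_maps_def
    using FU_subset FA.\<iota>_mem FA.\<iota>_add FA.\<iota>_smult by (auto simp: F_sub_def subset_iff)
  interpret D: dense_algebra_isometry FU AU A \<iota>U \<iota>
  proof (intro dense_algebra_isometry.intro dense_isometry.intro dense_map.intro
      dense_map_axioms.intro dense_isometry_axioms.intro dense_algebra_isometry_axioms.intro
      FA.A.banach_space_axioms FAU.A.banach_space_axioms FA.A.banach_algebra_axioms FAU.A.banach_algebra_axioms lin)
    show "seminormed_space FU" unfolding F_sub_def by (rule normed_space.axioms(1)[OF normed_space_F])
    show "\<iota>U \<in> linear_maps FU AU" using FAU.\<iota>_linear by (simp add: F_sub_def)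
    show "nclosure AU (\<iota>U ` carrier FU) = carrier AU" using FAU.\<iota>_dense by (simp add: F_sub_def)
    fix b assume b: "b \<in> carrier FU"
    then show "nrm A (\<iota> b) = nrm AU (\<iota>U b)"
      using FA.\<iota>_norm[of b] FAU.\<iota>_norm[of b] concrete_norm_U[OF b] FU_subset by (auto simp: F_sub_def)
    then show "nrm A (\<iota> b) \<le> nrm AU (\<iota>U b)" by simp
    fix c assume c: "c \<in> carrier FU"
    show "b \<otimes>\<^bsub>FU\<^esub> c \<in> carrier FU" using Uact.F_mult[of b c] b c by (simp add: F_sub_def)
    show "\<iota>U (b \<otimes>\<^bsub>FU\<^esub> c) = \<iota>U b \<otimes>\<^bsub>AU\<^esub> \<iota>U c" using FAU.\<iota>_mult[of b c] b c by (simp add: F_sub_def)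
    show "\<iota> (b \<otimes>\<^bsub>FU\<^esub> c) = \<iota> b \<otimes>\<^bsub>A\<^esub> \<iota> c"
      using FA.\<iota>_mult[of b c] b c FU_subset by (auto simp: mult_FU)
  qed
  show thesis
    by (rule that[of D.extension]) (simp_all add: D.extension_isometric_hom D.extension_\<iota> D.extension_image)
qed

text \<open>The quotient and \<open>AY\<close> are completions of the same algebra in the same
  norm.\<close>

lemma quotient_isometry:
  fixes AY :: "'d cnormed"
  assumes AY: "is_completion FY NY AY \<iota>Y"
  obtains \<Phi> where "\<Phi> \<in> isometric_iso (nquot A I) AY"
    "\<And>b. b \<in> carrier F \<Longrightarrow> \<Phi> (I +>\<^bsub>A\<^esub> \<iota> b) = \<iota>Y (restrict_fun Y b)"
proof -
  interpret FQ: F_completion G "subtopology X Y" "restrict_action \<phi> Y" "restrict_twist u Y" "nquot A I" \<iota>Q NY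
    using P completion_Q unfolding F_sub_def by (rule Yact.F_completion_concrete)
  interpret FAY: F_completion G "subtopology X Y" "restrict_action \<phi> Y" "restrict_twist u Y" AY \<iota>Y NY
    using P AY unfolding F_sub_def by (rule Yact.F_completion_concrete)
  interpret D: dense_algebra_isometry "F_alg G (subtopology X Y) (restrict_action \<phi> Y) (restrict_twist u Y)"
    "nquot A I" AY \<iota>Q \<iota>Y
  proof (intro dense_algebra_isometry.intro dense_isometry.intro dense_map.intro
      dense_map_axioms.intro dense_isometry_axioms.intro dense_algebra_isometry_axioms.intro
      FQ.A.banach_space_axioms FAY.A.banach_space_axioms FQ.A.banach_algebra_axioms FAY.A.banach_algebra_axioms
      FQ.\<iota>_linear FAY.\<iota>_linear FQ.\<iota>_dense)
    show "seminormed_space (F_alg G (subtopology X Y) (restrict_action \<phi> Y) (restrict_twist u Y))"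
      by (rule normed_space.axioms(1)[OF normed_space_F])
  qed (simp_all add: FQ.\<iota>_norm FAY.\<iota>_norm FQ.\<iota>_mult FAY.\<iota>_mult Yact.F_mult)
  show thesis
  proof (rule that[of D.extension])
    show "D.extension \<in> isometric_iso (nquot A I) AY"
      by (rule D.extension_isometric_iso[OF FAY.\<iota>_dense])
    fix b assume b: "b \<in> carrier F"
    then show "D.extension (I +>\<^bsub>A\<^esub> \<iota> b) = \<iota>Y (restrict_fun Y b)"
      using D.extension_\<iota>[of "restrict_fun Y b"] restrict_mem[OF b] by (simp add: \<iota>Q_restrict F_sub_def)
  qed
qed

end


section \<open>Hermitian operators\<close>

context twisted_action begin

lemma representation_simps:
  assumes rep: "representation F E \<psi>"
  shows "b \<in> carrier F \<Longrightarrow> \<psi> b \<in> carrier (bounded_operators E)"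
    and "b \<in> carrier F \<Longrightarrow> \<psi> b \<in> linear_maps E E"
    and "\<lbrakk>a \<in> carrier F; b \<in> carrier F; \<xi> \<in> carrier E\<rbrakk>
      \<Longrightarrow> \<psi> (\<lambda>t x. a t x + b t x) \<xi> = \<psi> a \<xi> \<oplus>\<^bsub>E\<^esub> \<psi> b \<xi>"
    and "\<lbrakk>b \<in> carrier F; \<xi> \<in> carrier E\<rbrakk> \<Longrightarrow> \<psi> (\<lambda>t x. c * b t x) \<xi> = c \<odot>\<^bsub>E\<^esub> \<psi> b \<xi>"
    and "\<lbrakk>a \<in> carrier F; b \<in> carrier F; \<xi> \<in> carrier E\<rbrakk> \<Longrightarrow> \<psi> (a \<otimes>\<^bsub>F\<^esub> b) \<xi> = \<psi> a (\<psi> b \<xi>)"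
    and "b \<in> carrier F \<Longrightarrow> nrm (bounded_operators E) (\<psi> b) \<le> nrm F b"
proof -
  have hom: "\<psi> \<in> alg_hom F (bounded_operators E)" and con: "\<psi> \<in> linear_contractions F (bounded_operators E)"
    using rep by (auto simp: representation_def)
  have lin: "\<psi> \<in> linear_maps F (bounded_operators E)" using hom by (simp add: alg_hom_def)
  show "b \<in> carrier F \<Longrightarrow> \<psi> b \<in> carrier (bounded_operators E)" for b
    using linear_mapsD(1)[OF lin] .
  then show "b \<in> carrier F \<Longrightarrow> \<psi> b \<in> linear_maps E E" for b
    by (simp add: bounded_operators_def)
  show "\<psi> (\<lambda>t x. a t x + b t x) \<xi> = \<psi> a \<xi> \<oplus>\<^bsub>E\<^esub> \<psi> b \<xi>"
    if "a \<in> carrier F" "b \<in> carrier F" "\<xi> \<in> carrier E" for a b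
    using linear_mapsD(2)[OF lin that(1,2)] that(3) by (simp add: bounded_operators_def)
  show "\<psi> (\<lambda>t x. c * b t x) \<xi> = c \<odot>\<^bsub>E\<^esub> \<psi> b \<xi>" if "b \<in> carrier F" "\<xi> \<in> carrier E" for b
    using linear_mapsD(3)[OF lin that(1), of c] that(2) by (simp add: bounded_operators_def)
  show "\<psi> (a \<otimes>\<^bsub>F\<^esub> b) \<xi> = \<psi> a (\<psi> b \<xi>)"
    if "a \<in> carrier F" "b \<in> carrier F" "\<xi> \<in> carrier E" for a b
  proof -
    have "\<psi> (a \<otimes>\<^bsub>F\<^esub> b) = \<psi> a \<otimes>\<^bsub>bounded_operators E\<^esub> \<psi> b" using hom that by (simp add: alg_hom_def)
    then show ?thesis using that(3) by (simp add: bounded_operators_def compose_def)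
  qed
  show "b \<in> carrier F \<Longrightarrow> nrm (bounded_operators E) (\<psi> b) \<le> nrm F b" for b
    using con by (simp add: linear_contractions_def)
qed

end

lemma monomial_add: "monomial s (\<lambda>x. a x + b x) = (\<lambda>t x. monomial s a t x + monomial s b t x)"
  and monomial_smult: "monomial s (\<lambda>x. c * a x) = (\<lambda>t x. c * monomial s a t x)"
  and monomial_diff: "monomial s (\<lambda>x. a x - b x) = (\<lambda>t x. monomial s a t x - monomial s b t x)"
  by (auto simp: monomial_def fun_eq_iff)

lemma (in seminormed_space) norm_finsum_map_diff:
  assumes T: "T \<in> linear_maps E E" and v: "\<And>i. i < (n::nat) \<Longrightarrow> v i \<in> carrier E"
  shows "nrm E (T (\<Oplus>i\<in>{..<n}. v i) \<ominus> (\<Oplus>i\<in>{..<n}. v i)) \<le> (\<Sum>i<n. nrm E (T (v i) \<ominus> v i))"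
  using v
proof (induction n)
  case 0
  have "T \<zero> = \<zero>" by (rule linear_maps_zero[OF T]) unfold_locales
  then show ?case by simp
next
  case (Suc n)
  let ?s = "\<Oplus>i\<in>{..<n}. v i"
  have m: "v n \<in> carrier E" "?s \<in> carrier E" using Suc.prems by (auto intro!: M.finsum_closed)
  have eq: "(\<Oplus>i\<in>{..<Suc n}. v i) = v n \<oplus> ?s"
    unfolding lessThan_Suc using Suc.prems by (subst M.finsum_insert) auto
  have "nrm E (T (v n \<oplus> ?s) \<ominus> (v n \<oplus> ?s)) \<le> nrm E (T (v n) \<ominus> v n) + nrm E (T ?s \<ominus> ?s)"
    using m linear_mapsD[OF T] by (simp add: norm_add_diff)
  then show ?case using Suc.IH Suc.prems unfolding eq by (simp add: add.commute)
qed

locale F_representation = twisted_action G X \<phi> u + E: normed_space E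
  for G :: "('g, 'z) monoid_scheme" (structure) and X :: "'x topology" and \<phi> u
    and E :: "'e cnormed" +
  fixes \<psi> :: "('g \<Rightarrow> 'x \<Rightarrow> complex) \<Rightarrow> 'e \<Rightarrow> 'e"
  assumes rep: "representation (F_alg G X \<phi> u) E \<psi>"
    and nondeg: "nondegenerate (F_alg G X \<phi> u) E \<psi>"
begin

lemmas \<psi>_simps = representation_simps[OF rep]

lemma \<psi>_mem: "b \<in> carrier F \<Longrightarrow> \<xi> \<in> carrier E \<Longrightarrow> \<psi> b \<xi> \<in> carrier E"
  using linear_mapsD(1)[OF \<psi>_simps(2)] .

lemma \<psi>_diff: "\<lbrakk>a \<in> carrier F; b \<in> carrier F; \<xi> \<in> carrier E\<rbrakk>
    \<Longrightarrow> \<psi> (\<lambda>t x. a t x - b t x) \<xi> = \<psi> a \<xi> \<ominus>\<^bsub>E\<^esub> \<psi> b \<xi>"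
  using \<psi>_simps(3)[of a "\<lambda>t x. (-1) * b t x" \<xi>] \<psi>_simps(4)[of b \<xi> "-1"] F_smult(1)[of b G X \<phi> u "-1"]
  by (simp add: E.diff_eq_smult \<psi>_mem)

lemma \<psi>_norm: "b \<in> carrier F \<Longrightarrow> \<xi> \<in> carrier E \<Longrightarrow> nrm E (\<psi> b \<xi>) \<le> nrm F b * nrm E \<xi>"
  using E.operator_norm_bound[OF \<psi>_simps(1), of b \<xi>] \<psi>_simps(6)[of b] E.norm_nonneg[of \<xi>]
  by (meson mult_right_mono order_trans)

definition \<pi> :: "('x \<Rightarrow> complex) \<Rightarrow> 'e \<Rightarrow> 'e" where "\<pi> a = \<psi> (monomial \<one> a)"

lemma monomial_one_mem: "a \<in> carrier (C0 X) \<Longrightarrow> monomial \<one> a \<in> carrier F"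
  by (rule monomial_mem(1)) auto

lemma \<pi>_mem: "a \<in> carrier (C0 X) \<Longrightarrow> \<xi> \<in> carrier E \<Longrightarrow> \<pi> a \<xi> \<in> carrier E"
  unfolding \<pi>_def by (intro \<psi>_mem monomial_one_mem)

lemma \<pi>_linear: "a \<in> carrier (C0 X) \<Longrightarrow> \<pi> a \<in> linear_maps E E"
  unfolding \<pi>_def by (intro \<psi>_simps(2) monomial_one_mem)

lemma \<pi>_add: "\<lbrakk>a \<in> carrier (C0 X); b \<in> carrier (C0 X); \<xi> \<in> carrier E\<rbrakk>
    \<Longrightarrow> \<pi> (\<lambda>x. a x + b x) \<xi> = \<pi> a \<xi> \<oplus>\<^bsub>E\<^esub> \<pi> b \<xi>"
  unfolding \<pi>_def monomial_add by (intro \<psi>_simps(3) monomial_one_mem)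

lemma \<pi>_smult: "\<lbrakk>a \<in> carrier (C0 X); \<xi> \<in> carrier E\<rbrakk> \<Longrightarrow> \<pi> (\<lambda>x. c * a x) \<xi> = c \<odot>\<^bsub>E\<^esub> \<pi> a \<xi>"
  unfolding \<pi>_def monomial_smult by (intro \<psi>_simps(4) monomial_one_mem)

lemma \<pi>_norm: "a \<in> carrier (C0 X) \<Longrightarrow> \<xi> \<in> carrier E \<Longrightarrow> nrm E (\<pi> a \<xi>) \<le> nrm (C0 X) a * nrm E \<xi>"
  unfolding \<pi>_def using \<psi>_norm[OF monomial_one_mem, of a \<xi>] monomial_mem(2)[of \<one> G a X \<phi> u] by simp

lemma \<pi>_\<psi>: "\<lbrakk>a \<in> carrier (C0 X); b \<in> carrier F; \<xi> \<in> carrier E\<rbrakk>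
    \<Longrightarrow> \<pi> a (\<psi> b \<xi>) = \<psi> (\<lambda>r x. a x * b r x) \<xi>"
  unfolding \<pi>_def using \<psi>_simps(5)[OF monomial_one_mem, of a b \<xi>] monomial_one_mult[of b a] by simp

lemma \<pi>_mult: "\<lbrakk>a \<in> carrier (C0 X); b \<in> carrier (C0 X); \<xi> \<in> carrier E\<rbrakk>
    \<Longrightarrow> \<pi> a (\<pi> b \<xi>) = \<pi> (\<lambda>x. a x * b x) \<xi>"
proof -
  assume ab: "a \<in> carrier (C0 X)" "b \<in> carrier (C0 X)" "\<xi> \<in> carrier E"
  have "(\<lambda>r x. a x * monomial \<one> b r x) = monomial \<one> (\<lambda>x. a x * b x)" by (auto simp: monomial_def fun_eq_iff)
  then show ?thesis using \<pi>_\<psi>[OF ab(1) monomial_one_mem[OF ab(2)] ab(3)] by (simp add: \<pi>_def)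
qed

text \<open>Non-degeneracy enters here: f is close to a finite sum of vectors \<psi>(b_i)\<xi>_i, on
  which \<pi>(e) is nearly the identity, and ||e|| \<le> 1 carries the estimate back to f.\<close>

lemma approximate_unit:
  assumes f: "f \<in> carrier E" and \<delta>: "\<delta> > 0"
  obtains e where "e \<in> carrier (C0 X)" "\<And>x. \<exists>r. 0 \<le> r \<and> r \<le> 1 \<and> e x = complex_of_real r"
    "nrm E (\<pi> e f \<ominus>\<^bsub>E\<^esub> f) < \<delta>"
proof -
  let ?V = "{\<Oplus>\<^bsub>E\<^esub>i\<in>{..<n}. \<psi> (b i) (\<xi> i) | (n::nat) b \<xi>.
       b \<in> {..<n} \<rightarrow> carrier F \<and> \<xi> \<in> {..<n} \<rightarrow> carrier E}"
  have V: "?V \<subseteq> carrier E" by (auto intro!: E.M.finsum_closed \<psi>_mem simp: Pi_iff)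
  have "f \<in> nclosure E ?V" using nondeg f by (simp add: nondegenerate_def)
  then obtain y where y: "y \<in> ?V" "nrm E (f \<ominus>\<^bsub>E\<^esub> y) < \<delta>/3"
    using \<delta> unfolding E.mem_nclosure_iff[OF V] by (meson divide_pos_pos zero_less_numeral)
  then obtain n :: nat and b \<xi> where yy: "y = (\<Oplus>\<^bsub>E\<^esub>i\<in>{..<n}. \<psi> (b i) (\<xi> i))"
    "\<And>i. i < n \<Longrightarrow> b i \<in> carrier F" "\<And>i. i < n \<Longrightarrow> \<xi> i \<in> carrier E" by (auto simp: Pi_iff)
  \<comment> \<open>The errors add up to at most \<delta>/(3K) times K - 1, which is below
    \<delta>/3; adding 1 covers the case where all norms vanish.\<close>
  define K where "K = (\<Sum>i<n. nrm E (\<xi> i)) + 1"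
  have K: "K > 0" using yy(3) by (auto simp: K_def intro!: add_nonneg_pos sum_nonneg E.norm_nonneg)
  obtain e where e: "e \<in> carrier (C0 X)" "nrm (C0 X) e \<le> 1" "\<And>x. \<exists>r. 0 \<le> r \<and> r \<le> 1 \<and> e x = complex_of_real r"
    and eb: "\<And>i. i \<in> {..<n} \<Longrightarrow> nrm F (\<lambda>t x. b i t x - (monomial \<one> e \<otimes>\<^bsub>F\<^esub> b i) t x) < \<delta> / (3 * K)"
    by (rule approximate_unit_left[of "{..<n}" b "\<delta> / (3 * K)"]) (use yy(2) \<delta> K in auto)
  have yE: "y \<in> carrier E" using y(1) V by blast
  have ei: "nrm E (\<pi> e (\<psi> (b i) (\<xi> i)) \<ominus>\<^bsub>E\<^esub> \<psi> (b i) (\<xi> i)) \<le> \<delta> / (3 * K) * nrm E (\<xi> i)" if i: "i < n" for i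
  proof -
    have bF: "b i \<in> carrier F" "\<xi> i \<in> carrier E" using yy i by auto
    have ebF: "monomial \<one> e \<otimes>\<^bsub>F\<^esub> b i \<in> carrier F" by (intro F_mult monomial_one_mem e(1) bF)
    have "\<pi> e (\<psi> (b i) (\<xi> i)) = \<psi> (monomial \<one> e \<otimes>\<^bsub>F\<^esub> b i) (\<xi> i)"
      using \<pi>_\<psi>[OF e(1) bF] by (simp add: monomial_one_mult[OF bF(1)])
    then have "nrm E (\<pi> e (\<psi> (b i) (\<xi> i)) \<ominus>\<^bsub>E\<^esub> \<psi> (b i) (\<xi> i))
        = nrm E (\<psi> (\<lambda>t x. b i t x - (monomial \<one> e \<otimes>\<^bsub>F\<^esub> b i) t x) (\<xi> i))"
      using \<psi>_diff[OF bF(1) ebF bF(2)] E.norm_diff_commute \<psi>_mem ebF bF by simp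
    also have "\<dots> \<le> nrm F (\<lambda>t x. b i t x - (monomial \<one> e \<otimes>\<^bsub>F\<^esub> b i) t x) * nrm E (\<xi> i)"
      by (intro \<psi>_norm F_diff bF ebF)
    also have "\<dots> \<le> \<delta> / (3 * K) * nrm E (\<xi> i)"
      using eb[of i] i by (intro mult_right_mono E.norm_nonneg bF) auto
    finally show ?thesis .
  qed
  have "nrm E (\<pi> e y \<ominus>\<^bsub>E\<^esub> y) \<le> (\<Sum>i<n. nrm E (\<pi> e (\<psi> (b i) (\<xi> i)) \<ominus>\<^bsub>E\<^esub> \<psi> (b i) (\<xi> i)))"
    unfolding yy(1) using yy(2,3) by (intro E.norm_finsum_map_diff \<pi>_linear e(1) \<psi>_mem) auto
  also have "\<dots> \<le> (\<Sum>i<n. \<delta> / (3 * K) * nrm E (\<xi> i))" using ei by (intro sum_mono) auto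
  also have "\<dots> = \<delta> / (3 * K) * (K - 1)" by (simp add: K_def sum_distrib_left)
  also have "\<dots> < \<delta>/3" using K \<delta> by (simp add: field_simps)
  finally have 1: "nrm E (\<pi> e y \<ominus>\<^bsub>E\<^esub> y) < \<delta>/3" .
  have 2: "nrm E (\<pi> e f \<ominus>\<^bsub>E\<^esub> \<pi> e y) < \<delta>/3"
  proof -
    have "nrm E (\<pi> e f \<ominus>\<^bsub>E\<^esub> \<pi> e y) = nrm E (\<pi> e (f \<ominus>\<^bsub>E\<^esub> y))"
      using linear_maps_diff[OF \<pi>_linear[OF e(1)] E.seminormed_space_axioms E.seminormed_space_axioms f yE] by simp
    also have "\<dots> \<le> nrm (C0 X) e * nrm E (f \<ominus>\<^bsub>E\<^esub> y)" using f yE by (intro \<pi>_norm e(1)) auto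
    also have "\<dots> \<le> 1 * nrm E (f \<ominus>\<^bsub>E\<^esub> y)" using f yE e(2) by (intro mult_right_mono E.norm_nonneg) auto
    finally show ?thesis using y(2) by simp
  qed
  have "nrm E (\<pi> e f \<ominus>\<^bsub>E\<^esub> f) \<le> nrm E (\<pi> e f \<ominus>\<^bsub>E\<^esub> \<pi> e y) + nrm E (\<pi> e y \<ominus>\<^bsub>E\<^esub> f)"
    using \<pi>_mem[OF e(1)] f yE by (intro E.norm_diff_triangle) auto
  moreover have "nrm E (\<pi> e y \<ominus>\<^bsub>E\<^esub> f) \<le> nrm E (\<pi> e y \<ominus>\<^bsub>E\<^esub> y) + nrm E (y \<ominus>\<^bsub>E\<^esub> f)"
    using \<pi>_mem[OF e(1)] f yE by (intro E.norm_diff_triangle) auto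
  ultimately have "nrm E (\<pi> e f \<ominus>\<^bsub>E\<^esub> f) < \<delta>"
    using 1 2 y(2) E.norm_diff_commute[OF f yE] by simp
  then show thesis using that[OF e(1,3)] by blast
qed

text \<open>Real functions act by Hermitian operators; only this infinitesimal form is needed.\<close>

lemma hermitian_bound:
  assumes a: "a \<in> carrier (C0 X)" and real: "\<And>x. a x \<in> \<real>" and f: "f \<in> carrier E"
  shows "nrm E (f \<oplus>\<^bsub>E\<^esub> (\<i> * complex_of_real t) \<odot>\<^bsub>E\<^esub> \<pi> a f) \<le> sqrt (1 + t\<^sup>2 * (nrm (C0 X) a)\<^sup>2) * nrm E f"
proof (rule field_le_epsilon)
  fix \<epsilon> :: real assume "\<epsilon> > 0"
  let ?c = "\<i> * complex_of_real t"
  \<comment> \<open>Replacing f by \<pi>(e)f costs its distance to f once directly and |t| ||a||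
    times through \<pi>(a).\<close>
  define D where "D = 1 + \<bar>t\<bar> * nrm (C0 X) a"
  have D: "D > 0" using C0_norm_nonneg[OF a] by (simp add: D_def add_pos_nonneg)
  obtain e where e: "e \<in> carrier (C0 X)" "\<And>x. \<exists>r. 0 \<le> r \<and> r \<le> 1 \<and> e x = complex_of_real r"
    "nrm E (\<pi> e f \<ominus>\<^bsub>E\<^esub> f) < \<epsilon> / D"
    by (rule approximate_unit[OF f, of "\<epsilon> / D"]) (use \<open>\<epsilon> > 0\<close> D in auto)
  \<comment> \<open>The function 1 + i t a need not be in C0(X); multiplied by e it is, and |h| = e
    |1 + i t a| stays below sqrt(1 + t^2 ||a||^2) because a is real and 0 \<le> e \<le> 1.\<close>
  define h where "h x = e x + ?c * (a x * e x)" for x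
  have ae: "(\<lambda>x. a x * e x) \<in> carrier (C0 X)" using a e(1) by simp
  have h: "h \<in> carrier (C0 X)" unfolding h_def using ae e(1) by (intro C0_add C0_smult)
  have "nrm (C0 X) h \<le> sqrt (1 + t\<^sup>2 * (nrm (C0 X) a)\<^sup>2)"
  proof (rule C0_norm_le[OF h])
    fix x
    obtain r where r: "0 \<le> r" "r \<le> 1" "e x = complex_of_real r" using e(2) by blast
    obtain s where s: "a x = complex_of_real s" using real[of x] by (auto elim: Reals_cases)
    have "\<bar>s\<bar> \<le> nrm (C0 X) a" using C0_le_norm[OF a, of x] s by simp
    then have s2: "s\<^sup>2 \<le> (nrm (C0 X) a)\<^sup>2" by (metis abs_ge_zero power_mono power2_abs)
    have "h x = complex_of_real r * Complex 1 (t * s)" using r(3) s by (simp add: h_def complex_eq_iff)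
    then have "cmod (h x) = r * sqrt (1 + t\<^sup>2 * s\<^sup>2)"
      using r(1) by (simp add: norm_mult complex_norm power_mult_distrib)
    also have "\<dots> \<le> 1 * sqrt (1 + t\<^sup>2 * (nrm (C0 X) a)\<^sup>2)"
      using r s2 by (intro mult_mono) (auto intro!: mult_left_mono)
    finally show "cmod (h x) \<le> sqrt (1 + t\<^sup>2 * (nrm (C0 X) a)\<^sup>2)" by simp
  qed simp
  then have 1: "nrm E (\<pi> h f) \<le> sqrt (1 + t\<^sup>2 * (nrm (C0 X) a)\<^sup>2) * nrm E f"
    by (intro order_trans[OF \<pi>_norm[OF h f]] mult_right_mono E.norm_nonneg f)
  have hf: "\<pi> h f = \<pi> e f \<oplus>\<^bsub>E\<^esub> ?c \<odot>\<^bsub>E\<^esub> \<pi> a (\<pi> e f)"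
    unfolding h_def using \<pi>_add[OF e(1) C0_smult[OF ae] f] \<pi>_smult[OF ae f] \<pi>_mult[OF a e(1) f] by simp
  have m: "\<pi> e f \<in> carrier E" "\<pi> a f \<in> carrier E" "\<pi> a (\<pi> e f) \<in> carrier E"
    using \<pi>_mem a e(1) f by auto
  have "nrm E (\<pi> a (\<pi> e f) \<ominus>\<^bsub>E\<^esub> \<pi> a f) \<le> nrm (C0 X) a * nrm E (\<pi> e f \<ominus>\<^bsub>E\<^esub> f)"
    using linear_maps_diff[OF \<pi>_linear[OF a] E.seminormed_space_axioms E.seminormed_space_axioms m(1) f]
      \<pi>_norm[OF a, of "\<pi> e f \<ominus>\<^bsub>E\<^esub> f"] m(1) f by simp
  then have "cmod ?c * nrm E (\<pi> a (\<pi> e f) \<ominus>\<^bsub>E\<^esub> \<pi> a f) \<le> \<bar>t\<bar> * (nrm (C0 X) a * nrm E (\<pi> e f \<ominus>\<^bsub>E\<^esub> f))"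
    by (simp add: norm_mult mult_left_mono)
  moreover have "nrm E (\<pi> h f \<ominus>\<^bsub>E\<^esub> (f \<oplus>\<^bsub>E\<^esub> ?c \<odot>\<^bsub>E\<^esub> \<pi> a f)) \<le>
      nrm E (\<pi> e f \<ominus>\<^bsub>E\<^esub> f) + nrm E (?c \<odot>\<^bsub>E\<^esub> \<pi> a (\<pi> e f) \<ominus>\<^bsub>E\<^esub> ?c \<odot>\<^bsub>E\<^esub> \<pi> a f)"
    unfolding hf using m f by (intro E.norm_add_diff) auto
  moreover have "nrm E (?c \<odot>\<^bsub>E\<^esub> \<pi> a (\<pi> e f) \<ominus>\<^bsub>E\<^esub> ?c \<odot>\<^bsub>E\<^esub> \<pi> a f) = cmod ?c * nrm E (\<pi> a (\<pi> e f) \<ominus>\<^bsub>E\<^esub> \<pi> a f)"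
    using m by (intro E.norm_diff_smult) auto
  ultimately have "nrm E (\<pi> h f \<ominus>\<^bsub>E\<^esub> (f \<oplus>\<^bsub>E\<^esub> ?c \<odot>\<^bsub>E\<^esub> \<pi> a f)) \<le> D * nrm E (\<pi> e f \<ominus>\<^bsub>E\<^esub> f)"
    by (simp add: D_def algebra_simps)
  also have "\<dots> \<le> \<epsilon>" using e(3) D by (simp add: field_simps)
  finally have 2: "nrm E (\<pi> h f \<ominus>\<^bsub>E\<^esub> (f \<oplus>\<^bsub>E\<^esub> ?c \<odot>\<^bsub>E\<^esub> \<pi> a f)) \<le> \<epsilon>" .
  have hm: "\<pi> h f \<in> carrier E" using \<pi>_mem[OF h f] .
  have fm: "f \<oplus>\<^bsub>E\<^esub> ?c \<odot>\<^bsub>E\<^esub> \<pi> a f \<in> carrier E" using m f by auto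
  show "nrm E (f \<oplus>\<^bsub>E\<^esub> ?c \<odot>\<^bsub>E\<^esub> \<pi> a f) \<le> sqrt (1 + t\<^sup>2 * (nrm (C0 X) a)\<^sup>2) * nrm E f + \<epsilon>"
    using E.norm_le_add_diff[OF fm hm] E.norm_diff_commute[OF fm hm] 1 2 by simp
qed

lemma \<psi>_zero: "\<xi> \<in> carrier E \<Longrightarrow> \<psi> (\<lambda>t x. 0) \<xi> = \<zero>\<^bsub>E\<^esub>"
  using \<psi>_simps(4)[of "\<lambda>t x. 0" \<xi> 0] \<psi>_mem[of "\<lambda>t x. 0" \<xi>] by simp

lemma truncate_insert:
  assumes "s \<notin> S"
  shows "(\<lambda>t x. if t \<in> insert s S then b t x else 0) =
    (\<lambda>t x. monomial s (b s) t x + (if t \<in> S then b t x else 0))"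
  using assms by (auto simp: monomial_def fun_eq_iff)

lemma norm_\<psi>_truncate:
  assumes b: "b \<in> carrier F" and f: "f \<in> carrier E" and S: "finite S" "S \<subseteq> carrier G"
  shows "nrm E (\<psi> (\<lambda>t x. if t \<in> S then b t x else 0) f) \<le> (\<Sum>t\<in>S. nrm E (\<psi> (monomial t (b t)) f))"
  using S
proof (induction S rule: finite_induct)
  case empty
  then show ?case using \<psi>_zero[OF f] by simp
next
  case (insert s S)
  have m: "monomial s (b s) \<in> carrier F" using insert.prems by (intro monomial_mem(1) F_D(1)[OF b]) auto
  have "\<psi> (\<lambda>t x. if t \<in> insert s S then b t x else 0) f
      = \<psi> (monomial s (b s)) f \<oplus>\<^bsub>E\<^esub> \<psi> (\<lambda>t x. if t \<in> S then b t x else 0) f"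
    unfolding truncate_insert[OF insert.hyps(2)] by (rule \<psi>_simps(3)[OF m F_truncate[OF b] f])
  then have "nrm E (\<psi> (\<lambda>t x. if t \<in> insert s S then b t x else 0) f)
      \<le> nrm E (\<psi> (monomial s (b s)) f) + nrm E (\<psi> (\<lambda>t x. if t \<in> S then b t x else 0) f)"
    using E.norm_triangle[OF \<psi>_mem[OF m f] \<psi>_mem[OF F_truncate[OF b] f]] by simp
  then show ?case using insert by simp
qed

lemma \<alpha>_inverse: "t \<in> carrier G \<Longrightarrow> a \<in> carrier (C0 X) \<Longrightarrow> \<alpha> t (\<alpha> (inv t) a) = a"
  using C0_D(3)[of a X] by (auto simp: dual_action_def fun_eq_iff \<phi>_mem)

text \<open>Up to a small error a\<delta>_t is the product of e\<delta>_t and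
  \<alpha>_{t^{-1}}(a)\<delta>_1, with ||e\<delta>_t|| \<le> 1. Moving the coefficient to the right
  of \<delta>_t applies \<alpha>_{t^{-1}} to it; this is the origin of the argument \<phi>_t(x) in
  the norm on L1-spaces.\<close>

lemma norm_\<psi>_monomial:
  assumes t: "t \<in> carrier G" and a: "a \<in> carrier (C0 X)" and f: "f \<in> carrier E"
  shows "nrm E (\<psi> (monomial t a) f) \<le> nrm E (\<pi> (\<alpha> (inv t) a) f)"
proof (rule field_le_epsilon)
  fix \<epsilon> :: real assume "\<epsilon> > 0"
  define \<eta> where "\<eta> = \<epsilon> / (nrm E f + 1)"
  have f0: "0 \<le> nrm E f" using f by (rule E.norm_nonneg)
  have \<eta>: "\<eta> > 0" "\<eta> * nrm E f \<le> \<epsilon>" using \<open>\<epsilon> > 0\<close> f0 by (auto simp: \<eta>_def field_simps)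
  define e where "e = (\<lambda>x. complex_of_real (cmod (a x) / (cmod (a x) + \<eta>)))"
  note e = C0_approximate_unit[OF C0_cmod[OF a] norm_ge_zero \<eta>(1), folded e_def]
  have ae: "(\<lambda>x. a x * e x) \<in> carrier (C0 X)" using a e(1) by simp
  have d: "(\<lambda>x. a x - a x * e x) \<in> carrier (C0 X)" using a ae by (rule C0_diff)
  have dn: "nrm (C0 X) (\<lambda>x. a x - a x * e x) \<le> \<eta>"
    using e(5) \<eta>(1) by (intro C0_norm_le[OF d]) (auto simp: e_def)
  have ai: "\<alpha> (inv t) a \<in> carrier (C0 X)" using \<alpha>_mem(1)[OF a] t by simp
  have "monomial t e \<otimes>\<^bsub>F\<^esub> monomial \<one> (\<alpha> (inv t) a) = monomial (t \<otimes> \<one>) (\<lambda>x. e x * \<alpha> t (\<alpha> (inv t) a) x * u t \<one> x)"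
    using t by (intro monomial_mult_monomial) auto
  also have "(\<lambda>x. e x * \<alpha> t (\<alpha> (inv t) a) x * u t \<one> x) = (\<lambda>x. a x * e x)"
    using u_one_right[OF t] C0_D(3)[OF a] unfolding \<alpha>_inverse[OF t a]
    by (auto simp: fun_eq_iff)
  finally have mm: "monomial t e \<otimes>\<^bsub>F\<^esub> monomial \<one> (\<alpha> (inv t) a) = monomial t (\<lambda>x. a x * e x)" using t by simp
  have te: "monomial t e \<in> carrier F" using t e(1) by (rule monomial_mem(1))
  have "nrm E (\<psi> (monomial t (\<lambda>x. a x * e x)) f) = nrm E (\<psi> (monomial t e) (\<pi> (\<alpha> (inv t) a) f))"
    using \<psi>_simps(5)[OF te monomial_one_mem[OF ai] f] by (simp add: mm \<pi>_def)
  also have "\<dots> \<le> nrm F (monomial t e) * nrm E (\<pi> (\<alpha> (inv t) a) f)"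
    by (intro \<psi>_norm te \<pi>_mem ai f)
  also have "\<dots> \<le> 1 * nrm E (\<pi> (\<alpha> (inv t) a) f)"
    using monomial_mem(2)[OF t e(1)] e(2) by (intro mult_right_mono E.norm_nonneg \<pi>_mem ai f) auto
  finally have 1: "nrm E (\<psi> (monomial t (\<lambda>x. a x * e x)) f) \<le> nrm E (\<pi> (\<alpha> (inv t) a) f)" by simp
  have ta: "monomial t a \<in> carrier F" "monomial t (\<lambda>x. a x * e x) \<in> carrier F"
    using t a ae by (auto intro: monomial_mem(1))
  have "nrm E (\<psi> (monomial t a) f \<ominus>\<^bsub>E\<^esub> \<psi> (monomial t (\<lambda>x. a x * e x)) f)
      = nrm E (\<psi> (monomial t (\<lambda>x. a x - a x * e x)) f)"
    unfolding monomial_diff using \<psi>_diff[OF ta f] by simp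
  also have "\<dots> \<le> nrm F (monomial t (\<lambda>x. a x - a x * e x)) * nrm E f"
    by (intro \<psi>_norm monomial_mem(1) t d f)
  also have "\<dots> \<le> \<eta> * nrm E f"
    using monomial_mem(2)[OF t d] dn f0 by (intro mult_right_mono) auto
  finally show "nrm E (\<psi> (monomial t a) f) \<le> nrm E (\<pi> (\<alpha> (inv t) a) f) + \<epsilon>"
    using E.norm_le_add_diff[OF \<psi>_mem[OF ta(1) f] \<psi>_mem[OF ta(2) f]] 1 \<eta>(2) by simp
qed

text \<open>Elements of finite support are dense in the l1-norm, for which \<psi> is
  contractive.\<close>

lemma norm_\<psi>_le_truncated:
  assumes b: "b \<in> carrier F" and f: "f \<in> carrier E" and C: "0 \<le> C"
    and le: "\<And>S. finite S \<Longrightarrow> S \<subseteq> carrier G \<Longrightarrow> nrm E (\<psi> (\<lambda>t x. if t \<in> S then b t x else 0) f) \<le> C"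
  shows "nrm E (\<psi> b f) \<le> C"
proof (rule field_le_epsilon)
  fix \<epsilon> :: real assume "\<epsilon> > 0"
  have f0: "0 \<le> nrm E f" using f by (rule E.norm_nonneg)
  have "\<epsilon> / (nrm E f + 1) > 0" using \<open>\<epsilon> > 0\<close> f0 by simp
  then obtain S where S: "finite S" "S \<subseteq> carrier G"
    "nrm F (\<lambda>t x. b t x - (if t \<in> S then b t x else 0)) < \<epsilon> / (nrm E f + 1)"
    by (rule F_finite_approx[OF b])
  note tr = F_truncate[OF b, of S]
  have "nrm E (\<psi> b f \<ominus>\<^bsub>E\<^esub> \<psi> (\<lambda>t x. if t \<in> S then b t x else 0) f) \<le>
      nrm F (\<lambda>t x. b t x - (if t \<in> S then b t x else 0)) * nrm E f"
    using \<psi>_norm[OF F_diff[OF b tr] f] \<psi>_diff[OF b tr f] by simp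
  also have "\<dots> \<le> \<epsilon> / (nrm E f + 1) * nrm E f" using S(3) f0 by (intro mult_right_mono) auto
  also have "\<dots> \<le> \<epsilon>" using \<open>\<epsilon> > 0\<close> f0 by (simp add: field_simps)
  finally show "nrm E (\<psi> b f) \<le> C + \<epsilon>"
    using E.norm_le_add_diff[OF \<psi>_mem[OF b f] \<psi>_mem[OF tr f]] le[OF S(1,2)] by simp
qed

text \<open>\<open>L\<close> is what remains to be proved about the space E. Applied to a_t =
  \<alpha>_{t^{-1}}(b(t)), whose values are b(t)(\<phi>_t(x)), it bounds the sum of the norms of the
  terms by the column sums; elements of finite support suffice.\<close>

lemma operator_norm_le_column_norm:
  assumes L: "\<And>(S :: 'g set) a C f. \<lbrakk>finite S; \<And>j. j \<in> S \<Longrightarrow> a j \<in> carrier (C0 X); f \<in> carrier E; 0 \<le> C;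
      \<And>x. x \<in> topspace X \<Longrightarrow> (\<Sum>j\<in>S. cmod (a j x)) \<le> C\<rbrakk> \<Longrightarrow> (\<Sum>j\<in>S. nrm E (\<pi> (a j) f)) \<le> C * nrm E f"
    and b: "b \<in> carrier F"
  shows "nrm (bounded_operators E) (\<psi> b) \<le> column_norm G X \<phi> b"
proof (rule operator_norm_le)
  interpret H: homeomorphism_family G X \<phi> using homeomorphism by unfold_locales
  show C: "0 \<le> column_norm G X \<phi> b" by (rule H.column_norm_nonneg[OF b])
  fix f assume f: "f \<in> carrier E"
  show "nrm E (\<psi> b f) \<le> column_norm G X \<phi> b * nrm E f"
  proof (rule norm_\<psi>_le_truncated[OF b f])
    show "0 \<le> column_norm G X \<phi> b * nrm E f" using C E.norm_nonneg[OF f] by simp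
    fix S assume S: "finite S" "S \<subseteq> carrier G"
    have "nrm E (\<psi> (\<lambda>t x. if t \<in> S then b t x else 0) f) \<le> (\<Sum>t\<in>S. nrm E (\<psi> (monomial t (b t)) f))"
      by (rule norm_\<psi>_truncate[OF b f S])
    also have "\<dots> \<le> (\<Sum>t\<in>S. nrm E (\<pi> (\<alpha> (inv t) (b t)) f))"
      using S by (intro sum_mono norm_\<psi>_monomial F_D(1)[OF b] f) auto
    also have "\<dots> \<le> column_norm G X \<phi> b * nrm E f"
    proof (rule L[OF S(1) _ f C])
      show "\<alpha> (inv t) (b t) \<in> carrier (C0 X)" if "t \<in> S" for t
        using that S by (intro \<alpha>_mem(1) F_D(1)[OF b]) auto
      fix x assume x: "x \<in> topspace X"
      have "(\<Sum>t\<in>S. cmod (\<alpha> (inv t) (b t) x)) = (\<Sum>t\<in>S. cmod (b t (\<phi> t x)))"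
        using x S by (intro sum.cong) (auto simp: dual_action_def subset_iff)
      then show "(\<Sum>t\<in>S. cmod (\<alpha> (inv t) (b t) x)) \<le> column_norm G X \<phi> b"
        using H.column_finite_sum_le[OF b x S] by simp
    qed
    finally show "nrm E (\<psi> (\<lambda>t x. if t \<in> S then b t x else 0) f) \<le> column_norm G X \<phi> b * nrm E f" .
  qed
qed

end


section \<open>Representations on \<open>C\<^sub>0\<close>-spaces\<close>

text \<open>Choosing phases that make every \<theta>_j z_j nonnegative turns the sum of moduli into
  one modulus. A bound on the operators \<pi>(\<Sum> \<theta>_j a_j), one for each choice of phases,
  thus bounds a sum of moduli.\<close>

lemma sum_cmod_le_unimodular:
  assumes "\<And>\<theta>. (\<And>j. cmod (\<theta> j) = 1) \<Longrightarrow> cmod (\<Sum>j\<in>S. \<theta> j * z j) \<le> R"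
  shows "(\<Sum>j\<in>S. cmod (z j)) \<le> R"
proof -
  \<comment> \<open>The value 1 at zeros keeps \<theta> unimodular everywhere, as sgn 0 = 0.\<close>
  define \<theta> where "\<theta> j = (if z j = 0 then 1 else cnj (sgn (z j)))" for j
  have "\<theta> j * z j = complex_of_real (cmod (z j))" for j
    by (simp add: \<theta>_def sgn_div_norm scaleR_conv_of_real complex_norm_square[symmetric] power2_eq_square field_simps)
  moreover have "cmod (\<Sum>j\<in>S. \<theta> j * z j) \<le> R" by (rule assms) (simp add: \<theta>_def norm_sgn)
  moreover have "0 \<le> (\<Sum>j\<in>S. cmod (z j))" by (intro sum_nonneg) simp
  ultimately show ?thesis by (simp flip: of_real_sum)
qed

text \<open>Divide by s and let s tend to 0. In this way a first order term is seen to vanish when a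
  bound of second order is available.\<close>

lemma eq_zero_if_le_square:
  fixes D C :: real
  assumes "0 \<le> D" "\<And>s. s > 0 \<Longrightarrow> s * D \<le> s\<^sup>2 * C"
  shows "D = 0"
proof (rule ccontr)
  assume "D \<noteq> 0"
  then have D: "D > 0" using assms(1) by simp
  define s where "s = D / (2 * (\<bar>C\<bar> + 1))"
  have s: "s > 0" using D by (simp add: s_def add_pos_nonneg)
  have "D \<le> s * C" using assms(2)[OF s] s by (simp add: power2_eq_square)
  also have "\<dots> \<le> s * (\<bar>C\<bar> + 1)" using s by (intro mult_left_mono) auto
  also have "\<dots> = D/2" by (simp add: s_def field_simps)
  finally show False using D by simp
qed

lemma sqrt_one_plus_le: "0 \<le> z \<Longrightarrow> sqrt (1 + z) \<le> 1 + z"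
  by (intro real_le_lsqrt) (auto simp: power2_eq_square algebra_simps)

locale C0_representation = F_representation G X \<phi> u "C0 \<Omega>" \<psi>
  for G :: "('g, 'z) monoid_scheme" (structure) and X :: "'x topology" and \<phi> u
    and \<Omega> :: "'w topology" and \<psi>
begin

text \<open>Put v = \<pi>(a)f(\<omega>). Since f attains its norm at \<omega> with value 1, |1 + i t
  v| is at most the norm of f + i t \<pi>(a)f, which the Hermitian bound keeps at 1 up to second
  order in t. The first order term on the left is -t Im(v), for t of either sign.\<close>

lemma hermitian_value:
  assumes a: "a \<in> carrier (C0 X)" and real: "\<And>x. a x \<in> \<real>" and f: "f \<in> carrier (C0 \<Omega>)"
    and "nrm (C0 \<Omega>) f \<le> 1" "f \<omega> = 1"
  shows "Im (\<pi> a f \<omega>) = 0"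
proof -
  let ?v = "\<pi> a f \<omega>" and ?A = "nrm (C0 X) a"
  have key: "- 2 * t * Im ?v \<le> t\<^sup>2 * ?A\<^sup>2" for t
  proof -
    have m: "f \<oplus>\<^bsub>C0 \<Omega>\<^esub> (\<i> * complex_of_real t) \<odot>\<^bsub>C0 \<Omega>\<^esub> \<pi> a f \<in> carrier (C0 \<Omega>)"
      using f \<pi>_mem[OF a f] by simp
    have "cmod (1 + \<i> * complex_of_real t * ?v) \<le> nrm (C0 \<Omega>) (f \<oplus>\<^bsub>C0 \<Omega>\<^esub> (\<i> * complex_of_real t) \<odot>\<^bsub>C0 \<Omega>\<^esub> \<pi> a f)"
      using C0_le_norm[OF m, of \<omega>] assms(5) by simp
    also have "\<dots> \<le> sqrt (1 + t\<^sup>2 * ?A\<^sup>2) * nrm (C0 \<Omega>) f" by (rule hermitian_bound[OF a real f])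
    also have "\<dots> \<le> sqrt (1 + t\<^sup>2 * ?A\<^sup>2) * 1" using assms(4) by (intro mult_left_mono) auto
    finally have "(cmod (1 + \<i> * complex_of_real t * ?v))\<^sup>2 \<le> (sqrt (1 + t\<^sup>2 * ?A\<^sup>2))\<^sup>2"
      by (intro power_mono) auto
    moreover have "(cmod (1 + \<i> * complex_of_real t * ?v))\<^sup>2 = 1 - 2 * t * Im ?v + t\<^sup>2 * (Im ?v)\<^sup>2 + t\<^sup>2 * (Re ?v)\<^sup>2"
    proof -
      have "1 + \<i> * complex_of_real t * ?v = Complex (1 - t * Im ?v) (t * Re ?v)"
        by (simp add: complex_eq_iff)
      then show ?thesis unfolding cmod_power2 by (simp add: power2_eq_square algebra_simps)
    qed
    moreover have "(sqrt (1 + t\<^sup>2 * ?A\<^sup>2))\<^sup>2 = 1 + t\<^sup>2 * ?A\<^sup>2" by simp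
    moreover have "0 \<le> t\<^sup>2 * (Im ?v)\<^sup>2" "0 \<le> t\<^sup>2 * (Re ?v)\<^sup>2" by simp_all
    ultimately show ?thesis by linarith
  qed
  have "s * (2 * \<bar>Im ?v\<bar>) \<le> s\<^sup>2 * ?A\<^sup>2" if "s > 0" for s
    using key[of s] key[of "- s"] by (simp add: abs_if mult.left_commute mult.assoc)
  then have "2 * \<bar>Im ?v\<bar> = 0" by (intro eq_zero_if_le_square) auto
  then show ?thesis by simp
qed

text \<open>The topology of \<Omega> is arbitrary, so there may be few functions; a peak at \<omega>
  is made by rescaling and truncating the modulus of one that does not vanish there.\<close>

lemma peak_function:
  assumes h: "h \<in> carrier (C0 \<Omega>)" "h \<omega> \<noteq> 0"
  obtains k where "(\<lambda>y. complex_of_real (k y)) \<in> carrier (C0 \<Omega>)" "\<And>y. 0 \<le> k y \<and> k y \<le> 1" "k \<omega> = 1"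
proof -
  define g where "g y = cmod (h y) / cmod (h \<omega>)" for y
  have "(\<lambda>y. complex_of_real (inverse (cmod (h \<omega>))) * complex_of_real (cmod (h y))) \<in> carrier (C0 \<Omega>)"
    by (intro C0_smult C0_cmod h(1))
  then have g: "(\<lambda>y. complex_of_real (g y)) \<in> carrier (C0 \<Omega>)" by (simp add: g_def divide_inverse mult.commute)
  have "continuous_map \<Omega> euclideanreal (\<lambda>y. cmod (complex_of_real (g y)))"
    by (intro continuous_map_norm C0_D(1)[OF g])
  moreover have g0: "0 \<le> g y" for y by (simp add: g_def)
  ultimately have gc: "continuous_map \<Omega> euclideanreal g" by simp
  show thesis
  proof (rule that[of "\<lambda>y. min 1 (g y)"])
    show "(\<lambda>y. complex_of_real (min 1 (g y))) \<in> carrier (C0 \<Omega>)"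
    proof (rule C0_dominated[OF _ _ g])
      show "continuous_map \<Omega> euclidean (\<lambda>y. complex_of_real (min 1 (g y)))"
        by (intro continuous_map_of_real continuous_map_real_min gc) auto
      show "complex_of_real (min 1 (g y)) = 0" if "y \<notin> topspace \<Omega>" for y using C0_D(3)[OF g that] by simp
      show "cmod (complex_of_real (min 1 (g y))) \<le> cmod (complex_of_real (g y))" for y
        using g0[of y] unfolding norm_of_real by simp
    qed
  qed (use g0 h in \<open>auto simp: g_def\<close>)
qed

text \<open>The function \<open>f = k (1 - |g|)\<close> and its perturbations \<open>f + c g\<close> all attain their norm at \<open>\<omega>\<close>.\<close>

lemma local_real:
  assumes a: "a \<in> carrier (C0 X)" and real: "\<And>x. a x \<in> \<real>"
    and g: "g \<in> carrier (C0 \<Omega>)" "g \<omega> = 0"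
  shows "\<pi> a g \<omega> = 0"
proof (rule ccontr)
  assume ne: "\<pi> a g \<omega> \<noteq> 0"
  \<comment> \<open>The function \<pi>(a)g itself, assumed nonzero at \<omega>, supplies the peak
    function that leads to the contradiction.\<close>
  obtain k where k: "(\<lambda>y. complex_of_real (k y)) \<in> carrier (C0 \<Omega>)" "\<And>y. 0 \<le> k y \<and> k y \<le> 1" "k \<omega> = 1"
    by (rule peak_function[OF \<pi>_mem[OF a g(1)] ne]) blast
  define r where "r = 1 / (nrm (C0 \<Omega>) g + 1)"
  have r: "r > 0" "r * nrm (C0 \<Omega>) g \<le> 1"
    using C0_norm_nonneg[OF g(1)] by (auto simp: r_def field_simps add_pos_nonneg)
  define g' where "g' y = complex_of_real r * g y" for y
  have g': "g' \<in> carrier (C0 \<Omega>)" unfolding g'_def by (rule C0_smult[OF g(1)])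
  have g1: "cmod (g' y) \<le> 1" for y
  proof -
    have "cmod (g' y) = r * cmod (g y)" using r(1) by (simp add: g'_def norm_mult)
    also have "\<dots> \<le> r * nrm (C0 \<Omega>) g" using r(1) C0_le_norm[OF g(1)] by (intro mult_left_mono) auto
    finally show ?thesis using r(2) by simp
  qed
  define f where "f y = complex_of_real (1 - cmod (g' y)) * complex_of_real (k y)" for y
  have f: "f \<in> carrier (C0 \<Omega>)"
    unfolding f_def
  proof (rule C0_mult_bounded[OF k(1), where B = 1])
    show "continuous_map \<Omega> euclidean (\<lambda>y. complex_of_real (1 - cmod (g' y)))"
      by (intro continuous_map_of_real continuous_map_diff continuous_map_norm C0_D(1)[OF g']) simp
    show "cmod (complex_of_real (1 - cmod (g' y))) \<le> 1" for y
      unfolding norm_of_real using g1[of y] by simp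
  qed
  have Im0: "Im (\<pi> a (\<lambda>y. f y + c * g' y) \<omega>) = 0" if c: "cmod c \<le> 1" for c
  proof (rule hermitian_value[OF a real])
    show m: "(\<lambda>y. f y + c * g' y) \<in> carrier (C0 \<Omega>)" using f g' by auto
    show "nrm (C0 \<Omega>) (\<lambda>y. f y + c * g' y) \<le> 1"
    proof (rule C0_norm_le[OF m])
      fix y
      have "cmod (f y) = (1 - cmod (g' y)) * k y"
        unfolding f_def norm_mult norm_of_real using g1[of y] k(2)[of y] by simp
      also have "\<dots> \<le> (1 - cmod (g' y)) * 1" using g1[of y] k(2)[of y] by (intro mult_left_mono) auto
      finally have "cmod (f y) \<le> 1 - cmod (g' y)" by simp
      moreover have "cmod (c * g' y) \<le> cmod (g' y)"
        using mult_right_mono[OF c norm_ge_zero[of "g' y"]] by (simp add: norm_mult)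
      ultimately show "cmod (f y + c * g' y) \<le> 1" using norm_triangle_ineq[of "f y" "c * g' y"] by linarith
    qed simp
    show "f \<omega> + c * g' \<omega> = 1" using g(2) k(3) by (simp add: f_def g'_def)
  qed
  have eq: "\<pi> a (\<lambda>y. f y + c * g' y) \<omega> = \<pi> a f \<omega> + c * \<pi> a g' \<omega>" for c
    using linear_mapsD(2,3)[OF \<pi>_linear[OF a]] f g' by simp
  \<comment> \<open>The cases c = 0, 1, i: with v = \<pi>(a)g'(\<omega>) the differences give Im(v)
    = 0 and Im(i v) = Re(v) = 0.\<close>
  have "Im (\<pi> a f \<omega>) = 0" "Im (\<pi> a f \<omega> + \<pi> a g' \<omega>) = 0" "Im (\<pi> a f \<omega> + \<i> * \<pi> a g' \<omega>) = 0"
    using Im0[of 0] Im0[of 1] Im0[of \<i>] unfolding eq by simp_all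
  then have "\<pi> a g' \<omega> = 0" by (simp add: complex_eq_iff)
  moreover have "\<pi> a g' \<omega> = complex_of_real r * \<pi> a g \<omega>"
    unfolding g'_def using linear_mapsD(3)[OF \<pi>_linear[OF a] g(1)] by simp
  ultimately show False using ne r(1) by simp
qed

lemma local:
  assumes a: "a \<in> carrier (C0 X)" and g: "g \<in> carrier (C0 \<Omega>)" "g \<omega> = 0"
  shows "\<pi> a g \<omega> = 0"
proof -
  have "\<pi> (\<lambda>x. complex_of_real (Re (a x)) + \<i> * complex_of_real (Im (a x))) g \<omega>
      = \<pi> (\<lambda>x. complex_of_real (Re (a x))) g \<omega> + \<i> * \<pi> (\<lambda>x. complex_of_real (Im (a x))) g \<omega>"
    using \<pi>_add[OF C0_Re_Im(1)[OF a] C0_smult[OF C0_Re_Im(2)[OF a]] g(1), of \<i>]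
      \<pi>_smult[OF C0_Re_Im(2)[OF a] g(1), of \<i>] by simp
  also have "\<dots> = 0" using local_real[OF C0_Re_Im(1)[OF a] _ g] local_real[OF C0_Re_Im(2)[OF a] _ g] by simp
  finally show ?thesis by (simp add: complex_eq[symmetric])
qed

lemma \<pi>_sum:
  assumes "finite S" "\<And>j. j \<in> S \<Longrightarrow> a j \<in> carrier (C0 X)" "\<xi> \<in> carrier (C0 \<Omega>)"
  shows "\<pi> (\<lambda>x. \<Sum>j\<in>S. c j * a j x) \<xi> \<omega> = (\<Sum>j\<in>S. c j * \<pi> (a j) \<xi> \<omega>)"
  using assms
proof (induction S rule: finite_induct)
  case empty
  have "\<pi> (\<lambda>x. 0 * 0) \<xi> = 0 \<odot>\<^bsub>C0 \<Omega>\<^esub> \<pi> (\<lambda>x. 0) \<xi>" using empty by (intro \<pi>_smult) auto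
  then show ?case by simp
next
  case (insert s S)
  have m: "(\<lambda>x. \<Sum>j\<in>S. c j * a j x) \<in> carrier (C0 X)" "(\<lambda>x. c s * a s x) \<in> carrier (C0 X)"
    using insert.prems by auto
  show ?case using insert \<pi>_add[OF m(2,1)] \<pi>_smult[of "a s" \<xi> "c s"] by simp
qed

text \<open>By locality \<pi>(a)f(\<omega>) = f(\<omega>) \<pi>(a)k(\<omega>) for a peak function k,
  as f - f(\<omega>)k vanishes at \<omega>. So \<pi>(a) acts at \<omega> through the functional a to
  \<pi>(a)k(\<omega>) of norm at most 1, for which phases give the bound. The f_j may differ because
  they will be the vectors \<psi>(e\<delta>_t)f.\<close>

lemma pointwise_bound:
  fixes S :: "'j set"
  assumes S: "finite S" and a: "\<And>j. j \<in> S \<Longrightarrow> a j \<in> carrier (C0 X)"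
    and f: "\<And>j. j \<in> S \<Longrightarrow> f j \<in> carrier (C0 \<Omega>)" "\<And>j. j \<in> S \<Longrightarrow> nrm (C0 \<Omega>) (f j) \<le> K"
    and C: "0 \<le> C" "\<And>x. x \<in> topspace X \<Longrightarrow> (\<Sum>j\<in>S. cmod (a j x)) \<le> C" and K: "0 \<le> K"
  shows "cmod (\<Sum>j\<in>S. \<pi> (a j) (f j) \<omega>) \<le> C * K"
proof (cases "\<exists>h\<in>carrier (C0 \<Omega>). h \<omega> \<noteq> 0")
  case False
  then have "\<pi> (a j) (f j) \<omega> = 0" if "j \<in> S" for j using \<pi>_mem[OF a f(1)] that by blast
  then show ?thesis using C K by simp
next
  case True
  then obtain h where h: "h \<in> carrier (C0 \<Omega>)" "h \<omega> \<noteq> 0" by blast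
  obtain k where k: "(\<lambda>y. complex_of_real (k y)) \<in> carrier (C0 \<Omega>)" "\<And>y. 0 \<le> k y \<and> k y \<le> 1" "k \<omega> = 1"
    by (rule peak_function[OF h]) blast
  let ?k = "\<lambda>y. complex_of_real (k y)"
  have kn: "nrm (C0 \<Omega>) ?k \<le> 1" using k by (intro C0_norm_le) auto
  have eq: "\<pi> (a j) (f j) \<omega> = f j \<omega> * \<pi> (a j) ?k \<omega>" if j: "j \<in> S" for j
  proof -
    have m: "(\<lambda>y. f j y - f j \<omega> * ?k y) \<in> carrier (C0 \<Omega>)" using f(1)[OF j] k(1) by auto
    have "\<pi> (a j) (\<lambda>y. f j y - f j \<omega> * ?k y) \<omega> = 0" using k(3) by (intro local a j m) simp
    moreover have "\<pi> (a j) (f j \<ominus>\<^bsub>C0 \<Omega>\<^esub> f j \<omega> \<odot>\<^bsub>C0 \<Omega>\<^esub> ?k)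
        = \<pi> (a j) (f j) \<ominus>\<^bsub>C0 \<Omega>\<^esub> f j \<omega> \<odot>\<^bsub>C0 \<Omega>\<^esub> \<pi> (a j) ?k"
      using linear_maps_diff[OF \<pi>_linear[OF a[OF j]] seminormed_space_C0 seminormed_space_C0 f(1)[OF j] C0_smult[OF k(1)]]
        linear_mapsD(3)[OF \<pi>_linear[OF a[OF j]] k(1)] by simp
    then have "\<pi> (a j) (\<lambda>y. f j y - f j \<omega> * ?k y) \<omega> = \<pi> (a j) (f j) \<omega> - f j \<omega> * \<pi> (a j) ?k \<omega>"
      using f(1)[OF j] k(1) \<pi>_mem[OF a[OF j]] by simp
    ultimately show ?thesis by simp
  qed
  have "(\<Sum>j\<in>S. cmod (\<pi> (a j) ?k \<omega>)) \<le> C"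
  proof (rule sum_cmod_le_unimodular)
    fix \<theta> :: "'j \<Rightarrow> complex" assume \<theta>: "\<And>j. cmod (\<theta> j) = 1"
    have m: "(\<lambda>x. \<Sum>j\<in>S. \<theta> j * a j x) \<in> carrier (C0 X)" using a by auto
    have n: "nrm (C0 X) (\<lambda>x. \<Sum>j\<in>S. \<theta> j * a j x) \<le> C"
    proof (rule C0_norm_le[OF m C(1)])
      fix x assume x: "x \<in> topspace X"
      have "cmod (\<Sum>j\<in>S. \<theta> j * a j x) \<le> (\<Sum>j\<in>S. cmod (a j x))"
        using \<theta> by (intro order_trans[OF norm_sum]) (simp add: norm_mult)
      then show "cmod (\<Sum>j\<in>S. \<theta> j * a j x) \<le> C" using C(2)[OF x] by simp
    qed
    have "cmod (\<Sum>j\<in>S. \<theta> j * \<pi> (a j) ?k \<omega>) = cmod (\<pi> (\<lambda>x. \<Sum>j\<in>S. \<theta> j * a j x) ?k \<omega>)"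
      using \<pi>_sum[OF S a k(1)] by simp
    also have "\<dots> \<le> nrm (C0 \<Omega>) (\<pi> (\<lambda>x. \<Sum>j\<in>S. \<theta> j * a j x) ?k)" by (intro C0_le_norm \<pi>_mem m k(1))
    also have "\<dots> \<le> nrm (C0 X) (\<lambda>x. \<Sum>j\<in>S. \<theta> j * a j x) * nrm (C0 \<Omega>) ?k" by (intro \<pi>_norm m k(1))
    also have "\<dots> \<le> C * 1" using n kn C(1) by (intro mult_mono C0_norm_nonneg k(1)) auto
    finally show "cmod (\<Sum>j\<in>S. \<theta> j * \<pi> (a j) ?k \<omega>) \<le> C" by simp
  qed
  then have b: "(\<Sum>j\<in>S. cmod (\<pi> (a j) ?k \<omega>)) * K \<le> C * K" using K by (rule mult_right_mono)
  have "cmod (\<Sum>j\<in>S. \<pi> (a j) (f j) \<omega>) \<le> (\<Sum>j\<in>S. cmod (\<pi> (a j) ?k \<omega>) * K)"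
  proof (rule order_trans[OF norm_sum], rule sum_mono)
    fix j assume j: "j \<in> S"
    have "cmod (f j \<omega>) \<le> K" using C0_le_norm[OF f(1)[OF j], of \<omega>] f(2)[OF j] by simp
    then show "cmod (\<pi> (a j) (f j) \<omega>) \<le> cmod (\<pi> (a j) ?k \<omega>) * K"
      unfolding eq[OF j] norm_mult by (subst mult.commute) (intro mult_left_mono, auto)
  qed
  then show ?thesis using b by (simp add: sum_distrib_right)
qed

lemma \<psi>_truncate_value:
  assumes b: "b \<in> carrier F" and f: "f \<in> carrier (C0 \<Omega>)" and S: "finite S" "S \<subseteq> carrier G"
  shows "\<psi> (\<lambda>t x. if t \<in> S then b t x else 0) f \<omega> = (\<Sum>t\<in>S. \<psi> (monomial t (b t)) f \<omega>)"
  using S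
proof (induction S rule: finite_induct)
  case empty
  then show ?case using \<psi>_zero[OF f] by simp
next
  case (insert s S)
  have m: "monomial s (b s) \<in> carrier F" using insert.prems by (intro monomial_mem(1) F_D(1)[OF b]) auto
  have "\<psi> (\<lambda>t x. if t \<in> insert s S then b t x else 0) f
      = \<psi> (monomial s (b s)) f \<oplus>\<^bsub>C0 \<Omega>\<^esub> \<psi> (\<lambda>t x. if t \<in> S then b t x else 0) f"
    unfolding truncate_insert[OF insert.hyps(2)] by (rule \<psi>_simps(3)[OF m F_truncate[OF b] f])
  then show ?case using insert by simp
qed

text \<open>Up to a small error b(t)\<delta>_t is the product of b(t) and e\<delta>_t. The
  coefficient stands on the left, so it is not moved, and the sums of |b(t)(x)| appear. Since
  ||\<psi>(e\<delta>_t)f|| \<le> ||f||, \<open>pointwise_bound\<close> applies with K =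
  ||f||.\<close>

lemma operator_norm_le_row_norm:
  assumes b: "b \<in> carrier F"
  shows "nrm (bounded_operators (C0 \<Omega>)) (\<psi> b) \<le> column_norm G X (\<lambda>t x. x) b"
proof (rule operator_norm_le)
  interpret H: homeomorphism_family G X "\<lambda>t x. x"
    using homeomorphic_map_id[of X X] by unfold_locales (auto simp: id_def)
  show C: "0 \<le> column_norm G X (\<lambda>t x. x) b" by (rule H.column_norm_nonneg[OF b])
  fix f assume f: "f \<in> carrier (C0 \<Omega>)"
  have f0: "0 \<le> nrm (C0 \<Omega>) f" by (rule C0_norm_nonneg[OF f])
  show "nrm (C0 \<Omega>) (\<psi> b f) \<le> column_norm G X (\<lambda>t x. x) b * nrm (C0 \<Omega>) f"
  proof (rule norm_\<psi>_le_truncated[OF b f])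
    show "0 \<le> column_norm G X (\<lambda>t x. x) b * nrm (C0 \<Omega>) f" using C f0 by simp
    fix S assume S: "finite S" "S \<subseteq> carrier G"
    have bt: "b t \<in> carrier (C0 X)" for t by (rule F_D(1)[OF b])
    show "nrm (C0 \<Omega>) (\<psi> (\<lambda>t x. if t \<in> S then b t x else 0) f) \<le> column_norm G X (\<lambda>t x. x) b * nrm (C0 \<Omega>) f"
    proof (rule C0_norm_le[OF \<psi>_mem[OF F_truncate[OF b] f]], simp add: C f0, rule field_le_epsilon)
      fix \<omega> and \<epsilon> :: real assume "\<epsilon> > 0"
      \<comment> \<open>Each t in S will contribute an error of at most \<eta> ||f||.\<close>
      define \<eta> where "\<eta> = \<epsilon> / (real (card S) * nrm (C0 \<Omega>) f + 1)"
      have "real (card S) * nrm (C0 \<Omega>) f + 1 > 0" using f0 by (simp add: add_nonneg_pos)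
      then have \<eta>: "\<eta> > 0" "real (card S) * (\<eta> * nrm (C0 \<Omega>) f) \<le> \<epsilon>"
        using \<open>\<epsilon> > 0\<close> f0 by (auto simp: \<eta>_def field_simps)
      define g where "g x = (\<Sum>t\<in>S. cmod (b t x))" for x
      have "(\<lambda>x. \<Sum>t\<in>S. complex_of_real (cmod (b t x))) \<in> carrier (C0 X)" by (intro C0_sum C0_cmod bt)
      then have g: "(\<lambda>x. complex_of_real (g x)) \<in> carrier (C0 X)" by (simp add: g_def)
      have g0: "0 \<le> g x" for x by (simp add: g_def sum_nonneg)
      define e where "e = (\<lambda>x. complex_of_real (g x / (g x + \<eta>)))"
      note e = C0_approximate_unit[OF g g0 \<eta>(1), folded e_def]
      have be: "(\<lambda>x. b t x * e x) \<in> carrier (C0 X)" "(\<lambda>x. b t x - b t x * e x) \<in> carrier (C0 X)" for t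
        using C0_mult[OF bt e(1)] C0_diff[OF bt C0_mult[OF bt e(1)]] by auto
      have split: "cmod (\<psi> (monomial t (b t)) f \<omega> - \<pi> (b t) (\<psi> (monomial t e) f) \<omega>) \<le> \<eta> * nrm (C0 \<Omega>) f"
        if t: "t \<in> S" for t
      proof -
        have tG: "t \<in> carrier G" using t S by auto
        have m: "monomial t (b t) \<in> carrier F" "monomial t e \<in> carrier F" "monomial t (\<lambda>x. b t x * e x) \<in> carrier F"
          "monomial t (\<lambda>x. b t x - b t x * e x) \<in> carrier F"
          by (intro monomial_mem(1) tG bt e(1) be)+
        have "(\<lambda>r x. b t x * monomial t e r x) = monomial t (\<lambda>x. b t x * e x)"
          by (auto simp: monomial_def fun_eq_iff)
        then have "\<pi> (b t) (\<psi> (monomial t e) f) = \<psi> (monomial t (\<lambda>x. b t x * e x)) f"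
          using \<pi>_\<psi>[OF bt m(2) f, of t] by simp
        then have "\<psi> (monomial t (b t)) f \<omega> - \<pi> (b t) (\<psi> (monomial t e) f) \<omega>
            = \<psi> (monomial t (\<lambda>x. b t x - b t x * e x)) f \<omega>"
          unfolding monomial_diff using \<psi>_diff[OF m(1,3) f] \<psi>_mem[OF m(1) f] \<psi>_mem[OF m(3) f] by simp
        then have "cmod (\<psi> (monomial t (b t)) f \<omega> - \<pi> (b t) (\<psi> (monomial t e) f) \<omega>)
            \<le> nrm (C0 \<Omega>) (\<psi> (monomial t (\<lambda>x. b t x - b t x * e x)) f)"
          using C0_le_norm[OF \<psi>_mem[OF m(4) f]] by simp
        also have "\<dots> \<le> nrm F (monomial t (\<lambda>x. b t x - b t x * e x)) * nrm (C0 \<Omega>) f"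
          by (rule \<psi>_norm[OF m(4) f])
        also have "\<dots> \<le> \<eta> * nrm (C0 \<Omega>) f"
        proof (rule mult_right_mono[OF _ f0])
          have "cmod (b t x) \<le> g x" for x unfolding g_def using t S by (intro member_le_sum) auto
          then have "nrm (C0 X) (\<lambda>x. b t x - b t x * e x) \<le> \<eta>"
            using e(5) \<eta>(1) by (intro C0_norm_le[OF be(2)]) (auto simp: e_def)
          then show "nrm F (monomial t (\<lambda>x. b t x - b t x * e x)) \<le> \<eta>"
            using monomial_mem(2)[OF tG be(2)[of t]] by simp
        qed
        finally show ?thesis .
      qed
      have main: "cmod (\<Sum>t\<in>S. \<pi> (b t) (\<psi> (monomial t e) f) \<omega>) \<le> column_norm G X (\<lambda>t x. x) b * nrm (C0 \<Omega>) f"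
      proof (rule pointwise_bound[OF S(1) bt _ _ C _ f0])
        fix t assume t: "t \<in> S"
        then have te: "monomial t e \<in> carrier F" using S e(1) by (intro monomial_mem(1)) auto
        show "\<psi> (monomial t e) f \<in> carrier (C0 \<Omega>)" by (rule \<psi>_mem[OF te f])
        have "nrm F (monomial t e) \<le> 1" using monomial_mem(2)[of t G e X] t S e(1,2) by auto
        then show "nrm (C0 \<Omega>) (\<psi> (monomial t e) f) \<le> nrm (C0 \<Omega>) f"
          using \<psi>_norm[OF te f] mult_right_mono[OF _ f0, of "nrm F (monomial t e)" 1] by simp
      qed (use H.column_finite_sum_le[OF b _ S] in auto)
      have "cmod (\<psi> (\<lambda>t x. if t \<in> S then b t x else 0) f \<omega> - (\<Sum>t\<in>S. \<pi> (b t) (\<psi> (monomial t e) f) \<omega>))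
          \<le> (\<Sum>t\<in>S. cmod (\<psi> (monomial t (b t)) f \<omega> - \<pi> (b t) (\<psi> (monomial t e) f) \<omega>))"
        unfolding \<psi>_truncate_value[OF b f S] by (simp add: sum_subtractf[symmetric] norm_sum)
      also have "\<dots> \<le> real (card S) * (\<eta> * nrm (C0 \<Omega>) f)" using split by (rule sum_bounded_above)
      finally have "cmod (\<psi> (\<lambda>t x. if t \<in> S then b t x else 0) f \<omega> - (\<Sum>t\<in>S. \<pi> (b t) (\<psi> (monomial t e) f) \<omega>)) \<le> \<epsilon>"
        using \<eta>(2) by simp
      then show "cmod (\<psi> (\<lambda>t x. if t \<in> S then b t x else 0) f \<omega>) \<le> column_norm G X (\<lambda>t x. x) b * nrm (C0 \<Omega>) f + \<epsilon>"
        using main norm_triangle_sub[of "\<psi> (\<lambda>t x. if t \<in> S then b t x else 0) f \<omega>"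
            "\<Sum>t\<in>S. \<pi> (b t) (\<psi> (monomial t e) f) \<omega>"] by linarith
    qed
  qed
qed

end


section \<open>Representations on \<open>L\<^sup>1\<close>-spaces\<close>

text \<open>The numerator of the quotient \<open>L1\<close>; naming it and the null functions makes
  the general theory of quotients applicable.\<close>

definition integrable_functions :: "'m measure \<Rightarrow> ('m \<Rightarrow> complex) cnormed" where
  "integrable_functions M = \<lparr>carrier = {f. integrable M f}, mult = undefined, one = undefined,
      zero = (\<lambda>x. 0), add = (\<lambda>f g x. f x + g x), smult = (\<lambda>c f x. c * f x),
      nrm = (\<lambda>f. integral\<^sup>L M (\<lambda>x. cmod (f x)))\<rparr>"

definition null_functions :: "'m measure \<Rightarrow> ('m \<Rightarrow> complex) set" where
  "null_functions M = {f. integrable M f \<and> (AE x in M. f x = 0)}"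

lemma L1_eq: "L1 M = nquot (integrable_functions M) (null_functions M)"
  by (simp add: L1_def integrable_functions_def null_functions_def)

lemma integrable_functions_simps [simp]:
  "f \<in> carrier (integrable_functions M) \<longleftrightarrow> integrable M f"
  "f \<oplus>\<^bsub>integrable_functions M\<^esub> g = (\<lambda>x. f x + g x)"
  "c \<odot>\<^bsub>integrable_functions M\<^esub> f = (\<lambda>x. c * f x)"
  "\<zero>\<^bsub>integrable_functions M\<^esub> = (\<lambda>x. 0)"
  "nrm (integrable_functions M) f = (\<integral>x. cmod (f x) \<partial>M)"
  by (simp_all add: integrable_functions_def)

lemma seminormed_space_integrable: "seminormed_space (integrable_functions M)" (is "seminormed_space ?E")
proof (intro seminormed_space.intro moduleI seminormed_space_axioms.intro)
  show "cring complex_ring" by (rule cring_complex_ring)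
  show "abelian_group ?E"
  proof (rule abelian_groupI)
    fix f assume "f \<in> carrier ?E"
    then show "\<exists>g\<in>carrier ?E. g \<oplus>\<^bsub>?E\<^esub> f = \<zero>\<^bsub>?E\<^esub>"
      by (intro bexI[of _ "\<lambda>x. - f x"]) auto
  qed (auto simp: algebra_simps)
  fix f g c assume f: "f \<in> carrier ?E"
  show "nrm ?E (c \<odot>\<^bsub>?E\<^esub> f) = cmod c * nrm ?E f" by (simp add: norm_mult)
  assume g: "g \<in> carrier ?E"
  have "(\<integral>x. cmod (f x + g x) \<partial>M) \<le> (\<integral>x. cmod (f x) + cmod (g x) \<partial>M)"
    using f g by (intro integral_mono) (auto intro: norm_triangle_ineq)
  then show "nrm ?E (f \<oplus>\<^bsub>?E\<^esub> g) \<le> nrm ?E f + nrm ?E g" using f g by simp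
qed (auto simp: algebra_simps)

locale L1_space =
  fixes M :: "'m measure"
begin

sublocale quotient_space "integrable_functions M" "null_functions M"
proof (intro quotient_space.intro quotient_space_axioms.intro seminormed_space_integrable)
  show "x \<oplus>\<^bsub>integrable_functions M\<^esub> y \<in> null_functions M"
    if xy: "x \<in> null_functions M" "y \<in> null_functions M" for x y
  proof -
    have "AE z in M. x z = 0" "AE z in M. y z = 0" using xy by (auto simp: null_functions_def)
    then have "AE z in M. x z + y z = 0" by eventually_elim simp
    then show ?thesis using xy by (simp add: null_functions_def)
  qed
qed (auto simp: null_functions_def)

abbreviation (input) cls :: "('m \<Rightarrow> complex) \<Rightarrow> ('m \<Rightarrow> complex) set" where
  "cls f \<equiv> null_functions M +>\<^bsub>integrable_functions M\<^esub> f"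

lemma integrable_minus:
  "\<lbrakk>integrable M f; integrable M g\<rbrakk> \<Longrightarrow> f \<ominus>\<^bsub>integrable_functions M\<^esub> g = (\<lambda>x. f x - g x)"
  by (simp add: diff_eq_smult)

lemma cls_eq_iff:
  assumes "integrable M f" "integrable M g"
  shows "cls f = cls g \<longleftrightarrow> (AE x in M. f x = g x)"
proof -
  have "cls f = cls g \<longleftrightarrow> (\<lambda>x. f x - g x) \<in> null_functions M"
    using assms coset_eq_iff[of f g] by (simp add: integrable_minus)
  also have "\<dots> \<longleftrightarrow> (AE x in M. f x - g x = 0)" using assms by (auto simp: null_functions_def)
  finally show ?thesis by simp
qed

text \<open>Members of a class agree almost everywhere, so the infimum that defines the quotient
  norm is taken over a constant.\<close>

lemma norm_cls:
  assumes f: "integrable M f"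
  shows "nrm (L1 M) (cls f) = (\<integral>x. cmod (f x) \<partial>M)"
  unfolding L1_eq
proof (rule antisym)
  show "nrm Q (cls f) \<le> (\<integral>x. cmod (f x) \<partial>M)" using norm_quot_le[of f] f by simp
  show "(\<integral>x. cmod (f x) \<partial>M) \<le> nrm Q (cls f)"
  proof (rule norm_quot_ge)
    fix g assume "g \<in> cls f"
    then have g: "integrable M g" "(\<lambda>x. g x - f x) \<in> null_functions M"
      using mem_coset_iff[of f g] f by (auto simp: integrable_minus)
    then have "AE x in M. g x - f x = 0" by (simp add: null_functions_def)
    then have "AE x in M. cmod (f x) = cmod (g x)" by eventually_elim simp
    then show "(\<integral>x. cmod (f x) \<partial>M) \<le> nrm (integrable_functions M) g"
    proof -
      have "(\<integral>x. cmod (f x) \<partial>M) = (\<integral>x. cmod (g x) \<partial>M)"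
        using f g \<open>AE x in M. cmod (f x) = cmod (g x)\<close> by (intro integral_cong_AE) auto
      then show ?thesis by simp
    qed
  qed (use f in simp)
qed

lemma L1_E:
  assumes "K \<in> carrier (L1 M)"
  obtains f where "integrable M f" "K = cls f"
  using assms unfolding L1_eq by (auto elim!: quotE)

lemma cls_mem: "integrable M f \<Longrightarrow> cls f \<in> carrier (L1 M)"
  unfolding L1_eq using coset_mem[of f] by simp

lemma cls_add: "\<lbrakk>integrable M f; integrable M g\<rbrakk> \<Longrightarrow> cls f \<oplus>\<^bsub>L1 M\<^esub> cls g = cls (\<lambda>x. f x + g x)"
  unfolding L1_eq using add_quot[of f g] by simp

lemma cls_smult: "integrable M f \<Longrightarrow> c \<odot>\<^bsub>L1 M\<^esub> cls f = cls (\<lambda>x. c * f x)"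
  unfolding L1_eq using smult_quot[of f c] by simp

lemma zero_L1: "\<zero>\<^bsub>L1 M\<^esub> = cls (\<lambda>x. 0)"
  unfolding L1_eq using zero_quot by simp

text \<open>The null functions are closed: subtracting one does not change the integral of the
  modulus, so a function approximated by them has integral 0.\<close>

lemma normed_space_L1: "normed_space (L1 M)"
  unfolding L1_eq
proof (rule normed_space_quot)
  fix f assume f: "f \<in> carrier (integrable_functions M)"
    and small: "\<And>\<epsilon>. \<epsilon> > 0 \<Longrightarrow> \<exists>i\<in>null_functions M. nrm (integrable_functions M) (f \<ominus>\<^bsub>integrable_functions M\<^esub> i) < \<epsilon>"
  have "(\<integral>x. cmod (f x) \<partial>M) \<le> 0 + \<epsilon>" if "\<epsilon> > 0" for \<epsilon>
  proof -
    obtain i where i: "i \<in> null_functions M" "nrm (integrable_functions M) (f \<ominus>\<^bsub>integrable_functions M\<^esub> i) < \<epsilon>"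
      using small[OF \<open>\<epsilon> > 0\<close>] by blast
    have im: "integrable M i" "AE x in M. i x = 0" using i(1) by (auto simp: null_functions_def)
    then have "AE x in M. cmod (f x) = cmod (f x - i x)" by (auto elim: eventually_mono)
    then have "(\<integral>x. cmod (f x) \<partial>M) = (\<integral>x. cmod (f x - i x) \<partial>M)"
      using f im by (intro integral_cong_AE) auto
    then show ?thesis using i(2) f im(1) by (simp add: integrable_minus)
  qed
  then have "(\<integral>x. cmod (f x) \<partial>M) \<le> 0" by (rule field_le_epsilon)
  then have "(\<integral>x. cmod (f x) \<partial>M) = 0" by (simp add: antisym)
  then have "AE x in M. cmod (f x) = 0" using f by (subst (asm) integral_nonneg_eq_0_iff_AE) auto
  then show "f \<in> null_functions M" using f by (simp add: null_functions_def)
qed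

end

text \<open>The functional given by \<open>sgn f\<close> supports \<open>f\<close>; a perturbation that is of second order in
  \<open>t\<close> must therefore vanish where \<open>f\<close> does.\<close>

lemma L1_support:
  fixes f k :: "'m \<Rightarrow> complex"
  assumes f: "integrable M f" and k: "integrable M k"
    and le: "\<And>t. (\<integral>x. cmod (f x + \<i> * complex_of_real t * k x) \<partial>M) \<le> sqrt (1 + t\<^sup>2 * A\<^sup>2) * (\<integral>x. cmod (f x) \<partial>M)"
  shows "AE x in M. f x = 0 \<longrightarrow> k x = 0"
proof -
  \<comment> \<open>The derivative at t = 0 of |f + i t k| where f is nonzero; where f = 0 the
    modulus is |t| |k|, which \<open>q\<close> collects.\<close>
  define p where "p x = Re (\<i> * (cnj (sgn (f x)) * k x))" for x
  define q where "q x = (if f x = 0 then cmod (k x) else 0)" for x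
  have pint: "integrable M p"
  proof (rule Bochner_Integration.integrable_bound[OF k])
    show "p \<in> borel_measurable M"
    proof -
      have "p = (\<lambda>x. Im (sgn (f x)) * Re (k x) - Re (sgn (f x)) * Im (k x))"
        by (simp add: p_def fun_eq_iff)
      then show ?thesis
        using borel_measurable_integrable[OF f] borel_measurable_integrable[OF k] by simp
    qed
    show "AE x in M. norm (p x) \<le> norm (k x)"
    proof (rule AE_I2)
      fix x
      have "cmod (\<i> * (cnj (sgn (f x)) * k x)) \<le> 1 * cmod (k x)"
        unfolding norm_mult by (simp add: norm_sgn mult_left_le_one_le)
      then show "norm (p x) \<le> norm (k x)" using abs_Re_le_cmod[of "\<i> * (cnj (sgn (f x)) * k x)"] by (simp add: p_def)
    qed
  qed
  have qint: "integrable M q"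
  proof (rule Bochner_Integration.integrable_bound[OF k])
    show "q \<in> borel_measurable M" unfolding q_def using f k by measurable
  qed (auto simp: q_def)
  define F where "F = (\<integral>x. cmod (f x) \<partial>M)"
  define B where "B = (\<integral>x. p x \<partial>M)"
  define D where "D = (\<integral>x. q x \<partial>M)"
  have F0: "0 \<le> F" by (simp add: F_def)
  have D0: "0 \<le> D" unfolding D_def q_def by (intro integral_nonneg_AE AE_I2) simp
  have key: "F + t * B + \<bar>t\<bar> * D \<le> (1 + t\<^sup>2 * A\<^sup>2) * F" for t
  proof -
    have "F + t * B + \<bar>t\<bar> * D = (\<integral>x. cmod (f x) + t * p x + \<bar>t\<bar> * q x \<partial>M)"
      using f pint qint by (simp add: F_def B_def D_def)
    also have "\<dots> \<le> (\<integral>x. cmod (f x + \<i> * complex_of_real t * k x) \<partial>M)"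
    proof (rule integral_mono)
      fix x
      show "cmod (f x) + t * p x + \<bar>t\<bar> * q x \<le> cmod (f x + \<i> * complex_of_real t * k x)"
      proof (cases "f x = 0")
        case True
        then show ?thesis by (simp add: p_def q_def norm_mult)
      next
        case False
        have "cnj (sgn (f x)) * f x = complex_of_real (cmod (f x))"
          using False by (simp add: sgn_div_norm scaleR_conv_of_real complex_norm_square[symmetric] power2_eq_square field_simps)
        then have "cnj (sgn (f x)) * (f x + \<i> * complex_of_real t * k x) =
            complex_of_real (cmod (f x)) + complex_of_real t * (\<i> * (cnj (sgn (f x)) * k x))"
          by (simp add: algebra_simps)
        then have "Re (cnj (sgn (f x)) * (f x + \<i> * complex_of_real t * k x)) = cmod (f x) + t * p x"
          by (simp add: p_def)
        moreover have "Re (cnj (sgn (f x)) * (f x + \<i> * complex_of_real t * k x)) \<le> cmod (f x + \<i> * complex_of_real t * k x)"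
          using complex_Re_le_cmod[of "cnj (sgn (f x)) * (f x + \<i> * complex_of_real t * k x)"] False
          by (simp add: norm_mult norm_sgn)
        ultimately show ?thesis using False by (simp add: q_def)
      qed
    qed (use f k pint qint in auto)
    also have "\<dots> \<le> sqrt (1 + t\<^sup>2 * A\<^sup>2) * F" unfolding F_def by (rule le)
    also have "\<dots> \<le> (1 + t\<^sup>2 * A\<^sup>2) * F" using F0 by (intro mult_right_mono sqrt_one_plus_le) auto
    finally show ?thesis .
  qed
  \<comment> \<open>Adding the inequalities for s and -s cancels the linear term B and leaves the
    one that is not differentiable at 0.\<close>
  have "s * D \<le> s\<^sup>2 * (A\<^sup>2 * F)" if "s > 0" for s
    using key[of s] key[of "- s"] that by (simp add: algebra_simps)
  then have "D = 0" by (rule eq_zero_if_le_square[OF D0])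
  then have "AE x in M. q x = 0"
    unfolding D_def using qint by (subst (asm) integral_nonneg_eq_0_iff_AE) (auto simp: q_def)
  then show ?thesis by eventually_elim (simp add: q_def split: if_splits)
qed

text \<open>Integrated over the set where the claim fails, the hypothesis makes the integral of a
  nonnegative difference nonpositive.\<close>

lemma L1_pointwise_bound:
  fixes f k :: "'m \<Rightarrow> complex"
  assumes f: "integrable M f" and k: "integrable M k"
    and le: "\<And>B. B \<in> sets M \<Longrightarrow> (\<integral>x. indicator B x * cmod (k x) \<partial>M) \<le> C * (\<integral>x. indicator B x * cmod (f x) \<partial>M)"
  shows "AE x in M. cmod (k x) \<le> C * cmod (f x)"
proof -
  define B where "B = {x \<in> space M. C * cmod (f x) < cmod (k x)}"
  have B: "B \<in> sets M" unfolding B_def using f k by measurable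
  have fi: "integrable M (\<lambda>x. indicator B x * cmod (f x))" "integrable M (\<lambda>x. indicator B x * cmod (k x))"
    using integrable_mult_indicator[OF B integrable_norm[OF f]] integrable_mult_indicator[OF B integrable_norm[OF k]]
    by simp_all
  have "(\<integral>x. indicator B x * cmod (k x) - C * (indicator B x * cmod (f x)) \<partial>M) \<le> 0"
    using le[OF B] fi by simp
  moreover have nn: "0 \<le> indicator B x * cmod (k x) - C * (indicator B x * cmod (f x))" for x
    by (simp add: B_def indicator_def)
  ultimately have "(\<integral>x. indicator B x * cmod (k x) - C * (indicator B x * cmod (f x)) \<partial>M) = 0"
    by (intro antisym integral_nonneg_AE AE_I2)
  then have "AE x in M. indicator B x * cmod (k x) - C * (indicator B x * cmod (f x)) = 0"
    using fi nn by (subst (asm) integral_nonneg_eq_0_iff_AE) auto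
  then show ?thesis
    using AE_space by eventually_elim (auto simp: B_def indicator_def split: if_splits)
qed

text \<open>On an L1-space each choice of phases gives an inequality off a null set of its own, so
  countably many choices have to represent all of them.\<close>

lemma countable_dense_unimodular:
  obtains D :: "complex set" where "countable D" "\<And>z. z \<in> D \<Longrightarrow> cmod z = 1"
    "\<And>z \<epsilon>. cmod z = 1 \<Longrightarrow> \<epsilon> > 0 \<Longrightarrow> \<exists>w\<in>D. cmod (w - z) < \<epsilon>"
proof -
  have "\<exists>w\<in>cis ` \<rat>. cmod (w - z) < \<epsilon>" if z: "cmod z = 1" and \<epsilon>: "\<epsilon> > 0" for z \<epsilon>
  proof -
    have zc: "z = cis (Arg z)" using z cis_Arg[of z] by (cases "z = 0") (auto simp: sgn_div_norm)
    have "isCont (\<lambda>x. exp (\<i> * complex_of_real x)) (Arg z)" by (intro continuous_intros)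
    then have "isCont cis (Arg z)" by (simp add: cis_conv_exp[abs_def])
    then obtain d where d: "d > 0" "\<And>y. dist y (Arg z) < d \<Longrightarrow> dist (cis y) (cis (Arg z)) < \<epsilon>"
      using \<epsilon> unfolding continuous_at_eps_delta by blast
    obtain q where q: "q \<in> \<rat>" "Arg z - d < q" "q < Arg z + d"
      using Rats_dense_in_real[of "Arg z - d" "Arg z + d"] d(1) by auto
    have "dist q (Arg z) < d" using q by (auto simp: dist_real_def)
    then have "cmod (cis q - z) < \<epsilon>" using d(2)[of q] zc by (simp add: dist_norm)
    then show ?thesis using q(1) by blast
  qed
  then show thesis
    by (rule that[of "cis ` \<rat>", rotated 2]) (auto intro: countable_image countable_rat)
qed

lemma sum_cmod_le_dense:
  fixes S :: "'j set"
  assumes "finite S" and D: "\<And>z \<epsilon>. cmod z = 1 \<Longrightarrow> \<epsilon> > 0 \<Longrightarrow> \<exists>w\<in>D. cmod (w - z) < \<epsilon>"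
    and le: "\<And>\<theta>. \<theta> \<in> S \<rightarrow>\<^sub>E D \<Longrightarrow> cmod (\<Sum>j\<in>S. \<theta> j * z j) \<le> R"
  shows "(\<Sum>j\<in>S. cmod (z j)) \<le> R"
proof (rule sum_cmod_le_unimodular, rule field_le_epsilon)
  fix \<theta> :: "'j \<Rightarrow> complex" and \<epsilon> :: real assume \<theta>: "\<And>j. cmod (\<theta> j) = 1" and \<epsilon>: "\<epsilon> > 0"
  define K where "K = (\<Sum>j\<in>S. cmod (z j)) + 1"
  have K: "K > 0" by (simp add: K_def add_nonneg_pos sum_nonneg)
  have "\<exists>w\<in>D. cmod (w - \<theta> j) < \<epsilon> / K" for j using D[OF \<theta>] \<epsilon> K by simp
  then obtain w where w: "\<And>j. w j \<in> D" "\<And>j. cmod (w j - \<theta> j) < \<epsilon> / K" by metis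
  have eq: "(\<Sum>j\<in>S. restrict w S j * z j) = (\<Sum>j\<in>S. w j * z j)" by (intro sum.cong) auto
  have "cmod (\<Sum>j\<in>S. w j * z j) \<le> R" using le[of "restrict w S"] w(1) unfolding eq by auto
  moreover have "cmod ((\<Sum>j\<in>S. \<theta> j * z j) - (\<Sum>j\<in>S. w j * z j)) \<le> (\<Sum>j\<in>S. \<epsilon> / K * cmod (z j))"
    unfolding sum_subtractf[symmetric]
  proof (rule order_trans[OF norm_sum], rule sum_mono)
    fix j
    have "cmod (\<theta> j * z j - w j * z j) = cmod (w j - \<theta> j) * cmod (z j)"
      by (simp add: left_diff_distrib[symmetric] norm_mult norm_minus_commute)
    also have "\<dots> \<le> \<epsilon> / K * cmod (z j)" using w(2)[of j] by (intro mult_right_mono) auto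
    finally show "cmod (\<theta> j * z j - w j * z j) \<le> \<epsilon> / K * cmod (z j)" .
  qed
  moreover have "(\<Sum>j\<in>S. \<epsilon> / K * cmod (z j)) = \<epsilon> / K * (K - 1)" by (simp add: K_def sum_distrib_left)
  moreover have "\<epsilon> / K * (K - 1) \<le> \<epsilon>" using K \<epsilon> by (simp add: field_simps)
  ultimately show "cmod (\<Sum>j\<in>S. \<theta> j * z j) \<le> R + \<epsilon>"
    using norm_triangle_sub[of "\<Sum>j\<in>S. \<theta> j * z j" "\<Sum>j\<in>S. w j * z j"] by linarith
qed

locale L1_representation = F_representation G X \<phi> u "L1 M" \<psi> + L1_space M
  for G :: "('g, 'z) monoid_scheme" (structure) and X :: "'x topology" and \<phi> u
    and M :: "'m measure" and \<psi>
begin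

lemma \<pi>_cls:
  assumes "a \<in> carrier (C0 X)" "integrable M f"
  obtains k where "integrable M k" "\<pi> a (cls f) = cls k"
  using L1_E[OF \<pi>_mem[OF assms(1) cls_mem[OF assms(2)]]] by blast

lemma local_real:
  assumes a: "a \<in> carrier (C0 X)" and real: "\<And>x. a x \<in> \<real>"
    and f: "integrable M f" and k: "integrable M k" "\<pi> a (cls f) = cls k"
  shows "AE x in M. f x = 0 \<longrightarrow> k x = 0"
proof (rule L1_support[OF f k(1)])
  fix t :: real
  have "cls f \<oplus>\<^bsub>L1 M\<^esub> (\<i> * complex_of_real t) \<odot>\<^bsub>L1 M\<^esub> \<pi> a (cls f) = cls (\<lambda>x. f x + \<i> * complex_of_real t * k x)"
    using f k by (simp add: cls_smult cls_add)
  then show "(\<integral>x. cmod (f x + \<i> * complex_of_real t * k x) \<partial>M) \<le> sqrt (1 + t\<^sup>2 * (nrm (C0 X) a)\<^sup>2) * (\<integral>x. cmod (f x) \<partial>M)"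
    using hermitian_bound[OF a real cls_mem[OF f], of t] f k by (simp add: norm_cls)
qed

lemma local:
  assumes a: "a \<in> carrier (C0 X)" and f: "integrable M f" and k: "integrable M k" "\<pi> a (cls f) = cls k"
  shows "AE x in M. f x = 0 \<longrightarrow> k x = 0"
proof -
  note re = C0_Re_Im(1)[OF a] and im = C0_Re_Im(2)[OF a]
  obtain k1 where k1: "integrable M k1" "\<pi> (\<lambda>x. complex_of_real (Re (a x))) (cls f) = cls k1" by (rule \<pi>_cls[OF re f])
  obtain k2 where k2: "integrable M k2" "\<pi> (\<lambda>x. complex_of_real (Im (a x))) (cls f) = cls k2" by (rule \<pi>_cls[OF im f])
  have "\<pi> (\<lambda>x. complex_of_real (Re (a x)) + \<i> * complex_of_real (Im (a x))) (cls f) = cls (\<lambda>x. k1 x + \<i> * k2 x)"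
    using \<pi>_add[OF re C0_smult[OF im] cls_mem[OF f], of \<i>] \<pi>_smult[OF im cls_mem[OF f], of \<i>] k1 k2
    by (simp add: cls_smult cls_add)
  then have "cls k = cls (\<lambda>x. k1 x + \<i> * k2 x)" using k(2) by (simp add: complex_eq[symmetric])
  then have "AE x in M. k x = k1 x + \<i> * k2 x" using k(1) k1(1) k2(1) by (subst (asm) cls_eq_iff) auto
  moreover have "AE x in M. f x = 0 \<longrightarrow> k1 x = 0" by (rule local_real[OF re _ f k1]) simp
  moreover have "AE x in M. f x = 0 \<longrightarrow> k2 x = 0" by (rule local_real[OF im _ f k2]) simp
  ultimately show ?thesis by eventually_elim simp
qed

text \<open>By locality \<pi>(a) preserves supports up to null sets, so it commutes with cutting f
  down to a measurable set B. The norm inequality then holds over every B, which makes it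
  pointwise.\<close>

lemma pointwise_le:
  assumes a: "a \<in> carrier (C0 X)" and f: "integrable M f" and k: "integrable M k" "\<pi> a (cls f) = cls k"
  shows "AE x in M. cmod (k x) \<le> nrm (C0 X) a * cmod (f x)"
proof (rule L1_pointwise_bound[OF f k(1)])
  fix B assume B: "B \<in> sets M"
  define f1 where "f1 x = indicator B x * f x" for x
  define f2 where "f2 x = indicator (- B) x * f x" for x
  have f1: "integrable M f1"
  proof -
    have "f1 = (\<lambda>x. indicator B x *\<^sub>R f x)" by (auto simp: f1_def indicator_def)
    then show ?thesis using integrable_mult_indicator[OF B f] by simp
  qed
  have f2eq: "f2 x = f x - f1 x" for x by (simp add: f1_def f2_def indicator_def)
  have f2: "integrable M f2" unfolding f2eq using f f1 by simp
  obtain k1 where k1: "integrable M k1" "\<pi> a (cls f1) = cls k1" by (rule \<pi>_cls[OF a f1])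
  obtain k2 where k2: "integrable M k2" "\<pi> a (cls f2) = cls k2" by (rule \<pi>_cls[OF a f2])
  have "cls f = cls f1 \<oplus>\<^bsub>L1 M\<^esub> cls f2" using f1 f2 by (simp add: cls_add f2eq)
  then have "cls k = cls (\<lambda>x. k1 x + k2 x)"
    using linear_mapsD(2)[OF \<pi>_linear[OF a] cls_mem[OF f1] cls_mem[OF f2]] k k1 k2 by (simp add: cls_add)
  then have ae: "AE x in M. k x = k1 x + k2 x" using k(1) k1(1) k2(1) by (subst (asm) cls_eq_iff) auto
  have "AE x in M. f1 x = 0 \<longrightarrow> k1 x = 0" "AE x in M. f2 x = 0 \<longrightarrow> k2 x = 0"
    using local[OF a f1 k1] local[OF a f2 k2] by auto
  with ae have "AE x in M. indicator B x * cmod (k x) = cmod (k1 x)"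
    by eventually_elim (auto simp: f1_def f2_def indicator_def)
  then have "(\<integral>x. indicator B x * cmod (k x) \<partial>M) = (\<integral>x. cmod (k1 x) \<partial>M)"
    using k(1) k1(1) B by (intro integral_cong_AE) auto
  also have "\<dots> \<le> nrm (C0 X) a * (\<integral>x. cmod (f1 x) \<partial>M)"
    using \<pi>_norm[OF a cls_mem[OF f1]] f1 k1 by (simp add: norm_cls)
  also have "(\<integral>x. cmod (f1 x) \<partial>M) = (\<integral>x. indicator B x * cmod (f x) \<partial>M)"
    by (intro Bochner_Integration.integral_cong) (auto simp: f1_def indicator_def)
  finally show "(\<integral>x. indicator B x * cmod (k x) \<partial>M) \<le> nrm (C0 X) a * (\<integral>x. indicator B x * cmod (f x) \<partial>M)" .
qed

lemma \<pi>_sum_cls: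
  assumes "finite S" "\<And>j. j \<in> S \<Longrightarrow> a j \<in> carrier (C0 X)" "integrable M f"
    "\<And>j. j \<in> S \<Longrightarrow> integrable M (k j)" "\<And>j. j \<in> S \<Longrightarrow> \<pi> (a j) (cls f) = cls (k j)"
  shows "\<pi> (\<lambda>x. \<Sum>j\<in>S. \<theta> j * a j x) (cls f) = cls (\<lambda>x. \<Sum>j\<in>S. \<theta> j * k j x)"
  using assms
proof (induction S rule: finite_induct)
  case empty
  have "\<pi> (\<lambda>x. 0 * 0) (cls f) = 0 \<odot>\<^bsub>L1 M\<^esub> \<pi> (\<lambda>x. 0) (cls f)"
    using empty cls_mem by (intro \<pi>_smult) auto
  also have "\<dots> = \<zero>\<^bsub>L1 M\<^esub>" using \<pi>_mem[OF C0_zero cls_mem[OF empty(2)]] by simp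
  finally show ?case by (simp add: zero_L1)
next
  case (insert s S)
  have m: "(\<lambda>x. \<Sum>j\<in>S. \<theta> j * a j x) \<in> carrier (C0 X)" "(\<lambda>x. \<theta> s * a s x) \<in> carrier (C0 X)" "a s \<in> carrier (C0 X)"
    using insert.prems by auto
  have i: "integrable M (k s)" "integrable M (\<lambda>x. \<Sum>j\<in>S. \<theta> j * k j x)" using insert.prems by auto
  have "\<pi> (\<lambda>x. \<theta> s * a s x + (\<Sum>j\<in>S. \<theta> j * a j x)) (cls f) = \<pi> (\<lambda>x. \<theta> s * a s x) (cls f) \<oplus>\<^bsub>L1 M\<^esub> \<pi> (\<lambda>x. \<Sum>j\<in>S. \<theta> j * a j x) (cls f)"
    by (intro \<pi>_add m cls_mem insert.prems)
  also have "\<pi> (\<lambda>x. \<theta> s * a s x) (cls f) = cls (\<lambda>x. \<theta> s * k s x)"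
    using \<pi>_smult[OF m(3) cls_mem[OF insert.prems(2)], of "\<theta> s"] insert.prems i by (simp add: cls_smult)
  also have "\<pi> (\<lambda>x. \<Sum>j\<in>S. \<theta> j * a j x) (cls f) = cls (\<lambda>x. \<Sum>j\<in>S. \<theta> j * k j x)" using insert by simp
  finally show ?case using insert.hyps i by (simp add: cls_add)
qed

text \<open>For each family of phases from a countable dense set, |\<Sum> \<theta>_j k_j| \<le> C
  |f| almost everywhere. Off one null set this yields \<Sum> |k_j| \<le> C |f|. Integration then
  gives a sum of norms on the left, because the integral is additive.\<close>

lemma sum_norm_le:
  assumes S: "finite S" and a: "\<And>j. j \<in> S \<Longrightarrow> a j \<in> carrier (C0 X)" and K: "K \<in> carrier (L1 M)"
    and C: "0 \<le> C" "\<And>x. x \<in> topspace X \<Longrightarrow> (\<Sum>j\<in>S. cmod (a j x)) \<le> C"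
  shows "(\<Sum>j\<in>S. nrm (L1 M) (\<pi> (a j) K)) \<le> C * nrm (L1 M) K"
proof -
  obtain f where f: "integrable M f" "K = cls f" by (rule L1_E[OF K])
  have "\<exists>k. integrable M k \<and> \<pi> (a j) (cls f) = cls k" if "j \<in> S" for j
    by (rule \<pi>_cls[OF a[OF that] f(1)]) blast
  then obtain k where k: "\<And>j. j \<in> S \<Longrightarrow> integrable M (k j)" "\<And>j. j \<in> S \<Longrightarrow> \<pi> (a j) (cls f) = cls (k j)"
    by metis
  obtain D :: "complex set" where D: "countable D" "\<And>z. z \<in> D \<Longrightarrow> cmod z = 1"
    "\<And>z \<epsilon>. cmod z = 1 \<Longrightarrow> \<epsilon> > 0 \<Longrightarrow> \<exists>w\<in>D. cmod (w - z) < \<epsilon>"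
    by (rule countable_dense_unimodular) blast
  have "AE x in M. \<forall>\<theta>\<in>S \<rightarrow>\<^sub>E D. cmod (\<Sum>j\<in>S. \<theta> j * k j x) \<le> C * cmod (f x)"
    unfolding AE_ball_countable[OF countable_PiE[OF S D(1)]]
  proof
    fix \<theta> assume \<theta>: "\<theta> \<in> S \<rightarrow>\<^sub>E D"
    have m: "(\<lambda>x. \<Sum>j\<in>S. \<theta> j * a j x) \<in> carrier (C0 X)" using a by auto
    have n: "nrm (C0 X) (\<lambda>x. \<Sum>j\<in>S. \<theta> j * a j x) \<le> C"
    proof (rule C0_norm_le[OF m C(1)])
      fix x assume x: "x \<in> topspace X"
      have "cmod (\<Sum>j\<in>S. \<theta> j * a j x) \<le> (\<Sum>j\<in>S. cmod (\<theta> j * a j x))" by (rule norm_sum)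
      also have "\<dots> = (\<Sum>j\<in>S. cmod (a j x))"
        using \<theta> D(2) by (intro sum.cong) (auto simp: norm_mult PiE_iff)
      finally show "cmod (\<Sum>j\<in>S. \<theta> j * a j x) \<le> C" using C(2)[OF x] by simp
    qed
    have "AE x in M. cmod (\<Sum>j\<in>S. \<theta> j * k j x) \<le> nrm (C0 X) (\<lambda>x. \<Sum>j\<in>S. \<theta> j * a j x) * cmod (f x)"
      by (rule pointwise_le[OF m f(1) _ \<pi>_sum_cls[OF S a f(1) k]]) (use k in auto)
    then show "AE x in M. cmod (\<Sum>j\<in>S. \<theta> j * k j x) \<le> C * cmod (f x)"
      by eventually_elim (rule order_trans, assumption, intro mult_right_mono n norm_ge_zero)
  qed
  then have ae: "AE x in M. (\<Sum>j\<in>S. cmod (k j x)) \<le> C * cmod (f x)"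
  proof eventually_elim
    case (elim x)
    show ?case by (rule sum_cmod_le_dense[OF S D(3)]) (use elim in auto)
  qed
  have "(\<Sum>j\<in>S. nrm (L1 M) (\<pi> (a j) K)) = (\<Sum>j\<in>S. \<integral>x. cmod (k j x) \<partial>M)"
    unfolding f(2) using k by (intro sum.cong) (auto simp: norm_cls)
  also have "\<dots> = (\<integral>x. (\<Sum>j\<in>S. cmod (k j x)) \<partial>M)"
    using k(1) by (intro Bochner_Integration.integral_sum[symmetric]) auto
  also have "\<dots> \<le> (\<integral>x. C * cmod (f x) \<partial>M)"
    using k(1) f(1) ae by (intro integral_mono_AE) auto
  also have "\<dots> = C * nrm (L1 M) K" unfolding f(2) using f(1) by (simp add: norm_cls)
  finally show ?thesis .
qed

lemma operator_norm_le_column_norm':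
  "b \<in> carrier F \<Longrightarrow> nrm (bounded_operators (L1 M)) (\<psi> b) \<le> column_norm G X \<phi> b"
  by (rule operator_norm_le_column_norm[OF sum_norm_le])

end


section \<open>Regular representations\<close>

lemma integrable_count_space_iff:
  fixes f :: "'s \<Rightarrow> complex"
  shows "integrable (count_space A) f \<longleftrightarrow> (\<lambda>x. cmod (f x)) summable_on A"
  using abs_summable_equivalent[of f A] by (simp add: Infinite_Set_Sum.abs_summable_on_def)

lemma integral_norm_count_space:
  fixes f :: "'s \<Rightarrow> complex"
  assumes "(\<lambda>x. cmod (f x)) summable_on A"
  shows "(\<integral>x. cmod (f x) \<partial>count_space A) = (\<Sum>\<^sub>\<infinity>x\<in>A. cmod (f x))"
proof -
  have "Infinite_Set_Sum.abs_summable_on (\<lambda>x. cmod (f x)) A"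
    using assms abs_summable_equivalent[of "\<lambda>x. cmod (f x)" A] by simp
  then show ?thesis using infsetsum_infsum[of "\<lambda>x. cmod (f x)" A] unfolding infsetsum_def by simp
qed

context twisted_action begin

lemma inv_cancel:
  assumes "a \<in> carrier G" "c \<in> carrier G"
  shows "inv a \<otimes> (a \<otimes> c) = c" "a \<otimes> (inv a \<otimes> c) = c"
  using assms by (simp_all add: GG.m_assoc[symmetric])

text \<open>The substitution (r, s) to (r s^{-1}, s) makes the double sum a product; this is the
  estimate for the action on l1(G).\<close>

lemma right_convolution_summable:
  fixes \<beta> \<gamma> :: "'g \<Rightarrow> real"
  assumes "\<beta> summable_on carrier G" "\<gamma> summable_on carrier G"
    "\<And>s. s \<in> carrier G \<Longrightarrow> 0 \<le> \<beta> s" "\<And>s. s \<in> carrier G \<Longrightarrow> 0 \<le> \<gamma> s"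
  shows "(\<lambda>(r, s). \<beta> (r \<otimes> inv s) * \<gamma> s) summable_on carrier G \<times> carrier G"
    and "(\<Sum>\<^sub>\<infinity>r\<in>carrier G. \<Sum>\<^sub>\<infinity>s\<in>carrier G. \<beta> (r \<otimes> inv s) * \<gamma> s)
      = infsum \<beta> (carrier G) * infsum \<gamma> (carrier G)"
proof -
  have bij: "bij_betw (\<lambda>(r, s). (r \<otimes> inv s, s)) (carrier G \<times> carrier G) (carrier G \<times> carrier G)"
    by (rule bij_betwI[where g = "\<lambda>(t, s). (t \<otimes> s, s)"]) (auto simp: GG.m_assoc)
  note p = summable_on_product_real[OF assms]
  show s: "(\<lambda>(r, s). \<beta> (r \<otimes> inv s) * \<gamma> s) summable_on carrier G \<times> carrier G"
    using summable_on_reindex_bij_betw[OF bij, of "\<lambda>(s, t). \<beta> s * \<gamma> t"] p by (simp add: case_prod_unfold)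
  have "(\<Sum>\<^sub>\<infinity>r\<in>carrier G. \<Sum>\<^sub>\<infinity>s\<in>carrier G. \<beta> (r \<otimes> inv s) * \<gamma> s)
      = (\<Sum>\<^sub>\<infinity>(r, s)\<in>carrier G \<times> carrier G. \<beta> (r \<otimes> inv s) * \<gamma> s)"
    using infsum_Sigma_banach[OF s] by simp
  also have "\<dots> = (\<Sum>\<^sub>\<infinity>(s, t)\<in>carrier G \<times> carrier G. \<beta> s * \<gamma> t)"
    using infsum_reindex_bij_betw[OF bij, of "\<lambda>(s, t). \<beta> s * \<gamma> t"] by (simp add: case_prod_unfold)
  also have "\<dots> = (\<Sum>\<^sub>\<infinity>s\<in>carrier G. \<Sum>\<^sub>\<infinity>t\<in>carrier G. \<beta> s * \<gamma> t)"
    using infsum_Sigma_banach[OF p] by simp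
  also have "\<dots> = infsum \<beta> (carrier G) * infsum \<gamma> (carrier G)"
    using assms by (simp add: infsum_cmult_right infsum_cmult_left)
  finally show "(\<Sum>\<^sub>\<infinity>r\<in>carrier G. \<Sum>\<^sub>\<infinity>s\<in>carrier G. \<beta> (r \<otimes> inv s) * \<gamma> s)
      = infsum \<beta> (carrier G) * infsum \<gamma> (carrier G)" .
qed

lemma bij_betw_mult_inv:
  assumes "r \<in> carrier G"
  shows "bij_betw (\<lambda>s. r \<otimes> inv s) (carrier G) (carrier G)"
  by (rule bij_betwI[where g = "\<lambda>t. inv t \<otimes> r"])
    (use assms in \<open>auto simp: GG.inv_mult_group GG.m_assoc inv_cancel\<close>)

lemma inverse_translate_summable:
  fixes \<beta> :: "'g \<Rightarrow> real"
  assumes "r \<in> carrier G" "\<beta> summable_on carrier G"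
  shows "(\<lambda>s. \<beta> (r \<otimes> inv s)) summable_on carrier G"
    and "(\<Sum>\<^sub>\<infinity>s\<in>carrier G. \<beta> (r \<otimes> inv s)) = infsum \<beta> (carrier G)"
proof -
  note bij = bij_betw_mult_inv[OF assms(1)]
  show "(\<lambda>s. \<beta> (r \<otimes> inv s)) summable_on carrier G"
    using assms(2) summable_on_reindex_bij_betw[OF bij, of \<beta>] by simp
  show "(\<Sum>\<^sub>\<infinity>s\<in>carrier G. \<beta> (r \<otimes> inv s)) = infsum \<beta> (carrier G)"
    by (rule infsum_reindex_bij_betw[OF bij])
qed

end

text \<open>The matrices of the regular representation at the point \<open>x\<close>; the copy of \<open>G\<close> in the left
  summand makes room for functions on \<open>'g + 'm\<close>.\<close>

locale regular_representation = twisted_action G X \<phi> u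
  for G :: "('g, 'z) monoid_scheme" (structure) and X :: "'x topology" and \<phi> u +
  fixes x :: 'x
  assumes x: "x \<in> topspace X"
begin

text \<open>Only t = r s^{-1} takes s to r, and the basis vector at r lies over the orbit point
  \<phi>_r(x), where the coefficient and the twist are evaluated. The twist factor is the one that
  makes products of elements into products of matrices.\<close>

definition kernel :: "('g \<Rightarrow> 'x \<Rightarrow> complex) \<Rightarrow> 'g \<Rightarrow> 'g \<Rightarrow> complex" where
  "kernel b r s = b (r \<otimes> inv s) (\<phi> r x) * u (r \<otimes> inv s) s (\<phi> r x)"

definition act :: "('g \<Rightarrow> 'x \<Rightarrow> complex) \<Rightarrow> ('g + 'm \<Rightarrow> complex) \<Rightarrow> 'g + 'm \<Rightarrow> complex" where
  "act b f z = (case z of Inl r \<Rightarrow> if r \<in> carrier G then \<Sum>\<^sub>\<infinity>s\<in>carrier G. kernel b r s * f (Inl s) else 0 | Inr _ \<Rightarrow> 0)"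

lemma act_Inl: "r \<in> carrier G \<Longrightarrow> act b f (Inl r) = (\<Sum>\<^sub>\<infinity>s\<in>carrier G. kernel b r s * f (Inl s))"
  by (simp add: act_def)

lemma act_off: "z \<notin> Inl ` carrier G \<Longrightarrow> act b f z = 0"
  by (cases z) (auto simp: act_def)

lemma norm_kernel: "r \<in> carrier G \<Longrightarrow> s \<in> carrier G \<Longrightarrow> cmod (kernel b r s) = cmod (b (r \<otimes> inv s) (\<phi> r x))"
  using twist_unimodular[of "r \<otimes> inv s" s "\<phi> r x"] x by (simp add: kernel_def norm_mult \<phi>_mem)

lemma kernel_le:
  assumes "b \<in> carrier F" "r \<in> carrier G" "s \<in> carrier G"
  shows "cmod (kernel b r s) \<le> nrm (C0 X) (b (r \<otimes> inv s))"
  using norm_kernel[OF assms(2,3)] C0_le_norm[OF F_D(1)[OF assms(1)]] by simp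

lemma kernel_row_summable:
  assumes b: "b \<in> carrier F" and r: "r \<in> carrier G" and f: "\<And>s. s \<in> carrier G \<Longrightarrow> cmod (f s) \<le> C"
  shows "(\<lambda>s. cmod (kernel b r s * f s)) summable_on carrier G"
    and "(\<Sum>\<^sub>\<infinity>s\<in>carrier G. cmod (kernel b r s * f s)) \<le> nrm F b * C"
proof -
  note t = inverse_translate_summable[OF r F_D(4)[OF b]]
  have le: "cmod (kernel b r s * f s) \<le> nrm (C0 X) (b (r \<otimes> inv s)) * C" if "s \<in> carrier G" for s
    unfolding norm_mult using kernel_le[OF b r that] f[OF that] C0_norm_nonneg[OF F_D(1)[OF b]]
    by (intro mult_mono) auto
  show s: "(\<lambda>s. cmod (kernel b r s * f s)) summable_on carrier G"
    by (rule summable_on_comparison_test[OF summable_on_cmult_left[OF t(1), of C]]) (use le in auto)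
  have "(\<Sum>\<^sub>\<infinity>s\<in>carrier G. cmod (kernel b r s * f s)) \<le> (\<Sum>\<^sub>\<infinity>s\<in>carrier G. nrm (C0 X) (b (r \<otimes> inv s)) * C)"
    by (intro infsum_mono s summable_on_cmult_left t(1) le)
  also have "\<dots> = nrm F b * C" using t by (simp add: infsum_cmult_left norm_F)
  finally show "(\<Sum>\<^sub>\<infinity>s\<in>carrier G. cmod (kernel b r s * f s)) \<le> nrm F b * C" .
qed

lemma kernel_row_summable':
  assumes b: "b \<in> carrier F" and r: "r \<in> carrier G" and f: "\<And>s. s \<in> carrier G \<Longrightarrow> cmod (f s) \<le> C"
  shows "(\<lambda>s. kernel b r s * f s) summable_on carrier G"
  using kernel_row_summable(1)[OF assms] by (rule abs_summable_summable)

lemma act_add_left: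
  assumes "a \<in> carrier F" "b \<in> carrier F" "\<And>s. s \<in> carrier G \<Longrightarrow> cmod (f (Inl s)) \<le> C"
  shows "act (\<lambda>t x. a t x + b t x) f = (\<lambda>z. act a f z + act b f z)"
proof
  fix z
  show "act (\<lambda>t x. a t x + b t x) f z = act a f z + act b f z"
  proof (cases "z \<in> Inl ` carrier G")
    case True
    then obtain r where r: "r \<in> carrier G" "z = Inl r" by blast
    have "kernel (\<lambda>t x. a t x + b t x) r s * f (Inl s) = kernel a r s * f (Inl s) + kernel b r s * f (Inl s)" for s
      by (simp add: kernel_def algebra_simps)
    then show ?thesis
      using r infsum_add[OF kernel_row_summable'[OF assms(1) r(1), of "\<lambda>s. f (Inl s)" C]
          kernel_row_summable'[OF assms(2) r(1), of "\<lambda>s. f (Inl s)" C]] assms(3)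
      by (simp add: act_Inl)
  qed (simp add: act_off)
qed

lemma act_smult_left: "act (\<lambda>t x. c * b t x) f = (\<lambda>z. c * act b f z)"
proof
  fix z
  show "act (\<lambda>t x. c * b t x) f z = c * act b f z"
  proof (cases "z \<in> Inl ` carrier G")
    case True
    then obtain r where r: "r \<in> carrier G" "z = Inl r" by blast
    have "kernel (\<lambda>t x. c * b t x) r s * f (Inl s) = c * (kernel b r s * f (Inl s))" for s
      by (simp add: kernel_def algebra_simps)
    then show ?thesis using r by (simp only: act_Inl infsum_cmult_right')
  qed (simp add: act_off)
qed

lemma act_add_right:
  assumes "b \<in> carrier F" "\<And>s. s \<in> carrier G \<Longrightarrow> cmod (f (Inl s)) \<le> C" "\<And>s. s \<in> carrier G \<Longrightarrow> cmod (g (Inl s)) \<le> D"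
  shows "act b (\<lambda>z. f z + g z) = (\<lambda>z. act b f z + act b g z)"
proof
  fix z
  show "act b (\<lambda>z. f z + g z) z = act b f z + act b g z"
  proof (cases "z \<in> Inl ` carrier G")
    case True
    then obtain r where r: "r \<in> carrier G" "z = Inl r" by blast
    then show ?thesis
      using infsum_add[OF kernel_row_summable'[OF assms(1) r(1), of "\<lambda>s. f (Inl s)" C]
          kernel_row_summable'[OF assms(1) r(1), of "\<lambda>s. g (Inl s)" D]] assms(2,3)
      by (simp add: act_Inl distrib_left)
  qed (simp add: act_off)
qed

lemma act_smult_right: "act b (\<lambda>z. c * f z) = (\<lambda>z. c * act b f z)"
proof
  fix z
  show "act b (\<lambda>z. c * f z) z = c * act b f z"
  proof (cases "z \<in> Inl ` carrier G")
    case True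
    then obtain r where r: "r \<in> carrier G" "z = Inl r" by blast
    have "kernel b r s * (c * f (Inl s)) = c * (kernel b r s * f (Inl s))" for s by simp
    then show ?thesis using r by (simp only: act_Inl infsum_cmult_right')
  qed (simp add: act_off)
qed

text \<open>With p = r q^{-1} the convolution sum becomes the matrix product; the twists match by
  the cocycle identity at (p, q s^{-1}, s), evaluated at \<phi>_r(x).\<close>

lemma kernel_mult:
  assumes a: "a \<in> carrier F" and b: "b \<in> carrier F" and r: "r \<in> carrier G" and s: "s \<in> carrier G"
  shows "kernel (a \<otimes>\<^bsub>F\<^esub> b) r s = (\<Sum>\<^sub>\<infinity>q\<in>carrier G. kernel a r q * kernel b q s)"
proof -
  let ?y = "\<phi> r x" and ?rs = "r \<otimes> inv s"
  have y: "?y \<in> topspace X" using r x by (rule \<phi>_mem)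
  note bij = bij_betw_mult_inv[OF r]
  have summand: "a p ?y * \<alpha> p (b (inv p \<otimes> ?rs)) ?y * u p (inv p \<otimes> ?rs) ?y * u ?rs s ?y = kernel a r q * kernel b q s"
    if q: "q \<in> carrier G" and p: "p = r \<otimes> inv q" for p q
  proof -
    have pG: "p \<in> carrier G" using p q r by simp
    have 1: "inv p \<otimes> ?rs = q \<otimes> inv s"
      using p q r s by (simp add: GG.inv_mult_group GG.m_assoc inv_cancel)
    have 2: "\<phi> (inv p) ?y = \<phi> q x"
    proof -
      have "\<phi> (inv p) ?y = \<phi> (inv p \<otimes> r) x" using pG r x by (simp add: \<phi>_mult)
      also have "inv p \<otimes> r = q" using p q r by (simp add: GG.inv_mult_group GG.m_assoc)
      finally show ?thesis .
    qed
    have 3: "q \<otimes> inv s \<otimes> s = q" "p \<otimes> (q \<otimes> inv s) = ?rs"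
      using p q r s by (simp_all add: GG.m_assoc inv_cancel)
    have "u (q \<otimes> inv s) s (\<phi> q x) * u p q ?y = u p (q \<otimes> inv s) ?y * u ?rs s ?y"
      using twist_cocycle[OF pG _ s y, of "q \<otimes> inv s"] q s y 2 3 by (simp add: dual_action_def)
    then show ?thesis
      using y 1 2 p by (simp add: kernel_def dual_action_def mult_ac)
  qed
  have "kernel (a \<otimes>\<^bsub>F\<^esub> b) r s = (\<Sum>\<^sub>\<infinity>p\<in>carrier G. a p ?y * \<alpha> p (b (inv p \<otimes> ?rs)) ?y * u p (inv p \<otimes> ?rs) ?y) * u ?rs s ?y"
    using r s by (simp add: kernel_def mult_F)
  also have "\<dots> = (\<Sum>\<^sub>\<infinity>p\<in>carrier G. a p ?y * \<alpha> p (b (inv p \<otimes> ?rs)) ?y * u p (inv p \<otimes> ?rs) ?y * u ?rs s ?y)"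
    by (rule infsum_cmult_left'[symmetric])
  also have "\<dots> = (\<Sum>\<^sub>\<infinity>q\<in>carrier G. kernel a r q * kernel b q s)"
    by (rule trans[OF infsum_reindex_bij_betw[OF bij, symmetric]]) (intro infsum_cong summand, simp_all)
  finally show ?thesis .
qed

text \<open>Interchange of the sums over q and s. For f only boundedness is assumed, so that the
  lemma serves both the L1 and the C0 case; summability comes from a and b.\<close>

lemma act_mult:
  assumes a: "a \<in> carrier F" and b: "b \<in> carrier F" and f: "\<And>s. s \<in> carrier G \<Longrightarrow> cmod (f (Inl s)) \<le> C"
  shows "act (a \<otimes>\<^bsub>F\<^esub> b) f = act a (act b f)"
proof
  fix z
  show "act (a \<otimes>\<^bsub>F\<^esub> b) f z = act a (act b f) z"
  proof (cases "z \<in> Inl ` carrier G")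
    case True
    then obtain r where r: "r \<in> carrier G" "z = Inl r" by blast
    have C: "0 \<le> C" using f[OF GG.one_closed] norm_ge_zero order_trans by blast
    let ?\<beta> = "\<lambda>t. nrm (C0 X) (a t)" and ?\<gamma> = "\<lambda>t. nrm (C0 X) (b t)"
    have prod: "(\<lambda>(q, s). kernel a r q * kernel b q s * f (Inl s)) summable_on carrier G \<times> carrier G"
    proof (rule abs_summable_summable)
      \<comment> \<open>For fixed r this substitution turns the majorant into a product
        family.\<close>
      have bij: "bij_betw (\<lambda>(q, s). (r \<otimes> inv q, q \<otimes> inv s)) (carrier G \<times> carrier G) (carrier G \<times> carrier G)"
        by (rule bij_betwI[where g = "\<lambda>(p, t). (inv p \<otimes> r, inv t \<otimes> (inv p \<otimes> r))"])
          (use r in \<open>auto simp: GG.inv_mult_group GG.m_assoc inv_cancel\<close>)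
      have "(\<lambda>(p, t). ?\<beta> p * ?\<gamma> t) summable_on carrier G \<times> carrier G"
        by (intro summable_on_product_real F_D(4)[OF a] F_D(4)[OF b] C0_norm_nonneg F_D(1)[OF a] F_D(1)[OF b])
      then have "(\<lambda>(q, s). ?\<beta> (r \<otimes> inv q) * ?\<gamma> (q \<otimes> inv s)) summable_on carrier G \<times> carrier G"
        using summable_on_reindex_bij_betw[OF bij, of "\<lambda>(p, t). ?\<beta> p * ?\<gamma> t"] by (simp add: case_prod_unfold)
      then have "(\<lambda>z. (case z of (q, s) \<Rightarrow> ?\<beta> (r \<otimes> inv q) * ?\<gamma> (q \<otimes> inv s)) * C) summable_on carrier G \<times> carrier G"
        by (rule summable_on_cmult_left)
      then show "(\<lambda>z. cmod (case z of (q, s) \<Rightarrow> kernel a r q * kernel b q s * f (Inl s))) summable_on carrier G \<times> carrier G"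
      proof (rule summable_on_comparison_test)
        fix z assume "z \<in> carrier G \<times> carrier G"
        then obtain q s where qs: "z = (q, s)" "q \<in> carrier G" "s \<in> carrier G" by blast
        have "cmod (kernel a r q) * cmod (kernel b q s) * cmod (f (Inl s)) \<le> ?\<beta> (r \<otimes> inv q) * ?\<gamma> (q \<otimes> inv s) * C"
          using kernel_le[OF a r(1) qs(2)] kernel_le[OF b qs(2,3)] f[OF qs(3)] C0_norm_nonneg[OF F_D(1)[OF a]]
            C0_norm_nonneg[OF F_D(1)[OF b]]
          by (intro mult_mono) auto
        then show "cmod (case z of (q, s) \<Rightarrow> kernel a r q * kernel b q s * f (Inl s))
            \<le> (case z of (q, s) \<Rightarrow> ?\<beta> (r \<otimes> inv q) * ?\<gamma> (q \<otimes> inv s)) * C"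
          by (simp add: qs(1) norm_mult)
      qed simp
    qed
    have "act (a \<otimes>\<^bsub>F\<^esub> b) f z = (\<Sum>\<^sub>\<infinity>s\<in>carrier G. \<Sum>\<^sub>\<infinity>q\<in>carrier G. kernel a r q * kernel b q s * f (Inl s))"
      unfolding r(2) act_Inl[OF r(1)]
      by (intro infsum_cong) (simp add: kernel_mult[OF a b r(1)] infsum_cmult_left')
    also have "\<dots> = (\<Sum>\<^sub>\<infinity>q\<in>carrier G. \<Sum>\<^sub>\<infinity>s\<in>carrier G. kernel a r q * kernel b q s * f (Inl s))"
      by (rule infsum_swap_banach[OF prod, symmetric])
    also have "\<dots> = (\<Sum>\<^sub>\<infinity>q\<in>carrier G. kernel a r q * act b f (Inl q))"
      by (intro infsum_cong) (simp add: act_Inl mult.assoc infsum_cmult_right')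
    also have "\<dots> = act a (act b f) z" unfolding r(2) act_Inl[OF r(1)] ..
    finally show ?thesis .
  qed (simp add: act_off)
qed

lemma act_bounded:
  assumes b: "b \<in> carrier F" and f: "\<And>s. s \<in> carrier G \<Longrightarrow> cmod (f (Inl s)) \<le> C" and C: "0 \<le> C"
  shows "cmod (act b f z) \<le> nrm F b * C"
proof (cases "z \<in> Inl ` carrier G")
  case True
  then obtain r where r: "r \<in> carrier G" "z = Inl r" by blast
  have "cmod (act b f z) \<le> (\<Sum>\<^sub>\<infinity>s\<in>carrier G. cmod (kernel b r s * f (Inl s)))"
    unfolding r(2) act_Inl[OF r(1)] using kernel_row_summable(1)[OF b r(1), of "\<lambda>s. f (Inl s)", OF f]
    by (rule norm_infsum_bound)
  then show ?thesis using kernel_row_summable(2)[OF b r(1), of "\<lambda>s. f (Inl s)", OF f] by simp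
next
  case False
  then show ?thesis using C F_norm_nonneg[OF b] by (simp add: act_off)
qed

text \<open>The kernel is diagonal because r s^{-1} = 1 only for s = r, so C0(X) acts through its
  values along the orbit.\<close>

lemma act_monomial_one:
  assumes r: "r \<in> carrier G"
  shows "act (monomial \<one> e) f (Inl r) = e (\<phi> r x) * f (Inl r)"
proof -
  have "act (monomial \<one> e) f (Inl r) = kernel (monomial \<one> e) r r * f (Inl r)"
    unfolding act_Inl[OF r]
  proof (rule infsum_eq_single[OF r])
    fix s assume s: "s \<in> carrier G" "s \<noteq> r"
    then have "r \<otimes> inv s \<noteq> \<one>" using r by (metis GG.inv_equality GG.inv_inv GG.inv_closed)
    then show "kernel (monomial \<one> e) r s * f (Inl s) = 0" by (simp add: kernel_def monomial_def)
  qed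
  then show ?thesis using r x by (simp add: kernel_def monomial_def u_one_left \<phi>_mem)
qed

text \<open>A majorant g with g \<ge> 1 at the finitely many orbit points makes e = g/(g + \<eta>)
  nearly 1 there, by the estimate for approximate units with z = 1.\<close>

lemma unit_on_orbit:
  assumes S: "finite S" "S \<subseteq> carrier G" and \<eta>: "\<eta> > 0"
  obtains e where "e \<in> carrier (C0 X)" "\<And>y. cmod (1 - e y) \<le> 1" "\<And>s. s \<in> S \<Longrightarrow> cmod (1 - e (\<phi> s x)) \<le> \<eta>"
proof -
  have "\<exists>a. a \<in> carrier (C0 X) \<and> a (\<phi> s x) = 1" if s: "s \<in> S" for s
    by (rule C0_nonvanishing[OF locally_compact Hausdorff, of "\<phi> s x"]) (use s S x \<phi>_mem in blast)+
  then obtain a where a: "\<And>s. s \<in> S \<Longrightarrow> a s \<in> carrier (C0 X)" "\<And>s. s \<in> S \<Longrightarrow> a s (\<phi> s x) = 1" by metis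
  define g where "g y = (\<Sum>s\<in>S. cmod (a s y))" for y
  have "(\<lambda>y. \<Sum>s\<in>S. complex_of_real (cmod (a s y))) \<in> carrier (C0 X)" using a by (intro C0_sum C0_cmod)
  then have g: "(\<lambda>y. complex_of_real (g y)) \<in> carrier (C0 X)" by (simp add: g_def)
  have g0: "0 \<le> g y" for y by (simp add: g_def sum_nonneg)
  note e = C0_approximate_unit[OF g g0 \<eta>]
  show thesis
  proof (rule that[OF e(1)])
    show "cmod (1 - complex_of_real (g y / (g y + \<eta>))) \<le> 1" for y using e(6)[of 1 y] by simp
    fix s assume s: "s \<in> S"
    have "cmod (a s (\<phi> s x)) \<le> g (\<phi> s x)" unfolding g_def using s S by (intro member_le_sum) auto
    then show "cmod (1 - complex_of_real (g (\<phi> s x) / (g (\<phi> s x) + \<eta>))) \<le> \<eta>"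
      using e(5)[of 1 "\<phi> s x"] a(2)[OF s] by simp
  qed
qed

end

text \<open>Sums with a single term already come arbitrarily close.\<close>

lemma nondegenerateI:
  assumes "normed_space E" and mem: "\<And>b \<xi>. \<lbrakk>b \<in> carrier F; \<xi> \<in> carrier E\<rbrakk> \<Longrightarrow> \<psi> b \<xi> \<in> carrier E"
    and "\<And>\<xi> \<epsilon>. \<lbrakk>\<xi> \<in> carrier E; \<epsilon> > 0\<rbrakk> \<Longrightarrow> \<exists>b\<in>carrier F. nrm E (\<xi> \<ominus>\<^bsub>E\<^esub> \<psi> b \<xi>) < \<epsilon>"
  shows "nondegenerate F E \<psi>"
proof -
  interpret E: normed_space E by fact
  let ?V = "{\<Oplus>\<^bsub>E\<^esub>i\<in>{..<n}. \<psi> (b i) (\<xi> i) | (n::nat) b \<xi>.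
       b \<in> {..<n} \<rightarrow> carrier F \<and> \<xi> \<in> {..<n} \<rightarrow> carrier E}"
  have V: "?V \<subseteq> carrier E" by (auto intro!: E.M.finsum_closed mem simp: Pi_iff)
  have "\<xi> \<in> nclosure E ?V" if \<xi>: "\<xi> \<in> carrier E" for \<xi>
    unfolding E.mem_nclosure_iff[OF V]
  proof (intro conjI \<xi> allI impI)
    fix \<epsilon> :: real assume "\<epsilon> > 0"
    then obtain b where b: "b \<in> carrier F" "nrm E (\<xi> \<ominus>\<^bsub>E\<^esub> \<psi> b \<xi>) < \<epsilon>" using assms(3)[OF \<xi>] by blast
    have "(\<Oplus>\<^bsub>E\<^esub>i\<in>{..<Suc 0}. \<psi> b \<xi>) = \<psi> b \<xi>"
      unfolding lessThan_Suc using mem[OF b(1) \<xi>] by (subst E.M.finsum_insert) auto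
    then have "\<psi> b \<xi> \<in> ?V" using b(1) \<xi>
      by (intro CollectI exI[of _ "Suc 0"] exI[of _ "\<lambda>_. b"] exI[of _ "\<lambda>_. \<xi>"]) auto
    then show "\<exists>y\<in>?V. nrm E (\<xi> \<ominus>\<^bsub>E\<^esub> y) < \<epsilon>" using b(2) by blast
  qed
  then show ?thesis unfolding nondegenerate_def using E.nclosure_subset by blast
qed

lemma (in twisted_action) representationI:
  assumes mem: "\<And>b. b \<in> carrier F \<Longrightarrow> \<psi> b \<in> linear_maps E E \<inter> extensional (carrier E)"
    and bound: "\<And>b \<xi>. \<lbrakk>b \<in> carrier F; \<xi> \<in> carrier E\<rbrakk> \<Longrightarrow> nrm E (\<psi> b \<xi>) \<le> nrm F b * nrm E \<xi>"
    and add: "\<And>a b \<xi>. \<lbrakk>a \<in> carrier F; b \<in> carrier F; \<xi> \<in> carrier E\<rbrakk>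
      \<Longrightarrow> \<psi> (\<lambda>t x. a t x + b t x) \<xi> = \<psi> a \<xi> \<oplus>\<^bsub>E\<^esub> \<psi> b \<xi>"
    and smult: "\<And>b c \<xi>. \<lbrakk>b \<in> carrier F; \<xi> \<in> carrier E\<rbrakk> \<Longrightarrow> \<psi> (\<lambda>t x. c * b t x) \<xi> = c \<odot>\<^bsub>E\<^esub> \<psi> b \<xi>"
    and mult: "\<And>a b \<xi>. \<lbrakk>a \<in> carrier F; b \<in> carrier F; \<xi> \<in> carrier E\<rbrakk> \<Longrightarrow> \<psi> (a \<otimes>\<^bsub>F\<^esub> b) \<xi> = \<psi> a (\<psi> b \<xi>)"
  shows "representation F E \<psi>"
proof -
  let ?B = "bounded_operators E"
  have eqI: "S = T" if "S \<in> extensional (carrier E)" "T \<in> extensional (carrier E)" "\<And>\<xi>. \<xi> \<in> carrier E \<Longrightarrow> S \<xi> = T \<xi>" for S T :: "'a \<Rightarrow> 'a"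
    using that by (rule extensionalityI)
  have ext: "\<psi> b \<in> extensional (carrier E)" if "b \<in> carrier F" for b using mem[OF that] by simp
  have B: "\<psi> b \<in> carrier ?B" if "b \<in> carrier F" for b
    using mem[OF that] bound[OF that] by (auto simp: bounded_operators_def)
  have n: "nrm ?B (\<psi> b) \<le> nrm F b" if "b \<in> carrier F" for b
    using bound[OF that] F_norm_nonneg[OF that] by (intro operator_norm_le)
  have 1: "\<psi> (a \<oplus>\<^bsub>F\<^esub> b) = \<psi> a \<oplus>\<^bsub>?B\<^esub> \<psi> b" if "a \<in> carrier F" "b \<in> carrier F" for a b
    using that add by (intro eqI ext) (auto simp: bounded_operators_def F_add(1) intro!: ext)
  have 2: "\<psi> (c \<odot>\<^bsub>F\<^esub> b) = c \<odot>\<^bsub>?B\<^esub> \<psi> b" if "b \<in> carrier F" for b c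
    using that smult by (intro eqI ext) (auto simp: bounded_operators_def F_smult(1) intro!: ext)
  have 3: "\<psi> (a \<otimes>\<^bsub>F\<^esub> b) = \<psi> a \<otimes>\<^bsub>?B\<^esub> \<psi> b" if "a \<in> carrier F" "b \<in> carrier F" for a b
    using that mult by (intro eqI ext F_mult) (auto simp: bounded_operators_def compose_def)
  show ?thesis
    unfolding representation_def alg_hom_def linear_contractions_def linear_maps_def
    using 1 2 3 B n by blast
qed

locale L1_regular = regular_representation G X \<phi> u x + L1_space M
  for G :: "('g, 'z) monoid_scheme" (structure) and X :: "'x topology" and \<phi> u x
    and M :: "('g + 'm) measure" +
  assumes M: "M = count_space (Inl ` carrier G)"
begin

lemma AE_iff: "(AE z in M. R z) \<longleftrightarrow> (\<forall>s\<in>carrier G. R (Inl s))"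
  unfolding M by (auto simp: AE_count_space)

lemma integrable_iff: "integrable M f \<longleftrightarrow> (\<lambda>s. cmod (f (Inl s))) summable_on carrier G"
  unfolding M integrable_count_space_iff by (subst summable_on_reindex) (auto simp: o_def)

lemma integral_eq:
  assumes "integrable M f"
  shows "(\<integral>z. cmod (f z) \<partial>M) = (\<Sum>\<^sub>\<infinity>s\<in>carrier G. cmod (f (Inl s)))"
proof -
  have "(\<integral>z. cmod (f z) \<partial>M) = (\<Sum>\<^sub>\<infinity>z\<in>Inl ` carrier G. cmod (f z))"
    using assms unfolding M integrable_count_space_iff by (rule integral_norm_count_space)
  also have "\<dots> = (\<Sum>\<^sub>\<infinity>s\<in>carrier G. cmod (f (Inl s)))" by (subst infsum_reindex) (auto simp: o_def)
  finally show ?thesis .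
qed

lemma value_le:
  assumes f: "integrable M f" and s: "s \<in> carrier G"
  shows "cmod (f (Inl s)) \<le> (\<integral>z. cmod (f z) \<partial>M)"
  using finite_sum_le_infsum[of "\<lambda>s. cmod (f (Inl s))" "carrier G" "{s}"] f s
  by (simp add: integral_eq integrable_iff)

lemma act_integrable:
  assumes b: "b \<in> carrier F" and f: "integrable M f"
  shows "integrable M (act b f)" and "(\<integral>z. cmod (act b f z) \<partial>M) \<le> nrm F b * (\<integral>z. cmod (f z) \<partial>M)"
proof -
  let ?\<beta> = "\<lambda>t. nrm (C0 X) (b t)" and ?\<gamma> = "\<lambda>s. cmod (f (Inl s))"
  have \<gamma>: "?\<gamma> summable_on carrier G" using f by (simp add: integrable_iff)
  have nonneg: "0 \<le> ?\<beta> t" for t by (intro C0_norm_nonneg F_D(1)[OF b])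
  note conv = right_convolution_summable[OF F_D(4)[OF b] \<gamma>, OF nonneg norm_ge_zero]
  have rows: "(\<lambda>r. \<Sum>\<^sub>\<infinity>s\<in>carrier G. ?\<beta> (r \<otimes> inv s) * ?\<gamma> s) summable_on carrier G"
    using summable_on_Sigma_banach[OF conv(1)] by simp
  have le: "cmod (act b f (Inl r)) \<le> (\<Sum>\<^sub>\<infinity>s\<in>carrier G. ?\<beta> (r \<otimes> inv s) * ?\<gamma> s)" if r: "r \<in> carrier G" for r
  proof -
    note s = kernel_row_summable(1)[OF b r, of "\<lambda>s. f (Inl s)", OF value_le[OF f]]
    have row: "(\<lambda>s. ?\<beta> (r \<otimes> inv s) * ?\<gamma> s) summable_on carrier G"
      using summable_on_SigmaD1[OF conv(1) r] by simp
    have "cmod (act b f (Inl r)) \<le> (\<Sum>\<^sub>\<infinity>s\<in>carrier G. cmod (kernel b r s * f (Inl s)))"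
      unfolding act_Inl[OF r] using s by (rule norm_infsum_bound)
    also have "\<dots> \<le> (\<Sum>\<^sub>\<infinity>s\<in>carrier G. ?\<beta> (r \<otimes> inv s) * ?\<gamma> s)"
      using kernel_le[OF b r] by (intro infsum_mono s row) (auto simp: norm_mult intro!: mult_right_mono)
    finally show ?thesis .
  qed
  show i: "integrable M (act b f)"
    unfolding integrable_iff by (rule summable_on_comparison_test[OF rows]) (use le in auto)
  have "(\<integral>z. cmod (act b f z) \<partial>M) \<le> (\<Sum>\<^sub>\<infinity>r\<in>carrier G. \<Sum>\<^sub>\<infinity>s\<in>carrier G. ?\<beta> (r \<otimes> inv s) * ?\<gamma> s)"
    unfolding integral_eq[OF i] using i le rows by (intro infsum_mono) (auto simp: integrable_iff)
  also have "\<dots> = nrm F b * (\<integral>z. cmod (f z) \<partial>M)" unfolding conv(2) by (simp add: norm_F integral_eq[OF f])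
  finally show "(\<integral>z. cmod (act b f z) \<partial>M) \<le> nrm F b * (\<integral>z. cmod (f z) \<partial>M)" .
qed

definition regular :: "('g \<Rightarrow> 'x \<Rightarrow> complex) \<Rightarrow> ('g + 'm \<Rightarrow> complex) set \<Rightarrow> ('g + 'm \<Rightarrow> complex) set" where
  "regular b = (\<lambda>K\<in>carrier (L1 M). cls (act b (SOME f. integrable M f \<and> K = cls f)))"

text \<open>Counting measure has no nonempty null sets, so a class determines the values on the copy
  of G, and \<open>act\<close> sees no others.\<close>

lemma regular_cls:
  assumes f: "integrable M f"
  shows "regular b (cls f) = cls (act b f)"
proof -
  define g where "g = (SOME g. integrable M g \<and> cls f = cls g)"
  have g: "integrable M g \<and> cls f = cls g" unfolding g_def by (rule someI[of _ f]) (simp add: f)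
  then have "AE z in M. f z = g z" using f cls_eq_iff by blast
  then have eq: "f (Inl s) = g (Inl s)" if "s \<in> carrier G" for s using that by (simp add: AE_iff)
  have "act b g = act b f"
  proof
    fix z show "act b g z = act b f z"
      using eq by (cases z) (auto simp: act_def intro!: infsum_cong)
  qed
  then show ?thesis using cls_mem[OF f] by (simp add: regular_def g_def)
qed

lemma regular_linear:
  assumes b: "b \<in> carrier F"
  shows "regular b \<in> linear_maps (L1 M) (L1 M) \<inter> extensional (carrier (L1 M))"
  unfolding linear_maps_def
proof (intro IntI CollectI conjI ballI allI Pi_I)
  show "regular b \<in> extensional (carrier (L1 M))" by (simp add: regular_def)
  fix K assume "K \<in> carrier (L1 M)"
  then obtain f where f: "integrable M f" "K = cls f" by (rule L1_E)
  show "regular b K \<in> carrier (L1 M)"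
    unfolding f(2) regular_cls[OF f(1)] by (intro cls_mem act_integrable b f)
  show "regular b (c \<odot>\<^bsub>L1 M\<^esub> K) = c \<odot>\<^bsub>L1 M\<^esub> regular b K" for c
    using f act_integrable(1)[OF b f(1)] by (simp add: cls_smult regular_cls act_smult_right)
  fix K' assume "K' \<in> carrier (L1 M)"
  then obtain f' where f': "integrable M f'" "K' = cls f'" by (rule L1_E)
  show "regular b (K \<oplus>\<^bsub>L1 M\<^esub> K') = regular b K \<oplus>\<^bsub>L1 M\<^esub> regular b K'"
    using f f' act_integrable(1)[OF b f(1)] act_integrable(1)[OF b f'(1)]
      act_add_right[where f = f and g = f', OF b value_le[OF f(1)] value_le[OF f'(1)]]
    by (simp add: cls_add regular_cls)
qed

lemma representation_regular: "representation F (L1 M) regular"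
proof (rule representationI)
  show "regular b \<in> linear_maps (L1 M) (L1 M) \<inter> extensional (carrier (L1 M))" if "b \<in> carrier F" for b
    using that by (rule regular_linear)
  show "nrm (L1 M) (regular b K) \<le> nrm F b * nrm (L1 M) K" if b: "b \<in> carrier F" and K: "K \<in> carrier (L1 M)" for b K
  proof -
    obtain f where f: "integrable M f" "K = cls f" using K by (rule L1_E)
    then show ?thesis using act_integrable[OF b f(1)] by (simp add: regular_cls norm_cls)
  qed
  show "regular (\<lambda>t x. a t x + b t x) K = regular a K \<oplus>\<^bsub>L1 M\<^esub> regular b K"
    if ab: "a \<in> carrier F" "b \<in> carrier F" and K: "K \<in> carrier (L1 M)" for a b K
  proof -
    obtain f where f: "integrable M f" "K = cls f" using K by (rule L1_E)
    then show ?thesis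
      using act_integrable(1)[OF ab(1) f(1)] act_integrable(1)[OF ab(2) f(1)] act_add_left[where f = f, OF ab value_le[OF f(1)]]
      by (simp add: regular_cls cls_add)
  qed
  show "regular (\<lambda>t x. c * b t x) K = c \<odot>\<^bsub>L1 M\<^esub> regular b K"
    if b: "b \<in> carrier F" and K: "K \<in> carrier (L1 M)" for b c K
  proof -
    obtain f where f: "integrable M f" "K = cls f" using K by (rule L1_E)
    then show ?thesis using act_integrable(1)[OF b f(1)] by (simp add: regular_cls cls_smult act_smult_left)
  qed
  show "regular (a \<otimes>\<^bsub>F\<^esub> b) K = regular a (regular b K)"
    if ab: "a \<in> carrier F" "b \<in> carrier F" and K: "K \<in> carrier (L1 M)" for a b K
  proof -
    obtain f where f: "integrable M f" "K = cls f" using K by (rule L1_E)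
    then show ?thesis
      using act_integrable(1)[OF ab(2) f(1)] act_mult[where f = f, OF ab value_le[OF f(1)]] by (simp add: regular_cls)
  qed
qed

text \<open>The part of f outside a finite set S is small in l1, and on S a function e close to 1 at
  the corresponding orbit points nearly fixes f.\<close>

lemma nondegenerate_regular: "nondegenerate F (L1 M) regular"
proof (rule nondegenerateI[OF normed_space_L1])
  show "regular b K \<in> carrier (L1 M)" if "b \<in> carrier F" "K \<in> carrier (L1 M)" for b K
    using regular_linear[OF that(1)] linear_mapsD(1)[OF _ that(2)] by blast
  fix K and \<epsilon> :: real assume K: "K \<in> carrier (L1 M)" and \<epsilon>: "\<epsilon> > 0"
  obtain f where f: "integrable M f" "K = cls f" using K by (rule L1_E)
  have \<gamma>: "(\<lambda>s. cmod (f (Inl s))) summable_on carrier G" using f(1) by (simp add: integrable_iff)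
  obtain S where S: "finite S" "S \<subseteq> carrier G" "(\<lambda>s. if s \<in> S then 0 else cmod (f (Inl s))) summable_on carrier G"
    "(\<Sum>\<^sub>\<infinity>s\<in>carrier G. if s \<in> S then 0 else cmod (f (Inl s))) < \<epsilon>/2"
    by (rule summable_on_small_tail[OF \<gamma> norm_ge_zero, of "\<epsilon>/2"]) (use \<epsilon> in auto)
  define I where "I = (\<integral>z. cmod (f z) \<partial>M)"
  have I: "0 \<le> I" by (simp add: I_def)
  define \<eta> where "\<eta> = \<epsilon> / (2 * (I + 1))"
  have \<eta>: "\<eta> > 0" using \<epsilon> I by (simp add: \<eta>_def)
  obtain e where e: "e \<in> carrier (C0 X)" "\<And>y. cmod (1 - e y) \<le> 1" "\<And>s. s \<in> S \<Longrightarrow> cmod (1 - e (\<phi> s x)) \<le> \<eta>"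
    by (rule unit_on_orbit[OF S(1,2) \<eta>]) blast
  have eF: "monomial \<one> e \<in> carrier F" by (rule monomial_mem(1)) (use e in auto)
  let ?g = "\<lambda>z. f z + (-1) * act (monomial \<one> e) f z"
  note i = act_integrable(1)[OF eF f(1)]
  have g: "integrable M ?g" by (intro Bochner_Integration.integrable_add integrable_mult_right f i)
  have le: "cmod (?g (Inl s)) \<le> \<eta> * cmod (f (Inl s)) + (if s \<in> S then 0 else cmod (f (Inl s)))" if s: "s \<in> carrier G" for s
  proof -
    have "?g (Inl s) = (1 - e (\<phi> s x)) * f (Inl s)" using s by (simp add: act_monomial_one algebra_simps)
    then have "cmod (?g (Inl s)) = cmod (1 - e (\<phi> s x)) * cmod (f (Inl s))" by (simp only: norm_mult)
    also have "\<dots> \<le> (if s \<in> S then \<eta> else 1) * cmod (f (Inl s))" using e by (intro mult_right_mono) auto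
    also have "\<dots> \<le> \<eta> * cmod (f (Inl s)) + (if s \<in> S then 0 else cmod (f (Inl s)))" using \<eta> by simp
    finally show ?thesis .
  qed
  interpret E: normed_space "L1 M" by (rule normed_space_L1)
  have "K \<ominus>\<^bsub>L1 M\<^esub> regular (monomial \<one> e) K = cls ?g"
    using f i integrable_mult_right[OF i, of "-1"] cls_mem
    by (simp add: E.diff_eq_smult regular_cls cls_smult cls_add)
  then have "nrm (L1 M) (K \<ominus>\<^bsub>L1 M\<^esub> regular (monomial \<one> e) K) = (\<Sum>\<^sub>\<infinity>s\<in>carrier G. cmod (?g (Inl s)))"
    using norm_cls[OF g] integral_eq[OF g] by simp
  also have "\<dots> \<le> (\<Sum>\<^sub>\<infinity>s\<in>carrier G. \<eta> * cmod (f (Inl s)) + (if s \<in> S then 0 else cmod (f (Inl s))))"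
    using g by (intro infsum_mono le summable_on_add summable_on_cmult_right \<gamma> S(3)) (simp add: integrable_iff)
  also have "\<dots> = \<eta> * I + (\<Sum>\<^sub>\<infinity>s\<in>carrier G. if s \<in> S then 0 else cmod (f (Inl s)))"
    using infsum_add[OF summable_on_cmult_right[OF \<gamma>, of \<eta>] S(3)] infsum_cmult_right'[of \<eta>]
    by (simp add: I_def integral_eq[OF f(1)])
  also have "\<dots> < \<epsilon>"
  proof -
    have "\<eta> * I \<le> \<epsilon>/2" using I \<epsilon> by (simp add: \<eta>_def field_simps)
    then show ?thesis using S(4) by simp
  qed
  finally show "\<exists>b\<in>carrier F. nrm (L1 M) (K \<ominus>\<^bsub>L1 M\<^esub> regular b K) < \<epsilon>" using eF by blast
qed

text \<open>The unit vector at the group unit is mapped to the function with values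
  b(r)(\<phi>_r(x)), since u(r,1) = 1; the l1-norm of this one column of the matrix is the column
  sum at x.\<close>

lemma orbit_sum_le:
  assumes b: "b \<in> carrier F"
  shows "(\<Sum>\<^sub>\<infinity>t\<in>carrier G. cmod (b t (\<phi> t x))) \<le> nrm (bounded_operators (L1 M)) (regular b)"
proof -
  interpret E: normed_space "L1 M" by (rule normed_space_L1)
  define \<delta> :: "'g + 'm \<Rightarrow> complex" where "\<delta> z = (if z = Inl \<one> then 1 else 0)" for z
  have "(\<lambda>s. cmod (\<delta> (Inl s))) summable_on carrier G"
    by (subst summable_on_cong_neutral[where T = "{\<one>}" and g = "\<lambda>s. cmod (\<delta> (Inl s))"])
      (auto simp: \<delta>_def)
  then have \<delta>: "integrable M \<delta>" by (simp add: integrable_iff)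
  have "nrm (L1 M) (cls \<delta>) = (\<Sum>\<^sub>\<infinity>s\<in>carrier G. cmod (\<delta> (Inl s)))"
    using \<delta> by (simp add: norm_cls integral_eq)
  also have "\<dots> = cmod (\<delta> (Inl \<one>))" by (rule infsum_eq_single) (auto simp: \<delta>_def)
  finally have n: "nrm (L1 M) (cls \<delta>) = 1" by (simp add: \<delta>_def)
  have "act b \<delta> (Inl r) = b r (\<phi> r x)" if r: "r \<in> carrier G" for r
  proof -
    have "act b \<delta> (Inl r) = kernel b r \<one> * \<delta> (Inl \<one>)"
      unfolding act_Inl[OF r] by (rule infsum_eq_single) (auto simp: \<delta>_def)
    then show ?thesis using r x by (simp add: \<delta>_def kernel_def u_one_right \<phi>_mem)
  qed
  then have "(\<Sum>\<^sub>\<infinity>t\<in>carrier G. cmod (b t (\<phi> t x))) = nrm (L1 M) (regular b (cls \<delta>))"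
    using act_integrable(1)[OF b \<delta>] \<delta> by (simp add: regular_cls norm_cls integral_eq cong: infsum_cong)
  also have "\<dots> \<le> nrm (bounded_operators (L1 M)) (regular b) * nrm (L1 M) (cls \<delta>)"
    using representation_simps(1)[OF representation_regular b] cls_mem[OF \<delta>] by (rule E.operator_norm_bound)
  finally show ?thesis using n by simp
qed

end

locale C0_regular = regular_representation G X \<phi> u x
  for G :: "('g, 'z) monoid_scheme" (structure) and X :: "'x topology" and \<phi> u x +
  fixes \<Omega> :: "('g + 'm) topology"
  assumes \<Omega>: "\<Omega> = discrete_topology (Inl ` carrier G)"
begin

lemma C0_iff: "f \<in> carrier (C0 \<Omega>) \<longleftrightarrow>
    (\<forall>\<epsilon>>0. finite {s \<in> carrier G. \<epsilon> \<le> cmod (f (Inl s))}) \<and> (\<forall>z. z \<notin> Inl ` carrier G \<longrightarrow> f z = 0)"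
proof -
  have "{z \<in> Inl ` carrier G. \<epsilon> \<le> cmod (f z)} = Inl ` {s \<in> carrier G. \<epsilon> \<le> cmod (f (Inl s))}" for \<epsilon>
    by auto
  then have "compactin \<Omega> {z \<in> topspace \<Omega>. \<epsilon> \<le> cmod (f z)} \<longleftrightarrow> finite {s \<in> carrier G. \<epsilon> \<le> cmod (f (Inl s))}" for \<epsilon>
    unfolding \<Omega> compactin_discrete_topology by (auto simp: finite_image_iff inj_on_def)
  then show ?thesis by (simp add: C0_def \<Omega>)
qed

text \<open>Let T carry all but \<eta> of the norms of b, and let K be the finite set where |f|
  \<ge> \<delta>. If r lies outside the finite set T K, then every s has r s^{-1} outside T or s
  outside K, and both parts of the row sum are small.\<close>

lemma act_C0:
  assumes b: "b \<in> carrier F" and f: "f \<in> carrier (C0 \<Omega>)"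
  shows "act b f \<in> carrier (C0 \<Omega>)"
  unfolding C0_iff
proof (intro conjI allI impI)
  fix \<epsilon> :: real assume \<epsilon>: "\<epsilon> > 0"
  let ?\<beta> = "\<lambda>t. nrm (C0 X) (b t)" and ?C = "nrm (C0 \<Omega>) f"
  have C: "0 \<le> ?C" by (rule C0_norm_nonneg[OF f])
  have B: "0 \<le> nrm F b" by (rule F_norm_nonneg[OF b])
  have nonneg: "0 \<le> ?\<beta> t" for t by (intro C0_norm_nonneg F_D(1)[OF b])
  define \<delta> where "\<delta> = \<epsilon> / (2 * (nrm F b + 1))"
  have \<delta>: "\<delta> > 0" "nrm F b * \<delta> \<le> \<epsilon>/2" using \<epsilon> B by (simp_all add: \<delta>_def field_simps)
  define \<eta> where "\<eta> = \<epsilon> / (2 * (?C + 1))"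
  have \<eta>: "\<eta> > 0" "\<eta> * ?C \<le> \<epsilon>/2" using \<epsilon> C by (simp_all add: \<eta>_def field_simps)
  obtain T where T: "finite T" "T \<subseteq> carrier G" "(\<lambda>t. if t \<in> T then 0 else ?\<beta> t) summable_on carrier G"
    "(\<Sum>\<^sub>\<infinity>t\<in>carrier G. if t \<in> T then 0 else ?\<beta> t) < \<eta>"
    by (rule summable_on_small_tail[OF F_D(4)[OF b] nonneg \<eta>(1)]) blast
  define K where "K = {s \<in> carrier G. \<delta> \<le> cmod (f (Inl s))}"
  have K: "finite K" using f \<delta>(1) by (simp add: K_def C0_iff)
  have "cmod (act b f (Inl r)) < \<epsilon>" if r: "r \<in> carrier G" "r \<notin> (\<lambda>(t, s). t \<otimes> s) ` (T \<times> K)" for r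
  proof -
    note t = inverse_translate_summable[OF r(1) F_D(4)[OF b]] inverse_translate_summable[OF r(1) T(3)]
    have le: "cmod (kernel b r s * f (Inl s))
        \<le> ?\<beta> (r \<otimes> inv s) * \<delta> + (if r \<otimes> inv s \<in> T then 0 else ?\<beta> (r \<otimes> inv s)) * ?C" if s: "s \<in> carrier G" for s
    proof (cases "r \<otimes> inv s \<in> T")
      case True
      have "r = (r \<otimes> inv s) \<otimes> s" using r(1) s by (simp add: GG.m_assoc)
      then have "s \<notin> K" using r(2) True by (auto simp: image_iff)
      then have "cmod (f (Inl s)) \<le> \<delta>" using s by (simp add: K_def)
      then show ?thesis using True kernel_le[OF b r(1) s] nonneg by (simp add: norm_mult mult_mono)
    next
      case False
      have "cmod (kernel b r s * f (Inl s)) \<le> ?\<beta> (r \<otimes> inv s) * ?C"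
        unfolding norm_mult using kernel_le[OF b r(1) s] nonneg C0_le_norm[OF f] by (intro mult_mono) auto
      moreover have "0 \<le> ?\<beta> (r \<otimes> inv s) * \<delta>" using nonneg \<delta>(1) by simp
      ultimately show ?thesis using False by simp
    qed
    note s = kernel_row_summable(1)[OF b r(1), of "\<lambda>s. f (Inl s)", OF C0_le_norm[OF f]]
    have "cmod (act b f (Inl r)) \<le> (\<Sum>\<^sub>\<infinity>s\<in>carrier G. cmod (kernel b r s * f (Inl s)))"
      unfolding act_Inl[OF r(1)] using s by (rule norm_infsum_bound)
    also have "\<dots> \<le> (\<Sum>\<^sub>\<infinity>s\<in>carrier G. ?\<beta> (r \<otimes> inv s) * \<delta> + (if r \<otimes> inv s \<in> T then 0 else ?\<beta> (r \<otimes> inv s)) * ?C)"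
      by (intro infsum_mono s summable_on_add summable_on_cmult_left t le)
    also have "\<dots> = nrm F b * \<delta> + (\<Sum>\<^sub>\<infinity>t\<in>carrier G. if t \<in> T then 0 else ?\<beta> t) * ?C"
      using infsum_add[OF summable_on_cmult_left[OF t(1), of \<delta>] summable_on_cmult_left[OF t(3), of ?C]] t(2,4)
      by (simp add: infsum_cmult_left' norm_F)
    also have "\<dots> < \<epsilon>"
    proof (cases "?C = 0")
      case True
      then show ?thesis using \<delta>(2) \<epsilon> by simp
    next
      case False
      then have "(\<Sum>\<^sub>\<infinity>t\<in>carrier G. if t \<in> T then 0 else ?\<beta> t) * ?C < \<eta> * ?C"
        using T(4) C by (intro mult_strict_right_mono) auto
      then show ?thesis using \<delta>(2) \<eta>(2) by linarith
    qed
    finally show ?thesis .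
  qed
  then have "{s \<in> carrier G. \<epsilon> \<le> cmod (act b f (Inl s))} \<subseteq> (\<lambda>(t, s). t \<otimes> s) ` (T \<times> K)"
    by (auto simp: not_le[symmetric])
  then show "finite {s \<in> carrier G. \<epsilon> \<le> cmod (act b f (Inl s))}"
    by (rule finite_subset) (intro finite_imageI finite_cartesian_product T(1) K)
qed (simp add: act_off)

lemma act_norm_le:
  assumes b: "b \<in> carrier F" and f: "f \<in> carrier (C0 \<Omega>)"
  shows "nrm (C0 \<Omega>) (act b f) \<le> nrm F b * nrm (C0 \<Omega>) f"
  by (rule C0_norm_le[OF act_C0[OF assms]])
    (auto intro!: mult_nonneg_nonneg F_norm_nonneg[OF b] C0_norm_nonneg[OF f] act_bounded[OF b C0_le_norm[OF f]])

definition regular :: "('g \<Rightarrow> 'x \<Rightarrow> complex) \<Rightarrow> ('g + 'm \<Rightarrow> complex) \<Rightarrow> ('g + 'm \<Rightarrow> complex)" where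
  "regular b = (\<lambda>f\<in>carrier (C0 \<Omega>). act b f)"

lemma representation_regular: "representation F (C0 \<Omega>) regular"
proof (rule representationI)
  show "regular b \<in> linear_maps (C0 \<Omega>) (C0 \<Omega>) \<inter> extensional (carrier (C0 \<Omega>))" if b: "b \<in> carrier F" for b
    unfolding linear_maps_def
  proof (intro IntI CollectI conjI ballI allI Pi_I)
    show "regular b \<in> extensional (carrier (C0 \<Omega>))" by (simp add: regular_def)
    fix f assume f: "f \<in> carrier (C0 \<Omega>)"
    show "regular b f \<in> carrier (C0 \<Omega>)" using f act_C0[OF b f] by (simp add: regular_def)
    show "regular b (c \<odot>\<^bsub>C0 \<Omega>\<^esub> f) = c \<odot>\<^bsub>C0 \<Omega>\<^esub> regular b f" for c
      using f by (simp add: regular_def act_smult_right)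
    fix g assume g: "g \<in> carrier (C0 \<Omega>)"
    show "regular b (f \<oplus>\<^bsub>C0 \<Omega>\<^esub> g) = regular b f \<oplus>\<^bsub>C0 \<Omega>\<^esub> regular b g"
      using f g act_add_right[where f = f and g = g, OF b C0_le_norm[OF f] C0_le_norm[OF g]]
      by (simp add: regular_def)
  qed
  show "nrm (C0 \<Omega>) (regular b f) \<le> nrm F b * nrm (C0 \<Omega>) f" if "b \<in> carrier F" "f \<in> carrier (C0 \<Omega>)" for b f
    using that act_norm_le by (simp add: regular_def)
  show "regular (\<lambda>t x. a t x + b t x) f = regular a f \<oplus>\<^bsub>C0 \<Omega>\<^esub> regular b f"
    if ab: "a \<in> carrier F" "b \<in> carrier F" and f: "f \<in> carrier (C0 \<Omega>)" for a b f
    using f act_add_left[where f = f, OF ab C0_le_norm[OF f]] by (simp add: regular_def)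
  show "regular (\<lambda>t x. c * b t x) f = c \<odot>\<^bsub>C0 \<Omega>\<^esub> regular b f" if "f \<in> carrier (C0 \<Omega>)" for b c f
    using that by (simp add: regular_def act_smult_left)
  show "regular (a \<otimes>\<^bsub>F\<^esub> b) f = regular a (regular b f)"
    if ab: "a \<in> carrier F" "b \<in> carrier F" and f: "f \<in> carrier (C0 \<Omega>)" for a b f
    using f act_C0[OF ab(2) f] act_mult[where f = f, OF ab C0_le_norm[OF f]] by (simp add: regular_def)
qed

text \<open>Where |f| \<ge> \<epsilon>/2, which is a finite set, e is chosen close to 1; elsewhere
  |1 - e| \<le> 1 is enough.\<close>

lemma nondegenerate_regular: "nondegenerate F (C0 \<Omega>) regular"
proof (rule nondegenerateI[OF normed_space_C0])
  show "regular b f \<in> carrier (C0 \<Omega>)" if "b \<in> carrier F" "f \<in> carrier (C0 \<Omega>)" for b f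
    using that act_C0 by (simp add: regular_def)
  fix f and \<epsilon> :: real assume f: "f \<in> carrier (C0 \<Omega>)" and \<epsilon>: "\<epsilon> > 0"
  let ?C = "nrm (C0 \<Omega>) f"
  have C: "0 \<le> ?C" by (rule C0_norm_nonneg[OF f])
  define \<eta> where "\<eta> = \<epsilon> / (2 * (?C + 1))"
  have \<eta>: "\<eta> > 0" "\<eta> * ?C \<le> \<epsilon>/2" using \<epsilon> C by (simp_all add: \<eta>_def field_simps)
  define K where "K = {s \<in> carrier G. \<epsilon>/2 \<le> cmod (f (Inl s))}"
  have K: "finite K" "K \<subseteq> carrier G" using f half_gt_zero[OF \<epsilon>] unfolding K_def C0_iff by blast+
  obtain e where e: "e \<in> carrier (C0 X)" "\<And>y. cmod (1 - e y) \<le> 1" "\<And>s. s \<in> K \<Longrightarrow> cmod (1 - e (\<phi> s x)) \<le> \<eta>"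
    by (rule unit_on_orbit[OF K \<eta>(1)]) blast
  have eF: "monomial \<one> e \<in> carrier F" by (rule monomial_mem(1)) (use e in auto)
  have m: "(\<lambda>z. f z - act (monomial \<one> e) f z) \<in> carrier (C0 \<Omega>)" by (intro C0_diff f act_C0 eF)
  have "nrm (C0 \<Omega>) (\<lambda>z. f z - act (monomial \<one> e) f z) \<le> \<epsilon>/2"
  proof (rule C0_norm_le[OF m])
    fix z assume "z \<in> topspace \<Omega>"
    then obtain s where s: "s \<in> carrier G" "z = Inl s" by (auto simp: \<Omega>)
    have "f z - act (monomial \<one> e) f z = (1 - e (\<phi> s x)) * f z"
      using s by (simp add: act_monomial_one algebra_simps)
    then have eq: "cmod (f z - act (monomial \<one> e) f z) = cmod (1 - e (\<phi> s x)) * cmod (f z)" by (simp only: norm_mult)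
    show "cmod (f z - act (monomial \<one> e) f z) \<le> \<epsilon>/2"
    proof (cases "s \<in> K")
      case True
      have "cmod (1 - e (\<phi> s x)) * cmod (f z) \<le> \<eta> * ?C"
        using e(3)[OF True] C0_le_norm[OF f] \<eta>(1) by (intro mult_mono) auto
      then show ?thesis using eq \<eta>(2) by simp
    next
      case False
      have "cmod (1 - e (\<phi> s x)) * cmod (f z) \<le> 1 * cmod (f z)" using e(2) by (intro mult_right_mono) auto
      then show ?thesis using eq False s by (simp add: K_def)
    qed
  qed (use \<epsilon> in simp)
  then have "nrm (C0 \<Omega>) (f \<ominus>\<^bsub>C0 \<Omega>\<^esub> regular (monomial \<one> e) f) < \<epsilon>"
    using f act_C0[OF eF f] \<epsilon> by (simp add: regular_def)
  then show "\<exists>b\<in>carrier F. nrm (C0 \<Omega>) (f \<ominus>\<^bsub>C0 \<Omega>\<^esub> regular b f) < \<epsilon>" using eF by blast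
qed

text \<open>The row at the group unit has entries of modulus |b(s^{-1})(x)|. A function of finite
  support with the conjugate phases has norm at most 1 and picks out the sum of these
  moduli.\<close>

lemma column_sum_le_operator_norm:
  assumes b: "b \<in> carrier F"
  shows "(\<Sum>\<^sub>\<infinity>t\<in>carrier G. cmod (b t x)) \<le> nrm (bounded_operators (C0 \<Omega>)) (regular b)"
proof (rule infsum_le_finite_sums[OF F_D(5)[OF b]])
  fix S assume S: "finite S" "S \<subseteq> carrier G"
  interpret E: normed_space "C0 \<Omega>" by (rule normed_space_C0)
  define k where "k s = kernel b \<one> s" for s
  define f :: "'g + 'm \<Rightarrow> complex" where
    "f z = (case z of Inl s \<Rightarrow> if s \<in> (\<lambda>t. inv t) ` S then cnj (sgn (k s)) else 0 | Inr _ \<Rightarrow> 0)" for z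
  have fin: "finite {s \<in> carrier G. \<epsilon> \<le> cmod (f (Inl s))}" if "\<epsilon> > 0" for \<epsilon>
    by (rule finite_subset[OF _ finite_imageI[OF S(1), of "\<lambda>t. inv t"]]) (use that in \<open>auto simp: f_def split: if_splits\<close>)
  have off: "f z = 0" if "z \<notin> Inl ` carrier G" for z
    using that S(2) by (cases z) (auto simp: f_def image_iff)
  have f: "f \<in> carrier (C0 \<Omega>)" unfolding C0_iff using fin off by blast
  have n: "nrm (C0 \<Omega>) f \<le> 1"
    by (rule C0_norm_le[OF f]) (auto simp: f_def norm_sgn split: sum.split)
  have inj: "inj_on (\<lambda>t. inv t) S" using S(2) by (metis GG.inv_inj inj_on_subset)
  have prod: "k s * cnj (sgn (k s)) = complex_of_real (cmod (k s))" for s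
    by (simp add: sgn_div_norm scaleR_conv_of_real complex_norm_square[symmetric] power2_eq_square field_simps)
  have "act b f (Inl \<one>) = (\<Sum>\<^sub>\<infinity>s\<in>carrier G. k s * f (Inl s))" by (simp add: act_Inl k_def)
  also have "\<dots> = (\<Sum>\<^sub>\<infinity>s\<in>(\<lambda>t. inv t) ` S. complex_of_real (cmod (k s)))"
    using S(2) by (intro infsum_cong_neutral) (auto simp: f_def prod)
  also have "\<dots> = (\<Sum>t\<in>S. complex_of_real (cmod (k (inv t))))"
    using S(1) inj by (simp add: sum.reindex o_def)
  also have "\<dots> = complex_of_real (\<Sum>t\<in>S. cmod (b t x))"
    unfolding of_real_sum k_def using S(2) x
    by (intro sum.cong) (auto simp: norm_kernel \<phi>_one subset_iff)
  finally have "(\<Sum>t\<in>S. cmod (b t x)) = cmod (act b f (Inl \<one>))"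
    by (simp only: norm_of_real) (simp add: sum_nonneg)
  also have "\<dots> \<le> nrm (C0 \<Omega>) (regular b f)"
    using C0_le_norm[OF act_C0[OF b f]] f by (simp add: regular_def)
  also have "\<dots> \<le> nrm (bounded_operators (C0 \<Omega>)) (regular b) * nrm (C0 \<Omega>) f"
    using representation_simps(1)[OF representation_regular b] f by (rule E.operator_norm_bound)
  also have "\<dots> \<le> nrm (bounded_operators (C0 \<Omega>)) (regular b) * 1"
    using n E.operator_norm_nonneg[OF representation_simps(1)[OF representation_regular b]] by (rule mult_left_mono)
  finally show "(\<Sum>t\<in>S. cmod (b t x)) \<le> nrm (bounded_operators (C0 \<Omega>)) (regular b)" by simp
qed

end


section \<open>Isometric quotients\<close>

context twisted_action begin

text \<open>A point of X supplies a representation, so the set of norms is not empty and its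
  supremum is meaningful. The upper bound holds on every L1-space and the regular representations
  live on the summand \<open>'g\<close>, so the value is the same for every choice of
  \<open>'m\<close>.\<close>

lemma L1_rep_norm_eq:
  assumes X: "topspace X \<noteq> {}" and b: "b \<in> carrier F"
  shows "L1_rep_norm TYPE('m) F b = column_norm G X \<phi> b"
proof -
  interpret H: homeomorphism_family G X \<phi> using homeomorphism by unfold_locales
  let ?N = "{nrm (bounded_operators (L1 M)) (\<psi> b) | (M :: ('g + 'm) measure) \<psi>.
     representation F (L1 M) \<psi> \<and> nondegenerate F (L1 M) \<psi>}"
  have upper: "c \<le> column_norm G X \<phi> b" if c: "c \<in> ?N" for c
  proof -
    obtain M :: "('g + 'm) measure" and \<psi> where \<psi>: "c = nrm (bounded_operators (L1 M)) (\<psi> b)"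
      "representation F (L1 M) \<psi>" "nondegenerate F (L1 M) \<psi>" using c by blast
    interpret L1_representation G X \<phi> u M \<psi>
      by (intro L1_representation.intro F_representation.intro F_representation_axioms.intro
          twisted_action_axioms L1_space.normed_space_L1 \<psi>(2,3))
    show ?thesis unfolding \<psi>(1) by (rule operator_norm_le_column_norm'[OF b])
  qed
  have lower: "\<exists>c\<in>?N. (\<Sum>\<^sub>\<infinity>t\<in>carrier G. cmod (b t (\<phi> t x))) \<le> c" if x: "x \<in> topspace X" for x
  proof -
    interpret R: L1_regular G X \<phi> u x "count_space (Inl ` carrier G) :: ('g + 'm) measure"
      using x by unfold_locales auto
    show ?thesis using R.orbit_sum_le[OF b] R.representation_regular R.nondegenerate_regular by blast
  qed
  have bdd: "bdd_above ?N" using upper by (rule bdd_aboveI)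
  have le: "(\<Sum>\<^sub>\<infinity>t\<in>carrier G. cmod (b t (\<phi> t x))) \<le> Sup ?N" if "x \<in> topspace X" for x
    using lower[OF that] cSup_upper[OF _ bdd] order_trans by blast
  obtain x where x: "x \<in> topspace X" using X by blast
  have "?N \<noteq> {}" using lower[OF x] by blast
  then have "Sup ?N \<le> column_norm G X \<phi> b" using upper by (rule cSup_least)
  moreover have "0 \<le> Sup ?N" using le[OF x] infsum_nonneg[of "carrier G" "\<lambda>t. cmod (b t (\<phi> t x))"] by simp
  then have "column_norm G X \<phi> b \<le> Sup ?N" using le by (rule H.column_norm_leI)
  ultimately show ?thesis by (simp only: L1_rep_norm_def antisym)
qed

lemma Linf_rep_norm_eq:
  assumes X: "topspace X \<noteq> {}" and b: "b \<in> carrier F"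
  shows "Linf_rep_norm TYPE('m) F b = column_norm G X (\<lambda>t x. x) b"
proof -
  interpret H: homeomorphism_family G X "\<lambda>t x. x"
    using homeomorphic_map_id[of X X] by unfold_locales (auto simp: id_def)
  let ?N = "{nrm (bounded_operators (C0 \<Omega>)) (\<psi> b) | (\<Omega> :: ('g + 'm) topology) \<psi>.
     representation F (C0 \<Omega>) \<psi> \<and> nondegenerate F (C0 \<Omega>) \<psi>}"
  have upper: "c \<le> column_norm G X (\<lambda>t x. x) b" if c: "c \<in> ?N" for c
  proof -
    obtain \<Omega> :: "('g + 'm) topology" and \<psi> where \<psi>: "c = nrm (bounded_operators (C0 \<Omega>)) (\<psi> b)"
      "representation F (C0 \<Omega>) \<psi>" "nondegenerate F (C0 \<Omega>) \<psi>" using c by blast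
    interpret C0_representation G X \<phi> u \<Omega> \<psi>
      by (intro C0_representation.intro F_representation.intro F_representation_axioms.intro
          twisted_action_axioms normed_space_C0 \<psi>(2,3))
    show ?thesis unfolding \<psi>(1) by (rule operator_norm_le_row_norm[OF b])
  qed
  have lower: "\<exists>c\<in>?N. (\<Sum>\<^sub>\<infinity>t\<in>carrier G. cmod (b t x)) \<le> c" if x: "x \<in> topspace X" for x
  proof -
    interpret R: C0_regular G X \<phi> u x "discrete_topology (Inl ` carrier G) :: ('g + 'm) topology"
      using x by unfold_locales auto
    show ?thesis using R.column_sum_le_operator_norm[OF b] R.representation_regular R.nondegenerate_regular by blast
  qed
  have bdd: "bdd_above ?N" using upper by (rule bdd_aboveI)
  have le: "(\<Sum>\<^sub>\<infinity>t\<in>carrier G. cmod (b t x)) \<le> Sup ?N" if "x \<in> topspace X" for x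
    using lower[OF that] cSup_upper[OF _ bdd] order_trans by blast
  obtain x where x: "x \<in> topspace X" using X by blast
  have "?N \<noteq> {}" using lower[OF x] by blast
  then have "Sup ?N \<le> column_norm G X (\<lambda>t x. x) b" using upper by (rule cSup_least)
  moreover have "0 \<le> Sup ?N" using le[OF x] infsum_nonneg[of "carrier G" "\<lambda>t. cmod (b t x)"] by simp
  then have "column_norm G X (\<lambda>t x. x) b \<le> Sup ?N" using le by (rule H.column_norm_leI)
  ultimately show ?thesis by (simp only: Linf_rep_norm_def antisym)
qed

text \<open>Over the empty space there are no points to represent on, so that \<open>P_norm\<close> could be a junk value;
  but a completion then has norm zero, and so has \<open>concrete_norm\<close>.\<close>

lemma FP_completion:
  assumes P: "P \<subseteq> {1, \<infinity>}" and FP: "is_FP TYPE('m) P F A \<iota>"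
  shows "is_completion F (concrete_norm G X \<phi> P) A \<iota>"
proof -
  have "concrete_norm G X \<phi> P b = P_norm TYPE('m) P F b" if b: "b \<in> carrier F" for b
  proof (cases "topspace X = {}")
    case False
    then show ?thesis
      using b by (simp add: concrete_norm_def P_norm_def norm_F L1_rep_norm_eq Linf_rep_norm_eq
          if_distrib[of "\<lambda>\<rho>. column_norm G X \<rho> b"] cong: if_cong)
  next
    case True
    have A: "banach_space A" and lin: "\<iota> \<in> linear_maps F A"
      and norm: "nrm A (\<iota> b) = P_norm TYPE('m) P F b"
      using FP b by (auto simp: is_FP_def is_completion_def alg_hom_def banach_algebra_def)
    have b0: "b = (\<lambda>t x. 0)" using F_D(3)[OF b] True by (simp add: fun_eq_iff)
    have "\<iota> (0 \<odot>\<^bsub>F\<^esub> b) = 0 \<odot>\<^bsub>A\<^esub> \<iota> b" "\<iota> b \<in> carrier A"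
      using linear_mapsD(3)[OF lin b] linear_mapsD(1)[OF lin b] by blast+
    moreover have "0 \<odot>\<^bsub>F\<^esub> b = b" by (simp add: b0 F_alg_def)
    ultimately have "nrm A (\<iota> b) = 0" using banach_space.nrm_smult[OF A, of "\<iota> b" 0] by simp
    moreover have "concrete_norm G X \<phi> P b = 0"
    proof -
      have "finite P" using P finite_subset by blast
      then show ?thesis using True by (auto simp: b0 concrete_norm_def column_norm_def image_constant_conv)
    qed
    ultimately show ?thesis using norm by simp
  qed
  then show ?thesis using FP unfolding is_FP_def by (rule is_completion_cong[rotated])
qed

end

theorem proposition6p10:
  fixes G :: "('g, 'z) monoid_scheme" and X :: "'x topology"
    and \<phi> :: "'g \<Rightarrow> 'x \<Rightarrow> 'x" and u :: "'g \<Rightarrow> 'g \<Rightarrow> 'x \<Rightarrow> complex"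
    and P :: "ereal set" and A :: "'a cnormed" and \<iota> :: "('g \<Rightarrow> 'x \<Rightarrow> complex) \<Rightarrow> 'a"
  assumes "twisted_action G X \<phi> u"
    and "P \<subseteq> {1, \<infinity>}"
    and "is_FP TYPE('m) P (F_alg G X \<phi> u) A \<iota>"
  shows "residually_reduced G X \<phi> u A \<iota> \<and>
    (\<forall>U (AU :: 'b cnormed) \<iota>U (AY :: 'c cnormed) \<iota>Y.
      openin X U \<and> invariant G \<phi> U \<and>
      is_FP TYPE('m) P (F_sub G X \<phi> u U) AU \<iota>U \<and>
      is_FP TYPE('m) P (F_sub G X \<phi> u (topspace X - U)) AY \<iota>Y \<longrightarrow>
      (\<exists>j \<in> isometric_hom AU A.
        (\<forall>b \<in> carrier (F_sub G X \<phi> u U). j (\<iota>U b) = \<iota> b) \<and>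
        j ` carrier AU = nclosure A (\<iota> ` carrier (F_sub G X \<phi> u U)) \<and>
        (\<exists>\<Phi> \<in> isometric_iso (nquot A (j ` carrier AU)) AY.
          \<forall>b \<in> carrier (F_alg G X \<phi> u).
            \<Phi> (j ` carrier AU +>\<^bsub>A\<^esub> \<iota> b) = \<iota>Y (restrict_fun (topspace X - U) b))))"
proof -
  interpret twisted_action G X \<phi> u by fact
  note completion = FP_completion[OF assms(2,3)]
  have concrete: "concrete_completion G X \<phi> u U A \<iota> P" if "openin X U" "invariant G \<phi> U" for U
    by unfold_locales (use that assms(2) completion in auto)
  interpret A: F_completion G X \<phi> u A \<iota> "concrete_norm G X \<phi> P"
    using assms(2) completion by (rule F_completion_concrete)
  show ?thesis
  proof (intro conjI allI impI)
    show "residually_reduced G X \<phi> u A \<iota>"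
      unfolding residually_reduced_def Let_def
    proof (intro conjI allI impI A.crossed_product)
      fix U assume U: "openin X U \<and> invariant G \<phi> U"
      interpret concrete_completion G X \<phi> u U A \<iota> P using U concrete by blast
      show "\<exists>\<iota>Y. (\<forall>b\<in>carrier (F_alg G X \<phi> u). \<iota>Y (restrict_fun (topspace X - U) b)
            = nclosure A (\<iota> ` carrier (F_sub G X \<phi> u U)) +>\<^bsub>A\<^esub> \<iota> b) \<and>
          reduced_crossed_product G (subtopology X (topspace X - U)) (restrict_action \<phi> (topspace X - U))
            (restrict_twist u (topspace X - U)) (nquot A (nclosure A (\<iota> ` carrier (F_sub G X \<phi> u U)))) \<iota>Y"
        using \<iota>Q_restrict reduced_Q by blast
    qed
    fix U and AU :: "'b cnormed" and \<iota>U and AY :: "'c cnormed" and \<iota>Y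
    assume H: "openin X U \<and> invariant G \<phi> U \<and>
      is_FP TYPE('m) P (F_sub G X \<phi> u U) AU \<iota>U \<and>
      is_FP TYPE('m) P (F_sub G X \<phi> u (topspace X - U)) AY \<iota>Y"
    interpret concrete_completion G X \<phi> u U A \<iota> P using H concrete by blast
    \<comment> \<open>The restrictions to U and Y are twisted actions in their own right, so the
      norms of the two further completions are given by the same formula.\<close>
    have AU: "is_completion (F_sub G X \<phi> u U)
        (concrete_norm G (subtopology X U) (restrict_action \<phi> U) P) AU \<iota>U"
      using H unfolding F_sub_def by (intro Uact.FP_completion assms(2)) blast
    have AY: "is_completion (F_sub G X \<phi> u (topspace X - U))
        (concrete_norm G (subtopology X (topspace X - U)) (restrict_action \<phi> (topspace X - U)) P) AY \<iota>Y"
      using H unfolding F_sub_def by (intro Yact.FP_completion assms(2)) blast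
    obtain j where j: "j \<in> isometric_hom AU A" "\<And>b. b \<in> carrier (F_sub G X \<phi> u U) \<Longrightarrow> j (\<iota>U b) = \<iota> b"
      "j ` carrier AU = nclosure A (\<iota> ` carrier (F_sub G X \<phi> u U))"
      by (rule ideal_isometry[OF AU]) blast
    obtain \<Phi> where \<Phi>: "\<Phi> \<in> isometric_iso (nquot A (nclosure A (\<iota> ` carrier (F_sub G X \<phi> u U)))) AY"
      "\<And>b. b \<in> carrier (F_alg G X \<phi> u) \<Longrightarrow>
        \<Phi> (nclosure A (\<iota> ` carrier (F_sub G X \<phi> u U)) +>\<^bsub>A\<^esub> \<iota> b) = \<iota>Y (restrict_fun (topspace X - U) b)"
      by (rule quotient_isometry[OF AY]) blast
    show "\<exists>j \<in> isometric_hom AU A.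
        (\<forall>b \<in> carrier (F_sub G X \<phi> u U). j (\<iota>U b) = \<iota> b) \<and>
        j ` carrier AU = nclosure A (\<iota> ` carrier (F_sub G X \<phi> u U)) \<and>
        (\<exists>\<Phi> \<in> isometric_iso (nquot A (j ` carrier AU)) AY.
          \<forall>b \<in> carrier (F_alg G X \<phi> u).
            \<Phi> (j ` carrier AU +>\<^bsub>A\<^esub> \<iota> b) = \<iota>Y (restrict_fun (topspace X - U) b))"
      by (intro bexI[OF _ j(1)] conjI ballI j(2,3), assumption, unfold j(3)) (intro bexI[OF _ \<Phi>(1)] ballI \<Phi>(2))
  qed
qed

end
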